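(* Fix $\sigma\in\mathcal{S}_n$ and let $$\mathcal{Z}=\{(w,P)\in\mathcal{W}_+\times\Pi \;:\; P=\Gamma(P-Phh'P)\Gamma'+(u+U\sigma+U\Gamma Ph)(u+U\sigma+U\Gamma Ph)'\}$$ be the zero locus of the Covariance Extension Equation (CEE) $$P=\Gamma(P-Phh'P)\Gamma'+(u+U\sigma+U\Gamma Ph)(u+U\sigma+U\Gamma Ph)',$$ where $u$ and $U$ are the functions of $w$ defined in the context. Then: (1) $\mathcal{Z}$ is a smooth semialgebraic manifold of dimension $n$. (2) The projection $\pi_{\mathcal{W}_+}:\mathcal{Z}\to\mathcal{W}_+$, $(w,P)\mapsto w$, is a diffeomorphism between $\mathcal{Z}$ and $\mathcal{W}_+$. In particular, the CEE has a unique solution $P\in\Pi$ for each $(\sigma,w)\in\mathcal{S}_n\times\mathcal{W}_+$. (3) For each $(\sigma,w)\in\mathcal{S}_n\times\mathcal{W}_+$, with $P\in\Pi$ the unique solution of the CEE, the unique pair $(a,b)\in\mathcal{P}_n(\sigma)$ for which $\varphi(z)=\frac12\frac{b_*(z)}{a_*(z)}$ satisfies $$\frac{\varphi^{(k)}(z_j)}{k!}=w_{jk},\qquad j=0,\dots,m,\ k=0,\dots,n_j-1,$$ is given by $$a=(I-U)(\Gamma Ph+\sigma)-u,\qquad b=(I+U)(\Gamma Ph+\sigma)+u ,$$ and $$\operatorname{rank}P=\deg\varphi=\deg f,$$ where $f(z)=\varphi(z^{-1})=\frac12\frac{b(z)}{a(z)}$.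
   Context: **Interpolation points and data.** Fix distinct points $z_0=0,z_1,\dots,z_m$ in the open unit disc $\mathbb{D}$ and multiplicities $n_0,\dots,n_m\ge 1$, and put $n:=\sum_{j=0}^m n_j-1$. The family of points is closed under complex conjugation, with conjugate points having equal multiplicities. The data are complex numbers $w_{jk}$ ($0\le j\le m$, $0\le k\le n_j-1$) with $w_{00}=\tfrac12$, and they are conjugate-symmetric: if $z_{j'}=\bar z_j$ then $w_{j'k}=\overline{w_{jk}}$ (in particular $w_{jk}$ is real if $z_j$ is real). The data vector $w$ is the $n$-vector of all $w_{jk}$ except $w_{00}$ (ordered by $j$, then $k$). By conjugate symmetry, the set of such $w$ is a real vector space of real dimension $n$, identified with $\mathbb{R}^n$. **Matrices.** $W=\mathrm{diag}(W_0,\dots,W_m)$ and $Z=\mathrm{diag}(Z_0,\dots,Z_m)$ are $(n+1)\times(n+1)$ block diagonal matrices. $W_j$ is the $n_j\times n_j$ lower triangular Toeplitz matrix with first column $(w_{j0},w_{j1},\dots,w_{j,n_j-1})'$. $Z_j$ is the $n_j\times n_j$ matrix with $z_j$ on the diagonal, $1$ on the first subdiagonal and $0$ elsewhere. Here $'$ denotes transposition and $^*$ conjugate transposition. The vector $e=[e_1^{n_0},\dots,e_1^{n_m}]'\in\mathbb{R}^{n+1}$, where $e_1^{n_j}=[1,0,\dots,0]\in\mathbb{R}^{n_j}$. $E$ is the unique solution of $E=ZEZ^*+ee^*$. **The set $\mathcal{W}_+$.** $\mathcal{W}_+$ is the set of all data vectors $w$ for which the generalized Pick matrix $\Sigma=WE+EW^*$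 is positive definite. It is regarded as a subset of the real $n$-dimensional space above. **The parameters $u,U$.** Let $V=[e,Ze,\dots,Z^ne]$ (an invertible $(n+1)\times(n+1)$ matrix) and $D=(W+\tfrac12I)^{-1}(W-\tfrac12I)$. Define $u\in\mathbb{R}^n$ and $U\in\mathbb{R}^{n\times n}$ by $$\begin{bmatrix}u&U\end{bmatrix}=\begin{bmatrix}0&I_n\end{bmatrix}V^{-1}DV,$$ i.e. delete the first row of $V^{-1}DV$; then $u$ is the first column and $U$ the remaining $n$ columns. **Polynomials.** $\mathcal{S}_n$ is the space of real monic Schur polynomials $\sigma(z)=z^n+\sigma_1z^{n-1}+\dots+\sigma_n$ (all roots in $\mathbb{D}$). Monic polynomials $a,b,\sigma$ of degree $n$ are identified with their coefficient column vectors $(a_1,\dots,a_n)'$ etc. in $\mathbb{R}^n$. For $a(z)=z^n+a_1z^{n-1}+\dots+a_n$, write $a_*(z)=z^na(z^{-1})$. $\mathcal{P}_n$ is the space of pairs $(a,b)\in\mathcal{S}_n\times\mathcal{S}_n$ such that $b/a$ is strictly positive real, i.e. analytic with positive real part in $\{|z|>1\}$. $\mathcal{P}_n(\sigma)$ is the set of $(a,b)\in\mathcal{P}_n$ for which there is a $\rho>0$ with $a(z)b(z^{-1})+b(z)a(z^{-1})=2\rho^2\sigma(z)\sigma(z^{-1})$. It is known that for every $\sigma\in\mathcal{S}_n$ and $w\in\mathcal{W}_+$ there is exactly one $(a,b)\in\mathcal{P}_n(\sigma)$ whose $\varphi=\frac12 b_*/a_*$ satisfies the interpolation conditions. **CEE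 notation.** $h=(1,0,\dots,0)'\in\mathbb{R}^n$; $J$ is the $n\times n$ matrix with ones on the first superdiagonal and zeros elsewhere; $\Gamma=J-\sigma h'$. $\Pi$ is the set of real symmetric positive semidefinite $n\times n$ matrices $P$ with $h'Ph<1$. The degree of a rational function is its degree after cancellation of common factors (McMillan degree). $\mathcal{Z}$ is viewed as a subset of the real vector space $\mathbb{R}^n\times\mathrm{Sym}_n(\mathbb{R})$. *)

theory Defs
  imports
    "HOL-Analysis.Analysis"
    "HOL-Computational_Algebra.Polynomial_Factorial"
    "HOL-Computational_Algebra.Field_as_Ring"
    "HOL-Library.Option_ord"
begin

text \<open>
  A matrix index type is a finite linear order; vectors in \<open>\<real>\<^sup>n\<close> are \<open>real^'n\<close>
  with \<open>CARD('n) = n\<close>, and the \<open>(n+1) \<times> (n+1)\<close> matrices are indexed by \<open>'n option\<close>, in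
  which \<open>None\<close> is the least element.  All positions are counted from 0, so \<open>None\<close> is the
  first index and \<open>Some i\<close> is the successor of the position of \<open>i\<close>.
\<close>

definition idx :: "'k::{finite,linorder} \<Rightarrow> nat" where
  "idx i = card {j. j < i}"

definition idx_inv :: "nat \<Rightarrow> 'k::{finite,linorder}" where
  "idx_inv p = (THE i. idx i = p)"

lemma idx_less: "i < j \<Longrightarrow> idx i < idx (j::'k::{finite,linorder})"
  unfolding idx_def by (rule psubset_card_mono) auto

lemma idx_inj: "inj (idx :: 'k::{finite,linorder} \<Rightarrow> nat)"
  by (rule injI) (metis idx_less less_irrefl linorder_neqE)

lemma idx_bound: "idx (i::'k::{finite,linorder}) < CARD('k)"
  unfolding idx_def by (rule psubset_card_mono) auto

lemma idx_bij: "bij_betw (idx :: 'k::{finite,linorder} \<Rightarrow> nat) UNIV {..<CARD('k)}"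
  unfolding bij_betw_def
  by (metis idx_inj idx_bound card_image card_lessThan card_subset_eq finite_lessThan
      image_subsetI lessThan_iff)

lemma idx_inv_idx [simp]: "idx_inv (idx i) = i"
  unfolding idx_inv_def using idx_inj by (auto dest: injD)

lemma idx_idx_inv: "p < CARD('k) \<Longrightarrow> idx (idx_inv p :: 'k::{finite,linorder}) = p"
  by (metis idx_bij bij_betw_imp_surj_on idx_inv_idx imageE lessThan_iff)

lemma idx_None [simp]: "idx (None :: 'n::{finite,linorder} option) = 0"
  by (simp add: idx_def)

lemma idx_Some [simp]: "idx (Some i :: 'n::{finite,linorder} option) = Suc (idx i)"
proof -
  have "{j. j < Some i} = insert None (Some ` {j. j < i})"
    by (auto simp: image_iff) (metis less_option_Some not_Some_eq)
  then show ?thesis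
    by (simp add: idx_def card_image)
qed

subsection \<open>Matrices\<close>

type_synonym 'k rvec = "(real, 'k) vec"
type_synonym 'k cvec = "(complex, 'k) vec"
type_synonym 'k rmat = "((real, 'k) vec, 'k) vec"
type_synonym 'k cmat = "((complex, 'k) vec, 'k) vec"

definition ctranspose :: "complex^'m^'n \<Rightarrow> complex^'n^'m" where
  "ctranspose A = (\<chi> i j. cnj (A $ j $ i))"

definition outer :: "('a::times)^'m \<Rightarrow> 'a^'n \<Rightarrow> 'a^'n^'m" where
  "outer x y = (\<chi> i j. x $ i * y $ j)"

definition hermitian_posdef :: "'k::finite cmat \<Rightarrow> bool" where
  "hermitian_posdef A \<longleftrightarrow> ctranspose A = A \<and>
     (\<forall>x. x \<noteq> 0 \<longrightarrow> 0 < Re (\<Sum>i\<in>UNIV. \<Sum>j\<in>UNIV. cnj (x $ i) * A $ i $ j * x $ j))"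

definition sym_psd :: "'n::finite rmat \<Rightarrow> bool" where
  "sym_psd P \<longleftrightarrow> transpose P = P \<and> (\<forall>x. 0 \<le> x \<bullet> (P *v x))"

subsection \<open>Interpolation data\<close>

text \<open>
  The nodes are \<open>z 0, \<dots>, z m\<close> with multiplicities \<open>\<nu> 0, \<dots>, \<nu> m\<close>.  The pair \<open>(j,k)\<close>
  with \<open>k < \<nu> j\<close> sits at position \<open>offset \<nu> j + k\<close>; \<open>block\<close> and \<open>loc\<close> recover
  \<open>j\<close> and \<open>k\<close> from an index.
\<close>

definition offset :: "(nat \<Rightarrow> nat) \<Rightarrow> nat \<Rightarrow> nat" where
  "offset \<nu> j = (\<Sum>l<j. \<nu> l)"

definition block :: "(nat \<Rightarrow> nat) \<Rightarrow> 'k::{finite,linorder} \<Rightarrow> nat" where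
  "block \<nu> i = (LEAST j. idx i < offset \<nu> (Suc j))"

definition loc :: "(nat \<Rightarrow> nat) \<Rightarrow> 'k::{finite,linorder} \<Rightarrow> nat" where
  "loc \<nu> i = idx i - offset \<nu> (block \<nu> i)"

definition full_data :: "'n::finite cvec \<Rightarrow> 'n option cvec" where
  "full_data w = (\<chi> i. case i of None \<Rightarrow> 1/2 | Some l \<Rightarrow> w $ l)"

text \<open>The number \<open>w\<^sub>j\<^sub>k\<close>, with \<open>w\<^sub>0\<^sub>0 = 1/2\<close> supplied by \<open>full_data\<close>.\<close>

definition datum ::
  "(nat \<Rightarrow> nat) \<Rightarrow> 'n::{finite,linorder} cvec \<Rightarrow> nat \<Rightarrow> nat \<Rightarrow> complex" where
  "datum \<nu> w j k = full_data w $ idx_inv (offset \<nu> j + k)"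

text \<open>
  The conjugate-symmetric data vectors form a real subspace of \<open>complex^'n\<close> of real
  dimension \<open>CARD('n)\<close>; it serves as the \<open>\<real>\<^sup>n\<close> of data vectors.
\<close>

definition data_space ::
  "nat \<Rightarrow> (nat \<Rightarrow> complex) \<Rightarrow> (nat \<Rightarrow> nat) \<Rightarrow> ('n::{finite,linorder} cvec) set" where
  "data_space m z \<nu> = {w. \<forall>j\<le>m. \<forall>j'\<le>m. z j' = cnj (z j) \<longrightarrow>
     (\<forall>k<\<nu> j. datum \<nu> w j' k = cnj (datum \<nu> w j k))}"

definition W_mat ::
  "(nat \<Rightarrow> nat) \<Rightarrow> 'n::{finite,linorder} cvec \<Rightarrow> 'n option cmat" where
  "W_mat \<nu> w = (\<chi> r c. if block \<nu> r = block \<nu> c \<and> loc \<nu> c \<le> loc \<nu> r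
     then datum \<nu> w (block \<nu> r) (loc \<nu> r - loc \<nu> c) else 0)"

definition Z_mat ::
  "(nat \<Rightarrow> complex) \<Rightarrow> (nat \<Rightarrow> nat) \<Rightarrow> 'k::{finite,linorder} cmat" where
  "Z_mat z \<nu> = (\<chi> r c. if block \<nu> r = block \<nu> c
     then (if r = c then z (block \<nu> r) else if loc \<nu> r = Suc (loc \<nu> c) then 1 else 0)
     else 0)"

definition e_vec :: "(nat \<Rightarrow> nat) \<Rightarrow> 'k::{finite,linorder} cvec" where
  "e_vec \<nu> = (\<chi> i. if loc \<nu> i = 0 then 1 else 0)"

definition E_mat ::
  "(nat \<Rightarrow> complex) \<Rightarrow> (nat \<Rightarrow> nat) \<Rightarrow> 'k::{finite,linorder} cmat" where
  "E_mat z \<nu> = (THE E. E = Z_mat z \<nu> ** E ** ctranspose (Z_mat z \<nu>)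
     + outer (e_vec \<nu>) (e_vec \<nu>))"

definition pick_mat ::
  "(nat \<Rightarrow> complex) \<Rightarrow> (nat \<Rightarrow> nat) \<Rightarrow> 'n::{finite,linorder} cvec
     \<Rightarrow> 'n option cmat" where
  "pick_mat z \<nu> w = W_mat \<nu> w ** E_mat z \<nu> + E_mat z \<nu> ** ctranspose (W_mat \<nu> w)"

definition W_plus ::
  "nat \<Rightarrow> (nat \<Rightarrow> complex) \<Rightarrow> (nat \<Rightarrow> nat) \<Rightarrow> ('n::{finite,linorder} cvec) set" where
  "W_plus m z \<nu> = {w \<in> data_space m z \<nu>. hermitian_posdef (pick_mat z \<nu> w)}"

subsection \<open>The parameters \<open>u\<close> and \<open>U\<close>\<close>

definition V_mat ::
  "(nat \<Rightarrow> complex) \<Rightarrow> (nat \<Rightarrow> nat) \<Rightarrow> 'k::{finite,linorder} cmat" where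
  "V_mat z \<nu> = (\<chi> r c. (((\<lambda>x. Z_mat z \<nu> *v x) ^^ idx c) (e_vec \<nu>)) $ r)"

definition D_mat ::
  "(nat \<Rightarrow> nat) \<Rightarrow> 'n::{finite,linorder} cvec \<Rightarrow> 'n option cmat" where
  "D_mat \<nu> w = matrix_inv (W_mat \<nu> w + mat (1/2)) ** (W_mat \<nu> w - mat (1/2))"

definition VDV_mat ::
  "(nat \<Rightarrow> complex) \<Rightarrow> (nat \<Rightarrow> nat) \<Rightarrow> 'n::{finite,linorder} cvec
     \<Rightarrow> 'n option cmat" where
  "VDV_mat z \<nu> w = matrix_inv (V_mat z \<nu>) ** D_mat \<nu> w ** V_mat z \<nu>"

text \<open>
  The row \<open>None\<close> is deleted.  For conjugate-symmetric data with positive definite Pick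
  matrix the entries of \<^const>\<open>VDV_mat\<close> are real, so \<open>Re\<close> only changes the type.
\<close>

definition u_vec ::
  "(nat \<Rightarrow> complex) \<Rightarrow> (nat \<Rightarrow> nat) \<Rightarrow> 'n::{finite,linorder} cvec \<Rightarrow> 'n rvec" where
  "u_vec z \<nu> w = (\<chi> i. Re (VDV_mat z \<nu> w $ Some i $ None))"

definition U_mat ::
  "(nat \<Rightarrow> complex) \<Rightarrow> (nat \<Rightarrow> nat) \<Rightarrow> 'n::{finite,linorder} cvec \<Rightarrow> 'n rmat" where
  "U_mat z \<nu> w = (\<chi> i j. Re (VDV_mat z \<nu> w $ Some i $ Some j))"

subsection \<open>The Covariance Extension Equation\<close>

definition h_vec :: "'n::{finite,linorder} rvec" where
  "h_vec = (\<chi> i. if idx i = 0 then 1 else 0)"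

definition J_mat :: "'n::{finite,linorder} rmat" where
  "J_mat = (\<chi> i j. if idx j = Suc (idx i) then 1 else 0)"

definition Gam :: "'n::{finite,linorder} rvec \<Rightarrow> 'n rmat" where
  "Gam \<sigma> = J_mat - outer \<sigma> h_vec"

definition Pi_set :: "('n::{finite,linorder} rmat) set" where
  "Pi_set = {P. sym_psd P \<and> h_vec \<bullet> (P *v h_vec) < 1}"

definition CEE ::
  "(nat \<Rightarrow> complex) \<Rightarrow> (nat \<Rightarrow> nat) \<Rightarrow> 'n::{finite,linorder} rvec \<Rightarrow> 'n cvec
     \<Rightarrow> 'n rmat \<Rightarrow> bool" where
  "CEE z \<nu> \<sigma> w P \<longleftrightarrow>
    (let \<Gamma> = Gam \<sigma>; U = U_mat z \<nu> w;
         g = u_vec z \<nu> w + U *v \<sigma> + U *v (\<Gamma> *v (P *v h_vec))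
     in P = \<Gamma> ** (P - P ** outer h_vec h_vec ** P) ** transpose \<Gamma> + outer g g)"

definition CEE_locus ::
  "nat \<Rightarrow> (nat \<Rightarrow> complex) \<Rightarrow> (nat \<Rightarrow> nat) \<Rightarrow> 'n::{finite,linorder} rvec
     \<Rightarrow> ('n cvec \<times> 'n rmat) set" where
  "CEE_locus m z \<nu> \<sigma> = {(w, P). w \<in> W_plus m z \<nu> \<and> P \<in> Pi_set \<and> CEE z \<nu> \<sigma> w P}"

subsection \<open>Polynomials\<close>

text \<open>\<open>z\<^sup>n + a\<^sub>1 z\<^sup>n\<^sup>-\<^sup>1 + \<dots> + a\<^sub>n\<close>, where \<open>a\<^sub>1\<close> has position 0.\<close>

definition monic_poly :: "'n::{finite,linorder} rvec \<Rightarrow> real poly" where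
  "monic_poly a = monom 1 CARD('n) + (\<Sum>i\<in>UNIV. monom (a $ i) (CARD('n) - 1 - idx i))"

definition cpoly :: "real poly \<Rightarrow> complex \<Rightarrow> complex" where
  "cpoly p = poly (map_poly complex_of_real p)"

definition Schur :: "('n::{finite,linorder} rvec) set" where
  "Schur = {a. \<forall>z. cpoly (monic_poly a) z = 0 \<longrightarrow> cmod z < 1}"

definition P_set :: "('n::{finite,linorder} rvec \<times> 'n rvec) set" where
  "P_set = {(a, b). a \<in> Schur \<and> b \<in> Schur \<and>
     (\<lambda>z. cpoly (monic_poly b) z / cpoly (monic_poly a) z) analytic_on {z. 1 < cmod z} \<and>
     (\<forall>z. 1 < cmod z \<longrightarrow> 0 < Re (cpoly (monic_poly b) z / cpoly (monic_poly a) z))}"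

definition P_sigma ::
  "'n::{finite,linorder} rvec \<Rightarrow> ('n rvec \<times> 'n rvec) set" where
  "P_sigma \<sigma> = {(a, b) \<in> P_set. \<exists>\<rho>>0. \<forall>z. z \<noteq> 0 \<longrightarrow>
     cpoly (monic_poly a) z * cpoly (monic_poly b) (inverse z)
       + cpoly (monic_poly b) z * cpoly (monic_poly a) (inverse z)
     = 2 * (complex_of_real \<rho>)\<^sup>2 * cpoly (monic_poly \<sigma>) z * cpoly (monic_poly \<sigma>) (inverse z)}"

text \<open>
  Since \<open>monic_poly a\<close> has degree exactly \<open>n\<close>, \<open>a\<^sub>*(z) = z\<^sup>n a(z\<^sup>-\<^sup>1)\<close> is its
  \<^const>\<open>reflect_poly\<close>.
\<close>

definition star_poly :: "'n::{finite,linorder} rvec \<Rightarrow> real poly" where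
  "star_poly a = reflect_poly (monic_poly a)"

definition phi :: "'n::{finite,linorder} rvec \<Rightarrow> 'n rvec \<Rightarrow> complex \<Rightarrow> complex" where
  "phi a b z = 1/2 * (cpoly (star_poly b) z / cpoly (star_poly a) z)"

definition interpolates ::
  "nat \<Rightarrow> (nat \<Rightarrow> complex) \<Rightarrow> (nat \<Rightarrow> nat) \<Rightarrow> 'n::{finite,linorder} cvec
     \<Rightarrow> (complex \<Rightarrow> complex) \<Rightarrow> bool" where
  "interpolates m z \<nu> w f \<longleftrightarrow>
     (\<forall>j\<le>m. \<forall>k<\<nu> j. (deriv ^^ k) f (z j) / fact k = datum \<nu> w j k)"

text \<open>The degree of the rational function \<open>p/q\<close> after cancellation of common factors.\<close>

definition ratfun_degree :: "real poly \<Rightarrow> real poly \<Rightarrow> nat" where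
  "ratfun_degree p q = max (degree (p div gcd p q)) (degree (q div gcd p q))"

definition deg_phi :: "'n::{finite,linorder} rvec \<Rightarrow> 'n rvec \<Rightarrow> nat" where
  "deg_phi a b = ratfun_degree (smult (1/2) (star_poly b)) (star_poly a)"

definition deg_f :: "'n::{finite,linorder} rvec \<Rightarrow> 'n rvec \<Rightarrow> nat" where
  "deg_f a b = ratfun_degree (smult (1/2) (monic_poly b)) (monic_poly a)"

subsection \<open>Smooth maps, manifolds and semialgebraic sets\<close>

fun Ck_on :: "nat \<Rightarrow> 'a::euclidean_space set \<Rightarrow> ('a \<Rightarrow> 'b::euclidean_space) \<Rightarrow> bool" where
  "Ck_on 0 N f \<longleftrightarrow> continuous_on N f"
| "Ck_on (Suc k) N f \<longleftrightarrow> (\<forall>x\<in>N. f differentiable (at x)) \<and>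
     (\<forall>v. Ck_on k N (\<lambda>x. frechet_derivative f (at x) v))"

text \<open>
  Smoothness on an arbitrary subset of a Euclidean space, and submanifolds of a Euclidean
  space, in the sense of Milnor (Topology from the Differentiable Viewpoint): a map is smooth
  on \<open>X\<close> if near each point of \<open>X\<close> it extends to a \<open>C\<^sup>\<infinity>\<close> map on an open set of
  the ambient space.
\<close>

definition smooth_on ::
  "'a::euclidean_space set \<Rightarrow> ('a \<Rightarrow> 'b::euclidean_space) \<Rightarrow> bool" where
  "smooth_on X f \<longleftrightarrow> (\<forall>x\<in>X. \<exists>N g. open N \<and> x \<in> N \<and> (\<forall>k. Ck_on k N g) \<and>
     (\<forall>y\<in>X \<inter> N. g y = f y))"

definition diffeomorphism ::
  "'a::euclidean_space set \<Rightarrow> 'b::euclidean_space set \<Rightarrow> ('a \<Rightarrow> 'b) \<Rightarrow> bool" where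
  "diffeomorphism X Y f \<longleftrightarrow> bij_betw f X Y \<and> smooth_on X f \<and> smooth_on Y (inv_into X f)"

text \<open>A smooth manifold modelled on \<open>'m\<close>, hence of dimension \<open>DIM('m)\<close>.\<close>

definition smooth_manifold ::
  "'m::euclidean_space itself \<Rightarrow> 'a::euclidean_space set \<Rightarrow> bool" where
  "smooth_manifold _ M \<longleftrightarrow> (\<forall>x\<in>M. \<exists>N (T :: 'm set) \<phi>. open N \<and> x \<in> N \<and> open T \<and>
     diffeomorphism (M \<inter> N) T \<phi>)"

definition semialgebraic :: "'a::euclidean_space set \<Rightarrow> bool" where
  "semialgebraic S \<longleftrightarrow> (\<exists>\<C>. finite \<C> \<and> S = \<Union>\<C> \<and>
     (\<forall>C\<in>\<C>. \<exists>F G. finite F \<and> finite G \<and> (\<forall>p\<in>F \<union> G. real_polynomial_function p) \<and>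
        C = {x. (\<forall>p\<in>F. p x = 0) \<and> (\<forall>q\<in>G. 0 < q x)}))"

end

theory Submission
  imports Defs "HOL-Complex_Analysis.Complex_Analysis" "HOL-Computational_Algebra.Fundamental_Theorem_Algebra"
begin

no_notation fps_nth (infixl "$" 75)

text \<open>
  Let \<open>N\<close> be the real polynomial \<open>\<Prod>\<^sub>j (x - z\<^sub>j)\<^bsup>n\<^sub>j\<^esup>\<close>.  In the basis given by the columns of \<open>V\<close>
  the data become \<open>[1/2; c]\<close> with \<open>c \<in> \<real>\<^sup>n\<close>, \<open>W\<close> becomes multiplication by that polynomial modulo
  \<open>N\<close>, and the interpolation conditions become the linear relation \<open>b\<^sub>* = 2 c a\<^sub>* mod N\<close>, which after
  the Cayley transform \<open>t = (a + b)/2\<close>, \<open>g = (b - a)/2\<close> reads \<open>g = u + U t\<close>.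

  With \<open>r = 1 - h'Ph\<close> and \<open>t = \<sigma> + \<Gamma>Ph\<close> the covariance extension equation is the displacement equation
  \<open>(a(x) b(y) + b(x) a(y))/2 - r \<sigma>(x) \<sigma>(y) = (1 - x y) P(x,y)\<close> for the reversed polynomials, so
  \<open>P\<close> exists and is unique (a Bezoutian) exactly if \<open>a\<close>, \<open>b\<close> solve the spectral equation
  with \<open>\<rho>\<^sup>2 = r\<close>.  It is then also the Gramian of the pair \<open>(\<Gamma>\<^sub>a, a - \<sigma>)\<close>, which gives
  \<open>P \<ge> 0\<close> and \<open>rank P = n - deg gcd(a, \<sigma>) = n - deg gcd(a, b)\<close>.

  Unique solvability and smooth dependence on \<open>c\<close> come from the map sending \<open>(a, c)\<close> to the
  autocorrelation of \<open>a\<close> and \<open>b = 2 c a mod N\<close>, together with \<open>c\<close>.  It is injective by a contour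
  integral identity, open by invariance of domain, and proper by positivity of the Pick matrix, hence a
  bijection onto a convex set.  Being quadratic in \<open>a\<close> and injective, it has injective differential;
  by Cramer's rule the derivative of the solution is a rational function of the solution and \<open>c\<close>,
  so the solution is smooth.
\<close>

subsection \<open>Vectors as polynomials\<close>

text \<open>The unknown factor \<rho> shapes the proof. A monic a together with \<rho> is replaced
  by the single vector v = a_*/\<rho>: the spectral equation becomes
  \<open>acorr v (beta c v) = dvec \<sigma>\<close>, with n+1 real unknowns and n+1 real equations,
  and \<rho> is recovered from the constant coefficient 1/\<rho> of v. Two normalisations keep this
  consistent: z_0 = 0 makes reduction modulo \<open>N\<close> preserve the value at 0, and w_00 =
  1/2 makes 2c equal to 1 there, so b_* has the same constant coefficient as a_*. Solvability then
  needs no degree theory: the target is convex, hence connected, and the image of the moment map is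
  open, relatively closed and nonempty. Smoothness needs only the first derivative of the solution,
  because a derivative that is rational in the solution and c can be differentiated again by the
  chain rule. The definition of \<open>semialgebraic\<close> asks for explicit polynomials, whereas
  definiteness quantifies over vectors; the coefficients of det (A + x I) replace the quantifier.
  The denominator of u and U is det (W + I/2), which is nonzero wherever the Pick matrix is positive
  definite.\<close>

text \<open>Ascending order, constant term first: in this order \<open>bord 1 a\<close> is the
  reversed polynomial a_* (\<open>star_poly_vpoly\<close>), which for a Schur polynomial has no
  zeros in the closed disc.\<close>

definition vpoly :: "'a::comm_ring_1^'k::{finite,linorder} \<Rightarrow> 'a poly" where
  "vpoly v = (\<Sum>i\<in>UNIV. monom (v $ i) (idx i))"

definition pvec :: "'a::comm_ring_1 poly \<Rightarrow> 'a^'k::{finite,linorder}" where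
  "pvec p = (\<chi> i. coeff p (idx i))"

lemma idx_eq_iff [simp]: "idx i = idx j \<longleftrightarrow> i = (j::'k::{finite,linorder})"
  using idx_inj by (auto dest: injD)

lemma sum_idx: "(\<Sum>i\<in>(UNIV::'k::{finite,linorder} set). g (idx i)) = (\<Sum>k<CARD('k). g k)"
  by (rule sum.reindex_bij_betw[OF idx_bij])

lemma coeff_vpoly_idx [simp]: "coeff (vpoly v) (idx i) = v $ i"
  by (simp add: vpoly_def coeff_sum)

lemma coeff_vpoly_ge: "CARD('k) \<le> k \<Longrightarrow> coeff (vpoly (v :: 'a::comm_ring_1^'k::{finite,linorder})) k = 0"
  unfolding vpoly_def coeff_sum coeff_monom
  using idx_bound[where 'k='k] by (intro sum.neutral) (auto simp: not_le[symmetric])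

lemma degree_vpoly_less: "degree (vpoly (v :: 'a::comm_ring_1^'k::{finite,linorder})) < CARD('k)"
proof (cases "vpoly v = 0")
  case False
  then show ?thesis
    using coeff_vpoly_ge[of "degree (vpoly v)" v] leading_coeff_0_iff by fastforce
qed simp

lemma pvec_vpoly [simp]: "pvec (vpoly v) = v"
  by (simp add: pvec_def vec_eq_iff)

lemma vpoly_pvec [simp]:
  assumes "degree p < CARD('k)"
  shows "vpoly (pvec p :: 'a::comm_ring_1^'k::{finite,linorder}) = p"
proof (rule poly_eqI)
  fix k
  show "coeff (vpoly (pvec p :: 'a^'k::{finite,linorder})) k = coeff p k"
  proof (cases "k < CARD('k)")
    case True
    have "coeff (vpoly (pvec p :: 'a^'k::{finite,linorder})) (idx (idx_inv k :: 'k)) = coeff p (idx (idx_inv k :: 'k))"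
      by (simp only: coeff_vpoly_idx) (simp add: pvec_def)
    then show ?thesis using True by (simp add: idx_idx_inv)
  next
    case False
    then show ?thesis using assms by (simp add: coeff_vpoly_ge coeff_eq_0)
  qed
qed

lemma vpoly_add: "vpoly (u + v) = vpoly u + vpoly v"
  by (simp add: vpoly_def add_monom[symmetric] sum.distrib)

lemma vpoly_0 [simp]: "vpoly 0 = 0"
  by (simp add: vpoly_def)

lemma vpoly_minus: "vpoly (- u) = - vpoly u"
  by (simp add: vpoly_def sum_negf minus_monom[symmetric])

lemma vpoly_diff: "vpoly (u - v) = vpoly u - vpoly v"
  using vpoly_add[of u "-v"] by (simp add: vpoly_minus)

lemma vpoly_scaleR: "vpoly (x *\<^sub>R u) = smult x (vpoly (u :: real^'k::{finite,linorder}))"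
  by (intro poly_eqI) (simp add: vpoly_def coeff_sum sum_distrib_left if_distrib cong: if_cong)

lemma vpoly_eq_0_iff [simp]: "vpoly u = 0 \<longleftrightarrow> u = 0"
  by (metis pvec_vpoly vpoly_0)

lemma vpoly_inject: "vpoly u = vpoly v \<longleftrightarrow> u = v"
  by (metis pvec_vpoly)

lemma pvec_add: "pvec (p + q) = pvec p + pvec q" by (simp add: pvec_def vec_eq_iff)
lemma pvec_smultR: "pvec (smult (x::real) p) = x *\<^sub>R pvec p" by (simp add: pvec_def vec_eq_iff)

lemma sum_UNIV_option: "(\<Sum>i\<in>(UNIV::'n::finite option set). g i) = g None + (\<Sum>i\<in>UNIV. g (Some i))"
  by (simp add: UNIV_option_conv sum.reindex)

definition bord :: "'a \<Rightarrow> 'a^'n::finite \<Rightarrow> 'a^'n option" where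
  "bord x v = (\<chi> i. case i of None \<Rightarrow> x | Some l \<Rightarrow> v $ l)"

lemma bord_nth [simp]: "bord x v $ None = x" "bord x v $ Some i = v $ i"
  by (simp_all add: bord_def)

lemma bord_eqI: "u $ None = x \<Longrightarrow> (\<And>i. u $ Some i = v $ i) \<Longrightarrow> u = bord x v"
  by (auto simp: vec_eq_iff bord_def split: option.split)

subsection \<open>Linear recurrences\<close>

text \<open>The polynomial p evaluated at the left shift and applied to the sequence f; products of
  polynomials therefore become compositions.\<close>

definition rec_op :: "'a::comm_ring_1 poly \<Rightarrow> (nat \<Rightarrow> 'a) \<Rightarrow> nat \<Rightarrow> 'a" where
  "rec_op p f k = (\<Sum>i\<le>degree p. coeff p i * f (k + i))"

lemma rec_op_le: "degree p \<le> n \<Longrightarrow> rec_op p f k = (\<Sum>i\<le>n. coeff p i * f (k + i))"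
  unfolding rec_op_def
  by (rule sum.mono_neutral_left) (auto simp: coeff_eq_0)

lemma rec_op_0 [simp]: "rec_op 0 f = (\<lambda>_. 0)"
  by (simp add: rec_op_def fun_eq_iff)

lemma rec_op_pCons: "rec_op (pCons a p) f k = a * f k + rec_op p f (Suc k)"
proof -
  have "rec_op (pCons a p) f k = (\<Sum>i\<le>Suc (degree p). coeff (pCons a p) i * f (k + i))"
    by (rule rec_op_le) (rule degree_pCons_le)
  also have "\<dots> = a * f k + (\<Sum>i\<le>degree p. coeff p i * f (Suc k + i))"
    by (subst sum.atMost_Suc_shift) simp
  finally show ?thesis by (simp add: rec_op_def)
qed

lemma rec_op_add: "rec_op (p + q) f k = rec_op p f k + rec_op q f k"
proof -
  let ?n = "max (degree p) (degree q)"
  have "rec_op (p + q) f k = (\<Sum>i\<le>?n. coeff (p + q) i * f (k + i))"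
    by (rule rec_op_le) (rule degree_add_le_max)
  then show ?thesis
    by (simp add: rec_op_le[of p ?n] rec_op_le[of q ?n] sum.distrib distrib_right)
qed

lemma rec_op_smult: "rec_op (smult c p) f k = c * rec_op p f k"
  by (subst rec_op_le[OF degree_smult_le]) (simp add: rec_op_def sum_distrib_left mult.assoc)

lemma rec_op_mult: "rec_op (p * q) f k = rec_op p (rec_op q f) k"
proof (induction p arbitrary: k)
  case (pCons a p)
  have "rec_op (pCons a p * q) f k = a * rec_op q f k + rec_op (pCons 0 (p * q)) f k"
    by (simp add: mult_pCons_left rec_op_add rec_op_smult)
  also have "\<dots> = rec_op (pCons a p) (rec_op q f) k"
    by (simp add: rec_op_pCons pCons.IH)
  finally show ?case .
qed simp

lemma contraction_tendsto_0:
  fixes f :: "nat \<Rightarrow> complex"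
  assumes lim: "(\<lambda>k. f (Suc k) - l * f k) \<longlonglongrightarrow> 0" and l: "cmod l < 1"
  shows "f \<longlonglongrightarrow> 0"
proof (rule LIMSEQ_I)
  fix e :: real assume e: "0 < e"
  \<comment> \<open>Chosen so that e/2 is the fixed point of x \<mapsto> d + |l| x; the error e/2
    then reproduces itself in the induction.\<close>
  define d where "d = e / 2 * (1 - cmod l)"
  have d: "d > 0" using e l by (simp add: d_def)
  obtain K where K: "\<And>k. k \<ge> K \<Longrightarrow> cmod (f (Suc k) - l * f k) < d"
    using LIMSEQ_D[OF lim d] by auto
  have bnd: "cmod (f (K + j)) \<le> cmod l ^ j * cmod (f K) + e / 2" for j
  proof (induction j)
    case (Suc j)
    have "cmod (f (K + Suc j)) \<le> cmod (f (Suc (K + j)) - l * f (K + j)) + cmod (l * f (K + j))"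
      by (metis add_Suc_right diff_add_cancel norm_triangle_ineq)
    also have "\<dots> \<le> d + cmod l * (cmod l ^ j * cmod (f K) + e / 2)"
      using K[of "K + j"] Suc.IH by (intro add_mono) (auto simp: norm_mult mult_left_mono)
    also have "\<dots> = cmod l ^ Suc j * cmod (f K) + e / 2"
      by (simp add: d_def algebra_simps)
    finally show ?case .
  qed (use e in auto)
  have "(\<lambda>j. cmod l ^ j * cmod (f K)) \<longlonglongrightarrow> 0 * cmod (f K)"
    using l by (intro tendsto_mult LIMSEQ_power_zero) auto
  then obtain J where J: "\<And>j. j \<ge> J \<Longrightarrow> cmod l ^ j * cmod (f K) < e / 2"
    using LIMSEQ_D[of "\<lambda>j. cmod l ^ j * cmod (f K)" 0 "e/2"] e by auto
  show "\<exists>no. \<forall>k\<ge>no. norm (f k - 0) < e"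
  proof (intro exI allI impI)
    fix k assume "k \<ge> K + J"
    then show "norm (f k - 0) < e"
      using bnd[of "k - K"] J[of "k - K"] by (simp add: le_diff_conv2)
  qed
qed

text \<open>Split off one root l at a time: with p = (x - l) q, the induction hypothesis for q
  applies to the sequence f (k+1) - l f k, and |l| < 1 passes the limit on to f.\<close>

lemma rec_op_tendsto_0:
  fixes f :: "nat \<Rightarrow> complex"
  assumes "p \<noteq> 0" and "\<And>z. poly p z = 0 \<Longrightarrow> cmod z < 1" and "rec_op p f \<longlonglongrightarrow> 0"
  shows "f \<longlonglongrightarrow> 0"
  using assms
proof (induction "degree p" arbitrary: p f)
  case 0
  then obtain c where c: "p = [:c:]" by (metis degree_eq_zeroE)
  have "rec_op p f = (\<lambda>k. c * f k)" by (simp add: c rec_op_pCons fun_eq_iff)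
  with 0 have "(\<lambda>k. inverse c * (c * f k)) \<longlonglongrightarrow> inverse c * 0"
    by (intro tendsto_mult tendsto_const) simp
  then show ?case using 0 c by (simp add: field_simps)
next
  case (Suc d)
  obtain l where l: "poly p l = 0" using alg_closed_imp_poly_has_root[of p] Suc.hyps(2) by auto
  then obtain q where q: "p = [:-l, 1:] * q" by (metis dvdE poly_eq_0_iff_dvd)
  have q0: "q \<noteq> 0" using Suc.prems(1) q by auto
  have dq: "d = degree q" using Suc.hyps(2) q q0 by (simp add: degree_mult_eq del: mult_pCons_left)
  have "rec_op p f = rec_op q (rec_op [:-l, 1:] f)"
    by (rule ext) (simp only: q mult.commute[of "[:-l, 1:]" q] rec_op_mult)
  then have "rec_op [:-l, 1:] f \<longlonglongrightarrow> 0"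
    using Suc.hyps(1)[OF dq q0, of "rec_op [:-l, 1:] f"] Suc.prems q
    by (simp del: mult_pCons_left)
  moreover have "rec_op [:-l, 1:] f = (\<lambda>k. f (Suc k) - l * f k)"
    by (rule ext) (simp add: rec_op_pCons)
  ultimately have "(\<lambda>k. f (Suc k) - l * f k) \<longlonglongrightarrow> 0"
    by simp
  then show ?case using contraction_tendsto_0 l Suc.prems(2) by blast
qed

lemma mod_sum_real: "(\<Sum>i\<in>A. f i) mod (N::real poly) = (\<Sum>i\<in>A. f i mod N)"
  by (induction A rule: infinite_finite_induct) (auto simp: poly_mod_add_left)

text \<open>As a function of k, each coefficient of x^k p mod N satisfies the linear recurrence with
  characteristic polynomial N, whose roots lie in the open disc.\<close>

lemma mod_power_tendsto_0:
  fixes N p :: "real poly"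
  assumes N: "N \<noteq> 0" "\<And>z. cpoly N z = 0 \<Longrightarrow> cmod z < 1"
  shows "(\<lambda>k. coeff (monom 1 k * p mod N) i) \<longlonglongrightarrow> 0"
proof -
  define f where "f k = coeff (monom 1 k * p mod N) i" for k
  have rec: "(\<Sum>l\<le>degree N. coeff N l * f (k + l)) = 0" for k
  proof -
    have "(\<Sum>l\<le>degree N. coeff N l * f (k + l))
        = coeff (\<Sum>l\<le>degree N. smult (coeff N l) (monom 1 (k + l) * p mod N)) i"
      by (simp add: coeff_sum f_def)
    also have "(\<Sum>l\<le>degree N. smult (coeff N l) (monom 1 (k + l) * p mod N))
        = (\<Sum>l\<le>degree N. monom 1 k * p * monom (coeff N l) l) mod N"
      unfolding mod_sum_real mod_smult_left[symmetric]
      by (intro sum.cong refl arg_cong2[where f="(mod)"])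
         (simp add: mult.assoc mult_monom mult.commute mult.left_commute smult_monom flip: mult_smult_right mult_smult_left)
    also have "(\<Sum>l\<le>degree N. monom 1 k * p * monom (coeff N l) l) = monom 1 k * p * N"
      by (subst sum_distrib_left[symmetric]) (metis poly_as_sum_of_monoms)
    finally show ?thesis by simp
  qed
  let ?N = "map_poly complex_of_real N"
  have deg: "degree ?N = degree N" by (rule degree_map_poly) simp
  have cf: "coeff ?N l = complex_of_real (coeff N l)" for l by (simp add: coeff_map_poly)
  have "rec_op ?N (\<lambda>k. complex_of_real (f k)) = (\<lambda>_. 0)"
    by (rule ext) (simp add: rec_op_def deg cf rec flip: of_real_mult of_real_sum)
  moreover have "?N \<noteq> 0" using N(1) by (simp add: map_poly_eq_0_iff)
  moreover have "cmod z < 1" if "poly ?N z = 0" for z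
    using N(2)[of z] that by (simp only: cpoly_def)
  ultimately have "(\<lambda>k. complex_of_real (f k)) \<longlonglongrightarrow> 0"
    using rec_op_tendsto_0[of ?N "\<lambda>k. complex_of_real (f k)"] by (simp only: tendsto_const simp_thms)
  then have "f \<longlonglongrightarrow> 0" by (simp only: tendsto_of_real_iff of_real_0[symmetric, where 'a=complex])
  then show ?thesis by (simp add: f_def[abs_def])
qed

subsection \<open>Stein equations\<close>

lemma inner_transpose_vec:
  fixes A :: "real^'m^'k"
  shows "(transpose A *v x) \<bullet> y = x \<bullet> (A *v y)"
  by (simp add: dot_lmul_matrix)

lemma transpose_iter_inner:
  fixes A :: "real^'k^'k"
  shows "(((*v) (transpose A) ^^ k) x) \<bullet> y = x \<bullet> (((*v) A ^^ k) y)"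
proof (induction k arbitrary: y)
  case (Suc k)
  have "(((*v) (transpose A) ^^ Suc k) x) \<bullet> y = (((*v) (transpose A) ^^ k) x) \<bullet> (A *v y)"
    by (simp add: inner_transpose_vec del: transpose_matrix_vector)
  also have "\<dots> = x \<bullet> (((*v) A ^^ k) (A *v y))" by (rule Suc)
  finally show ?case by (simp add: funpow_swap1 del: transpose_matrix_vector)
qed simp

lemma transpose_iter_tendsto:
  fixes A :: "real^'k^'k"
  assumes "\<And>x. (\<lambda>k. ((*v) A ^^ k) x) \<longlonglongrightarrow> 0"
  shows "(\<lambda>k. ((*v) (transpose A) ^^ k) x) \<longlonglongrightarrow> 0"
proof (rule vec_tendstoI)
  fix i
  have "(\<lambda>k. x \<bullet> (((*v) A ^^ k) (axis i 1))) \<longlonglongrightarrow> x \<bullet> 0"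
    by (intro tendsto_inner tendsto_const assms)
  moreover have "x \<bullet> (((*v) A ^^ k) (axis i 1)) = ((*v) (transpose A) ^^ k) x $ i" for k
    using transpose_iter_inner[where A=A and k=k and x=x and y="axis i 1"] by (simp add: inner_axis)
  ultimately show "(\<lambda>k. ((*v) (transpose A) ^^ k) x $ i) \<longlonglongrightarrow> 0 $ i" by simp
qed

text \<open>Along the orbit of x under the transpose of A the form does not increase, and it tends
  to 0 because the orbit does.\<close>

lemma stein_psd:
  fixes A P :: "real^'k^'k"
  assumes lim: "\<And>x. (\<lambda>k. ((*v) A ^^ k) x) \<longlonglongrightarrow> 0"
    and le: "\<And>x. (transpose A *v x) \<bullet> (P *v (transpose A *v x)) \<le> x \<bullet> (P *v x)"
  shows "0 \<le> x \<bullet> (P *v x)"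
proof -
  let ?x = "\<lambda>k. ((*v) (transpose A) ^^ k) x"
  have dec: "?x k \<bullet> (P *v ?x k) \<le> x \<bullet> (P *v x)" for k
  proof (induction k)
    case (Suc k)
    then show ?case using le[of "?x k"] by (simp del: transpose_matrix_vector)
  qed simp
  have "(\<lambda>k. ?x k \<bullet> (P *v ?x k)) \<longlonglongrightarrow> 0 \<bullet> (P *v 0)"
    by (intro tendsto_inner transpose_iter_tendsto lim
        bounded_linear.tendsto[OF matrix_vector_mul_bounded_linear])
  then show ?thesis using dec by (intro LIMSEQ_le_const2[of "\<lambda>k. ?x k \<bullet> (P *v ?x k)" 0]) auto
qed

text \<open>The bilinear form of X is constant along pairs of orbits of the transpose of A, and
  these orbits tend to 0.\<close>

lemma stein_unique_0:
  fixes A X :: "real^'k^'k"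
  assumes lim: "\<And>x. (\<lambda>k. ((*v) A ^^ k) x) \<longlonglongrightarrow> 0" and X: "X = A ** X ** transpose A"
  shows "X = 0"
proof -
  let ?t = "\<lambda>k x. ((*v) (transpose A) ^^ k) x"
  have step: "y \<bullet> (X *v x) = (transpose A *v y) \<bullet> (X *v (transpose A *v x))" for x y
  proof -
    have "X *v x = A *v (X *v (transpose A *v x))"
      by (subst X) (simp only: matrix_vector_mul_assoc matrix_mul_assoc)
    then show ?thesis by (simp add: inner_transpose_vec del: transpose_matrix_vector)
  qed
  have it: "y \<bullet> (X *v x) = ?t k y \<bullet> (X *v ?t k x)" for x y k
  proof (induction k)
    case (Suc k)
    then show ?case using step[of "?t k y" "?t k x"] by (simp del: transpose_matrix_vector)
  qed simp
  have "y \<bullet> (X *v x) = 0" for x y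
  proof -
    have "(\<lambda>k. ?t k y \<bullet> (X *v ?t k x)) \<longlonglongrightarrow> 0 \<bullet> (X *v 0)"
      by (intro tendsto_inner transpose_iter_tendsto lim
          bounded_linear.tendsto[OF matrix_vector_mul_bounded_linear])
    then have "(\<lambda>k. y \<bullet> (X *v x)) \<longlonglongrightarrow> 0" by (simp add: it[symmetric])
    then show ?thesis by (simp add: LIMSEQ_const_iff)
  qed
  then have "X *v x = 0 *v x" for x by (metis inner_eq_zero_iff matrix_vector_mult_0)
  then show ?thesis using matrix_eq by blast
qed

lemma matrix_add_rdistrib: "(A + B) ** C = A ** C + B ** (C :: 'a::comm_ring_1^'m^'k)"
  by (simp add: matrix_matrix_mult_def vec_eq_iff sum.distrib distrib_right)

text \<open>X \<mapsto> X - A X A' is an injective endomorphism of a finite-dimensional space, hence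
  surjective; no series has to be summed.\<close>

lemma stein_exists:
  fixes A Q :: "real^'k^'k"
  assumes lim: "\<And>x. (\<lambda>k. ((*v) A ^^ k) x) \<longlonglongrightarrow> 0"
  shows "\<exists>X. X = A ** X ** transpose A + Q"
proof -
  define L where "L X = X - A ** X ** transpose A" for X :: "real^'k^'k"
  have lin: "linear L"
    unfolding L_def
    by (intro linearI)
       (simp_all add: matrix_add_ldistrib matrix_add_rdistrib scaleR_diff_right
        scalar_matrix_assoc matrix_scalar_ac)
  have "inj L"
    unfolding linear_injective_0[OF lin] L_def using stein_unique_0[OF lim] by simp
  then have "surj L" using lin linear_injective_imp_surjective by blast
  then obtain X where "L X = Q" by (metis surjD)
  then show ?thesis unfolding L_def by (metis add.commute diff_add_cancel)
qed

subsection \<open>The displacement kernel\<close>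

text \<open>Solves \<open>\<mu>(x,y) = (1 - x y) Q(x,y)\<close> for the coefficients of \<open>Q\<close>.\<close>

definition diagsum :: "(nat \<Rightarrow> nat \<Rightarrow> 'a::comm_ring_1) \<Rightarrow> nat \<Rightarrow> nat \<Rightarrow> 'a" where
  "diagsum \<mu> i j = (\<Sum>l\<le>min i j. \<mu> (i - l) (j - l))"

lemma diagsum_0 [simp]: "diagsum \<mu> 0 j = \<mu> 0 j" "diagsum \<mu> i 0 = \<mu> i 0"
  by (simp_all add: diagsum_def)

lemma diagsum_Suc: "diagsum \<mu> (Suc i) (Suc j) = \<mu> (Suc i) (Suc j) + diagsum \<mu> i j"
  unfolding diagsum_def min_Suc_Suc by (subst sum.atMost_Suc_shift) simp

text \<open>The recursion compares coefficients in \<mu> = (1 - x y) Q. The vanishing of row and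
  column n says that Q stops before degree n, so that the product has degree at most n in each
  variable.\<close>

lemma displacement_generating:
  fixes q :: "nat \<Rightarrow> nat \<Rightarrow> 'a::comm_ring_1"
  assumes "\<And>j. j \<le> n \<Longrightarrow> q n j = 0" "\<And>i. i \<le> n \<Longrightarrow> q i n = 0"
    and 0: "\<And>j. \<mu> 0 j = q 0 j" "\<And>i. \<mu> i 0 = q i 0"
    and S: "\<And>i j. i < n \<Longrightarrow> j < n \<Longrightarrow> \<mu> (Suc i) (Suc j) = q (Suc i) (Suc j) - q i j"
  shows "(\<Sum>i\<le>n. \<Sum>j\<le>n. \<mu> i j * x ^ i * y ^ j) = (1 - x * y) * (\<Sum>i<n. \<Sum>j<n. q i j * x ^ i * y ^ j)"
proof -
  have sh: "(\<Sum>i\<le>n. \<Sum>j\<le>n. g i j) = (\<Sum>i<n. \<Sum>j<n. g i j) + (\<Sum>i<n. g i n) + (\<Sum>j\<le>n. g n j)" for g :: "nat \<Rightarrow> nat \<Rightarrow> 'a"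
    by (simp add: lessThan_Suc_atMost[symmetric] sum.distrib)
  have sh': "(\<Sum>i\<le>n. \<Sum>j\<le>n. g i j) = (\<Sum>j\<le>n. g 0 j) + (\<Sum>i<n. g (Suc i) 0) + (\<Sum>i<n. \<Sum>j<n. g (Suc i) (Suc j))" for g :: "nat \<Rightarrow> nat \<Rightarrow> 'a"
    by (simp add: lessThan_Suc_atMost[symmetric] sum.lessThan_Suc_shift sum.distrib del: sum.lessThan_Suc)
  have "(\<Sum>i\<le>n. \<Sum>j\<le>n. \<mu> i j * x ^ i * y ^ j)
      = (\<Sum>j\<le>n. q 0 j * y ^ j) + (\<Sum>i<n. q (Suc i) 0 * x ^ Suc i)
        + (\<Sum>i<n. \<Sum>j<n. (q (Suc i) (Suc j) - q i j) * x ^ Suc i * y ^ Suc j)"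
    by (subst sh') (simp add: 0 S)
  also have "\<dots> = (\<Sum>i\<le>n. \<Sum>j\<le>n. q i j * x ^ i * y ^ j) - x * y * (\<Sum>i<n. \<Sum>j<n. q i j * x ^ i * y ^ j)"
    by (subst sh') (simp add: sum_subtractf algebra_simps sum_distrib_left)
  also have "(\<Sum>i\<le>n. \<Sum>j\<le>n. q i j * x ^ i * y ^ j) = (\<Sum>i<n. \<Sum>j<n. q i j * x ^ i * y ^ j)"
    by (subst sh) (simp add: assms(1,2))
  finally show ?thesis by (simp add: algebra_simps)
qed

subsection \<open>Real polynomials on the unit circle\<close>

lemma cpoly_0 [simp]: "cpoly 0 z = 0" by (simp add: cpoly_def)

lemma cpoly_1 [simp]: "cpoly 1 z = 1" by (simp add: cpoly_def)

lemma cpoly_pCons: "cpoly (pCons a p) z = of_real a + z * cpoly p z"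
  by (cases "a = 0 \<and> p = 0") (auto simp: cpoly_def map_poly_pCons)

lemma cpoly_smult: "cpoly (smult c p) z = of_real c * cpoly p z"
  by (induction p) (auto simp: cpoly_pCons algebra_simps)

lemma cpoly_add: "cpoly (p + q) z = cpoly p z + cpoly q z"
  by (induction p q rule: poly_induct2) (auto simp: cpoly_pCons algebra_simps)

lemma cpoly_mult: "cpoly (p * q) z = cpoly p z * cpoly q z"
  by (induction p) (auto simp: cpoly_pCons cpoly_add cpoly_smult algebra_simps)

lemma cpoly_altdef: "cpoly p z = (\<Sum>i\<le>degree p. of_real (coeff p i) * z ^ i)"
proof -
  have "degree (map_poly complex_of_real p) = degree p" by (rule degree_map_poly) simp
  then show ?thesis by (simp add: cpoly_def poly_altdef coeff_map_poly)
qed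

lemma cpoly_le: "degree p \<le> n \<Longrightarrow> cpoly p z = (\<Sum>i\<le>n. of_real (coeff p i) * z ^ i)"
  unfolding cpoly_altdef by (rule sum.mono_neutral_left) (auto simp: coeff_eq_0)

lemma cpoly_minus: "cpoly (- p) z = - cpoly p z"
  using cpoly_smult[of "-1" p z] by simp

lemma cpoly_diff: "cpoly (p - q) z = cpoly p z - cpoly q z"
  using cpoly_add[of p "-q" z] by (simp add: cpoly_minus)

lemma cpoly_monom: "cpoly (monom c k) z = of_real c * z ^ k"
  by (simp add: cpoly_def map_poly_monom poly_monom)

lemma cpoly_sum: "cpoly (\<Sum>i\<in>A. f i) z = (\<Sum>i\<in>A. cpoly (f i) z)"
  by (induction A rule: infinite_finite_induct) (auto simp: cpoly_add)

lemma cpoly_at_0 [simp]: "cpoly p 0 = of_real (coeff p 0)"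
  by (simp add: cpoly_def poly_0_coeff_0 coeff_map_poly)

lemma cnj_cpoly: "cnj (cpoly p z) = cpoly p (cnj z)"
  by (simp add: cpoly_altdef)

lemma cpoly_of_real: "cpoly p (of_real x) = of_real (poly p x)"
  by (simp add: cpoly_altdef poly_altdef)

lemma holomorphic_cpoly [holomorphic_intros]:
  "f holomorphic_on S \<Longrightarrow> (\<lambda>x. cpoly p (f x)) holomorphic_on S"
  unfolding cpoly_altdef by (intro holomorphic_intros)

lemma continuous_on_cpoly [continuous_intros]:
  "continuous_on S f \<Longrightarrow> continuous_on S (\<lambda>x. cpoly p (f x))"
  unfolding cpoly_altdef by (intro continuous_intros)

lemma infinite_unit_circle: "infinite (sphere (0::complex) 1)"
  using uncountable_infinite connected_uncountable[of "sphere (0::complex) 1" 1 "-1"]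
  by (simp add: connected_sphere)

lemma cpoly_zero_on_circle:
  assumes "\<And>z. cmod z = 1 \<Longrightarrow> cpoly p z = 0"
  shows "p = 0"
proof (rule ccontr)
  assume "p \<noteq> 0"
  then have "map_poly complex_of_real p \<noteq> 0" by (simp add: map_poly_eq_0_iff)
  then have "finite {z. poly (map_poly complex_of_real p) z = 0}" by (rule poly_roots_finite)
  moreover have "sphere 0 1 \<subseteq> {z. poly (map_poly complex_of_real p) z = 0}"
    using assms by (auto simp: cpoly_def)
  ultimately show False using infinite_unit_circle finite_subset by blast
qed

lemma cpoly_eq_on_circle: "(\<And>z. cmod z = 1 \<Longrightarrow> cpoly p z = cpoly q z) \<Longrightarrow> p = q"
  using cpoly_zero_on_circle[of "p - q"] by (simp add: cpoly_diff)

text \<open>z^n p(1/z) with a prescribed n instead of the degree of p, so that polynomials of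
  different degrees can be reversed with a common exponent.\<close>

definition rev_poly :: "nat \<Rightarrow> 'a::comm_ring_1 poly \<Rightarrow> 'a poly" where
  "rev_poly n p = (\<Sum>i\<le>n. monom (coeff p i) (n - i))"

lemma cpoly_rev_poly:
  assumes "degree p \<le> n" "z \<noteq> 0"
  shows "cpoly (rev_poly n p) z = z ^ n * cpoly p (inverse z)"
  unfolding rev_poly_def cpoly_sum cpoly_monom cpoly_le[OF assms(1)] sum_distrib_left
  using assms(2) by (intro sum.cong) (auto simp: power_diff field_simps)

lemma inverse_on_circle: "cmod z = 1 \<Longrightarrow> inverse z = cnj z"
  by (metis complex_div_cnj complex_norm_square div_by_1 inverse_eq_divide mult_1 of_real_1 one_power2)

lemma cpoly_rev_poly_circle:
  assumes "degree p \<le> n" "cmod z = 1"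
  shows "cpoly (rev_poly n p) z = z ^ n * cnj (cpoly p z)"
  using cpoly_rev_poly[OF assms(1), of z] assms(2) inverse_on_circle[OF assms(2)]
  by (cases "z = 0") (auto simp: cnj_cpoly)

text \<open>Cauchy's formula for f(u)/u at 0: on the unit circle du = 2 pi i u dt, which cancels the
  denominator.\<close>

lemma mean_value_circle:
  assumes "open S" "cball 0 1 \<subseteq> S" "f holomorphic_on S"
  shows "((\<lambda>t. f (circlepath 0 1 t)) has_integral f 0) {0..1}"
proof -
  have "((\<lambda>u. f u / (u - 0)) has_contour_integral (2 * of_real pi * \<i> * f 0)) (circlepath 0 1)"
    using assms by (intro Cauchy_integral_circlepath_simple) (auto intro: holomorphic_on_subset)
  then have "((\<lambda>t. f (circlepath 0 1 t) / circlepath 0 1 t *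
      vector_derivative (circlepath 0 1) (at t within {0..1})) has_integral (2 * of_real pi * \<i> * f 0)) {0..1}"
    by (simp add: has_contour_integral_def)
  then have "((\<lambda>t. (2 * of_real pi * \<i>) * f (circlepath 0 1 t)) has_integral (2 * of_real pi * \<i> * f 0)) {0..1}"
  proof (rule has_integral_eq[rotated])
    fix t :: real assume "t \<in> {0..1}"
    then have d: "vector_derivative (circlepath 0 1) (at t within {0..1}) = 2 * of_real pi * \<i> * circlepath 0 1 t"
      by (simp add: vector_derivative_circlepath01) (simp add: circlepath)
    have "circlepath 0 1 t \<noteq> 0" by (simp add: circlepath)
    then show "f (circlepath 0 1 t) / circlepath 0 1 t * vector_derivative (circlepath 0 1) (at t within {0..1})
        = 2 * of_real pi * \<i> * f (circlepath 0 1 t)" unfolding d by (simp add: field_simps)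
  qed
  note int2 = this
  obtain c where c: "c \<noteq> 0" and int: "((\<lambda>t. c * f (circlepath 0 1 t)) has_integral c * f 0) {0..1}"
    by (rule that[OF _ int2]) simp
  from has_integral_mult_right[OF int, of "inverse c"] show ?thesis
    using c by (simp add: mult.assoc[symmetric])
qed

text \<open>The mean of F over the circle is Re (G 0) = 0, and F is continuous and nonnegative. Each
  of the uniqueness results on the circle below is an instance with a suitable G.\<close>

lemma circle_vanish:
  assumes S: "open S" "cball 0 1 \<subseteq> S" "G holomorphic_on S" and G0: "Re (G 0) = 0"
    and F: "continuous_on (sphere 0 1) F" "\<And>z. cmod z = 1 \<Longrightarrow> 0 \<le> F z"
    and FG: "\<And>z. cmod z = 1 \<Longrightarrow> Re (G z) = F z"
    and z: "cmod z = 1"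
  shows "F z = 0"
proof -
  have pi: "circlepath (0::complex) 1 ` {0..1} = sphere 0 1"
    using path_image_circlepath[of 0 1] by (simp add: path_image_def)
  then have c1: "cmod (circlepath 0 1 t) = 1" if "t \<in> {0..1}" for t using that by force
  have "((\<lambda>t. Re (G (circlepath 0 1 t))) has_integral Re (G 0)) {0..1}"
    using has_integral_linear[OF mean_value_circle[OF S] bounded_linear_Re] by (simp add: o_def)
  then have int: "((\<lambda>t. F (circlepath 0 1 t)) has_integral 0) (cbox 0 1)"
    unfolding G0 cbox_interval by (rule has_integral_eq[rotated]) (simp add: FG c1)
  obtain t where t: "t \<in> {0..1}" "z = circlepath 0 1 t" using z pi by (metis imageE mem_sphere_0)
  have "continuous_on (cbox 0 1) (\<lambda>t. F (circlepath 0 1 t))"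
    by (rule continuous_on_compose2[OF F(1)]) (auto simp: c1 intro: continuous_on_subset path_circlepath[unfolded path_def])
  then have "F (circlepath 0 1 t) = 0"
    using t(1) by (intro has_integral_0_cbox_imp_0[OF _ _ int]) (auto simp: F(2) c1)
  then show ?thesis using t(2) by simp
qed

lemma open_nonvanishing:
  assumes "\<And>z. cmod z \<le> 1 \<Longrightarrow> cpoly p z \<noteq> 0"
  shows "open {z. cpoly p z \<noteq> 0}" "cball 0 1 \<subseteq> {z. cpoly p z \<noteq> 0}"
  using assms by (auto intro!: open_Collect_neq continuous_on_cpoly continuous_intros)

lemma cpoly_Re_zero_on_circle:
  assumes "\<And>z. cmod z = 1 \<Longrightarrow> Re (cpoly p z) = 0"
  shows "p = 0"
proof (rule cpoly_zero_on_circle)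
  fix z :: complex assume z: "cmod z = 1"
  have "(Im (cpoly p z))\<^sup>2 + (coeff p 0)\<^sup>2 = 0"
  \<comment> \<open>On the circle p is purely imaginary, so Re (- p^2) = (Im p)^2; the constant
    p(0)^2 is added to make G vanish at 0.\<close>
  proof (rule circle_vanish[of UNIV "\<lambda>z. of_real ((coeff p 0)\<^sup>2) - (cpoly p z)\<^sup>2"
        "\<lambda>z. (Im (cpoly p z))\<^sup>2 + (coeff p 0)\<^sup>2"])
    show "Re (of_real ((coeff p 0)\<^sup>2) - (cpoly p z)\<^sup>2) = (Im (cpoly p z))\<^sup>2 + (coeff p 0)\<^sup>2"
      if "cmod z = 1" for z using assms[OF that] by (simp add: power2_eq_square)
  qed (auto intro!: holomorphic_intros continuous_intros z simp: power2_eq_square)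
  then have "Im (cpoly p z) = 0" by (simp add: sum_power2_eq_zero_iff)
  then show "cpoly p z = 0" using assms[OF z] complex_eqI by auto
qed

text \<open>The quotient w = A/B has modulus 1 on the circle, so B/A is its conjugate and both
  quotients have the same mean real part: x = 1/x for x = A(0)/B(0) > 0. Then Re (1 - w) = |w - 1|^2
  / 2 on the circle, while 1 - w vanishes at 0.\<close>

lemma spectral_factor_unique:
  assumes A: "\<And>z. cmod z \<le> 1 \<Longrightarrow> cpoly A z \<noteq> 0" and B: "\<And>z. cmod z \<le> 1 \<Longrightarrow> cpoly B z \<noteq> 0"
    and pos: "0 < coeff A 0" "0 < coeff B 0"
    and eq: "\<And>z. cmod z = 1 \<Longrightarrow> cmod (cpoly A z) = cmod (cpoly B z)"
  shows "A = B"
proof -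
  let ?S = "{z. cpoly A z \<noteq> 0} \<inter> {z. cpoly B z \<noteq> 0}"
  have S: "open ?S" "cball 0 1 \<subseteq> ?S"
    using open_nonvanishing[of A, OF A] open_nonvanishing[of B, OF B] by auto
  have hA: "(\<lambda>z. cpoly A z / cpoly B z) holomorphic_on ?S" 
    by (intro holomorphic_intros) auto
  have hB: "(\<lambda>z. cpoly B z / cpoly A z) holomorphic_on ?S"
    by (intro holomorphic_intros) auto
  have quot: "cpoly B z / cpoly A z = cnj (cpoly A z / cpoly B z)" if "cmod z = 1" for z
  proof -
    have "cpoly A z * cnj (cpoly A z) = cpoly B z * cnj (cpoly B z)"
      using eq[OF that] by (simp add: complex_norm_square[symmetric])
    then show ?thesis using A[of z] B[of z] that by (simp add: field_simps)
  qed
  define x where "x = coeff A 0 / coeff B 0"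
  have xpos: "x > 0" using pos by (simp add: x_def)
  have c1: "cmod (circlepath 0 1 t) = 1" if "t \<in> {0..1}" for t
    using path_image_circlepath[of 0 1] that by (force simp: path_image_def)
  have "((\<lambda>t. Re (cpoly A (circlepath 0 1 t) / cpoly B (circlepath 0 1 t))) has_integral x) {0..1}"
    using has_integral_linear[OF mean_value_circle[OF S hA] bounded_linear_Re]
    by (simp add: o_def x_def flip: of_real_divide)
  moreover have "((\<lambda>t. Re (cpoly B (circlepath 0 1 t) / cpoly A (circlepath 0 1 t))) has_integral 1/x) {0..1}"
    using has_integral_linear[OF mean_value_circle[OF S hB] bounded_linear_Re]
    by (simp add: o_def x_def flip: of_real_divide)
  moreover have "Re (cpoly B (circlepath 0 1 t) / cpoly A (circlepath 0 1 t))
      = Re (cpoly A (circlepath 0 1 t) / cpoly B (circlepath 0 1 t))" if "t \<in> {0..1}" for t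
    using arg_cong[OF quot[OF c1[OF that]], of Re] by (simp only: cnj.simps)
  ultimately have "x = 1 / x"
    by (metis (no_types, lifting) has_integral_eq has_integral_unique)
  then have "x\<^sup>2 = 1" using xpos by (simp add: field_simps power2_eq_square)
  then have x1: "x = 1" using xpos by (simp add: power2_eq_1_iff)
  have "cpoly A z = cpoly B z" if z: "cmod z = 1" for z
  proof -
    have "(cmod (cpoly A z / cpoly B z - 1))\<^sup>2 / 2 = 0"
    proof (rule circle_vanish[OF S, of "\<lambda>z. 1 - cpoly A z / cpoly B z"
          "\<lambda>z. (cmod (cpoly A z / cpoly B z - 1))\<^sup>2 / 2"])
      show "Re (1 - cpoly A 0 / cpoly B 0) = 0"
        using x1 by (simp add: x_def flip: of_real_divide)
      show "continuous_on (sphere 0 1) (\<lambda>z. (cmod (cpoly A z / cpoly B z - 1))\<^sup>2 / 2)"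
        using B by (intro continuous_intros) auto
      show "Re (1 - cpoly A z / cpoly B z) = (cmod (cpoly A z / cpoly B z - 1))\<^sup>2 / 2" if "cmod z = 1" for z
      proof -
        let ?w = "cpoly A z / cpoly B z"
        have "cmod ?w = 1" using eq[OF that] B[of z] that by (simp add: norm_divide)
        then have "(Re ?w)\<^sup>2 + (Im ?w)\<^sup>2 = 1" by (metis cmod_power2 one_power2)
        moreover have "(cmod (?w - 1))\<^sup>2 = (Re ?w - 1)\<^sup>2 + (Im ?w)\<^sup>2" by (simp add: cmod_power2)
        ultimately show ?thesis by (simp add: power2_eq_square algebra_simps)
      qed
    qed (use z in \<open>auto intro!: holomorphic_intros\<close>)
    then show ?thesis using B[of z] z by simp
  qed
  then show ?thesis by (rule cpoly_eq_on_circle)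
qed

text \<open>On the circle Re (B_i/A_i) = d/|A_i|^2 with a common d > 0. The difference B1/A1 - B2/A2
  equals N r/(A1 A2); multiplied by the weight (|A2|^2 - |A1|^2)/|N|^2 it becomes the boundary value
  of a function G holomorphic near the closed disc, and its real part is d (|A2|^2 - |A1|^2)^2 up to
  a positive factor. Hence |A1| = |A2| on the circle.\<close>

lemma interpolant_unique:
  fixes N A1 A2 B1 B2 :: "real poly"
  assumes N: "N \<noteq> 0" "\<And>z. cpoly N z = 0 \<Longrightarrow> cmod z < 1"
    and deg: "degree A1 < degree N" "degree A2 < degree N"
    and nz1: "\<And>z. cmod z \<le> 1 \<Longrightarrow> cpoly A1 z \<noteq> 0" and nz2: "\<And>z. cmod z \<le> 1 \<Longrightarrow> cpoly A2 z \<noteq> 0"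
    and pos: "0 < coeff A1 0" "0 < coeff A2 0"
    and dvd: "N dvd B1 * A2 - B2 * A1"
    and eq: "\<And>z. cmod z = 1 \<Longrightarrow> Re (cpoly B1 z * cnj (cpoly A1 z)) = Re (cpoly B2 z * cnj (cpoly A2 z))"
    and d: "\<And>z. cmod z = 1 \<Longrightarrow> 0 < Re (cpoly B1 z * cnj (cpoly A1 z))"
  shows "A1 = A2"
proof -
  obtain r where r: "B1 * A2 - B2 * A1 = N * r" using dvd by (elim dvdE)
  define n where "n = degree N - 1"
  have n: "degree N = Suc n" "degree A1 \<le> n" "degree A2 \<le> n" using deg by (auto simp: n_def)
  define Rh where "Rh = A2 * rev_poly n A2 - A1 * rev_poly n A1"
  define Ns where "Ns = rev_poly (Suc n) N"
  have Ns: "cpoly Ns z \<noteq> 0" if "cmod z \<le> 1" for z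
  proof (cases "z = 0")
    case True
    have "coeff Ns 0 = lead_coeff N"
      by (simp add: Ns_def rev_poly_def coeff_sum n)
    then show ?thesis using N(1) True by simp
  next
    case False
    have "1 \<le> cmod (inverse z)" unfolding norm_inverse using that False by (intro one_le_inverse) auto
    then have "\<not> cmod (inverse z) < 1" by simp
    then have "cpoly N (inverse z) \<noteq> 0" using N(2) by blast
    then show ?thesis using False n by (simp add: Ns_def cpoly_rev_poly)
  qed
  let ?S = "{z. cpoly A1 z \<noteq> 0} \<inter> {z. cpoly A2 z \<noteq> 0} \<inter> {z. cpoly Ns z \<noteq> 0}"
  have S: "open ?S" "cball 0 1 \<subseteq> ?S"
    using open_nonvanishing[of A1, OF nz1] open_nonvanishing[of A2, OF nz2] open_nonvanishing[of Ns, OF Ns]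
    by auto
  \<comment> \<open>On the circle \<open>Rh\<close> is z^n (|A2|^2 - |A1|^2) and \<open>Ns\<close>
    is z^(n+1) times the conjugate of N. The extra factor z balances the powers and makes G vanish
    at 0; it is available because deg N = n + 1.\<close>
  let ?G = "\<lambda>z. z * cpoly Rh z * cpoly r z / (cpoly A1 z * cpoly A2 z * cpoly Ns z)"
  let ?R = "\<lambda>z. (cmod (cpoly A2 z))\<^sup>2 - (cmod (cpoly A1 z))\<^sup>2"
  let ?d = "\<lambda>z. Re (cpoly B1 z * cnj (cpoly A1 z))"
  let ?F = "\<lambda>z. ?d z * (?R z)\<^sup>2 / ((cmod (cpoly N z))\<^sup>2 * (cmod (cpoly A1 z))\<^sup>2 * (cmod (cpoly A2 z))\<^sup>2)"
  have Nz: "cpoly N z \<noteq> 0" if "cmod z = 1" for z using N(2)[of z] that by auto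
  have F0: "?F z = 0" if z: "cmod z = 1" for z
  proof (rule circle_vanish[OF S, of ?G ?F])
    show "?G holomorphic_on ?S" by (intro holomorphic_intros) auto
    show "continuous_on (sphere 0 1) ?F"
      using Nz nz1 nz2 by (intro continuous_intros) auto
    show "Re (?G z) = ?F z" if z: "cmod z = 1" for z
    proof -
      let ?a1 = "cpoly A1 z" and ?a2 = "cpoly A2 z" and ?b1 = "cpoly B1 z" and ?b2 = "cpoly B2 z" and ?N = "cpoly N z"
      have z0: "z \<noteq> 0" using z by auto
      have nz: "?a1 \<noteq> 0" "?a2 \<noteq> 0" "?N \<noteq> 0" using nz1 nz2 Nz z by auto
      have Rh: "cpoly Rh z = z ^ n * of_real (?R z)"
        using z n by (simp add: Rh_def cpoly_diff cpoly_mult cpoly_rev_poly_circle complex_norm_square algebra_simps flip: of_real_power)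
      have Ns: "cpoly Ns z = z ^ Suc n * cnj ?N"
        using z n unfolding Ns_def by (intro cpoly_rev_poly_circle) auto
      have r': "?N * cpoly r z = ?b1 * ?a2 - ?b2 * ?a1"
        using arg_cong[OF r, of "\<lambda>p. cpoly p z"] by (simp add: cpoly_diff cpoly_mult)
      have Re_real_mult: "Re (of_real x * w) = x * Re w" for x w by simp
      have "?G z = of_real (?R z) * cpoly r z / (?a1 * ?a2 * cnj ?N)"
      proof -
        have "z * cpoly Rh z * cpoly r z = z ^ Suc n * (of_real (?R z) * cpoly r z)"
          unfolding Rh by (simp only: power_Suc mult.assoc)
        moreover have "?a1 * ?a2 * cpoly Ns z = z ^ Suc n * (?a1 * ?a2 * cnj ?N)"
          unfolding Ns by (simp only: mult.assoc mult.left_commute)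
        ultimately show ?thesis using z0 by (simp only: nonzero_mult_divide_mult_cancel_left power_not_zero simp_thms)
      qed
      also have "\<dots> = of_real (?R z) * (?N * cpoly r z) / (?a1 * ?a2 * (?N * cnj ?N))"
        using nz by (simp add: field_simps)
      also have "\<dots> = of_real (?R z / (cmod ?N)\<^sup>2) * (?b1 / ?a1 - ?b2 / ?a2)"
        unfolding r' using nz by (simp add: complex_norm_square field_simps flip: of_real_power)
      finally have "Re (?G z) = ?R z / (cmod ?N)\<^sup>2 * (Re (?b1 / ?a1) - Re (?b2 / ?a2))"
        by (simp only: Re_real_mult minus_complex.sel)
      moreover have "Re (?b1 / ?a1) = ?d z / (cmod ?a1)\<^sup>2" by (subst complex_div_cnj) (simp add: Re_divide_of_real flip: of_real_power)
      moreover have "Re (?b2 / ?a2) = ?d z / (cmod ?a2)\<^sup>2" using eq[OF z] by (subst complex_div_cnj) (simp add: Re_divide_of_real flip: of_real_power)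
      ultimately show ?thesis using nz by (simp add: field_simps power2_eq_square)
    qed
    show "0 \<le> ?F z" if "cmod z = 1" for z using d[OF that] by simp
  qed (use z in auto)
  show ?thesis
  proof (rule spectral_factor_unique[OF nz1 nz2 pos])
    fix z assume z: "cmod z = 1"
    have "?R z = 0" using F0[OF z] Nz[OF z] nz1[of z] nz2[of z] d[OF z] z by auto
    then show "cmod (cpoly A1 z) = cmod (cpoly A2 z)"
      by (metis eq_iff_diff_eq_0 norm_ge_zero power2_eq_imp_eq)
  qed
qed

subsection \<open>Smooth maps\<close>

lemma frechet_derivative_eq:
  "(f has_derivative f') (at x) \<Longrightarrow> frechet_derivative f (at x) = f'"
  using frechet_derivative_at by metis

lemma Ck_on_cong:
  assumes "open N" "\<And>x. x \<in> N \<Longrightarrow> f x = g x" "Ck_on k N f"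
  shows "Ck_on k N g"
  using assms(2,3)
proof (induction k arbitrary: f g)
  case 0
  then show ?case using continuous_on_cong[of N N f g] by simp
next
  case (Suc k)
  have d: "(g has_derivative frechet_derivative f (at x)) (at x)" if "x \<in> N" for x
    using Suc.prems that assms(1)
    by (auto intro!: has_derivative_transform_within_open[of f _ x UNIV N g] simp: frechet_derivative_works[symmetric])
  have "Ck_on k N (\<lambda>x. frechet_derivative g (at x) v)" for v
    by (rule Suc.IH[of "\<lambda>x. frechet_derivative f (at x) v"])
       (use Suc.prems(2) in \<open>auto simp: frechet_derivative_eq[OF d]\<close>)
  then show ?case using d by (auto simp: differentiable_def)
qed

text \<open>A class of differentiable functions that is closed under directional derivatives
  consists of smooth functions; this replaces any computation of higher derivatives.\<close>

lemma Ck_on_closed_class: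
  assumes "open N"
    and diff: "\<And>f x. f \<in> F \<Longrightarrow> x \<in> N \<Longrightarrow> f differentiable (at x)"
    and clo: "\<And>f v. f \<in> F \<Longrightarrow> \<exists>g\<in>F. \<forall>x\<in>N. frechet_derivative f (at x) v = g x"
    and "f \<in> F"
  shows "Ck_on k N f"
  using assms(4)
proof (induction k arbitrary: f)
  case 0
  then show ?case
    by (auto intro!: continuous_at_imp_continuous_on differentiable_imp_continuous_within diff)
next
  case (Suc k)
  have "Ck_on k N (\<lambda>x. frechet_derivative f (at x) v)" for v
  proof -
    obtain g where g: "g \<in> F" "\<forall>x\<in>N. frechet_derivative f (at x) v = g x" using clo[OF Suc.prems] by blast
    show ?thesis by (rule Ck_on_cong[OF assms(1) _ Suc.IH[OF g(1)]]) (simp add: g(2))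
  qed
  then show ?case using diff Suc.prems by auto
qed

lemma Ck_on_bounded_linear_compose:
  assumes "open N" "bounded_linear L" "Ck_on k N f"
  shows "Ck_on k N (\<lambda>x. L (f x))"
  using assms(3)
proof (induction k arbitrary: f)
  case 0
  then show ?case using linear_continuous_on_compose[of N f L] assms(2)
    by (simp add: linear_conv_bounded_linear)
next
  case (Suc k)
  have d: "((\<lambda>x. L (f x)) has_derivative (\<lambda>v. L (frechet_derivative f (at x) v))) (at x)" if "x \<in> N" for x
    using Suc.prems that by (intro bounded_linear.has_derivative[OF assms(2)]) (auto simp: frechet_derivative_works)
  have "Ck_on k N (\<lambda>x. frechet_derivative (\<lambda>x. L (f x)) (at x) v)" for v
    by (rule Ck_on_cong[OF assms(1) _ Suc.IH[of "\<lambda>x. frechet_derivative f (at x) v"]])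
       (use Suc.prems in \<open>auto simp: frechet_derivative_eq[OF d]\<close>)
  then show ?case using d by (auto simp: differentiable_def)
qed

lemma Ck_on_componentwise:
  assumes "open N" "\<And>b. b \<in> Basis \<Longrightarrow> Ck_on k N (\<lambda>x. f x \<bullet> b)"
  shows "Ck_on k N f"
  using assms(2)
proof (induction k arbitrary: f)
  case 0
  then show ?case by (subst Ck_on.simps, subst continuous_on_componentwise) auto
next
  case (Suc k)
  have d: "f differentiable (at x)" if "x \<in> N" for x
    using Suc.prems that by (subst differentiable_componentwise_within) auto
  then have w: "(f has_derivative frechet_derivative f (at x)) (at x)" if "x \<in> N" for x
    using that by (simp add: frechet_derivative_works[symmetric])
  have "Ck_on k N (\<lambda>x. frechet_derivative f (at x) v)" for v
  proof (rule Suc.IH)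
    fix b :: 'b assume b: "b \<in> Basis"
    show "Ck_on k N (\<lambda>x. frechet_derivative f (at x) v \<bullet> b)"
    proof (rule Ck_on_cong[OF assms(1)])
      show "Ck_on k N (\<lambda>x. frechet_derivative (\<lambda>x. f x \<bullet> b) (at x) v)" using Suc.prems[OF b] by simp
      show "frechet_derivative (\<lambda>x. f x \<bullet> b) (at x) v = frechet_derivative f (at x) v \<bullet> b" if "x \<in> N" for x
        using frechet_derivative_eq[OF has_derivative_inner_left[OF w[OF that], of b]] by simp
    qed
  qed
  then show ?case using d by auto
qed

lemma Ck_on_affine_compose:
  assumes "Ck_on k M f" "linear L" "\<And>x. x \<in> N \<Longrightarrow> L x + c \<in> M" "open N"
  shows "Ck_on k N (\<lambda>x. f (L x + c))"
  using assms(1)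
proof (induction k arbitrary: f)
  case 0
  have "continuous_on N (\<lambda>x. L x + c)"
    using assms(2) by (intro continuous_intros linear_continuous_on) (simp add: linear_conv_bounded_linear)
  then show ?case using 0 assms(3) by (auto intro: continuous_on_compose2[of M f])
next
  case (Suc k)
  have d: "((\<lambda>x. f (L x + c)) has_derivative (\<lambda>v. frechet_derivative f (at (L x + c)) (L v))) (at x)" if "x \<in> N" for x
  proof -
    have "((\<lambda>x. L x + c) has_derivative L) (at x)"
      using assms(2) by (auto intro!: derivative_eq_intros bounded_linear_imp_has_derivative simp: linear_conv_bounded_linear)
    moreover have "(f has_derivative frechet_derivative f (at (L x + c))) (at (L x + c))"
      using Suc.prems assms(3)[OF that] by (simp add: frechet_derivative_works[symmetric])
    ultimately show ?thesis by (rule has_derivative_compose)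
  qed
  have "Ck_on k N (\<lambda>x. frechet_derivative (\<lambda>x. f (L x + c)) (at x) v)" for v
    by (rule Ck_on_cong[OF assms(4) _ Suc.IH[of "\<lambda>x. frechet_derivative f (at x) (L v)"]])
       (use Suc.prems in \<open>auto simp: frechet_derivative_eq[OF d]\<close>)
  then show ?case using d by (auto simp: differentiable_def)
qed

lemma Ck_on_affine:
  assumes "linear L" "open N"
  shows "Ck_on k N (\<lambda>x. L x + c)"
proof -
  have "Ck_on k N (\<lambda>_. y)" for y :: 'b and k
    by (induction k arbitrary: y) (auto simp: frechet_derivative_const)
  then show ?thesis
  proof (induction k)
    case 0
    have "continuous_on N L" using assms(1) by (intro linear_continuous_on) (simp add: linear_conv_bounded_linear)
    then show ?case by (auto intro!: continuous_intros)
  next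
    case (Suc k)
    have d: "((\<lambda>x. L x + c) has_derivative L) (at x)" for x
      using assms(1) by (auto intro!: derivative_eq_intros bounded_linear_imp_has_derivative simp: linear_conv_bounded_linear)
    then show ?case using Suc by (auto simp: frechet_derivative_eq[OF d] differentiable_def)
  qed
qed

lemma Ck_on_Pair:
  assumes "open N" "Ck_on k N f" "Ck_on k N g"
  shows "Ck_on k N (\<lambda>x. (f x, g x))"
proof (rule Ck_on_componentwise[OF assms(1)])
  fix b :: "'b \<times> 'c"
  assume "b \<in> Basis"
  then consider u where "b = (u, 0)" | u where "b = (0, u)" by (auto simp: Basis_prod_def)
  then show "Ck_on k N (\<lambda>x. (f x, g x) \<bullet> b)"
    by cases (auto intro: Ck_on_bounded_linear_compose[OF assms(1) bounded_linear_inner_left] assms)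
qed

lemma Ck_on_smooth_onI:
  assumes "open N" "X \<subseteq> N" "\<And>k. Ck_on k N g" "\<And>x. x \<in> X \<Longrightarrow> g x = f x"
  shows "smooth_on X f"
  unfolding smooth_on_def using assms by (intro ballI exI[of _ N] exI[of _ g]) auto

subsection \<open>Rational functions\<close>

text \<open>The denominator may vanish off S, and S need not be open: it will be the graph of the
  solution over the parameter set, or the semialgebraic set of admissible pairs (w, P).\<close>

definition rat_on :: "'a::real_normed_vector set \<Rightarrow> ('a \<Rightarrow> real) \<Rightarrow> bool" where
  "rat_on S f \<longleftrightarrow> (\<exists>p q. real_polynomial_function p \<and> real_polynomial_function q \<and>
     (\<forall>x\<in>S. q x \<noteq> 0 \<and> f x = p x / q x))"

lemmas rpf_intros = real_polynomial_function.intros(2-4) real_polynomial_function_minus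
  real_polynomial_function_diff real_polynomial_function_power real_polynomial_function_sum
  real_polynomial_function_prod

lemma rpf_linear: "linear f \<Longrightarrow> real_polynomial_function (f :: 'a::euclidean_space \<Rightarrow> real)"
  by (intro real_polynomial_function.intros(1)) (simp add: linear_conv_bounded_linear)

lemma rat_on_rpf: "real_polynomial_function f \<Longrightarrow> rat_on S f"
  unfolding rat_on_def by (rule exI[of _ f], rule exI[of _ "\<lambda>_. 1"]) (auto intro: rpf_intros)

lemma rat_on_const: "rat_on S (\<lambda>_. c)"
  by (intro rat_on_rpf rpf_intros)

lemma rat_onE:
  assumes "rat_on S f"
  obtains p q where "real_polynomial_function p" "real_polynomial_function q"
    "\<And>x. x \<in> S \<Longrightarrow> q x \<noteq> 0" "\<And>x. x \<in> S \<Longrightarrow> f x = p x / q x"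
  using assms unfolding rat_on_def by blast

lemma rat_onI:
  assumes "real_polynomial_function p" "real_polynomial_function q"
    "\<And>x. x \<in> S \<Longrightarrow> q x \<noteq> 0" "\<And>x. x \<in> S \<Longrightarrow> f x = p x / q x"
  shows "rat_on S f"
  using assms unfolding rat_on_def by blast

lemma rat_on_add: "rat_on S f \<Longrightarrow> rat_on S g \<Longrightarrow> rat_on S (\<lambda>x. f x + g x)"
proof (elim rat_onE)
  fix p q p' q'
  assume pq: "real_polynomial_function p" "real_polynomial_function q"
    "real_polynomial_function p'" "real_polynomial_function q'"
    and q: "\<And>x. x \<in> S \<Longrightarrow> q x \<noteq> 0" "\<And>x. x \<in> S \<Longrightarrow> q' x \<noteq> 0"
    and fg: "\<And>x. x \<in> S \<Longrightarrow> f x = p x / q x" "\<And>x. x \<in> S \<Longrightarrow> g x = p' x / q' x"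
  show "rat_on S (\<lambda>x. f x + g x)"
  proof (rule rat_onI)
    show "real_polynomial_function (\<lambda>x. p x * q' x + p' x * q x)" "real_polynomial_function (\<lambda>x. q x * q' x)"
      using pq by (simp_all add: real_polynomial_function.intros)
    show "f x + g x = (p x * q' x + p' x * q x) / (q x * q' x)" if "x \<in> S" for x
      unfolding fg[OF that] using q[OF that] by (simp add: add_frac_eq)
  qed (simp add: q)
qed

lemma rat_on_mult: "rat_on S f \<Longrightarrow> rat_on S g \<Longrightarrow> rat_on S (\<lambda>x. f x * g x)"
proof (elim rat_onE)
  fix p q p' q'
  assume pq: "real_polynomial_function p" "real_polynomial_function q"
    "real_polynomial_function p'" "real_polynomial_function q'"
    and q: "\<And>x. x \<in> S \<Longrightarrow> q x \<noteq> 0" "\<And>x. x \<in> S \<Longrightarrow> q' x \<noteq> 0"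
    and fg: "\<And>x. x \<in> S \<Longrightarrow> f x = p x / q x" "\<And>x. x \<in> S \<Longrightarrow> g x = p' x / q' x"
  show "rat_on S (\<lambda>x. f x * g x)"
  proof (rule rat_onI)
    show "real_polynomial_function (\<lambda>x. p x * p' x)" "real_polynomial_function (\<lambda>x. q x * q' x)"
      using pq by (simp_all add: real_polynomial_function.intros)
    show "f x * g x = (p x * p' x) / (q x * q' x)" if "x \<in> S" for x
      unfolding fg[OF that] by simp
  qed (simp add: q)
qed

lemma rat_on_inverse:
  assumes "rat_on S f" "\<And>x. x \<in> S \<Longrightarrow> f x \<noteq> 0"
  shows "rat_on S (\<lambda>x. inverse (f x))"
proof -
  obtain p q where pq: "real_polynomial_function p" "real_polynomial_function q"
    "\<And>x. x \<in> S \<Longrightarrow> q x \<noteq> 0" "\<And>x. x \<in> S \<Longrightarrow> f x = p x / q x" using assms(1) by (rule rat_onE) blast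
  show ?thesis
    by (rule rat_onI[OF pq(2,1)]) (use assms(2) pq(4) in \<open>force+\<close>)
qed

lemma rat_on_divide:
  assumes "rat_on S f" "rat_on S g" "\<And>x. x \<in> S \<Longrightarrow> g x \<noteq> 0"
  shows "rat_on S (\<lambda>x. f x / g x)"
  using rat_on_mult[OF assms(1) rat_on_inverse[OF assms(2,3)]] by (simp add: divide_inverse)

lemma rat_on_minus: "rat_on S f \<Longrightarrow> rat_on S (\<lambda>x. - f x)"
  using rat_on_mult[OF rat_on_const[of S "-1"]] by simp

lemma rat_on_diff: "rat_on S f \<Longrightarrow> rat_on S g \<Longrightarrow> rat_on S (\<lambda>x. f x - g x)"
  using rat_on_add[OF _ rat_on_minus] by simp

lemma rat_on_sum: "(\<And>i. i \<in> I \<Longrightarrow> rat_on S (f i)) \<Longrightarrow> rat_on S (\<lambda>x. \<Sum>i\<in>I. f i x)"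
  by (induction I rule: infinite_finite_induct) (auto intro: rat_on_const rat_on_add)

lemma rat_on_prod: "(\<And>i. i \<in> I \<Longrightarrow> rat_on S (f i)) \<Longrightarrow> rat_on S (\<lambda>x. \<Prod>i\<in>I. f i x)"
  by (induction I rule: infinite_finite_induct) (auto intro: rat_on_const rat_on_mult)

lemmas rat_intros = rat_on_const rat_on_add rat_on_mult rat_on_minus rat_on_diff rat_on_sum

lemma rat_on_cong: "(\<And>x. x \<in> S \<Longrightarrow> f x = g x) \<Longrightarrow> rat_on S f \<longleftrightarrow> rat_on S g"
  unfolding rat_on_def by auto

lemma rat_on_det:
  fixes A :: "'a::real_normed_vector \<Rightarrow> real^'k^'k"
  assumes "\<And>i j. rat_on S (\<lambda>x. A x $ i $ j)"
  shows "rat_on S (\<lambda>x. det (A x))"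
  unfolding det_def by (intro rat_on_sum rat_on_mult rat_on_prod rat_on_const assms)

text \<open>Cramer's rule writes each component of f as a quotient of two determinants, which are
  polynomial expressions in the entries.\<close>

lemma rat_on_solve:
  fixes A :: "'a::real_normed_vector \<Rightarrow> real^'k^'k"
  assumes "\<And>i j. rat_on S (\<lambda>x. A x $ i $ j)" "\<And>i. rat_on S (\<lambda>x. b x $ i)"
    and "\<And>x. x \<in> S \<Longrightarrow> det (A x) \<noteq> 0" "\<And>x. x \<in> S \<Longrightarrow> A x *v f x = b x"
  shows "rat_on S (\<lambda>x. f x $ k)"
proof -
  have "f x $ k = det (\<chi> i j. if j = k then b x $ i else A x $ i $ j) / det (A x)" if "x \<in> S" for x
    using cramer[OF assms(3)[OF that], of "f x" "b x"] assms(4)[OF that] by simp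
  moreover have "rat_on S (\<lambda>x. det (\<chi> i j. if j = k then b x $ i else A x $ i $ j) / det (A x))"
  proof (intro rat_on_divide rat_on_det assms)
    show "rat_on S (\<lambda>x. (\<chi> i j. if j = k then b x $ i else A x $ i $ j) $ i $ j)" for i j
      using assms(1,2) by (cases "j = k") auto
  qed
  ultimately show ?thesis by (subst rat_on_cong)
qed

lemma rpf_has_derivative:
  fixes p :: "'a::euclidean_space \<Rightarrow> real"
  assumes "real_polynomial_function p"
  shows "\<exists>D. (\<forall>b. real_polynomial_function (D b)) \<and>
     (\<forall>x. (p has_derivative (\<lambda>w. \<Sum>b\<in>Basis. (w \<bullet> b) * D b x)) (at x))"
  using assms
proof induction
  case (linear f)
  have "f w = (\<Sum>b\<in>Basis. (w \<bullet> b) * f b)" for w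
  proof -
    interpret bounded_linear f by (rule linear)
    have "f w = f (\<Sum>b\<in>Basis. (w \<bullet> b) *\<^sub>R b)" by (simp only: euclidean_representation)
    also have "\<dots> = (\<Sum>b\<in>Basis. (w \<bullet> b) * f b)" by (simp add: sum scaleR)
    finally show ?thesis .
  qed
  then have eq: "(\<lambda>w. \<Sum>b\<in>Basis. (w \<bullet> b) * f b) = f" by (intro ext) (rule sym)
  have "(f has_derivative (\<lambda>w. \<Sum>b\<in>Basis. (w \<bullet> b) * f b)) (at x)" for x
    unfolding eq by (rule bounded_linear_imp_has_derivative[OF linear])
  then show ?case by (intro exI[of _ "\<lambda>b _. f b"]) (auto intro: rpf_intros)
next
  case (const c)
  then show ?case by (intro exI[of _ "\<lambda>_ _. 0"]) (auto intro: rpf_intros)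
next
  case (add f g)
  then obtain D E where D: "\<And>b. real_polynomial_function (D b)" "\<And>b. real_polynomial_function (E b)"
    "\<And>x. (f has_derivative (\<lambda>w. \<Sum>b\<in>Basis. (w \<bullet> b) * D b x)) (at x)"
    "\<And>x. (g has_derivative (\<lambda>w. \<Sum>b\<in>Basis. (w \<bullet> b) * E b x)) (at x)" by blast
  have "((\<lambda>x. f x + g x) has_derivative (\<lambda>w. \<Sum>b\<in>Basis. (w \<bullet> b) * (D b x + E b x))) (at x)" for x
    using has_derivative_add[OF D(3)[of x] D(4)[of x]] by (simp add: sum.distrib distrib_left)
  then show ?case using D by (intro exI[of _ "\<lambda>b x. D b x + E b x"]) (simp add: real_polynomial_function.intros(3))
next
  case (mult f g)
  then obtain D E where D: "\<And>b. real_polynomial_function (D b)" "\<And>b. real_polynomial_function (E b)"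
    "\<And>x. (f has_derivative (\<lambda>w. \<Sum>b\<in>Basis. (w \<bullet> b) * D b x)) (at x)"
    "\<And>x. (g has_derivative (\<lambda>w. \<Sum>b\<in>Basis. (w \<bullet> b) * E b x)) (at x)" by blast
  have dd: "((\<lambda>x. f x * g x) has_derivative (\<lambda>w. \<Sum>b\<in>Basis. (w \<bullet> b) * (f x * E b x + D b x * g x))) (at x)" for x
    using has_derivative_mult[OF D(3)[of x] D(4)[of x]]
    by (simp add: sum.distrib distrib_left sum_distrib_left sum_distrib_right mult.assoc mult.left_commute)
  show ?case
    by (intro exI[of _ "\<lambda>b x. f x * E b x + D b x * g x"] conjI allI dd real_polynomial_function.intros(3,4) D(1,2) mult.hyps)
qed

text \<open>G satisfies a first-order system whose right-hand side is rational in G itself. By the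
  chain and quotient rules the functions R(G x) with R rational form a class closed under
  differentiation, so \<open>Ck_on_closed_class\<close> applies.\<close>

lemma Ck_on_rational_graph:
  fixes G :: "'a::euclidean_space \<Rightarrow> 'b::euclidean_space"
  assumes N: "open N" and G: "\<And>x. x \<in> N \<Longrightarrow> (G has_derivative G' x) (at x)"
    and G': "\<And>v b. b \<in> Basis \<Longrightarrow> \<exists>R. rat_on (G ` N) R \<and> (\<forall>x\<in>N. G' x v \<bullet> b = R (G x))"
    and R: "rat_on (G ` N) R"
  shows "Ck_on k N (\<lambda>x. R (G x))"
proof -
  define F where "F = {f. \<exists>R. rat_on (G ` N) R \<and> (\<forall>x\<in>N. f x = R (G x))}"
  have der: "\<exists>f'. (\<forall>v. (\<lambda>x. f' x v) \<in> F) \<and> (\<forall>x\<in>N. (f has_derivative f' x) (at x))" if fF: "f \<in> F" for f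
  proof -
    obtain R where R: "rat_on (G ` N) R" "\<And>x. x \<in> N \<Longrightarrow> f x = R (G x)"
      using fF unfolding F_def by blast
    obtain p q where pq: "real_polynomial_function p" "real_polynomial_function q"
      "\<And>y. y \<in> G ` N \<Longrightarrow> q y \<noteq> 0 \<and> R y = p y / q y" using R(1) unfolding rat_on_def by blast
    obtain D where D: "\<And>b. real_polynomial_function (D b)"
      "\<And>x. (p has_derivative (\<lambda>w. \<Sum>b\<in>Basis. (w \<bullet> b) * D b x)) (at x)"
      using rpf_has_derivative[OF pq(1)] by blast
    obtain E where E: "\<And>b. real_polynomial_function (E b)"
      "\<And>x. (q has_derivative (\<lambda>w. \<Sum>b\<in>Basis. (w \<bullet> b) * E b x)) (at x)"
      using rpf_has_derivative[OF pq(2)] by blast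
    define f' where "f' x v = ((\<Sum>b\<in>Basis. (G' x v \<bullet> b) * D b (G x)) * q (G x)
       - p (G x) * (\<Sum>b\<in>Basis. (G' x v \<bullet> b) * E b (G x))) / (q (G x) * q (G x))" for x v
    have "(f has_derivative f' x) (at x)" if x: "x \<in> N" for x
    proof -
      have "((\<lambda>x. p (G x) / q (G x)) has_derivative f' x) (at x)"
        unfolding f'_def[abs_def]
        using pq(3) x
        by (intro has_derivative_divide' has_derivative_compose[OF G[OF x] D(2)] has_derivative_compose[OF G[OF x] E(2)]) auto
      then show ?thesis
        by (rule has_derivative_transform_within_open[OF _ N x]) (use R(2) pq(3) in auto)
    qed
    moreover have "(\<lambda>x. f' x v) \<in> F" for v
    proof -
      obtain Q where Q: "\<And>b. b \<in> Basis \<Longrightarrow> rat_on (G ` N) (Q b) \<and> (\<forall>x\<in>N. G' x v \<bullet> b = Q b (G x))"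
        using G'[of _ v] by metis
      define T where "T y = ((\<Sum>b\<in>Basis. Q b y * D b y) * q y
       - p y * (\<Sum>b\<in>Basis. Q b y * E b y)) / (q y * q y)" for y
      have "rat_on (G ` N) T" unfolding T_def[abs_def]
        using Q rat_on_rpf[OF D(1)] rat_on_rpf[OF E(1)] rat_on_rpf[OF pq(1)] rat_on_rpf[OF pq(2)] pq(3)
        by (intro rat_on_divide rat_intros) simp_all
      moreover have "f' x v = T (G x)" if "x \<in> N" for x
        using Q that by (simp add: f'_def T_def)
      ultimately show ?thesis unfolding F_def by blast
    qed
    ultimately show ?thesis by blast
  qed
  show ?thesis
  proof (rule Ck_on_closed_class[OF N, of F])
    show "f differentiable (at x)" if "f \<in> F" "x \<in> N" for f x
      using der[OF that(1)] that(2) by (auto simp: differentiable_def)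
    show "\<exists>g\<in>F. \<forall>x\<in>N. frechet_derivative f (at x) v = g x" if f: "f \<in> F" for f v
    proof -
      obtain f' where f': "\<forall>v. (\<lambda>x. f' x v) \<in> F" "\<forall>x\<in>N. (f has_derivative f' x) (at x)"
        using der[OF f] by blast
      then have "frechet_derivative f (at x) = f' x" if "x \<in> N" for x
        using that by (intro frechet_derivative_eq) blast
      then have "\<forall>x\<in>N. frechet_derivative f (at x) v = f' x v" by simp
      then show ?thesis using f'(1) by (intro bexI[of _ "\<lambda>x. f' x v"]) auto
    qed
    show "(\<lambda>x. R (G x)) \<in> F" using R unfolding F_def by blast
  qed
qed

subsection \<open>Semialgebraic sets\<close>

definition basic_semialgebraic :: "'a::euclidean_space set \<Rightarrow> bool" where
  "basic_semialgebraic C \<longleftrightarrow> (\<exists>F G. finite F \<and> finite G \<and> (\<forall>p\<in>F \<union> G. real_polynomial_function p) \<and>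
        C = {x. (\<forall>p\<in>F. p x = 0) \<and> (\<forall>q\<in>G. 0 < q x)})"

lemma semialgebraic_basic:
  "semialgebraic S \<longleftrightarrow> (\<exists>\<C>. finite \<C> \<and> S = \<Union>\<C> \<and> (\<forall>C\<in>\<C>. basic_semialgebraic C))"
  by (simp add: semialgebraic_def basic_semialgebraic_def)

lemma basic_semialgebraic_Int:
  assumes "basic_semialgebraic A" "basic_semialgebraic B"
  shows "basic_semialgebraic (A \<inter> B)"
proof -
  obtain F G where A: "finite F" "finite G" "\<forall>p\<in>F \<union> G. real_polynomial_function p"
    "A = {x. (\<forall>p\<in>F. p x = 0) \<and> (\<forall>q\<in>G. 0 < q x)}"
    using assms(1) unfolding basic_semialgebraic_def by blast
  obtain F' G' where B: "finite F'" "finite G'" "\<forall>p\<in>F' \<union> G'. real_polynomial_function p"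
    "B = {x. (\<forall>p\<in>F'. p x = 0) \<and> (\<forall>q\<in>G'. 0 < q x)}"
    using assms(2) unfolding basic_semialgebraic_def by blast
  show ?thesis
    unfolding basic_semialgebraic_def
    by (intro exI[of _ "F \<union> F'"] exI[of _ "G \<union> G'"]) (use A B in auto)
qed

text \<open>Intersection distributes over the two finite unions, and basic sets intersect by joining
  their lists of conditions.\<close>

lemma semialgebraic_Int:
  assumes "semialgebraic S" "semialgebraic T"
  shows "semialgebraic (S \<inter> T)"
proof -
  obtain A B where "finite A" "S = \<Union>A" "\<forall>C\<in>A. basic_semialgebraic C"
    "finite B" "T = \<Union>B" "\<forall>C\<in>B. basic_semialgebraic C"
    using assms unfolding semialgebraic_basic by blast
  then show ?thesis unfolding semialgebraic_basic
    by (intro exI[of _ "(\<lambda>(C, D). C \<inter> D) ` (A \<times> B)"]) (auto intro!: basic_semialgebraic_Int)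
qed

lemma basic_semialgebraic_zero: "real_polynomial_function p \<Longrightarrow> basic_semialgebraic {x. p x = 0}"
  unfolding basic_semialgebraic_def by (intro exI[of _ "{p}"] exI[of _ "{}"]) auto

lemma basic_semialgebraic_pos: "real_polynomial_function p \<Longrightarrow> basic_semialgebraic {x. 0 < p x}"
  unfolding basic_semialgebraic_def by (intro exI[of _ "{}"] exI[of _ "{p}"]) auto

lemma semialgebraic_zero: "real_polynomial_function p \<Longrightarrow> semialgebraic {x. p x = 0}"
  unfolding semialgebraic_basic by (intro exI[of _ "{{x. p x = 0}}"]) (simp add: basic_semialgebraic_zero)

lemma semialgebraic_pos: "real_polynomial_function p \<Longrightarrow> semialgebraic {x. 0 < p x}"
  unfolding semialgebraic_basic by (intro exI[of _ "{{x. 0 < p x}}"]) (simp add: basic_semialgebraic_pos)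

lemma semialgebraic_nonneg: "real_polynomial_function p \<Longrightarrow> semialgebraic {x. 0 \<le> p x}"
  unfolding semialgebraic_basic
  by (intro exI[of _ "{{x. 0 < p x}, {x. p x = 0}}"])
     (auto simp: basic_semialgebraic_pos basic_semialgebraic_zero)

lemma semialgebraic_nonzero: "real_polynomial_function p \<Longrightarrow> semialgebraic {x. p x \<noteq> 0}"
  using semialgebraic_pos[of "\<lambda>x. p x * p x"]
  by (simp add: real_polynomial_function.intros(4) zero_less_mult_iff linorder_neq_iff disj_commute)

lemma semialgebraic_UNIV: "semialgebraic (UNIV :: 'a::euclidean_space set)"
  using semialgebraic_zero[of "\<lambda>_::'a. 0"] by (simp add: real_polynomial_function.intros)

lemma semialgebraic_INT:
  "finite I \<Longrightarrow> (\<And>i. i \<in> I \<Longrightarrow> semialgebraic (S i)) \<Longrightarrow> semialgebraic {x. \<forall>i\<in>I. x \<in> S i}"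
proof (induction I rule: finite_induct)
  case (insert i I)
  have "{x. \<forall>j\<in>insert i I. x \<in> S j} = S i \<inter> {x. \<forall>j\<in>I. x \<in> S j}" by auto
  then show ?case using insert by (simp add: semialgebraic_Int)
qed (simp add: semialgebraic_UNIV)

lemma semialgebraic_rat_zero:
  assumes "semialgebraic S" "rat_on S f"
  shows "semialgebraic {x \<in> S. f x = 0}"
proof -
  obtain p q where pq: "real_polynomial_function p" "\<And>x. x \<in> S \<Longrightarrow> q x \<noteq> 0" "\<And>x. x \<in> S \<Longrightarrow> f x = p x / q x"
    using assms(2) by (rule rat_onE) blast
  have "{x \<in> S. f x = 0} = S \<inter> {x. p x = 0}" using pq(2,3) by auto
  then show ?thesis using assms(1) pq(1) by (simp add: semialgebraic_Int semialgebraic_zero)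
qed

subsection \<open>Positive semidefinite matrices\<close>

definition psdef :: "real^'k^'k \<Rightarrow> bool" where
  "psdef A \<longleftrightarrow> (\<forall>x. 0 \<le> x \<bullet> (A *v x))"

definition pdef :: "real^'k^'k \<Rightarrow> bool" where
  "pdef A \<longleftrightarrow> (\<forall>x. x \<noteq> 0 \<longrightarrow> 0 < x \<bullet> (A *v x))"

lemma sym_inner: "transpose A = A \<Longrightarrow> x \<bullet> (A *v y) = y \<bullet> (A *v (x :: real^'k))"
  by (metis inner_commute inner_transpose_vec)

lemma det_eq_0_iff_kernel: "det (A :: 'a::field^'k^'k) = 0 \<longleftrightarrow> (\<exists>x. x \<noteq> 0 \<and> A *v x = 0)"
  by (metis invertible_det_nz invertible_left_inverse matrix_left_invertible_ker)

text \<open>The form at x + t A x is a nonnegative quadratic in t without constant term, so its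
  linear coefficient 2 |A x|^2 is 0.\<close>

lemma psdef_null:
  assumes "transpose A = A" "psdef A" "x \<bullet> (A *v x) = 0"
  shows "A *v x = 0"
proof -
  let ?w = "A *v x"
  have "0 \<le> t * (2 * (?w \<bullet> ?w)) + t\<^sup>2 * (?w \<bullet> (A *v ?w))" for t
  proof -
    have "0 \<le> (x + t *\<^sub>R ?w) \<bullet> (A *v (x + t *\<^sub>R ?w))" using assms(2) by (simp add: psdef_def)
    also have "\<dots> = t * (2 * (?w \<bullet> ?w)) + t\<^sup>2 * (?w \<bullet> (A *v ?w))"
      using assms(3) sym_inner[OF assms(1), of x ?w]
      by (simp add: matrix_vector_right_distrib matrix_vector_mult_scaleR inner_add_left inner_add_right power2_eq_square algebra_simps)
    finally show ?thesis .
  qed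
  note q = this
  define b where "b = ?w \<bullet> ?w"
  define c where "c = ?w \<bullet> (A *v ?w)"
  have c: "c \<ge> 0" using assms(2) by (simp add: psdef_def c_def)
  have "b = 0"
  proof (rule ccontr)
    assume "b \<noteq> 0"
    then have b: "b > 0" by (simp add: b_def)
    \<comment> \<open>The summand 1 only guards against c = 0; any small positive t would make the
      linear term dominate at -t.\<close>
    define t where "t = b / (c + 1)"
    have t: "t > 0" "t * (c + 1) = b" using b c by (auto simp: t_def)
    then have tc: "t * c < 2 * b" using b by (simp add: algebra_simps)
    have "0 \<le> (- t) * (2 * b) + (- t)\<^sup>2 * c" using q[of "- t"] by (simp add: b_def c_def)
    also have "\<dots> = - (t * (2 * b - t * c))" by (simp add: algebra_simps power2_eq_square)
    also have "\<dots> < 0" using t tc by simp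
    finally show False by simp
  qed
  then show ?thesis by (simp add: b_def)
qed

text \<open>The characteristic polynomial with the sign det (A + x I): an eigenvalue l gives the
  root -l, so that semidefiniteness shows up as nonnegative coefficients.\<close>

definition charp :: "real^'k^'k \<Rightarrow> real poly" where
  "charp A = det (\<chi> i j. [:A $ i $ j, if i = j then 1 else 0:])"

lemma poly_charp: "poly (charp A) x = det (A + mat x)"
proof -
  have "poly (charp A) x = det (\<chi> i j. A $ i $ j + (if i = j then x else 0))"
    unfolding charp_def det_def
    by (simp add: poly_sum poly_prod) (intro sum.cong prod.cong refl arg_cong2[where f="(*)"]; auto)
  also have "(\<chi> i j. A $ i $ j + (if i = j then x else 0)) = A + mat x"
    by (simp add: vec_eq_iff mat_def)
  finally show ?thesis .
qed

lemma cpoly_prod: "cpoly (\<Prod>i\<in>A. f i) z = (\<Prod>i\<in>A. cpoly (f i) z)"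
  by (induction A rule: infinite_finite_induct) (auto simp: cpoly_mult)

lemma cpoly_of_int: "cpoly (of_int k) z = of_int k"
proof -
  have "(of_int k :: real poly) = [:of_int k:]" by (simp add: of_int_poly)
  then show ?thesis by (simp add: cpoly_pCons)
qed

lemma cpoly_charp: "cpoly (charp A) z = det (\<chi> i j. of_real (A $ i $ j) + (if i = j then z else 0))"
  unfolding charp_def det_def
  by (simp add: cpoly_sum cpoly_mult cpoly_prod cpoly_of_int cpoly_pCons)
     (intro sum.cong prod.cong refl arg_cong2[where f="(*)"]; auto simp: cpoly_pCons)

lemma degree_charp: "degree (charp (A :: real^'k^'k)) \<le> CARD('k)"
proof -
  have "degree (of_int (sign p) * (\<Prod>i\<in>UNIV. (\<chi> i j. [:A $ i $ j, if i = j then 1 else 0:]) $ i $ p i)) \<le> CARD('k)" for p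
  proof -
    let ?f = "\<lambda>i. (\<chi> i j. [:A $ i $ j, if i = j then 1 else 0:]) $ i $ p i"
    have "degree (\<Prod>i\<in>UNIV. ?f i) \<le> (\<Sum>i\<in>(UNIV::'k set). degree (?f i))"
      using degree_prod_sum_le[of UNIV ?f] by (simp add: o_def)
    also have "\<dots> \<le> (\<Sum>i\<in>(UNIV::'k set). 1)" by (intro sum_mono) simp
    finally have "degree (\<Prod>i\<in>UNIV. ?f i) \<le> CARD('k)" by simp
    moreover have "degree (of_int (sign p) * (\<Prod>i\<in>UNIV. ?f i)) \<le> 0 + degree (\<Prod>i\<in>UNIV. ?f i)"
      by (rule order_trans[OF degree_mult_le]) simp
    ultimately show ?thesis by simp
  qed
  then show ?thesis unfolding charp_def det_def
    by (intro degree_sum_le) (auto simp: finite_permutations)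
qed

text \<open>For a kernel vector a + i b, adding the forms at a and b bounds Re z, and the symmetry
  of A applied to the mixed terms forces Im z = 0.\<close>

lemma charp_root:
  assumes A: "transpose A = A" "psdef A" and z: "cpoly (charp A) z = 0"
  shows "Im z = 0 \<and> Re z \<le> 0"
proof -
  let ?M = "(\<chi> i j. of_real (A $ i $ j) + (if i = j then z else 0)) :: complex^'a^'a"
  have "det ?M = 0" using z by (simp add: cpoly_charp)
  then obtain v where v: "v \<noteq> 0" "?M *v v = 0"
    using det_eq_0_iff_kernel[of ?M] by blast
  define a b where "a = (\<chi> i. Re (v $ i))" and "b = (\<chi> i. Im (v $ i))"
  have eq: "(\<Sum>j\<in>UNIV. of_real (A $ i $ j) * v $ j) + z * v $ i = 0" for i
  proof -
    have "(?M *v v) $ i = (\<Sum>j\<in>UNIV. of_real (A $ i $ j) * v $ j) + (\<Sum>j\<in>UNIV. (if i = j then z * v $ j else 0))"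
      by (simp add: matrix_vector_mult_def distrib_right sum.distrib if_distrib[of "\<lambda>x. x * _"] cong: if_cong)
    then show ?thesis using v(2) by simp
  qed
  have ra: "(A *v a) $ i = - (Re z * a $ i - Im z * b $ i)" for i
    using arg_cong[OF eq[of i], of Re] by (simp add: matrix_vector_mult_def a_def b_def)
  have rb: "(A *v b) $ i = - (Re z * b $ i + Im z * a $ i)" for i
    using arg_cong[OF eq[of i], of Im] by (simp add: matrix_vector_mult_def a_def b_def)
  have Aa: "A *v a = - (Re z *\<^sub>R a - Im z *\<^sub>R b)" and Ab: "A *v b = - (Re z *\<^sub>R b + Im z *\<^sub>R a)"
    by (simp_all add: vec_eq_iff ra rb)
  have pos: "a \<bullet> a + b \<bullet> b > 0"
  proof -
    have "a \<noteq> 0 \<or> b \<noteq> 0" using v(1) by (auto simp: a_def b_def vec_eq_iff complex_eq_iff)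
    then show ?thesis by (metis add_nonneg_pos add_pos_nonneg inner_ge_zero inner_gt_zero_iff)
  qed
  have "0 \<le> a \<bullet> (A *v a) + b \<bullet> (A *v b)" using A(2) by (simp add: psdef_def)
  also have "\<dots> = - (Re z * (a \<bullet> a + b \<bullet> b))" unfolding Aa Ab by (simp add: inner_diff_right inner_add_right inner_commute algebra_simps)
  finally have "Re z \<le> 0" using pos by (simp add: mult_le_0_iff)
  moreover have "Im z * (a \<bullet> a + b \<bullet> b) = 0"
    using sym_inner[OF A(1), of a b] unfolding Aa Ab
    by (simp add: inner_diff_right inner_add_right inner_commute algebra_simps)
  ultimately show ?thesis using pos by auto
qed

text \<open>The polynomial is a constant times factors x - r with r \<le> 0; positivity at 1 fixes
  the sign of the constant.\<close>

lemma coeffs_nonneg_of_roots: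
  assumes "\<And>z. cpoly q z = 0 \<Longrightarrow> Im z = 0 \<and> Re z \<le> 0" and "0 < poly q (1::real)"
  shows "0 \<le> coeff q i"
  using assms
proof (induction "degree q" arbitrary: q i)
  case 0
  then obtain c where "q = [:c:]" by (metis degree_eq_zeroE)
  then show ?case using 0 by (cases i) auto
next
  case (Suc d)
  let ?q = "map_poly complex_of_real q"
  have "degree ?q = degree q" by (rule degree_map_poly) simp
  then obtain z where z: "cpoly q z = 0"
    using alg_closed_imp_poly_has_root[of ?q] Suc.hyps(2) unfolding cpoly_def by auto
  then have zr: "z = of_real (Re z)" "Re z \<le> 0" using Suc.prems(1)[OF z] by (auto simp: complex_eq_iff)
  define r where "r = Re z"
  have "poly q r = 0" using z zr(1) cpoly_of_real[of q r] by (simp add: r_def)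
  then obtain q1 where q1: "q = [:-r, 1:] * q1" by (metis dvdE poly_eq_0_iff_dvd)
  have q0: "q1 \<noteq> 0" using Suc.prems(2) q1 by auto
  have d: "d = degree q1" using Suc.hyps(2) q1 q0 by (simp add: degree_mult_eq del: mult_pCons_left)
  have "0 \<le> coeff q1 k" for k
  proof (rule Suc.hyps(1)[OF d])
    show "Im z = 0 \<and> Re z \<le> 0" if "cpoly q1 z = 0" for z
      using Suc.prems(1)[of z] that by (simp add: q1 cpoly_mult del: mult_pCons_left)
    have "0 < (1 - r) * poly q1 1" using Suc.prems(2) by (simp add: q1 algebra_simps)
    then show "0 < poly q1 1" using zr(2) by (auto simp: zero_less_mult_iff r_def)
  qed
  then have "r * coeff q1 i \<le> 0" "0 \<le> coeff q1 (i - 1)" using zr(2) by (simp_all add: r_def mult_nonpos_nonneg)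
  then show ?case by (cases i) (simp_all add: q1)
qed

lemma matrix_add_mat_mult: "(A + mat x) *v v = A *v v + x *\<^sub>R (v :: real^'k)"
proof -
  have "mat x *v v = x *\<^sub>R v"
    by (simp add: vec_eq_iff matrix_vector_mult_def mat_def if_distrib[of "\<lambda>x. x * _"] cong: if_cong)
  then show ?thesis by (simp add: matrix_vector_mult_add_rdistrib)
qed

lemma det_nonzero_of_pos:
  assumes "\<And>x. x \<noteq> 0 \<Longrightarrow> 0 < x \<bullet> (A *v (x :: real^'k))"
  shows "det A \<noteq> 0"
  using assms det_eq_0_iff_kernel[of A] by force

text \<open>det (t A + I) equals 1 at t = 0 and has no zero for t \<ge> 0, since t A + I has a
  positive quadratic form.\<close>

lemma det_add_one_pos:
  assumes "psdef (A :: real^'k^'k)"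
  shows "0 < det (A + mat 1)"
proof (rule ccontr)
  assume neg: "\<not> 0 < det (A + mat 1)"
  define f where "f t = det (t *\<^sub>R A + mat 1)" for t
  have nz: "f t \<noteq> 0" if "0 \<le> t" for t
    unfolding f_def
  proof (rule det_nonzero_of_pos)
    fix x :: "real^'k" assume "x \<noteq> 0"
    then have "0 < x \<bullet> x" using inner_gt_zero_iff by blast
    moreover have "0 \<le> t * (x \<bullet> (A *v x))" using assms that by (simp add: psdef_def)
    ultimately show "0 < x \<bullet> ((t *\<^sub>R A + mat 1) *v x)"
      by (simp add: matrix_add_mat_mult inner_add_right scaleR_matrix_vector_assoc[symmetric] del: inner_gt_zero_iff)
  qed
  have "continuous_on {0..1} f"
    unfolding f_def det_def by (intro continuous_intros)
  moreover have "f 0 = 1" "f 1 \<le> 0" using neg by (simp_all add: f_def)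
  ultimately obtain t where "0 \<le> t" "t \<le> 1" "f t = 0"
    using IVT2'[of f 1 0 0] by auto
  then show False using nz by blast
qed

text \<open>Turns a condition quantified over vectors into finitely many polynomial inequalities.
  Conversely, if the minimum l of the form on the unit sphere were negative, A - l I would be
  semidefinite and singular, so \<open>charp A\<close> would vanish at -l > 0; but nonnegative
  coefficients, not all 0 by the value at 1, make it positive there.\<close>

lemma psdef_iff_charp:
  assumes sym: "transpose A = (A :: real^'k^'k)"
  shows "psdef A \<longleftrightarrow> (\<forall>i\<le>CARD('k). 0 \<le> coeff (charp A) i) \<and> 0 < poly (charp A) 1"
proof
  assume psd: "psdef A"
  have "0 < poly (charp A) 1" using det_add_one_pos[OF psd] by (simp add: poly_charp)
  then show "(\<forall>i\<le>CARD('k). 0 \<le> coeff (charp A) i) \<and> 0 < poly (charp A) 1"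
    using coeffs_nonneg_of_roots[of "charp A"] charp_root[OF sym psd] by blast
next
  assume c: "(\<forall>i\<le>CARD('k). 0 \<le> coeff (charp A) i) \<and> 0 < poly (charp A) 1"
  then have c0: "0 \<le> coeff (charp A) i" for i
    using degree_charp[of A] by (cases "i \<le> CARD('k)") (auto simp: coeff_eq_0)
  have pos: "0 < poly (charp A) x" if "x > 0" for x
  proof -
    have "charp A \<noteq> 0" using c by auto
    then have "0 < lead_coeff (charp A)" using c0[of "degree (charp A)"] by (simp add: less_le)
    then have "0 < lead_coeff (charp A) * x ^ degree (charp A)" using that by simp
    also have "\<dots> \<le> (\<Sum>i\<le>degree (charp A). coeff (charp A) i * x ^ i)"
      by (rule member_le_sum[where f="\<lambda>i. coeff (charp A) i * x ^ i"]) (use c0 that in auto)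
    finally show ?thesis by (simp add: poly_altdef)
  qed
  show "psdef A"
  proof (rule ccontr)
    assume "\<not> psdef A"
    then obtain x where x: "x \<bullet> (A *v x) < 0" by (auto simp: psdef_def not_le)
    have "continuous_on (sphere 0 1) (\<lambda>v. v \<bullet> (A *v v))"
      by (intro continuous_intros linear_continuous_on matrix_vector_mul_bounded_linear)
    moreover have "sphere (0::real^'k) 1 \<noteq> {}" by (simp add: sphere_eq_empty)
    ultimately obtain v where v: "norm v = 1" and vmin: "\<And>w. norm w = 1 \<Longrightarrow> v \<bullet> (A *v v) \<le> w \<bullet> (A *v w)"
      using continuous_attains_inf[of "sphere (0::real^'k) 1" "\<lambda>v. v \<bullet> (A *v v)"] by auto
    define l where "l = v \<bullet> (A *v v)"
    have scale: "l * (w \<bullet> w) \<le> w \<bullet> (A *v w)" for w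
    proof (cases "w = 0")
      case False
      let ?u = "(1 / norm w) *\<^sub>R w"
      have "l \<le> ?u \<bullet> (A *v ?u)" unfolding l_def using False by (intro vmin) simp
      also have "\<dots> = (w \<bullet> (A *v w)) / (w \<bullet> w)"
        by (simp add: matrix_vector_mult_scaleR dot_square_norm power2_eq_square)
      finally show ?thesis using False by (simp add: field_simps)
    qed simp
    have lneg: "l < 0"
    proof (rule ccontr)
      assume "\<not> l < 0"
      then have "0 \<le> l * (x \<bullet> x)" by simp
      then show False using scale[of x] x by simp
    qed
    let ?B = "A + mat (- l)"
    have "psdef ?B" using scale by (simp add: psdef_def matrix_add_mat_mult inner_diff_right)
    moreover have "transpose ?B = ?B"
      using sym by (simp add: vec_eq_iff transpose_def mat_def)
    moreover have "v \<bullet> (?B *v v) = 0"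
      using v by (simp add: matrix_add_mat_mult inner_diff_right l_def dot_square_norm)
    ultimately have "?B *v v = 0" by (intro psdef_null)
    then have "det ?B = 0" using det_eq_0_iff_kernel[of ?B] v by (metis norm_zero zero_neq_one)
    then show False using pos[of "- l"] lneg by (simp add: poly_charp)
  qed
qed

lemma pdef_iff:
  assumes "transpose A = A"
  shows "pdef A \<longleftrightarrow> psdef A \<and> det A \<noteq> 0"
proof (intro iffI conjI)
  assume p: "pdef A"
  show "psdef A" unfolding psdef_def
  proof
    fix x show "0 \<le> x \<bullet> (A *v x)" using p by (cases "x = 0") (auto simp: pdef_def less_imp_le)
  qed
  show "det A \<noteq> 0" using p by (intro det_nonzero_of_pos) (simp add: pdef_def)
next
  assume p: "psdef A \<and> det A \<noteq> 0"
  have "x \<bullet> (A *v x) \<noteq> 0" if "x \<noteq> 0" for x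
    using psdef_null[OF assms, of x] p det_eq_0_iff_kernel[of A] that by blast
  then show "pdef A" using p by (simp add: pdef_def psdef_def less_le)
qed

lemma rpf_coeff_prod:
  assumes "\<And>i k. i \<in> I \<Longrightarrow> real_polynomial_function (\<lambda>x. coeff (f i x) k)"
  shows "real_polynomial_function (\<lambda>x. coeff (\<Prod>i\<in>I. f i x) k)"
  using assms
proof (induction I arbitrary: k rule: infinite_finite_induct)
  case (insert i I)
  then show ?case
    by (simp add: coeff_mult) (intro real_polynomial_function_sum real_polynomial_function.intros(4); simp)
qed (simp_all add: real_polynomial_function.intros)

lemma rpf_coeff_charp:
  assumes "\<And>i j. real_polynomial_function (\<lambda>x. A x $ i $ j)"
  shows "real_polynomial_function (\<lambda>x. coeff (charp (A x)) k)"
proof -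
  have e: "real_polynomial_function (\<lambda>x. coeff [:A x $ i $ j, c:] k)" for i j k c
    using assms by (cases k) (auto simp: coeff_pCons split: nat.splits intro: real_polynomial_function.intros)
  have "real_polynomial_function (\<lambda>x. \<Sum>p | p permutes UNIV. of_int (sign p) *
     coeff (\<Prod>i\<in>UNIV. [:A x $ i $ p i, if i = p i then 1 else 0:]) k)"
    by (intro real_polynomial_function_sum real_polynomial_function.intros rpf_coeff_prod e) (simp add: finite_permutations)
  moreover have "coeff (of_int s * (P :: real poly)) k = of_int s * coeff P k" for s P
    by (simp add: of_int_poly)
  ultimately show ?thesis by (simp add: charp_def det_def coeff_sum)
qed

lemma rpf_det:
  assumes "\<And>i j. real_polynomial_function (\<lambda>x. A x $ i $ j)"
  shows "real_polynomial_function (\<lambda>x. det (A x))"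
  unfolding det_def
  by (intro real_polynomial_function_sum real_polynomial_function.intros(3,4) real_polynomial_function_prod
      real_polynomial_function.intros(2) assms) (simp_all add: finite_permutations)

lemma semialgebraic_psdef:
  fixes A :: "'a::euclidean_space \<Rightarrow> real^'k^'k"
  assumes "\<And>i j. real_polynomial_function (\<lambda>x. A x $ i $ j)" "\<And>x. x \<in> S \<Longrightarrow> transpose (A x) = A x" "semialgebraic S"
  shows "semialgebraic {x \<in> S. psdef (A x)}"
proof -
  have "{x \<in> S. psdef (A x)} = S \<inter> {x. \<forall>i\<in>{..CARD('k)}. x \<in> {x. 0 \<le> coeff (charp (A x)) i}}
      \<inter> {x. 0 < det (A x + mat 1)}"
    using psdef_iff_charp assms(2) by (auto simp: poly_charp)
  moreover have "real_polynomial_function (\<lambda>x. (A x + mat 1) $ i $ j)" for i j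
    using assms(1) by (simp add: real_polynomial_function.intros)
  ultimately show ?thesis
    using assms(3) by (simp only: semialgebraic_Int semialgebraic_INT finite_atMost semialgebraic_nonneg
        semialgebraic_pos rpf_coeff_charp rpf_det assms(1))
qed

lemma semialgebraic_pdef:
  fixes A :: "'a::euclidean_space \<Rightarrow> real^'k^'k"
  assumes "\<And>i j. real_polynomial_function (\<lambda>x. A x $ i $ j)" "\<And>x. x \<in> S \<Longrightarrow> transpose (A x) = A x" "semialgebraic S"
  shows "semialgebraic {x \<in> S. pdef (A x)}"
proof -
  have "{x \<in> S. pdef (A x)} = {x \<in> S. psdef (A x)} \<inter> {x. det (A x) \<noteq> 0}"
    using pdef_iff assms(2) by blast
  then show ?thesis using semialgebraic_psdef[OF assms] assms(1)
    by (simp only: semialgebraic_Int semialgebraic_nonzero rpf_det)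
qed

subsection \<open>Compactness and bilinear maps\<close>

text \<open>The complement is the projection of a closed set along the compact factor K, hence
  closed. All openness statements about stability, positivity on the circle and definiteness are
  reduced to this form.\<close>

lemma open_forall_compact_pos:
  fixes F :: "'a::euclidean_space \<Rightarrow> 'b::euclidean_space \<Rightarrow> real"
  assumes K: "compact K" and F: "continuous_on (UNIV \<times> K) (\<lambda>(x, y). F x y)"
  shows "open {x. \<forall>y\<in>K. 0 < F x y}"
proof -
  have "closed {x. \<exists>y\<in>K. F x y \<le> 0}"
    unfolding closed_sequential_limits
  proof (intro allI impI, elim conjE)
    fix X x assume X: "\<forall>n. X n \<in> {x. \<exists>y\<in>K. F x y \<le> 0}" and lim: "X \<longlonglongrightarrow> x"
    then obtain Y where Y: "\<And>n. Y n \<in> K" "\<And>n. F (X n) (Y n) \<le> 0" by (simp add: Bex_def) metis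
    obtain y r where r: "y \<in> K" "strict_mono r" "(Y \<circ> r) \<longlonglongrightarrow> y"
      using K Y(1) unfolding compact_def by blast
    have "(\<lambda>n. (X (r n), Y (r n))) \<longlonglongrightarrow> (x, y)"
      using r(3) LIMSEQ_subseq_LIMSEQ[OF lim r(2)] by (intro tendsto_Pair) (auto simp: o_def)
    then have "(\<lambda>n. (\<lambda>(x, y). F x y) (X (r n), Y (r n))) \<longlonglongrightarrow> (\<lambda>(x, y). F x y) (x, y)"
      by (intro continuous_on_tendsto_compose[OF F]) (use r(1) Y(1) in auto)
    then have "F x y \<le> 0" using Y(2) by (intro LIMSEQ_le_const2[of "\<lambda>n. F (X (r n)) (Y (r n))"]) auto
    then show "x \<in> {x. \<exists>y\<in>K. F x y \<le> 0}" using r(1) by blast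
  qed
  moreover have "{x. \<forall>y\<in>K. 0 < F x y} = - {x. \<exists>y\<in>K. F x y \<le> 0}" by (auto simp: not_le[symmetric])
  ultimately show ?thesis by (simp add: open_closed)
qed

definition vec_rpf :: "('a::real_normed_vector \<Rightarrow> real^'k) \<Rightarrow> bool" where
  "vec_rpf f \<longleftrightarrow> (\<forall>i. real_polynomial_function (\<lambda>x. f x $ i))"

lemma vec_rpf_bilinear:
  fixes b :: "real^'i \<Rightarrow> real^'j \<Rightarrow> real^'k"
  assumes "bounded_bilinear b" "vec_rpf u" "vec_rpf v"
  shows "vec_rpf (\<lambda>x. b (u x) (v x))"
proof -
  interpret bounded_bilinear b by (rule assms(1))
  have bexp: "b x y = (\<Sum>j\<in>UNIV. \<Sum>l\<in>UNIV. (x $ j * y $ l) *\<^sub>R b (axis j 1) (axis l 1))" for x y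
  proof -
    have "x = (\<Sum>j\<in>UNIV. x $ j *\<^sub>R axis j 1)" "y = (\<Sum>l\<in>UNIV. y $ l *\<^sub>R axis l 1)"
      using basis_expansion[of x] basis_expansion[of y] by (simp_all add: scalar_mult_eq_scaleR)
    from arg_cong2[OF this, of b] have "b x y = b (\<Sum>j\<in>UNIV. x $ j *\<^sub>R axis j 1) (\<Sum>l\<in>UNIV. y $ l *\<^sub>R axis l 1)" .
    also have "\<dots> = (\<Sum>j\<in>UNIV. \<Sum>l\<in>UNIV. (x $ j * y $ l) *\<^sub>R b (axis j 1) (axis l 1))"
      unfolding sum_left sum_right scaleR_left scaleR_right scaleR_sum_right scaleR_scaleR
      by (subst sum.swap) (simp add: mult.commute)
    finally show ?thesis .
  qed
  have "b (u x) (v x) $ i = (\<Sum>j\<in>UNIV. \<Sum>l\<in>UNIV. (u x $ j * v x $ l) * (b (axis j 1) (axis l 1) $ i))" for x i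
    by (subst bexp) simp
  then show ?thesis
    using assms(2,3) unfolding vec_rpf_def
    by (simp only:) (intro allI real_polynomial_function_sum real_polynomial_function.intros(2,4); simp)
qed

lemma vec_rpf_linear: "linear f \<Longrightarrow> vec_rpf (f :: 'a::euclidean_space \<Rightarrow> real^'k)"
  unfolding vec_rpf_def
  by (auto simp: linear_conv_bounded_linear intro!: real_polynomial_function.intros(1)
      bounded_linear_compose[OF bounded_linear_vec_nth])

lemma vec_rpf_add: "vec_rpf f \<Longrightarrow> vec_rpf g \<Longrightarrow> vec_rpf (\<lambda>x. f x + g x)"
  unfolding vec_rpf_def by (simp add: real_polynomial_function.intros)

lemma vec_rpf_scaleR: "vec_rpf f \<Longrightarrow> vec_rpf (\<lambda>x. c *\<^sub>R f x)"
  unfolding vec_rpf_def by (simp add: real_polynomial_function.intros)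

lemma vec_rpf_const: "vec_rpf (\<lambda>x. c)"
  unfolding vec_rpf_def by (simp add: real_polynomial_function.intros)

lemma linear_bord_0: "linear (bord 0 :: real^'n::finite \<Rightarrow> real^'n option)"
  by (intro linearI) (auto simp: bord_def vec_eq_iff split: option.split)

lemma bord_split: "bord x v = bord x 0 + bord 0 (v :: real^'n::finite)"
  by (auto simp: bord_def vec_eq_iff split: option.split)

lemma bord_diff: "bord x v - bord y w = bord (x - y) (v - w :: real^'n::finite)"
  by (auto simp: bord_def vec_eq_iff split: option.split)

lemma bord_add: "bord x v + bord y w = bord (x + y) (v + w :: real^'n::finite)"
  by (auto simp: bord_def vec_eq_iff split: option.split)

lemma bord_scaleR: "r *\<^sub>R bord x v = bord (r * x) (r *\<^sub>R v :: real^'n::finite)"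
  by (auto simp: bord_def vec_eq_iff split: option.split)

lemma bord_inject [simp]: "bord x v = bord y w \<longleftrightarrow> x = y \<and> v = (w :: 'a^'n::finite)"
  by (metis bord_nth vec_eq_iff)

subsection \<open>Autocorrelations\<close>

text \<open>Entry i is the coefficient of z^i in u(z) v(1/z) + v(z) u(1/z); the negative powers
  carry the same coefficients. The bound \<open>CARD('n)\<close> loses nothing, as both polynomials
  have degree at most n.\<close>

definition acorr :: "real^'n option \<Rightarrow> real^'n option \<Rightarrow> real^'n::{finite,linorder} option" where
  "acorr u v = (\<chi> i. \<Sum>l\<le>CARD('n). coeff (vpoly u) l * coeff (vpoly v) (l + idx i)
      + coeff (vpoly v) l * coeff (vpoly u) (l + idx i))"

lemma bounded_bilinear_acorr: "bounded_bilinear (acorr :: real^'n::{finite,linorder} option \<Rightarrow> _)"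
  unfolding bilinear_conv_bounded_bilinear[symmetric] bilinear_def
  by (intro conjI allI linearI)
     (auto simp: acorr_def vec_eq_iff vpoly_add vpoly_scaleR algebra_simps sum.distrib sum_distrib_left)

text \<open>The Laurent polynomial with coefficient d_|i| at z^i, evaluated on the unit circle,
  where it is real.\<close>

definition trig :: "real^'n::{finite,linorder} option \<Rightarrow> complex \<Rightarrow> real" where
  "trig d z = d $ None + (\<Sum>i\<in>UNIV. 2 * d $ Some i * Re (z ^ Suc (idx i)))"

definition pair_coeff :: "real^'n option \<Rightarrow> real^'n::{finite,linorder} option \<Rightarrow> nat \<Rightarrow> nat \<Rightarrow> real" where
  "pair_coeff u v i j = coeff (vpoly u) i * coeff (vpoly v) j + coeff (vpoly v) i * coeff (vpoly u) j"

lemma acorr_nth: "acorr u v $ i = (\<Sum>l\<le>CARD('n). pair_coeff u v l (l + idx i))"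
  for u :: "real^'n::{finite,linorder} option"
  by (simp add: acorr_def pair_coeff_def)

lemma coeff_vpoly_gt: "CARD('n) < k \<Longrightarrow> coeff (vpoly (u :: 'a::comm_ring_1^'n::{finite,linorder} option)) k = 0"
  by (rule coeff_vpoly_ge) (simp add: card_option)

lemma pair_coeff_gt: "CARD('n) < i \<or> CARD('n) < j \<Longrightarrow> pair_coeff u v i j = 0"
  for u :: "real^'n::{finite,linorder} option"
  by (auto simp: pair_coeff_def coeff_vpoly_gt)

lemma pair_coeff_sym: "pair_coeff u v i j = pair_coeff u v j i"
  by (simp add: pair_coeff_def)

text \<open>An entry in the last row or column adds up a whole diagonal of \<mu>. The vanishing of
  all diagonal sums is thus the condition for 1 - x y to divide \<mu>(x,y).\<close>

lemma diagsum_last_zero: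
  assumes supp: "\<And>i j. n < i \<or> n < j \<Longrightarrow> \<mu> i j = 0" and sym: "\<And>i j. \<mu> i j = \<mu> j i"
    and zero: "\<And>k. k \<le> n \<Longrightarrow> (\<Sum>l\<le>n. \<mu> l (l + k)) = (0::real)" and i: "i \<le> n"
  shows "diagsum \<mu> i n = 0" "diagsum \<mu> n i = 0"
proof -
  have "diagsum \<mu> i n = (\<Sum>l\<le>i. \<mu> (i - l) (n - l))" using i by (simp add: diagsum_def min_def)
  also have "\<dots> = (\<Sum>l\<le>i. \<mu> l (l + (n - i)))"
    by (rule sum.reindex_bij_witness[of _ "\<lambda>l. i - l" "\<lambda>l. i - l"]) (use i in auto)
  also have "\<dots> = (\<Sum>l\<le>n. \<mu> l (l + (n - i)))"
    by (rule sum.mono_neutral_left) (use i in \<open>auto intro!: supp\<close>)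
  also have "\<dots> = 0" by (rule zero) simp
  finally show "diagsum \<mu> i n = 0" .
  then show "diagsum \<mu> n i = 0" by (simp add: diagsum_def min.commute sym)
qed

lemma sum_pair_coeff:
  fixes u v :: "real^'n::{finite,linorder} option"
  shows "(\<Sum>i\<le>CARD('n). \<Sum>j\<le>CARD('n). of_real (pair_coeff u v i j) * x ^ i * y ^ j)
     = cpoly (vpoly u) x * cpoly (vpoly v) y + cpoly (vpoly v) x * cpoly (vpoly u) y"
proof -
  have "degree (vpoly w) \<le> CARD('n)" for w :: "real^'n::{finite,linorder} option"
    using degree_vpoly_less[of w] by (simp add: card_option)
  then have "cpoly (vpoly w) x = (\<Sum>i\<le>CARD('n). of_real (coeff (vpoly w) i) * x ^ i)" for w :: "real^'n::{finite,linorder} option" and x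
    by (intro cpoly_le)
  then show ?thesis
    by (simp add: pair_coeff_def sum_product sum.distrib distrib_left distrib_right mult_ac)
qed

text \<open>The coefficient array of u(x) v(y) + v(x) u(y) has the same diagonal sums as an array
  supported on the first row and column. The difference is divisible by 1 - x y, which vanishes for
  y = cnj x on the circle.\<close>

lemma trig_acorr:
  fixes u v :: "real^'n::{finite,linorder} option"
  assumes z: "cmod z = 1"
  shows "2 * Re (cpoly (vpoly v) z * cnj (cpoly (vpoly u) z)) = trig (acorr u v) z"
proof -
  let ?n = "CARD('n)"
  define d where "d k = (\<Sum>l\<le>?n. pair_coeff u v l (l + k))" for k
  \<comment> \<open>Row 0 and column 0 contain one entry of every diagonal, so all diagonal sums can
    be placed there.\<close>
  define \<delta> where "\<delta> i j = (if i = 0 then (if j \<le> ?n then d j else 0) else if j = 0 then (if i \<le> ?n then d i else 0) else 0)" for i j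
  define \<mu> where "\<mu> i j = pair_coeff u v i j - \<delta> i j" for i j
  have dsum: "(\<Sum>l\<le>?n. \<delta> l (l + k)) = d k" if "k \<le> ?n" for k
  proof -
    have "(\<Sum>l\<le>?n. \<delta> l (l + k)) = (\<Sum>l\<in>{0}. \<delta> l (l + k))"
      by (rule sum.mono_neutral_right) (auto simp: \<delta>_def)
    then show ?thesis using that by (simp add: \<delta>_def)
  qed
  have supp: "\<mu> i j = 0" if "?n < i \<or> ?n < j" for i j
    using that pair_coeff_gt[of i j u v] by (auto simp: \<mu>_def \<delta>_def)
  have sym: "\<mu> i j = \<mu> j i" for i j
    using pair_coeff_sym[of u v i j] by (auto simp: \<mu>_def \<delta>_def)
  have zero: "(\<Sum>l\<le>?n. \<mu> l (l + k)) = 0" if "k \<le> ?n" for k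
    using dsum[OF that] by (simp add: \<mu>_def sum_subtractf d_def)
  define q where "q i j = complex_of_real (diagsum \<mu> i j)" for i j
  have "(\<Sum>i\<le>?n. \<Sum>j\<le>?n. of_real (\<mu> i j) * z ^ i * (cnj z) ^ j)
      = (1 - z * cnj z) * (\<Sum>i<?n. \<Sum>j<?n. q i j * z ^ i * (cnj z) ^ j)"
    by (rule displacement_generating)
       (simp_all add: q_def diagsum_last_zero[OF supp sym zero] diagsum_Suc)
  also have "z * cnj z = 1" using z by (simp add: complex_norm_square[symmetric])
  finally have "(\<Sum>i\<le>?n. \<Sum>j\<le>?n. of_real (pair_coeff u v i j) * z ^ i * (cnj z) ^ j)
     = (\<Sum>i\<le>?n. \<Sum>j\<le>?n. of_real (\<delta> i j) * z ^ i * (cnj z) ^ j)"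
    by (simp add: \<mu>_def sum_subtractf left_diff_distrib)
  also have "\<dots> = (\<Sum>j\<le>?n. of_real (d j) * (cnj z) ^ j) + (\<Sum>i<?n. of_real (d (Suc i)) * z ^ Suc i)"
    by (simp add: lessThan_Suc_atMost[symmetric] sum.lessThan_Suc_shift \<delta>_def del: sum.lessThan_Suc)
  also have "\<dots> = of_real (d 0) + (\<Sum>i<?n. of_real (d (Suc i)) * (z ^ Suc i + cnj z ^ Suc i))"
    by (simp add: lessThan_Suc_atMost[symmetric] sum.lessThan_Suc_shift sum.distrib distrib_left del: sum.lessThan_Suc)
  also have "\<dots> = of_real (d 0) + (\<Sum>i<?n. of_real (2 * d (Suc i) * Re (z ^ Suc i)))"
  proof -
    have "z ^ Suc i + cnj z ^ Suc i = of_real (2 * Re (z ^ Suc i))" for i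
      using complex_add_cnj[of "z ^ Suc i"] by (simp only: complex_cnj_power)
    then show ?thesis by (simp only: of_real_mult mult.assoc) (simp only: mult.left_commute)
  qed
  finally have "cpoly (vpoly u) z * cnj (cpoly (vpoly v) z) + cpoly (vpoly v) z * cnj (cpoly (vpoly u) z)
      = of_real (d 0 + (\<Sum>i<?n. 2 * d (Suc i) * Re (z ^ Suc i)))"
    unfolding sum_pair_coeff cnj_cpoly by simp
  then have "Re (cpoly (vpoly u) z * cnj (cpoly (vpoly v) z) + cpoly (vpoly v) z * cnj (cpoly (vpoly u) z))
      = d 0 + (\<Sum>i<?n. 2 * d (Suc i) * Re (z ^ Suc i))" by (simp only: Re_complex_of_real)
  moreover have "Re (cpoly (vpoly u) z * cnj (cpoly (vpoly v) z)) = Re (cpoly (vpoly v) z * cnj (cpoly (vpoly u) z))"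
    by simp
  moreover have "trig (acorr u v) z = d 0 + (\<Sum>i<?n. 2 * d (Suc i) * Re (z ^ Suc i))"
    unfolding trig_def acorr_nth d_def[symmetric] idx_None idx_Some
    using sum_idx[where 'k='n, of "\<lambda>k. 2 * d (Suc k) * Re (z ^ Suc k)"] by simp
  ultimately show ?thesis by (simp only: plus_complex.sel)
qed

text \<open>\<open>trig d\<close> is the real part of a real polynomial, with the coefficients of
  positive powers doubled.\<close>

lemma trig_eq_0_imp:
  assumes "\<And>z. cmod z = 1 \<Longrightarrow> trig d z = 0"
  shows "d = 0"
proof -
  define e where "e = (\<chi> i. case i of None \<Rightarrow> d $ None | Some j \<Rightarrow> 2 * d $ Some j)"
  have "vpoly e = 0"
  proof (rule cpoly_Re_zero_on_circle)
    fix z :: complex assume "cmod z = 1"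
    have "cpoly (vpoly e) z = of_real (e $ None) + (\<Sum>i\<in>UNIV. of_real (e $ Some i) * z ^ Suc (idx i))"
      unfolding vpoly_def sum_UNIV_option cpoly_sum cpoly_monom cpoly_add by simp
    then have "Re (cpoly (vpoly e) z) = trig d z" by (simp add: e_def trig_def)
    then show "Re (cpoly (vpoly e) z) = 0" using assms \<open>cmod z = 1\<close> by simp
  qed
  then have "e $ i = 0" for i by simp
  from this[of None] this[of "Some j" for j] have "d $ i = 0" for i
    by (cases i) (simp_all add: e_def)
  then show ?thesis by (simp add: vec_eq_iff)
qed

lemma trig_add: "trig (a + b) z = trig a z + trig b z"
  by (simp add: trig_def sum.distrib distrib_left distrib_right del: power_Suc)

lemma trig_scaleR: "trig (r *\<^sub>R a) z = r * trig a z"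
  by (simp add: trig_def sum_distrib_left distrib_left mult.assoc mult.left_commute del: power_Suc)

lemma trig_diff: "trig (a - b) z = trig a z - trig b z"
  using trig_add[of "a - b" b z] by simp

lemma trig_eq_imp: "(\<And>z. cmod z = 1 \<Longrightarrow> trig a z = trig b z) \<Longrightarrow> a = b"
  using trig_eq_0_imp[of "a - b"] by (simp add: trig_diff)

definition pos_trig :: "(real^'n::{finite,linorder} option) set" where
  "pos_trig = {d. \<forall>z\<in>sphere 0 1. 0 < trig d z}"

text \<open>The square makes this a strict inequality over a compact set, the shape required by
  \<open>open_forall_compact_pos\<close>; \<open>stable_vecs_iff\<close> gives the usual
  form.\<close>

definition stable_vecs :: "(real^'n::{finite,linorder} option) set" where
  "stable_vecs = {u. \<forall>z\<in>cball 0 1. 0 < (cmod (cpoly (vpoly u) z))\<^sup>2}"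

lemma stable_vecs_iff: "u \<in> stable_vecs \<longleftrightarrow> (\<forall>z. cmod z \<le> 1 \<longrightarrow> cpoly (vpoly u) z \<noteq> 0)"
  by (auto simp: stable_vecs_def)

lemma open_pos_trig: "open (pos_trig :: (real^'n::{finite,linorder} option) set)"
  unfolding pos_trig_def trig_def
  by (intro open_forall_compact_pos) (auto simp: case_prod_unfold intro!: continuous_intros)

lemma convex_pos_trig: "convex (pos_trig :: (real^'n::{finite,linorder} option) set)"
proof (rule convexI)
  fix x y :: "real^'n option" and u v :: real
  assume xy: "x \<in> pos_trig" "y \<in> pos_trig" and uv: "0 \<le> u" "0 \<le> v" "u + v = 1"
  have "0 < u * trig x z + v * trig y z" if "z \<in> sphere 0 1" for z
  proof (cases "u = 0")
    case False
    then show ?thesis using xy uv that by (intro add_pos_nonneg) (auto simp: pos_trig_def less_imp_le)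
  qed (use xy uv that in \<open>auto simp: pos_trig_def\<close>)
  then show "u *\<^sub>R x + v *\<^sub>R y \<in> pos_trig" by (simp add: pos_trig_def trig_add trig_scaleR)
qed

lemma cpoly_vpoly: "cpoly (vpoly u) z = (\<Sum>i\<in>UNIV. of_real (u $ i) * z ^ idx i)"
  by (simp add: vpoly_def cpoly_sum cpoly_monom)

lemma open_stable_vecs: "open (stable_vecs :: (real^'n::{finite,linorder} option) set)"
  unfolding stable_vecs_def cpoly_vpoly
  by (intro open_forall_compact_pos) (auto simp: case_prod_unfold intro!: continuous_intros)

subsection \<open>The algebra of polynomials modulo a stable polynomial\<close>

lemma transpose_add: "transpose (A + B :: real^'a^'b) = transpose A + transpose B"
  by (simp add: transpose_def vec_eq_iff)

lemma transpose_outer: "transpose (outer u v :: real^'a^'b) = outer v u"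
  by (simp add: transpose_def outer_def vec_eq_iff mult.commute)

lemma outer_mult: "outer u v *v w = (v \<bullet> w) *\<^sub>R (u :: real^'a)"
  by (simp add: outer_def vec_eq_iff matrix_vector_mult_def inner_vec_def sum_distrib_left sum_distrib_right mult_ac)

lemma transpose_scaleR: "transpose (r *\<^sub>R A :: real^'a^'b) = r *\<^sub>R transpose A"
  by (simp add: transpose_def vec_eq_iff)

text \<open>Isolates what the nodal polynomial contributes: its degree n+1, stability, and the node
  at 0.\<close>

locale stable_modulus =
  fixes N :: "real poly" and T :: "'n::{finite,linorder} itself"
  assumes deg_N: "degree N = Suc CARD('n)"
    and root_N: "\<And>z. cpoly N z = 0 \<Longrightarrow> cmod z < 1"
    and N_at_0: "coeff N 0 = 0"
begin

lemma N_nz: "N \<noteq> 0" using deg_N by auto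

lemma deg_vpoly_N: "degree (vpoly (u :: real^'n option)) < degree N"
  using degree_vpoly_less[of u] by (simp add: deg_N card_option)

definition mm :: "real^'n option \<Rightarrow> real^'n option \<Rightarrow> real^'n option" where
  "mm u v = pvec (vpoly u * vpoly v mod N)"

lemma vpoly_pvec_mod [simp]: "vpoly (pvec (p mod N) :: real^'n option) = p mod N"
proof -
  have "degree (p mod N) < CARD('n option)"
    using degree_mod_less[OF N_nz, of p] by (auto simp: deg_N card_option)
  then show ?thesis by simp
qed

lemma vpoly_mm: "vpoly (mm u v) = vpoly u * vpoly v mod N"
  by (simp add: mm_def)

lemma bounded_bilinear_mm: "bounded_bilinear mm"
  unfolding bilinear_conv_bounded_bilinear[symmetric] bilinear_def
  by (intro conjI allI linearI)
     (simp_all add: mm_def vpoly_add vpoly_scaleR pvec_add pvec_smultR distrib_left distrib_right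
       poly_mod_add_left mod_smult_left)

lemma mm_commute: "mm u v = mm v u"
  by (simp add: mm_def mult.commute)

lemma mm_assoc: "mm u (mm v w) = mm (mm u v) w"
  by (simp add: mm_def mod_mult_left_eq mod_mult_right_eq mult.assoc)

definition e0 :: "real^'n option" where "e0 = pvec 1"

lemma vpoly_e0: "vpoly e0 = 1" by (simp add: e0_def)

lemma e0_eq: "e0 = axis None 1"
proof -
  have "e0 $ i = axis None 1 $ i" for i
    by (cases i) (simp_all add: e0_def pvec_def axis_def)
  then show ?thesis by (simp add: vec_eq_iff)
qed

lemma mm_e0 [simp]: "mm e0 v = v" "mm v e0 = v"
  by (simp_all add: mm_def vpoly_e0 mod_poly_less deg_vpoly_N)

text \<open>As N vanishes at 0, evaluation at 0 is well defined on polynomials modulo N.\<close>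

lemma mm_None: "mm u v $ None = u $ None * v $ None"
proof -
  have "coeff (p mod N) 0 = coeff p 0" for p
  proof -
    have "coeff p 0 = coeff (p div N * N + p mod N) 0" by simp
    also have "\<dots> = coeff (p mod N) 0" by (simp only: coeff_add coeff_mult_0 N_at_0)
    finally show ?thesis by simp
  qed
  then have "coeff (vpoly u * vpoly v mod N) 0 = coeff (vpoly u) 0 * coeff (vpoly v) 0"
    by (simp add: coeff_mult_0)
  moreover have "coeff (vpoly w) 0 = w $ None" for w :: "real^'n option"
    using coeff_vpoly_idx[of w None] by simp
  ultimately show ?thesis by (simp add: mm_def pvec_def)
qed

definition Mc :: "real^'n option \<Rightarrow> real^'n option^'n option" where
  "Mc u = matrix (mm u)"

lemma Mc_works: "Mc u *v v = mm u v"
proof -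
  have "linear (mm u)"
    using bounded_bilinear.bounded_linear_right[OF bounded_bilinear_mm] by (simp add: linear_conv_bounded_linear)
  then show ?thesis unfolding Mc_def using matrix_works[of "mm u"] by (simp only: linear_matrix_vector_mul_eq)
qed

lemma Mc_mult: "Mc u ** Mc v = Mc (mm u v)"
  by (simp add: matrix_eq Mc_works matrix_vector_mul_assoc[symmetric] mm_assoc)

lemma Mc_commute: "Mc u ** Mc v = Mc v ** Mc u"
  by (simp add: Mc_mult mm_commute)

definition X1 :: "real^'n option" where "X1 = pvec [:0, 1:]"

lemma vpoly_X1: "vpoly X1 = [:0, 1:]"
  unfolding X1_def by (rule vpoly_pvec) (simp add: card_option)

text \<open>The companion matrix of N: multiplication by x modulo N in the monomial basis.\<close>

definition Cm :: "real^'n option^'n option" where "Cm = Mc X1"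

lemma Cm_power: "((*v) Cm ^^ k) v = pvec (monom 1 k * vpoly v mod N)"
proof (induction k)
  case 0
  then show ?case by (simp add: mod_poly_less deg_vpoly_N one_poly_eq_simps(1)[symmetric] monom_0)
next
  case (Suc k)
  then show ?case
    by (simp add: Cm_def Mc_works mm_def vpoly_X1 mod_mult_right_eq monom_Suc mult.assoc[symmetric] del: mult_pCons_left)
       (simp add: mult_pCons_left)
qed

lemma Cm_power_tendsto: "(\<lambda>k. ((*v) Cm ^^ k) v) \<longlonglongrightarrow> 0"
  unfolding Cm_power
  by (rule vec_tendstoI) (simp add: pvec_def mod_power_tendsto_0[OF N_nz root_N])

text \<open>Before the last column, multiplication by x is a pure shift, because the degree stays
  below that of N.\<close>

lemma Cm_nth:
  assumes "idx k < CARD('n)"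
  shows "Cm $ i $ k = (if idx i = Suc (idx k) then 1 else 0)"
proof -
  have v: "vpoly (axis k 1 :: real^'n option) = monom 1 (idx k)"
    by (simp add: vpoly_def axis_def if_distrib[of "\<lambda>x. monom x _"] cong: if_cong)
  have "Cm $ i $ k = (Cm *v axis k 1) $ i" by (simp add: matrix_vector_mul_component inner_axis)
  also have "Cm *v axis k 1 = pvec (monom 1 (Suc (idx k)) mod N)"
    by (simp add: Cm_def Mc_works mm_def vpoly_X1 v monom_Suc)
  also have "monom 1 (Suc (idx k)) mod N = monom 1 (Suc (idx k))"
    by (rule mod_poly_less) (use assms in \<open>simp add: degree_monom_eq deg_N\<close>)
  finally show ?thesis by (auto simp: pvec_def)
qed

text \<open>The matrix \<open>E\<close> in the basis given by the columns of \<open>V\<close>; see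
  \<open>E_mat_eq\<close>.\<close>

definition Eh :: "real^'n option^'n option" where
  "Eh = (SOME X. X = Cm ** X ** transpose Cm + outer e0 e0)"

lemma Eh: "Eh = Cm ** Eh ** transpose Cm + outer e0 e0"
  unfolding Eh_def by (rule someI_ex) (rule stein_exists[OF Cm_power_tendsto])

lemma stein_unique:
  assumes "X = Cm ** X ** transpose Cm + Q" "Y = Cm ** Y ** transpose Cm + Q"
  shows "X = Y"
proof -
  have "X - Y = Cm ** (X - Y) ** transpose Cm"
  proof -
    have "X - Y = (Cm ** X ** transpose Cm + Q) - (Cm ** Y ** transpose Cm + Q)"
      by (rule arg_cong2[of X _ Y _ "(-)", OF assms])
    also have "\<dots> = Cm ** X ** transpose Cm - Cm ** Y ** transpose Cm" by simp
    also have "\<dots> = Cm ** (X - Y) ** transpose Cm"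
      using matrix_add_ldistrib[of Cm "X - Y" Y] matrix_add_rdistrib[of "Cm ** (X - Y)" "Cm ** Y" "transpose Cm"]
      by simp
    finally show ?thesis .
  qed
  then have "X - Y = 0" by (rule stein_unique_0[OF Cm_power_tendsto])
  then show ?thesis by simp
qed

lemma Eh_sym: "transpose Eh = Eh"
proof (rule stein_unique)
  show "transpose Eh = Cm ** transpose Eh ** transpose Cm + outer e0 e0"
    by (subst Eh) (simp add: transpose_add transpose_outer matrix_transpose_mul matrix_mul_assoc)
  show "Eh = Cm ** Eh ** transpose Cm + outer e0 e0" by (rule Eh)
qed

lemma Eh_quad: "x \<bullet> (Eh *v x) = (transpose Cm *v x) \<bullet> (Eh *v (transpose Cm *v x)) + (x \<bullet> e0)\<^sup>2"
proof -
  have "Eh *v x = Cm *v (Eh *v (transpose Cm *v x)) + (e0 \<bullet> x) *\<^sub>R e0"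
    by (subst Eh) (simp only: matrix_vector_mult_add_rdistrib matrix_vector_mul_assoc matrix_mul_assoc outer_mult)
  then show ?thesis
    by (simp only: inner_add_right inner_transpose_vec inner_scaleR_right) (simp add: power2_eq_square inner_commute)
qed

lemma psdef_Eh: "psdef Eh"
  unfolding psdef_def
proof
  show "0 \<le> x \<bullet> (Eh *v x)" for x
    by (rule stein_psd[OF Cm_power_tendsto]) (subst (2) Eh_quad, simp del: transpose_matrix_vector)
qed

text \<open>Where the form vanishes it vanishes along the whole orbit, which makes x orthogonal to
  every \<open>Cm\<close>-iterate of \<open>e0\<close>. These iterates are the powers of x modulo N
  and contain the standard basis.\<close>

lemma pdef_Eh: "pdef Eh"
proof -
  have "x = 0" if x: "x \<bullet> (Eh *v x) = 0" for x
  proof -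
    let ?t = "\<lambda>k. ((*v) (transpose Cm) ^^ k) x"
    have it: "?t k \<bullet> (Eh *v ?t k) = 0" for k
    proof (induction k)
      case (Suc k)
      have "0 \<le> (transpose Cm *v ?t k) \<bullet> (Eh *v (transpose Cm *v ?t k))"
        using psdef_Eh unfolding psdef_def by blast
      moreover have "0 = (transpose Cm *v ?t k) \<bullet> (Eh *v (transpose Cm *v ?t k)) + (?t k \<bullet> e0)\<^sup>2"
        using Eh_quad[of "?t k"] Suc by simp
      ultimately have "(transpose Cm *v ?t k) \<bullet> (Eh *v (transpose Cm *v ?t k)) = 0"
        using zero_le_power2[of "?t k \<bullet> e0"] by linarith
      then show ?case by (simp del: transpose_matrix_vector)
    qed (simp add: x)
    have "?t k \<bullet> e0 = 0" for k
    proof -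
      have "?t (Suc k) \<bullet> (Eh *v ?t (Suc k)) + (?t k \<bullet> e0)\<^sup>2 = 0"
        using it[of k] Eh_quad[of "?t k"] by (simp del: transpose_matrix_vector)
      then show ?thesis using it[of "Suc k"] by simp
    qed
    then have "x \<bullet> pvec (monom 1 k mod N) = 0" for k
      using transpose_iter_inner[where A=Cm and k=k and x=x and y=e0] by (simp only: Cm_power vpoly_e0 mult_1_right)
    then have "x $ i = 0" for i
    proof -
      have "monom 1 (idx i) mod N = (monom 1 (idx i) :: real poly)"
        using idx_bound[of i] by (intro mod_poly_less) (simp add: degree_monom_eq deg_N card_option)
      moreover have "pvec (monom 1 (idx i)) = (axis i 1 :: real^'n option)"
        by (auto simp: pvec_def axis_def vec_eq_iff)
      ultimately show ?thesis using \<open>\<And>k. x \<bullet> pvec (monom 1 k mod N) = 0\<close>[of "idx i"] by (simp add: inner_axis)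
    qed
    then show ?thesis by (simp add: vec_eq_iff)
  qed
  then show ?thesis using psdef_Eh unfolding pdef_def psdef_def less_le by metis
qed

text \<open>The generalized Pick matrix up to congruence by \<open>V\<close>; see
  \<open>pick_mat_eq\<close>.\<close>

definition Pick :: "real^'n option \<Rightarrow> real^'n option^'n option" where
  "Pick u = Mc u ** Eh + Eh ** transpose (Mc u)"

lemma Pick_sym: "transpose (Pick u) = Pick u"
  by (simp add: Pick_def transpose_add matrix_transpose_mul Eh_sym add.commute)

lemma Pick_quad: "x \<bullet> (Pick u *v x) = 2 * ((transpose (Mc u) *v x) \<bullet> (Eh *v x))"
proof -
  have "x \<bullet> (Pick u *v x) = x \<bullet> (Mc u *v (Eh *v x)) + x \<bullet> (Eh *v (transpose (Mc u) *v x))"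
    unfolding Pick_def by (simp only: matrix_vector_mult_add_rdistrib matrix_vector_mul_assoc[symmetric] inner_add_right)
  moreover have "x \<bullet> (Mc u *v (Eh *v x)) = (transpose (Mc u) *v x) \<bullet> (Eh *v x)"
    by (simp only: inner_transpose_vec)
  moreover have "x \<bullet> (Eh *v (transpose (Mc u) *v x)) = (transpose (Mc u) *v x) \<bullet> (Eh *v x)"
    by (rule sym_inner[OF Eh_sym])
  ultimately show ?thesis by simp
qed

text \<open>An eigenvector of the transpose of \<open>Mc u\<close> for -1/2 would give the Pick form
  the value - x'Eh x \<le> 0. This makes the Cayley transform \<open>D\<close> well defined.\<close>

lemma det_half_nz:
  assumes "pdef (Pick u)"
  shows "det (Mc u + mat (1/2)) \<noteq> 0"
proof
  assume "det (Mc u + mat (1/2)) = 0"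
  then have "det (transpose (Mc u + mat (1/2))) = 0" by (simp add: det_transpose)
  moreover have "transpose (Mc u + mat (1/2)) = transpose (Mc u) + mat (1/2)"
    by (simp add: transpose_add transpose_mat)
  ultimately obtain x where x: "x \<noteq> 0" "(transpose (Mc u) + mat (1/2)) *v x = 0"
    using det_eq_0_iff_kernel by metis
  then have "transpose (Mc u) *v x = - ((1/2) *\<^sub>R x)"
    unfolding matrix_add_mat_mult by (simp only: eq_neg_iff_add_eq_0)
  then have "x \<bullet> (Pick u *v x) = - (x \<bullet> (Eh *v x))" unfolding Pick_quad by simp
  moreover have "0 < x \<bullet> (Pick u *v x)" "0 \<le> x \<bullet> (Eh *v x)"
    using x(1) assms psdef_Eh unfolding pdef_def psdef_def by blast+
  ultimately show False by linarith
qed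

lemma Mc_add: "Mc (u + v) = Mc u + Mc v"
  by (simp add: matrix_eq Mc_works matrix_vector_mult_add_rdistrib bounded_bilinear.add_left[OF bounded_bilinear_mm])

lemma Mc_scaleR: "Mc (r *\<^sub>R v) = r *\<^sub>R Mc v"
  by (simp add: matrix_eq Mc_works scaleR_matrix_vector_assoc[symmetric] bounded_bilinear.scaleR_left[OF bounded_bilinear_mm])

lemma Mc_e0: "Mc e0 = mat 1"
  by (simp add: matrix_eq Mc_works)

lemma Pick_add: "Pick (u + v) = Pick u + Pick v"
  by (simp add: Pick_def Mc_add transpose_add matrix_add_ldistrib matrix_add_rdistrib)

lemma Pick_scaleR: "Pick (r *\<^sub>R u) = r *\<^sub>R Pick u"
  by (simp add: Pick_def Mc_scaleR transpose_scaleR scalar_matrix_assoc matrix_scalar_ac scaleR_add_right)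

text \<open>\<open>Mc u\<close> commutes with \<open>Cm\<close>, so multiplying the Stein equation
  of \<open>Eh\<close> by \<open>Mc u\<close> yields another Stein equation; the transpose gives the
  second half.\<close>

lemma Pick_displacement: "Pick u = Cm ** Pick u ** transpose Cm + (outer u e0 + outer e0 u)"
proof -
  have a: "Mc u ** Eh = Cm ** (Mc u ** Eh) ** transpose Cm + outer u e0"
  proof -
    have "Mc u ** Eh = Mc u ** (Cm ** Eh ** transpose Cm) + Mc u ** outer e0 e0"
      by (subst Eh) (simp add: matrix_add_ldistrib)
    also have "Mc u ** (Cm ** Eh ** transpose Cm) = Cm ** (Mc u ** Eh) ** transpose Cm"
    proof -
      have "Mc u ** (Cm ** Eh ** transpose Cm) = (Mc u ** Cm) ** Eh ** transpose Cm" by (simp only: matrix_mul_assoc)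
      also have "Mc u ** Cm = Cm ** Mc u" unfolding Cm_def by (rule Mc_commute)
      finally show ?thesis by (simp only: matrix_mul_assoc)
    qed
    also have "Mc u ** outer e0 e0 = outer u e0"
      by (simp add: matrix_eq matrix_vector_mul_assoc[symmetric] outer_mult matrix_vector_mult_scaleR Mc_works)
    finally show ?thesis .
  qed
  have "Eh ** transpose (Mc u) = transpose (Mc u ** Eh)" by (simp add: matrix_transpose_mul Eh_sym)
  also have "\<dots> = transpose (Cm ** (Mc u ** Eh) ** transpose Cm + outer u e0)" using a by simp
  also have "\<dots> = Cm ** (Eh ** transpose (Mc u)) ** transpose Cm + outer e0 u"
    by (simp add: transpose_add matrix_transpose_mul transpose_outer Eh_sym matrix_mul_assoc)
  finally have b: "Eh ** transpose (Mc u) = Cm ** (Eh ** transpose (Mc u)) ** transpose Cm + outer e0 u" .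
  show ?thesis unfolding Pick_def matrix_add_ldistrib matrix_add_rdistrib
    using arg_cong2[OF a b, of "(+)"] by (simp only: add.assoc add.left_commute)
qed

text \<open>Links the coefficient recursion for 1 - x y with Stein equations: on an array whose last
  row and column are 0, \<open>Cm\<close> acts as a shift, since its last column only meets
  zeros.\<close>

lemma embed_displacement:
  fixes q :: "nat \<Rightarrow> nat \<Rightarrow> real"
  assumes q: "\<And>j. j \<le> CARD('n) \<Longrightarrow> q (CARD('n)) j = 0" "\<And>i. i \<le> CARD('n) \<Longrightarrow> q i (CARD('n)) = 0"
    and \<mu>: "\<And>j. \<mu> 0 j = q 0 j" "\<And>i. \<mu> i 0 = q i 0"
      "\<And>i j. \<mu> (Suc i) (Suc j) = q (Suc i) (Suc j) - q i j"
  shows "(\<chi> i j. q (idx i) (idx j)) = Cm ** (\<chi> i j. q (idx i) (idx j)) ** transpose Cm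
     + ((\<chi> i j. \<mu> (idx i) (idx j)) :: real^'n option^'n option)"
proof -
  let ?P = "(\<chi> i j. q (idx i) (idx j)) :: real^'n option^'n option"
  define sh :: "nat \<Rightarrow> 'n option \<Rightarrow> real" where "sh k i = (if idx i = Suc k then 1 else 0)" for k i
  have idx_le: "idx i \<le> CARD('n)" for i :: "'n option" using idx_bound[of i] by (simp add: card_option)
  have Cq: "Cm $ i $ k * q (idx k) b = sh (idx k) i * q (idx k) b" if "b \<le> CARD('n)" for i k b
  proof (cases "idx k < CARD('n)")
    case False
    then have "idx k = CARD('n)" using idx_le[of k] by simp
    then show ?thesis using q(1)[OF that] by simp
  qed (simp add: Cm_nth sh_def)
  have Cq': "q a (idx l) * Cm $ j $ l = q a (idx l) * sh (idx l) j" if "a \<le> CARD('n)" for j l a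
  proof (cases "idx l < CARD('n)")
    case False
    then have "idx l = CARD('n)" using idx_le[of l] by simp
    then show ?thesis using q(2)[OF that] by simp
  qed (simp add: Cm_nth sh_def)
  have pick: "(\<Sum>k\<in>(UNIV::'n option set). sh (idx k) i * f (idx k)) = (case i of None \<Rightarrow> 0 | Some i' \<Rightarrow> f (idx i'))" for i and f :: "nat \<Rightarrow> real"
  proof -
    have "(\<Sum>k\<in>(UNIV::'n option set). sh (idx k) i * f (idx k)) = (\<Sum>k<CARD('n option). (if idx i = Suc k then 1 else 0) * f k)"
      unfolding sh_def by (rule sum_idx[where 'k="'n option"])
    also have "\<dots> = (case i of None \<Rightarrow> 0 | Some i' \<Rightarrow> f (idx i'))"
    proof (cases i)
      case (Some i')
      have "(\<Sum>k<CARD('n option). (if idx i = Suc k then 1 else 0) * f k) = (\<Sum>k\<in>{idx i'}. f k)"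
        by (rule sum.mono_neutral_cong_right) (use idx_bound[of i'] in \<open>auto simp: Some card_option\<close>)
      then show ?thesis by (simp add: Some)
    qed simp
    finally show ?thesis .
  qed
  have "(Cm ** ?P ** transpose Cm) $ i $ j = (case i of None \<Rightarrow> 0 | Some i' \<Rightarrow> (case j of None \<Rightarrow> 0 | Some j' \<Rightarrow> q (idx i') (idx j')))" for i j
  proof -
    have "(Cm ** ?P ** transpose Cm) $ i $ j = (\<Sum>l\<in>UNIV. (\<Sum>k\<in>UNIV. Cm $ i $ k * q (idx k) (idx l)) * Cm $ j $ l)"
      by (simp add: matrix_matrix_mult_def transpose_def)
    also have "\<dots> = (\<Sum>l\<in>(UNIV::'n option set). (\<Sum>k\<in>(UNIV::'n option set). sh (idx k) i * q (idx k) (idx l)) * Cm $ j $ l)"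
      using idx_le by (simp add: Cq)
    also have "\<dots> = (\<Sum>l\<in>(UNIV::'n option set). (\<Sum>k\<in>(UNIV::'n option set). sh (idx k) i * (q (idx k) (idx l) * Cm $ j $ l)))"
      by (simp add: sum_distrib_right mult.assoc)
    also have "\<dots> = (\<Sum>l\<in>(UNIV::'n option set). (\<Sum>k\<in>(UNIV::'n option set). sh (idx k) i * (q (idx k) (idx l) * sh (idx l) j)))"
      using idx_le by (simp add: Cq')
    also have "\<dots> = (\<Sum>l\<in>(UNIV::'n option set). sh (idx l) j * (\<Sum>k\<in>(UNIV::'n option set). sh (idx k) i * q (idx k) (idx l)))"
      by (simp add: sum_distrib_left mult_ac)
    also have "\<dots> = (\<Sum>l\<in>(UNIV::'n option set). sh (idx l) j * (case i of None \<Rightarrow> 0 | Some i' \<Rightarrow> q (idx i') (idx l)))"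
      using pick[of i "\<lambda>a. q a b" for b] by (simp only:)
    also have "\<dots> = (case i of None \<Rightarrow> 0 | Some i' \<Rightarrow> (case j of None \<Rightarrow> 0 | Some j' \<Rightarrow> q (idx i') (idx j')))"
      using pick[of j "\<lambda>b. q a b" for a] by (cases i) simp_all
    finally show ?thesis .
  qed
  moreover have "q (idx i) (idx j) = (case i of None \<Rightarrow> 0 | Some i' \<Rightarrow> (case j of None \<Rightarrow> 0 | Some j' \<Rightarrow> q (idx i') (idx j')))
      + \<mu> (idx i) (idx j)" for i j :: "'n option"
    using \<mu> by (cases i; cases j) auto
  ultimately show ?thesis by (simp add: vec_eq_iff)
qed

text \<open>
  A vanishing autocorrelation makes the quadratic form of the Pick matrix vanish at the last row of
  the multiplication matrix of \<open>v\<close>; this row is nonzero, as some shift of \<open>v\<close> has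
  degree exactly \<open>CARD('n)\<close>.
\<close>

lemma pick_coercive:
  assumes pd: "pdef (Pick u)" and ac: "acorr v (mm u v) = 0"
  shows "v = 0"
proof -
  let ?n = "CARD('n)"
  define w where "w = mm u v"
  define \<mu> where "\<mu> = pair_coeff v w"
  have mat\<mu>: "(\<chi> i j. \<mu> (idx i) (idx j)) = outer v w + outer w v"
    by (simp add: vec_eq_iff \<mu>_def pair_coeff_def outer_def)
  have zero: "(\<Sum>l\<le>?n. \<mu> l (l + k)) = 0" if "k \<le> ?n" for k
  proof -
    have "idx (idx_inv k :: 'n option) = k" using that by (simp add: idx_idx_inv card_option)
    moreover have "acorr v w $ (idx_inv k) = 0" using ac by (simp add: w_def)
    ultimately show ?thesis by (simp add: acorr_nth \<mu>_def)
  qed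
  have supp: "\<And>i j. ?n < i \<or> ?n < j \<Longrightarrow> \<mu> i j = 0" unfolding \<mu>_def by (rule pair_coeff_gt)
  have sym: "\<And>i j. \<mu> i j = \<mu> j i" unfolding \<mu>_def by (rule pair_coeff_sym)
  define P where "P = ((\<chi> i j. diagsum \<mu> (idx i) (idx j)) :: real^'n option^'n option)"
  have P: "P = Cm ** P ** transpose Cm + (outer v w + outer w v)"
    unfolding P_def mat\<mu>[symmetric]
    by (rule embed_displacement) (simp_all add: diagsum_last_zero[OF supp sym zero] diagsum_Suc)
  \<comment> \<open>Multiplication by v commutes with \<open>Cm\<close>, so \<Psi> solves the same
    Stein equation as the array P of diagonal sums. Uniqueness identifies them, and the last column
    of P is 0.\<close>
  define \<Psi> where "\<Psi> = Mc v ** Pick u ** transpose (Mc v)"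
  have "\<Psi> = Cm ** \<Psi> ** transpose Cm + (outer v w + outer w v)"
  proof -
    have "\<Psi> = Mc v ** (Cm ** Pick u ** transpose Cm) ** transpose (Mc v) + Mc v ** (outer u e0 + outer e0 u) ** transpose (Mc v)"
      unfolding \<Psi>_def by (subst Pick_displacement) (simp add: matrix_add_ldistrib matrix_add_rdistrib)
    also have "Mc v ** (Cm ** Pick u ** transpose Cm) ** transpose (Mc v) = Cm ** \<Psi> ** transpose Cm"
    proof -
      have c: "Mc v ** Cm = Cm ** Mc v" unfolding Cm_def by (rule Mc_commute)
      have c': "transpose Cm ** transpose (Mc v) = transpose (Mc v) ** transpose Cm"
        using arg_cong[OF c, of transpose] by (simp only: matrix_transpose_mul)
      have "Mc v ** (Cm ** Pick u ** transpose Cm) ** transpose (Mc v)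
          = (Mc v ** Cm) ** Pick u ** (transpose Cm ** transpose (Mc v))" by (simp only: matrix_mul_assoc)
      then show ?thesis unfolding \<Psi>_def c c' by (simp only: matrix_mul_assoc)
    qed
    also have "Mc v ** (outer u e0 + outer e0 u) ** transpose (Mc v) = outer v w + outer w v"
    proof -
      have "Mc v ** outer a b ** transpose (Mc v) = outer (mm v a) (mm v b)" for a b
      proof -
        have "Mc v ** outer a b ** transpose (Mc v) *v x = outer (mm v a) (mm v b) *v x" for x
        proof -
          have "b \<bullet> (transpose (Mc v) *v x) = mm v b \<bullet> x"
            using inner_transpose_vec[of "Mc v" x b] by (simp only: Mc_works inner_commute)
          then show ?thesis
            by (simp only: matrix_vector_mul_assoc[symmetric] outer_mult matrix_vector_mult_scaleR Mc_works)
        qed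
        then show ?thesis using matrix_eq by blast
      qed
      then show ?thesis by (simp add: matrix_add_ldistrib matrix_add_rdistrib w_def mm_commute add.commute)
    qed
    finally show ?thesis .
  qed
  then have \<Psi>P: "\<Psi> = P" using P by (rule stein_unique)
  define k :: "'n option" where "k = idx_inv ?n"
  have k: "idx k = ?n" by (simp add: k_def idx_idx_inv card_option)
  have "P *v axis k 1 = 0"
  proof -
    have "(P *v axis k 1) $ i = P $ i $ k" for i by (simp add: matrix_vector_mul_component inner_axis)
    moreover have "P $ i $ k = 0" for i
      unfolding P_def using diagsum_last_zero(1)[OF supp sym zero, of "idx i"] idx_bound[of i]
      by (simp add: k card_option)
    ultimately show ?thesis by (simp add: vec_eq_iff)
  qed
  then have "axis k 1 \<bullet> (\<Psi> *v axis k 1) = 0" by (simp add: \<Psi>P)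
  then have "(transpose (Mc v) *v axis k 1) \<bullet> (Pick u *v (transpose (Mc v) *v axis k 1)) = 0"
    unfolding \<Psi>_def by (simp only: matrix_vector_mul_assoc[symmetric] inner_transpose_vec)
  then have tv: "transpose (Mc v) *v axis k 1 = 0"
    using pd[unfolded pdef_def, rule_format, of "transpose (Mc v) *v axis k 1"] by (metis less_irrefl)
  have last0: "mm v y $ k = 0" for y
  proof -
    have "mm v y $ k = axis k 1 \<bullet> (Mc v *v y)" by (simp add: Mc_works inner_axis')
    also have "\<dots> = (transpose (Mc v) *v axis k 1) \<bullet> y" by (simp only: inner_transpose_vec)
    finally show ?thesis by (simp only: tv inner_zero_left)
  qed
  show "v = 0"
  proof (rule ccontr)
    assume "v \<noteq> 0"
    define d where "d = degree (vpoly v)"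
    have d: "d \<le> ?n" using degree_vpoly_less[of v] by (simp add: d_def card_option)
    define y :: "real^'n option" where "y = pvec (monom 1 (?n - d))"
    have vy: "vpoly y = monom 1 (?n - d)" unfolding y_def
      by (rule vpoly_pvec) (simp add: degree_monom_eq card_option)
    have "degree (vpoly v * vpoly y) \<le> ?n" unfolding vy
      using degree_mult_le[of "vpoly v" "monom 1 (?n - d)"] d by (simp add: d_def degree_monom_eq)
    then have "vpoly v * vpoly y mod N = vpoly v * vpoly y" by (intro mod_poly_less) (simp add: deg_N)
    then have "mm v y $ k = coeff (monom 1 (?n - d) * vpoly v) ?n"
      by (simp add: mm_def pvec_def k vy mult.commute)
    also have "\<dots> = coeff (vpoly v) d" using d by (simp add: coeff_monom_mult)
    finally show False using last0 \<open>v \<noteq> 0\<close> by (simp add: d_def)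
  qed
qed

end

subsection \<open>The moment map\<close>

lemma cmod_cpoly_vpoly_le:
  fixes u :: "real^'k::{finite,linorder}"
  assumes "cmod z \<le> 1"
  shows "cmod (cpoly (vpoly u) z) \<le> real CARD('k) * norm u"
proof -
  have "cmod (cpoly (vpoly u) z) \<le> (\<Sum>i\<in>UNIV. cmod (of_real (u $ i) * z ^ idx i))"
    unfolding cpoly_vpoly by (rule norm_sum)
  also have "\<dots> \<le> (\<Sum>i\<in>(UNIV::'k set). norm u)"
  proof (rule sum_mono)
    fix i :: 'k
    have "cmod (of_real (u $ i) * z ^ idx i) \<le> \<bar>u $ i\<bar> * 1"
      unfolding norm_mult norm_power using assms by (intro mult_mono power_le_one) auto
    also have "\<dots> \<le> norm u" using component_le_norm_cart[of u i] by simp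
    finally show "cmod (of_real (u $ i) * z ^ idx i) \<le> norm u" .
  qed
  finally show ?thesis by simp
qed

text \<open>By Hurwitz a nonconstant limit of functions without zeros in the open disc has none
  there; a constant limit has the nonzero value that it takes at 1. Zeros on the circle are excluded
  by hypothesis.\<close>

lemma stable_limit:
  fixes V :: "nat \<Rightarrow> real^'n::{finite,linorder} option"
  assumes V: "\<And>n. V n \<in> stable_vecs" "V \<longlonglongrightarrow> v"
    and circ: "\<And>z. cmod z = 1 \<Longrightarrow> cpoly (vpoly v) z \<noteq> 0"
  shows "v \<in> stable_vecs"
proof -
  have "cpoly (vpoly v) z \<noteq> 0" if z: "cmod z < 1" for z
  proof (cases "(\<lambda>z. cpoly (vpoly v) z) constant_on ball 0 1")
    case True
    then obtain c where c: "\<And>z. z \<in> ball 0 1 \<Longrightarrow> cpoly (vpoly v) z = c" unfolding constant_on_def by blast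
    have "cpoly (vpoly v) 1 = c"
    proof (rule continuous_constant_on_closure[of "ball 0 1" "cpoly (vpoly v)"])
      show "continuous_on (closure (ball 0 1)) (cpoly (vpoly v))"
        by (intro continuous_on_cpoly continuous_on_id)
    qed (use c in auto)
    then show ?thesis using circ[of 1] c[of z] z by auto
  next
    case False
    show ?thesis
    proof (rule Hurwitz_no_zeros[of "ball 0 1" "\<lambda>n z. cpoly (vpoly (V n)) z" "\<lambda>z. cpoly (vpoly v) z"])
      fix K :: "complex set" assume "compact K" and K: "K \<subseteq> ball 0 1"
      show "uniform_limit K (\<lambda>n z. cpoly (vpoly (V n)) z) (\<lambda>z. cpoly (vpoly v) z) sequentially"
      proof (rule uniform_limitI)
        fix e :: real assume e: "e > 0"
        let ?C = "real CARD('n option)"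
        have C: "?C > 0" by simp
        obtain M where M: "\<And>n. n \<ge> M \<Longrightarrow> norm (V n - v) < e / ?C"
          using LIMSEQ_D[OF V(2), of "e / ?C"] e C by (metis divide_pos_pos)
        have "dist (cpoly (vpoly (V n)) z) (cpoly (vpoly v) z) < e" if "n \<ge> M" "z \<in> K" for n z
        proof -
          have "cmod (cpoly (vpoly (V n - v)) z) \<le> ?C * norm (V n - v)"
            using K that(2) by (intro cmod_cpoly_vpoly_le) auto
          also have "\<dots> < e" using M[OF that(1)] C by (simp add: field_simps)
          finally show ?thesis by (simp add: vpoly_diff cpoly_diff dist_norm)
        qed
        then show "\<forall>\<^sub>F n in sequentially. \<forall>z\<in>K. dist (cpoly (vpoly (V n)) z) (cpoly (vpoly v) z) < e"
          unfolding eventually_sequentially by blast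
      qed
    qed (use V(1) z False in \<open>auto intro!: holomorphic_intros simp: stable_vecs_iff\<close>)
  qed
  then show ?thesis unfolding stable_vecs_iff using circ by (metis order_le_less)
qed

lemma pdef_iff_sphere: "pdef (A :: real^'k^'k) \<longleftrightarrow> (\<forall>x\<in>sphere 0 1. 0 < x \<bullet> (A *v x))"
proof
  assume s: "\<forall>x\<in>sphere 0 1. 0 < x \<bullet> (A *v x)"
  show "pdef A" unfolding pdef_def
  proof (intro allI impI)
    fix x :: "real^'k" assume x: "x \<noteq> 0"
    let ?u = "inverse (norm x) *\<^sub>R x"
    have "?u \<in> sphere 0 1" using x by simp
    then have "0 < ?u \<bullet> (A *v ?u)" using s by blast
    also have "\<dots> = inverse (norm x) * (inverse (norm x) * (x \<bullet> (A *v x)))"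
      by (simp add: matrix_vector_mult_scaleR)
    finally show "0 < x \<bullet> (A *v x)" using x by (simp add: zero_less_mult_iff)
  qed
next
  assume "pdef A"
  moreover have "x \<noteq> 0" if "x \<in> sphere 0 1" for x :: "real^'k" using that by auto
  ultimately show "\<forall>x\<in>sphere 0 1. 0 < x \<bullet> (A *v x)" unfolding pdef_def by blast
qed

context stable_modulus
begin

text \<open>The polynomial b_* forced by the interpolation conditions when v is a_*, both up to a
  common scalar.\<close>

definition beta :: "'n rvec \<Rightarrow> real^'n option \<Rightarrow> real^'n option" where
  "beta c v = 2 *\<^sub>R mm (bord (1/2) c) v"

definition Wset :: "('n rvec) set" where
  "Wset = {c. pdef (Pick (bord (1/2) c))}"

text \<open>The parameter c is carried along as a second component: source and target are open sets
  of equal dimension, so invariance of domain yields continuity jointly in c.\<close>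

definition moment :: "(real^'n option) \<times> ('n rvec) \<Rightarrow> (real^'n option) \<times> ('n rvec)" where
  "moment = (\<lambda>(v, c). (acorr v (beta c v), c))"

text \<open>The map is even in v, so a sign has to be fixed; the constant coefficient is nonzero by
  stability. The scale of v stays free and encodes \<rho>.\<close>

definition Om :: "((real^'n option) \<times> ('n rvec)) set" where
  "Om = {(v, c). v \<in> stable_vecs \<and> 0 < v $ None \<and> acorr v (beta c v) \<in> pos_trig \<and> c \<in> Wset}"

lemma beta_None: "beta c v $ None = v $ None"
  by (simp add: beta_def mm_None)

lemmas mm_scaleR_right = bounded_bilinear.scaleR_right[OF bounded_bilinear_mm]
lemmas mm_add_right = bounded_bilinear.add_right[OF bounded_bilinear_mm]

lemma Pick_quad_mm: "x \<bullet> (Pick u *v x) = 2 * (x \<bullet> mm u (Eh *v x))"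
  unfolding Pick_quad inner_transpose_vec Mc_works ..

lemma continuous_bord [continuous_intros]: "continuous_on S f \<Longrightarrow> continuous_on S (\<lambda>x. bord r (f x :: 'n rvec))"
  using bounded_linear.continuous_on[of "bord 0" S f] linear_bord_0
  by (subst bord_split) (auto intro!: continuous_intros simp: linear_conv_bounded_linear)

lemma continuous_mm [continuous_intros]:
  "continuous_on S f \<Longrightarrow> continuous_on S g \<Longrightarrow> continuous_on S (\<lambda>x. mm (f x) (g x))"
  by (rule bounded_bilinear.continuous_on[OF bounded_bilinear_mm])

lemma continuous_acorr [continuous_intros]:
  "continuous_on S f \<Longrightarrow> continuous_on S g \<Longrightarrow> continuous_on S (\<lambda>x. acorr (f x) (g x :: real^'n option))"
  by (rule bounded_bilinear.continuous_on[OF bounded_bilinear_acorr])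

lemma continuous_beta [continuous_intros]:
  "continuous_on S f \<Longrightarrow> continuous_on S g \<Longrightarrow> continuous_on S (\<lambda>x. beta (f x) (g x))"
  unfolding beta_def by (intro continuous_intros)

lemma open_Wset: "open Wset"
proof -
  have "Wset = {c. \<forall>x\<in>sphere 0 1. 0 < 2 * (x \<bullet> mm (bord (1/2) c) (Eh *v x))}"
    by (simp add: Wset_def pdef_iff_sphere Pick_quad_mm)
  also have "open \<dots>"
    by (intro open_forall_compact_pos)
       (auto simp: case_prod_unfold intro!: continuous_intros matrix_vector_mult_linear_continuous_on[THEN continuous_on_compose2])
  finally show ?thesis .
qed

lemma convex_Wset: "convex Wset"
proof (rule convexI)
  fix x y :: "'n rvec" and u v :: real
  assume xy: "x \<in> Wset" "y \<in> Wset" and uv: "0 \<le> u" "0 \<le> v" "u + v = 1"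
  have b: "bord (1/2) (u *\<^sub>R x + v *\<^sub>R y) = u *\<^sub>R bord (1/2) x + v *\<^sub>R bord (1/2) y"
    using uv by (simp add: bord_scaleR bord_add flip: distrib_right add_divide_distrib)
  have "0 < u * (w \<bullet> (Pick (bord (1/2) x) *v w)) + v * (w \<bullet> (Pick (bord (1/2) y) *v w))" if "w \<noteq> 0" for w
  proof (cases "u = 0")
    case False
    then show ?thesis using xy uv that by (intro add_pos_nonneg) (auto simp: Wset_def pdef_def less_imp_le)
  qed (use xy uv that in \<open>auto simp: Wset_def pdef_def\<close>)
  then show "u *\<^sub>R x + v *\<^sub>R y \<in> Wset"
    unfolding Wset_def pdef_def mem_Collect_eq b Pick_add Pick_scaleR
    by (simp only: matrix_vector_mult_add_rdistrib scaleR_matrix_vector_assoc[symmetric] inner_add_right inner_scaleR_right) blast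
qed

lemma continuous_moment: "continuous_on S moment"
  unfolding moment_def case_prod_unfold by (intro continuous_intros)

lemma open_Om: "open Om"
proof -
  have "Om = ((stable_vecs \<inter> {v. 0 < v $ None}) \<times> Wset) \<inter> moment -` (pos_trig \<times> UNIV)"
    by (auto simp: Om_def moment_def)
  moreover have "open ((stable_vecs \<inter> {v :: real^'n option. 0 < v $ None}) \<times> Wset)"
    by (intro open_Times open_Int open_stable_vecs open_Wset open_Collect_less continuous_intros)
  moreover have "open (moment -` (pos_trig \<times> UNIV))"
    by (intro open_vimage open_Times open_pos_trig open_UNIV continuous_moment)
  ultimately show ?thesis by (simp only: open_Int)
qed

lemma vpoly_beta_cong: "N dvd vpoly (beta c v) * vpoly w - vpoly (beta c w) * vpoly v"
proof -
  have m: "vpoly (beta c x) * vpoly y mod N = smult 2 (vpoly (bord (1/2) c) * (vpoly x * vpoly y) mod N)" for x y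
    by (simp add: beta_def vpoly_scaleR vpoly_mm mod_smult_left mod_mult_left_eq mult.assoc)
  show ?thesis unfolding mod_eq_dvd_iff[symmetric] m by (simp only: mult.commute)
qed

text \<open>Instance of \<open>interpolant_unique\<close>: both pairs interpolate the same c, which
  gives the divisibility, and equal autocorrelations give equal real parts on the circle.\<close>

lemma inj_on_moment: "inj_on moment Om"
proof (rule inj_onI, clarsimp simp: moment_def)
  fix v w c assume vc: "(v, c) \<in> Om" and wc: "(w, c) \<in> Om" and eq: "acorr v (beta c v) = acorr w (beta c w)"
  have z0: "coeff (vpoly x) 0 = x $ None" for x :: "real^'n option"
    using coeff_vpoly_idx[of x None] by simp
  have "vpoly v = vpoly w"
  proof (rule interpolant_unique[OF N_nz root_N deg_vpoly_N deg_vpoly_N])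
    show "N dvd vpoly (beta c v) * vpoly w - vpoly (beta c w) * vpoly v" by (rule vpoly_beta_cong)
    show "Re (cpoly (vpoly (beta c v)) z * cnj (cpoly (vpoly v) z)) = Re (cpoly (vpoly (beta c w)) z * cnj (cpoly (vpoly w) z))"
      if "cmod z = 1" for z
      using trig_acorr[OF that, of "beta c v" v] trig_acorr[OF that, of "beta c w" w] unfolding eq by linarith
    show "0 < Re (cpoly (vpoly (beta c v)) z * cnj (cpoly (vpoly v) z))" if "cmod z = 1" for z
      using trig_acorr[OF that, of "beta c v" v] vc that by (force simp: Om_def pos_trig_def)
  qed (use vc wc in \<open>auto simp: Om_def stable_vecs_iff z0\<close>)
  then show "v = w" by (simp add: vpoly_inject)
qed

lemma acorr_beta_scale: "acorr (r *\<^sub>R v) (beta c (r *\<^sub>R v)) = r\<^sup>2 *\<^sub>R acorr v (beta c v)"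
  by (simp add: beta_def mm_scaleR_right bounded_bilinear.scaleR_left[OF bounded_bilinear_acorr]
      bounded_bilinear.scaleR_right[OF bounded_bilinear_acorr] power2_eq_square)

lemma coercive:
  assumes "c \<in> Wset" "acorr v (beta c v) = 0"
  shows "v = 0"
  using assms pick_coercive[of "bord (1/2) c" v]
  by (simp add: Wset_def beta_def bounded_bilinear.scaleR_right[OF bounded_bilinear_acorr])

text \<open>Properness. Coercivity bounds the preimages, a subsequence converges, and the limit
  stays in \<open>Om\<close>: since d is positive on the circle, the limit polynomial has no zeros
  there and \<open>stable_limit\<close> applies.\<close>

lemma moment_image_closed:
  assumes dc: "(d, c) \<in> closure (moment ` Om)" "d \<in> pos_trig" "c \<in> Wset"
  shows "(d, c) \<in> moment ` Om"
proof -
  obtain Y where Y: "\<And>n. Y n \<in> moment ` Om" "Y \<longlonglongrightarrow> (d, c)"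
    using dc(1) unfolding closure_sequential by blast
  have "\<exists>x. x \<in> Om \<and> Y n = moment x" for n using Y(1)[of n] by blast
  then obtain X where X: "\<And>n. X n \<in> Om" "\<And>n. Y n = moment (X n)" by metis
  define V C where "V n = fst (X n)" and "C n = snd (X n)" for n
  have VC: "(V n, C n) \<in> Om" "Y n = (acorr (V n) (beta (C n) (V n)), C n)" for n
    using X(1)[of n] X(2)[of n] by (auto simp: V_def C_def moment_def case_prod_unfold)
  have Clim: "C \<longlonglongrightarrow> c" using tendsto_snd[OF Y(2)] VC(2) by simp
  have Dlim: "(\<lambda>n. acorr (V n) (beta (C n) (V n))) \<longlonglongrightarrow> d" using tendsto_fst[OF Y(2)] VC(2) by simp
  \<comment> \<open>A compact set of parameters inside \<open>Wset\<close>, so that the lower bound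
    m below is uniform along the sequence.\<close>
  define K where "K = insert c (range C)"
  have K: "compact K" unfolding K_def using Clim by (rule compact_sequence_with_limit)
  have KW: "K \<subseteq> Wset" using dc(3) VC(1) by (auto simp: K_def Om_def)
  let ?f = "\<lambda>(v, c). norm (acorr v (beta c v))"
  have "continuous_on (sphere 0 1 \<times> K) ?f"
    unfolding case_prod_unfold by (intro continuous_intros)
  moreover have "compact (sphere (0::real^'n option) 1 \<times> K)" using K by (intro compact_Times compact_sphere)
  moreover have "sphere (0::real^'n option) 1 \<times> K \<noteq> {}" by (auto simp: K_def)
  ultimately obtain x0 where x0: "x0 \<in> sphere (0::real^'n option) 1 \<times> K"
    "\<And>x. x \<in> sphere (0::real^'n option) 1 \<times> K \<Longrightarrow> ?f x0 \<le> ?f x"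
    using continuous_attains_inf[of "sphere (0::real^'n option) 1 \<times> K" ?f] by blast
  define m where "m = ?f x0"
  have m: "m > 0"
  proof -
    have "acorr (fst x0) (beta (snd x0) (fst x0)) \<noteq> 0"
    proof
      assume a: "acorr (fst x0) (beta (snd x0) (fst x0)) = 0"
      have "snd x0 \<in> Wset" using x0(1) KW by auto
      from coercive[OF this a] show False using x0(1) by auto
    qed
    then show ?thesis by (simp add: m_def case_prod_unfold)
  qed
  \<comment> \<open>Both sides are homogeneous of degree 2 in v, so the bound on the unit sphere
    extends to all v.\<close>
  have low: "m * (norm (V n))\<^sup>2 \<le> norm (acorr (V n) (beta (C n) (V n)))" for n
  proof (cases "V n = 0")
    case False
    let ?u = "inverse (norm (V n)) *\<^sub>R V n"
    have V: "V n = norm (V n) *\<^sub>R ?u" using False by simp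
    have "m \<le> norm (acorr ?u (beta (C n) ?u))"
      using x0(2)[of "(?u, C n)"] False by (simp add: m_def K_def)
    then have "(norm (V n))\<^sup>2 * m \<le> (norm (V n))\<^sup>2 * norm (acorr ?u (beta (C n) ?u))"
      by (intro mult_left_mono) auto
    also have "\<dots> = norm (acorr (norm (V n) *\<^sub>R ?u) (beta (C n) (norm (V n) *\<^sub>R ?u)))"
      unfolding acorr_beta_scale by simp
    finally show ?thesis unfolding V[symmetric] by (simp add: mult.commute)
  qed simp
  obtain B where B: "\<And>n. norm (acorr (V n) (beta (C n) (V n))) \<le> B"
    using convergent_imp_Bseq[OF convergentI[OF Dlim]] unfolding Bseq_def by blast
  have "norm (V n) \<le> B / m + 1" for n
  proof -
    have "(norm (V n))\<^sup>2 \<le> B / m" using order_trans[OF low[of n] B[of n]] m by (simp add: field_simps)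
    moreover have "norm (V n) \<le> (norm (V n))\<^sup>2 + 1"
      using zero_le_power2[of "norm (V n) - 1/2"] by (simp add: power2_diff) (simp add: power2_eq_square)
    ultimately show ?thesis by linarith
  qed
  then have "\<forall>n. V n \<in> cball 0 (B / m + 1)" by simp
  then obtain v r where r: "strict_mono r" "(V \<circ> r) \<longlonglongrightarrow> v"
    using compact_cball[of "0::real^'n option" "B / m + 1"] unfolding compact_def by blast
  have Cr: "(C \<circ> r) \<longlonglongrightarrow> c" by (rule LIMSEQ_subseq_LIMSEQ[OF Clim r(1)])
  have "(\<lambda>n. (V (r n), C (r n))) \<longlonglongrightarrow> (v, c)"
    using r(2) Cr by (intro tendsto_Pair) (auto simp: o_def)
  then have "(\<lambda>n. moment (V (r n), C (r n))) \<longlonglongrightarrow> moment (v, c)"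
    using continuous_on_tendsto_compose[OF continuous_moment[of UNIV]] by auto
  moreover have "(\<lambda>n. moment (V (r n), C (r n))) \<longlonglongrightarrow> (d, c)"
    using LIMSEQ_subseq_LIMSEQ[OF Y(2) r(1)] VC(2) by (simp add: o_def moment_def)
  ultimately have eq: "moment (v, c) = (d, c)" using LIMSEQ_unique by blast
  then have ac: "acorr v (beta c v) = d" by (simp add: moment_def)
  have st: "v \<in> stable_vecs"
  proof (rule stable_limit[OF _ r(2)])
    show "(V \<circ> r) n \<in> stable_vecs" for n using VC(1) by (simp add: Om_def)
    show "cpoly (vpoly v) z \<noteq> 0" if "cmod z = 1" for z
      using trig_acorr[OF that, of "beta c v" v] dc(2) that by (force simp: ac pos_trig_def)
  qed
  have "(\<lambda>n. V (r n) $ None) \<longlonglongrightarrow> v $ None" using tendsto_vec_nth[OF r(2)] by (simp add: o_def)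
  then have "0 \<le> v $ None"
    by (rule LIMSEQ_le_const) (use VC(1) in \<open>auto simp: Om_def intro: less_imp_le\<close>)
  moreover have "v $ None \<noteq> 0"
    using st[unfolded stable_vecs_iff, rule_format, of 0] coeff_vpoly_idx[of v None] by simp
  ultimately have "(v, c) \<in> Om" using st dc(2,3) by (simp add: Om_def ac)
  then show ?thesis using eq by force
qed

lemma moment_image: "moment ` Om = pos_trig \<times> Wset"
proof -
  let ?Y = "pos_trig \<times> Wset :: ((real^'n option) \<times> ('n rvec)) set"
  have sub: "moment ` Om \<subseteq> ?Y" by (auto simp: moment_def Om_def)
  have "connected ?Y" by (intro convex_connected convex_Times convex_pos_trig convex_Wset)
  moreover have "openin (top_of_set ?Y) (moment ` Om)"
    by (rule open_openin_trans[OF open_Times[OF open_pos_trig open_Wset]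
         invariance_of_domain[OF continuous_moment open_Om inj_on_moment] sub])
  moreover have "closedin (top_of_set ?Y) (moment ` Om)"
  proof -
    have "moment ` Om = ?Y \<inter> closure (moment ` Om)"
      using sub moment_image_closed closure_subset by fast
    then show ?thesis unfolding closedin_closed by (intro exI[of _ "closure (moment ` Om)"]) simp
  qed
  moreover have "moment ` Om \<noteq> {}"
  proof -
    have b: "bord (1/2) 0 = (1/2) *\<^sub>R e0"
      by (rule bord_eqI[symmetric]) (simp_all add: e0_eq axis_def)
    have be: "beta 0 e0 = e0" by (simp add: beta_def b bounded_bilinear.scaleR_left[OF bounded_bilinear_mm])
    \<comment> \<open>v = 1 with the constant interpolant 1/2: here \<open>beta\<close> fixes v, and
      the Pick matrix is \<open>Eh\<close>, which is positive definite.\<close>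
    have "(e0, 0) \<in> Om"
    proof -
      have "Pick (bord (1/2) 0) = Eh"
        unfolding b Pick_scaleR by (simp add: Pick_def Mc_e0 transpose_mat flip: scaleR_2)
      then have "0 \<in> Wset" by (simp add: Wset_def pdef_Eh)
      moreover have "0 < trig (acorr e0 (beta 0 e0)) z" if "cmod z = 1" for z
        using trig_acorr[OF that, of "beta 0 e0" e0] by (simp add: be vpoly_e0)
      ultimately show ?thesis by (simp add: Om_def stable_vecs_iff vpoly_e0 pos_trig_def e0_eq[THEN arg_cong[of _ _ "\<lambda>x. x $ None"]] axis_def)
    qed
    then show ?thesis by blast
  qed
  ultimately show ?thesis unfolding connected_clopen by blast
qed

section \<open>The differential of the moment map and the smoothness of its inverse\<close>

definition jac :: "'n rvec \<Rightarrow> real^'n option \<Rightarrow> real^'n option \<Rightarrow> real^'n option" where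
  "jac c v x = acorr x (beta c v) + acorr v (beta c x)"

definition jac_c :: "real^'n option \<Rightarrow> 'n rvec \<Rightarrow> real^'n option" where
  "jac_c v y = acorr v (2 *\<^sub>R mm (bord 0 y) v)"

lemma beta_add: "beta c (v + w) = beta c v + beta c w"
  by (simp add: beta_def mm_add_right scaleR_add_right)

lemma beta_scaleR: "beta c (r *\<^sub>R v) = r *\<^sub>R beta c v"
  by (simp add: beta_def mm_scaleR_right)

lemmas acorr_add_left = bounded_bilinear.add_left[OF bounded_bilinear_acorr]
lemmas acorr_add_right = bounded_bilinear.add_right[OF bounded_bilinear_acorr]
lemmas acorr_scaleR_left = bounded_bilinear.scaleR_left[OF bounded_bilinear_acorr]
lemmas acorr_scaleR_right = bounded_bilinear.scaleR_right[OF bounded_bilinear_acorr]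

lemma linear_jac: "linear (jac c v)"
  by (intro linearI)
     (simp_all add: jac_def beta_add beta_scaleR acorr_add_left acorr_add_right acorr_scaleR_left
       acorr_scaleR_right scaleR_add_right)

text \<open>
  The moment map is quadratic in its first argument, so a kernel vector \<open>x\<close> of the
  differential at \<open>v\<close> would give \<open>v + t x\<close> and \<open>v - t x\<close> the same image.
\<close>

lemma jac_inj:
  assumes vc: "(v, c) \<in> Om" and x: "jac c v x = 0"
  shows "x = 0"
proof -
  have cont: "(\<lambda>t. (v + t *\<^sub>R x, c)) \<midarrow>0\<rightarrow> (v + 0 *\<^sub>R x, c)" "(\<lambda>t. (v - t *\<^sub>R x, c)) \<midarrow>0\<rightarrow> (v - 0 *\<^sub>R x, c)"
    by (intro tendsto_intros)+
  have "\<forall>\<^sub>F t in at (0::real). (v + t *\<^sub>R x, c) \<in> Om" "\<forall>\<^sub>F t in at (0::real). (v - t *\<^sub>R x, c) \<in> Om"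
    using vc by (auto intro!: topological_tendstoD[OF cont(1) open_Om] topological_tendstoD[OF cont(2) open_Om])
  then have "\<forall>\<^sub>F t in at (0::real). (v + t *\<^sub>R x, c) \<in> Om \<and> (v - t *\<^sub>R x, c) \<in> Om \<and> t \<noteq> 0"
  proof (intro eventually_conj)
    show "\<forall>\<^sub>F t in at (0::real). t \<noteq> 0" by (simp add: eventually_at_filter)
  qed
  then obtain t :: real where t: "(v + t *\<^sub>R x, c) \<in> Om" "(v - t *\<^sub>R x, c) \<in> Om" "t \<noteq> 0"
    using eventually_happens'[OF at_neq_bot] by blast
  have ex: "acorr (v + s *\<^sub>R x) (beta c (v + s *\<^sub>R x)) = acorr v (beta c v) + s\<^sup>2 *\<^sub>R acorr x (beta c x)" for s
  proof -
    have "acorr (v + s *\<^sub>R x) (beta c (v + s *\<^sub>R x)) = acorr v (beta c v) + s *\<^sub>R jac c v x + s\<^sup>2 *\<^sub>R acorr x (beta c x)"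
      by (simp add: jac_def beta_add beta_scaleR acorr_add_left acorr_add_right acorr_scaleR_left
          acorr_scaleR_right scaleR_add_right power2_eq_square)
    then show ?thesis by (simp add: x)
  qed
  have "moment (v + t *\<^sub>R x, c) = moment (v - t *\<^sub>R x, c)"
    using ex[of t] ex[of "- t"] by (simp add: moment_def)
  then have "v + t *\<^sub>R x = v - t *\<^sub>R x" using inj_onD[OF inj_on_moment _ t(1,2)] by simp
  then have "t *\<^sub>R x + t *\<^sub>R x = 0" by (metis add.assoc add_cancel_left_right diff_add_cancel)
  then have "(t + t) *\<^sub>R x = 0" by (simp only: scaleR_add_left)
  then show ?thesis using t(3) by simp
qed

lemma moment_has_derivative:
  "(moment has_derivative (\<lambda>(x, y). (jac c v x + jac_c v y, y))) (at (v, c))"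
proof -
  have bb: "bounded_linear (\<lambda>p. bord 0 (snd p) :: real^'n option)" for p :: "(real^'n option) \<times> 'n rvec"
    using linear_bord_0 by (intro bounded_linear_compose[OF _ bounded_linear_snd]) (simp add: linear_conv_bounded_linear)
  have b: "((\<lambda>p. bord (1/2) (snd p)) has_derivative (\<lambda>p. bord 0 (snd p))) (at (v, c))"
    using has_derivative_add[OF has_derivative_const bounded_linear_imp_has_derivative[OF bb], of "bord (1/2) 0"]
    by (subst bord_split) simp
  have be: "((\<lambda>p. beta (snd p) (fst p)) has_derivative
      (\<lambda>p. 2 *\<^sub>R (mm (bord (1/2) c) (fst p) + mm (bord 0 (snd p)) v))) (at (v, c))"
    unfolding beta_def
    using bounded_bilinear.FDERIV[OF bounded_bilinear_mm b has_derivative_fst[OF has_derivative_ident]]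
    by (intro has_derivative_scaleR_right) simp
  have "((\<lambda>p. acorr (fst p) (beta (snd p) (fst p))) has_derivative
      (\<lambda>p. jac c v (fst p) + jac_c v (snd p))) (at (v, c))"
    using bounded_bilinear.FDERIV[OF bounded_bilinear_acorr has_derivative_fst[OF has_derivative_ident] be]
    by (rule has_derivative_eq_rhs)
       (simp add: fun_eq_iff jac_def jac_c_def beta_def scaleR_add_right acorr_add_right algebra_simps)
  from has_derivative_Pair[OF this has_derivative_snd[OF has_derivative_ident]] show ?thesis
    by (simp add: moment_def case_prod_unfold)
qed

definition sol :: "real^'n option \<Rightarrow> 'n rvec \<Rightarrow> real^'n option" where
  "sol d c = fst (inv_into Om moment (d, c))"

lemma sol:
  assumes "d \<in> pos_trig" "c \<in> Wset"
  shows "inv_into Om moment (d, c) = (sol d c, c)" "(sol d c, c) \<in> Om" "acorr (sol d c) (beta c (sol d c)) = d"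
proof -
  have "(d, c) \<in> moment ` Om" using assms by (simp add: moment_image)
  then have i: "inv_into Om moment (d, c) \<in> Om" "moment (inv_into Om moment (d, c)) = (d, c)"
    by (auto intro: inv_into_into f_inv_into_f)
  then show 1: "inv_into Om moment (d, c) = (sol d c, c)"
    by (cases "inv_into Om moment (d, c)") (auto simp: moment_def sol_def)
  show "(sol d c, c) \<in> Om" "acorr (sol d c) (beta c (sol d c)) = d" using i unfolding 1 by (auto simp: moment_def)
qed

lemma sol_unique:
  assumes "(v, c) \<in> Om" "acorr v (beta c v) = d"
  shows "v = sol d c"
proof -
  have d: "d \<in> pos_trig" "c \<in> Wset" using assms by (auto simp: Om_def)
  have "moment (v, c) = moment (sol d c, c)" using sol(3)[OF d] assms(2) by (simp add: moment_def)
  then show ?thesis using inj_onD[OF inj_on_moment _ assms(1) sol(2)[OF d]] by simp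
qed

text \<open>The differential of \<open>moment\<close> is block triangular with the identity in the
  c-block, so injectivity of \<open>jac\<close> makes it invertible; the inverse map is continuous
  by invariance of domain, hence differentiable. The linear equation for f' is recorded because
  Cramer's rule will be applied to it.\<close>

lemma sol_has_derivative:
  assumes "d \<in> pos_trig" "c \<in> Wset"
  shows "\<exists>f'. (sol d has_derivative f') (at c) \<and> (\<forall>y. jac c (sol d c) (f' y) = - jac_c (sol d c) y)"
proof -
  let ?g = "inv_into Om moment" and ?Y = "pos_trig \<times> Wset :: ((real^'n option) \<times> 'n rvec) set"
  let ?D = "\<lambda>(x, y). (jac c (sol d c) x + jac_c (sol d c) y, y)"
  have Y: "open ?Y" by (intro open_Times open_pos_trig open_Wset)
  have g: "?g (d, c) = (sol d c, c)" by (rule sol(1)[OF assms])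
  have D: "(moment has_derivative ?D) (at (?g (d, c)))" unfolding g by (rule moment_has_derivative)
  then have lin: "linear ?D" by (intro bounded_linear.linear has_derivative_bounded_linear)
  have "inj ?D" unfolding linear_injective_0[OF lin]
  proof (intro allI impI)
    fix p assume p: "?D p = 0"
    obtain x y where xy: "p = (x, y)" by (cases p)
    have "jac_c (sol d c) 0 = 0"
      by (simp add: jac_c_def linear_0[OF linear_bord_0] bounded_bilinear.zero_left[OF bounded_bilinear_mm]
          bounded_bilinear.zero_right[OF bounded_bilinear_acorr])
    then show "p = 0" using jac_inj[OF sol(2)[OF assms]] p by (auto simp: xy zero_prod_def)
  qed
  then obtain g' where g': "linear g'" "g' \<circ> ?D = id" using linear_injective_left_inverse[OF lin] by blast
  have Dg: "?D \<circ> g' = id" using linear_inverse_left[OF lin g'(1)] g'(2) by blast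
  obtain h where h: "homeomorphism Om (moment ` Om) moment h"
    using invariance_of_domain_homeomorphism[OF open_Om continuous_moment _ inj_on_moment] by blast
  have "continuous_on ?Y ?g"
  proof (rule continuous_on_eq)
    show "continuous_on ?Y h" using h by (simp add: homeomorphism_def moment_image)
    show "h x = ?g x" if "x \<in> ?Y" for x
    proof -
      have "x \<in> moment ` Om" using that by (simp add: moment_image)
      then have "h x \<in> Om" "moment (h x) = x" using h by (auto simp: homeomorphism_def)
      then show ?thesis using inv_into_f_f[OF inj_on_moment] by metis
    qed
  qed
  then have cont: "isCont ?g (d, c)" using Y assms by (simp add: continuous_on_eq_continuous_at)
  have G: "(?g has_derivative g') (at (d, c))"
  proof (intro has_derivative_inverse_basic[where f=moment and g="?g" and y="(d, c)" and T="?Y" and f'="?D" and g'=g'])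
    show "bounded_linear g'" using g'(1) by (simp add: linear_conv_bounded_linear)
    show "(d, c) \<in> ?Y" using assms by simp
    show "moment (?g x) = x" if "x \<in> ?Y" for x
      using that by (intro f_inv_into_f) (simp only: moment_image)
  qed (fact D g'(2) Y cont)+
  have "((\<lambda>c. (d, c)) has_derivative (\<lambda>y. (0, y))) (at c)"
    by (auto intro!: derivative_eq_intros)
  from has_derivative_fst[OF has_derivative_compose[OF this G]]
  have "((\<lambda>c. fst (?g (d, c))) has_derivative (\<lambda>y. fst (g' (0, y)))) (at c)" .
  moreover have "jac c (sol d c) (fst (g' (0, y))) = - jac_c (sol d c) y" for y
  proof -
    have "?D (g' (0, y)) = (0, y)" using fun_cong[OF Dg, of "(0, y)"] by simp
    then show ?thesis by (cases "g' (0, y)") (auto simp: add_eq_0_iff)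
  qed
  ultimately show ?thesis unfolding sol_def[abs_def] by (intro exI[of _ "\<lambda>y. fst (g' (0, y))"]) auto
qed

lemma vec_rpf_beta:
  fixes f :: "'b::euclidean_space \<Rightarrow> 'n rvec"
  assumes "linear f" "vec_rpf g"
  shows "vec_rpf (\<lambda>x. beta (f x) (g x))"
proof -
  have "vec_rpf (\<lambda>x. bord (1/2) 0 + bord 0 (f x))"
    by (intro vec_rpf_add vec_rpf_const vec_rpf_linear linear_compose[OF assms(1) linear_bord_0, unfolded o_def])
  then show ?thesis unfolding beta_def
    by (subst bord_split) (intro vec_rpf_scaleR vec_rpf_bilinear[OF bounded_bilinear_mm] assms)
qed

lemma Ck_on_sol:
  fixes p :: "(real^'n option) \<times> 'n rvec \<Rightarrow> real"
  assumes d: "d \<in> pos_trig" and p: "rat_on ((\<lambda>c. (sol d c, c)) ` Wset) p"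
  shows "Ck_on k Wset (\<lambda>c. p (sol d c, c))"
proof -
  let ?G = "\<lambda>c. (sol d c, c)"
  obtain f' where f': "\<And>c. c \<in> Wset \<Longrightarrow> (sol d has_derivative f' c) (at c)"
    "\<And>c y. c \<in> Wset \<Longrightarrow> jac c (sol d c) (f' c y) = - jac_c (sol d c) y"
    using sol_has_derivative[OF d] by metis
  have fst_snd: "vec_rpf (fst :: (real^'n option) \<times> 'n rvec \<Rightarrow> _)" "linear (snd :: (real^'n option) \<times> 'n rvec \<Rightarrow> _)"
    by (auto intro!: vec_rpf_linear bounded_linear.linear bounded_linear_fst bounded_linear_snd)
  have jac_rpf: "vec_rpf (\<lambda>x :: (real^'n option) \<times> 'n rvec. jac (snd x) (fst x) y)" for y
    unfolding jac_def
    by (intro vec_rpf_add vec_rpf_bilinear[OF bounded_bilinear_acorr] vec_rpf_const vec_rpf_beta fst_snd)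
  have jac_c_rpf: "vec_rpf (\<lambda>x :: (real^'n option) \<times> 'n rvec. (-1) *\<^sub>R jac_c (fst x) y)" for y
    unfolding jac_c_def
    by (intro vec_rpf_scaleR vec_rpf_bilinear[OF bounded_bilinear_acorr] vec_rpf_bilinear[OF bounded_bilinear_mm] vec_rpf_const fst_snd)
  have comp: "rat_on (?G ` Wset) (\<lambda>x. f' (snd x) y $ i)" for y i
  proof (rule rat_on_solve[where A="\<lambda>x. matrix (jac (snd x) (fst x))" and b="\<lambda>x. (-1) *\<^sub>R jac_c (fst x) y"])
    show "rat_on (?G ` Wset) (\<lambda>x. matrix (jac (snd x) (fst x)) $ i $ j)" for i j
      using jac_rpf[of "axis j 1"] by (simp add: matrix_def vec_rpf_def rat_on_rpf)
    show "rat_on (?G ` Wset) (\<lambda>x. ((-1) *\<^sub>R jac_c (fst x) y) $ i)" for i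
      using jac_c_rpf[of y] unfolding vec_rpf_def by (intro rat_on_rpf) blast
    have works: "matrix (jac c v) *v x = jac c v x" for c v x
      using matrix_works[of "jac c v"] linear_jac by (simp only: linear_matrix_vector_mul_eq)
    fix x assume "x \<in> ?G ` Wset"
    then obtain c where c: "c \<in> Wset" "x = ?G c" by blast
    show "det (matrix (jac (snd x) (fst x))) \<noteq> 0"
      unfolding det_eq_0_iff_kernel works using jac_inj[OF sol(2)[OF d c(1)]] c(2) by auto
    show "matrix (jac (snd x) (fst x)) *v f' (snd x) y = (-1) *\<^sub>R jac_c (fst x) y"
      unfolding works using f'(2)[OF c(1)] c(2) by simp
  qed
  show ?thesis
  proof (rule Ck_on_rational_graph[OF open_Wset, where G="?G" and G'="\<lambda>c y. (f' c y, y)" and R=p])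
    show "(?G has_derivative (\<lambda>y. (f' c y, y))) (at c)" if "c \<in> Wset" for c
      by (intro has_derivative_Pair f' that has_derivative_ident)
    show "rat_on (?G ` Wset) p" by (rule p)
    fix y :: "'n rvec" and b :: "(real^'n option) \<times> 'n rvec" assume "b \<in> Basis"
    then consider i where "b = (axis i 1, 0)" | e where "b = (0, e)"
      by (auto simp: Basis_prod_def Basis_vec_def)
    then show "\<exists>R. rat_on (?G ` Wset) R \<and> (\<forall>x\<in>Wset. (f' x y, y) \<bullet> b = R (?G x))"
    proof cases
      case 1
      then show ?thesis using comp[of y] by (intro exI[of _ "\<lambda>x. f' (snd x) y $ i"]) (simp add: inner_axis)
    next
      case 2
      then show ?thesis by (intro exI[of _ "\<lambda>_. y \<bullet> e"]) (simp add: rat_on_const)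
    qed
  qed
qed

end

subsection \<open>The covariance extension equation in coordinates\<close>

text \<open>Coordinates by natural position, extended by 0. The 0 one step beyond the last position
  is what the shift \<open>J_mat\<close> produces there; \<open>qn\<close> does the same for
  matrices.\<close>

definition nx :: "'n::{finite,linorder} rvec \<Rightarrow> nat \<Rightarrow> real" where
  "nx y k = (if k < CARD('n) then y $ idx_inv k else 0)"

definition qn :: "'n::{finite,linorder} rmat \<Rightarrow> nat \<Rightarrow> nat \<Rightarrow> real" where
  "qn P i j = (if i < CARD('n) \<and> j < CARD('n) then P $ idx_inv i $ idx_inv j else 0)"

lemma nx_idx [simp]: "nx y (idx i) = y $ i"
  by (simp add: nx_def idx_bound)

lemma qn_idx [simp]: "qn P (idx i) (idx j) = P $ i $ j"
  by (simp add: qn_def idx_bound)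

lemma qn_ge: "CARD('n) \<le> i \<or> CARD('n) \<le> j \<Longrightarrow> qn (P :: 'n::{finite,linorder} rmat) i j = 0"
  by (auto simp: qn_def)

lemma nx_ge: "CARD('n) \<le> i \<Longrightarrow> nx (y :: 'n::{finite,linorder} rvec) i = 0"
  by (auto simp: nx_def)

lemma exists_idx: "k < CARD('n) \<Longrightarrow> \<exists>i::'n::{finite,linorder}. idx i = k"
  using idx_idx_inv by blast

lemma sum_idx_eq:
  "(\<Sum>j\<in>UNIV. (if idx j = k then 1 else 0) * y $ j) = nx (y :: 'n::{finite,linorder} rvec) k"
proof (cases "k < CARD('n)")
  case True
  then obtain i :: 'n where i: "idx i = k" using exists_idx by blast
  have "(\<Sum>j\<in>UNIV. (if idx j = idx i then 1 else 0) * y $ j) = (\<Sum>j\<in>{i}. y $ j)"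
    by (rule sum.mono_neutral_cong_right) auto
  then show ?thesis using i by auto
next
  case False
  then have "idx j \<noteq> k" for j :: 'n using idx_bound[of j] by auto
  then show ?thesis using False by (simp add: nx_def)
qed

lemma h_vec_inner: "h_vec \<bullet> y = nx (y :: 'n::{finite,linorder} rvec) 0"
  using sum_idx_eq[of 0 y] by (simp add: h_vec_def inner_vec_def)

lemma Gam_nth: "(Gam \<sigma> *v y) $ i = nx y (Suc (idx i)) - \<sigma> $ i * nx (y :: 'n::{finite,linorder} rvec) 0"
proof -
  have "(J_mat *v y) $ i = nx y (Suc (idx i))"
    using sum_idx_eq[of "Suc (idx i)" y] by (simp add: J_mat_def matrix_vector_mult_def)
  then show ?thesis
    by (simp add: Gam_def matrix_vector_mult_diff_rdistrib outer_mult h_vec_inner mult.commute)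
qed

lemma Gam_sandwich_nth:
  "(Gam \<sigma> ** X ** transpose (Gam \<sigma>)) $ i $ j
    = qn X (Suc (idx i)) (Suc (idx j)) - \<sigma> $ j * qn X (Suc (idx i)) 0
      - \<sigma> $ i * (qn X 0 (Suc (idx j)) - \<sigma> $ j * qn X 0 0)"
proof -
  define c where "c = (\<chi> k. (X ** transpose (Gam \<sigma>)) $ k $ j)"
  have c: "c $ k = nx (X $ k) (Suc (idx j)) - \<sigma> $ j * nx (X $ k) 0" for k
  proof -
    have "c $ k = (Gam \<sigma> *v (X $ k)) $ j"
      by (simp add: c_def matrix_matrix_mult_def matrix_vector_mult_def transpose_def mult.commute)
    then show ?thesis by (simp add: Gam_nth)
  qed
  have "(Gam \<sigma> ** X ** transpose (Gam \<sigma>)) $ i $ j = (Gam \<sigma> *v c) $ i"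
    unfolding matrix_mul_assoc[symmetric] by (simp add: c_def matrix_matrix_mult_def matrix_vector_mult_def)
  also have "\<dots> = nx c (Suc (idx i)) - \<sigma> $ i * nx c 0" by (rule Gam_nth)
  moreover have "nx c a = qn X a (Suc (idx j)) - \<sigma> $ j * qn X a 0" for a
    by (auto simp: nx_def c qn_def)
  ultimately show ?thesis by simp
qed

lemma matrix_h_nth: "(P *v h_vec) $ k = qn P (idx k) 0"
proof -
  have "(P *v h_vec) $ k = h_vec \<bullet> (P $ k)"
    by (simp add: matrix_vector_mult_def inner_vec_def mult.commute)
  then show ?thesis by (simp add: h_vec_inner nx_def qn_def idx_bound)
qed

lemma nx_matrix_h: "nx (P *v h_vec) k = qn P k 0"
proof (cases "k < CARD('a)")
  case True
  then obtain i :: 'a where "idx i = k" using exists_idx by blast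
  then show ?thesis using matrix_h_nth[of P i] by auto
qed (simp add: nx_def qn_def)

lemma h_P_h: "h_vec \<bullet> (P *v h_vec) = qn P 0 0"
  by (simp add: h_vec_inner nx_matrix_h)

lemma qn_sym: "transpose P = P \<Longrightarrow> qn P i j = qn P j i"
  by (auto simp: qn_def transpose_def vec_eq_iff)

lemma coeff_vpoly_bord [simp]:
  "coeff (vpoly (bord x v)) 0 = x" "coeff (vpoly (bord x v)) (Suc k) = nx v k"
proof -
  show "coeff (vpoly (bord x v)) 0 = x" using coeff_vpoly_idx[of "bord x v" None] by simp
  show "coeff (vpoly (bord x v)) (Suc k) = nx v k"
  proof (cases "k < CARD('a)")
    case True
    then obtain i :: 'a where "idx i = k" using exists_idx by blast
    then show ?thesis using coeff_vpoly_idx[of "bord x v" "Some i"] by auto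
  qed (simp add: nx_def coeff_vpoly_ge card_option)
qed

text \<open>\<open>pair_coeff\<close> symmetrises, whence the halves; the product of T - G and T + G
  symmetrises to T(x) T(y) - G(x) G(y).\<close>

definition bez :: "'n::{finite,linorder} rvec \<Rightarrow> 'n rvec \<Rightarrow> real \<Rightarrow> 'n rvec \<Rightarrow> nat \<Rightarrow> nat \<Rightarrow> real" where
  "bez t g r \<sigma> i j = pair_coeff (bord 1 (t - g)) (bord 1 (t + g)) i j / 2
     - r * pair_coeff (bord 1 \<sigma>) (bord 1 \<sigma>) i j / 2"

text \<open>
  With \<open>\<mu>\<close> the coefficients of \<open>T(x) T(y) - G(x) G(y) - r S(x) S(y)\<close>, where
  \<open>T, G, S\<close> are the polynomials of \<open>[1; t], [0; g], [1; \<sigma>]\<close>, this says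
  \<open>\<mu>(x,y) = (1 - x y) P(x,y)\<close>.
\<close>

definition disp_eq :: "'n::{finite,linorder} rvec \<Rightarrow> 'n rvec \<Rightarrow> real \<Rightarrow> 'n rvec \<Rightarrow> 'n rmat \<Rightarrow> bool" where
  "disp_eq t g r \<sigma> P \<longleftrightarrow> qn P 0 0 = 1 - r \<and> (\<forall>i. qn P (Suc (idx i)) 0 = t $ i - r * \<sigma> $ i) \<and>
     (\<forall>i j. P $ i $ j = qn P (Suc (idx i)) (Suc (idx j)) - t $ i * t $ j + g $ i * g $ j + r * (\<sigma> $ i * \<sigma> $ j))"

definition cee_eq :: "'n::{finite,linorder} rvec \<Rightarrow> 'n rvec \<Rightarrow> 'n rmat \<Rightarrow> bool" where
  "cee_eq \<sigma> g P \<longleftrightarrow>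
     P = Gam \<sigma> ** (P - P ** outer h_vec h_vec ** P) ** transpose (Gam \<sigma>) + outer g g"

lemma outer_nth: "outer u v $ i $ j = u $ i * v $ j"
  by (simp add: outer_def)

text \<open>The quadratic terms of the equation involve only the first column of P. Naming its data
  t and r turns the equation into one that is affine in P for fixed t, g, r.\<close>

lemma cee_iff_disp:
  assumes sym: "transpose P = P"
  shows "cee_eq \<sigma> g P \<and> t = Gam \<sigma> *v (P *v h_vec) + \<sigma> \<and> r = 1 - h_vec \<bullet> (P *v h_vec) \<longleftrightarrow> disp_eq t g r \<sigma> P"
proof -
  let ?q = "qn P"
  have qX: "qn (P - P ** outer h_vec h_vec ** P) i j = ?q i j - ?q i 0 * ?q j 0" for i j
  proof -
    have "P ** outer h_vec h_vec ** P = outer (P *v h_vec) (P *v h_vec)"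
    proof -
      have "P ** outer h_vec h_vec ** P *v x = outer (P *v h_vec) (P *v h_vec) *v x" for x
      proof -
        have "h_vec \<bullet> (P *v x) = (P *v h_vec) \<bullet> x"
          using inner_transpose_vec[of P h_vec x] sym by simp
        then show ?thesis by (simp only: matrix_vector_mul_assoc[symmetric] outer_mult matrix_vector_mult_scaleR)
      qed
      then show ?thesis using matrix_eq by blast
    qed
    then have "(P - P ** outer h_vec h_vec ** P) $ a $ b = P $ a $ b - (P *v h_vec) $ a * (P *v h_vec) $ b" for a b
      by (simp add: outer_def)
    then show ?thesis
      by (auto simp: qn_def matrix_h_nth idx_idx_inv)
  qed
  have t: "t = Gam \<sigma> *v (P *v h_vec) + \<sigma> \<longleftrightarrow> (\<forall>i. t $ i = ?q (Suc (idx i)) 0 - \<sigma> $ i * ?q 0 0 + \<sigma> $ i)"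
    by (auto simp: vec_eq_iff Gam_nth nx_matrix_h)
  have cee: "cee_eq \<sigma> g P \<longleftrightarrow> (\<forall>i j. P $ i $ j =
      (?q (Suc (idx i)) (Suc (idx j)) - ?q (Suc (idx i)) 0 * ?q (Suc (idx j)) 0)
       - \<sigma> $ j * (?q (Suc (idx i)) 0 - ?q (Suc (idx i)) 0 * ?q 0 0)
       - \<sigma> $ i * ((?q (Suc (idx j)) 0 - ?q 0 0 * ?q (Suc (idx j)) 0) - \<sigma> $ j * (?q 0 0 - ?q 0 0 * ?q 0 0)) + g $ i * g $ j)"
    unfolding cee_eq_def vec_eq_iff
    by (simp add: Gam_sandwich_nth qX outer_nth qn_sym[OF sym, of 0 "Suc k" for k])
  \<comment> \<open>One entry of the equation after inserting P(i+1,0) = t_i - r \<sigma>_i and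
    P(0,0) = 1 - r; the remaining products of first-column entries collapse.\<close>
  have key: "(p = (Q - (ti - r * si) * (tj - r * sj)) - sj * ((ti - r * si) - (ti - r * si) * (1 - r))
       - si * (((tj - r * sj) - (1 - r) * (tj - r * sj)) - sj * ((1 - r) - (1 - r) * (1 - r))) + gi * gj)
      \<longleftrightarrow> p = Q - ti * tj + gi * gj + r * (si * sj)" for p Q ti tj si sj gi gj :: real
    by (simp add: algebra_simps)
  show ?thesis
  proof
    assume a: "cee_eq \<sigma> g P \<and> t = Gam \<sigma> *v (P *v h_vec) + \<sigma> \<and> r = 1 - h_vec \<bullet> (P *v h_vec)"
    have r: "?q 0 0 = 1 - r" using a by (simp add: h_P_h)
    have q0: "?q (Suc (idx i)) 0 = t $ i - r * \<sigma> $ i" for i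
      using a unfolding t r by (simp add: algebra_simps)
    show "disp_eq t g r \<sigma> P"
      using a unfolding disp_eq_def cee q0 r key by blast
  next
    assume d: "disp_eq t g r \<sigma> P"
    then have r: "?q 0 0 = 1 - r" and q0: "\<And>i. ?q (Suc (idx i)) 0 = t $ i - r * \<sigma> $ i"
      by (auto simp: disp_eq_def)
    have "cee_eq \<sigma> g P" unfolding cee q0 r key using d by (simp add: disp_eq_def)
    moreover have "t = Gam \<sigma> *v (P *v h_vec) + \<sigma>" unfolding t q0 r by (simp add: algebra_simps)
    ultimately show "cee_eq \<sigma> g P \<and> t = Gam \<sigma> *v (P *v h_vec) + \<sigma> \<and> r = 1 - h_vec \<bullet> (P *v h_vec)"
      by (simp add: h_P_h r)
  qed
qed

lemma bez_nth:
  "bez t g r \<sigma> 0 0 = 1 - r"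
  "bez t g r \<sigma> (Suc k) 0 = nx t k - r * nx \<sigma> k"
  "bez t g r \<sigma> 0 (Suc k) = nx t k - r * nx \<sigma> k"
  "bez t g r \<sigma> (Suc k) (Suc l) = nx t k * nx t l - nx g k * nx g l - r * (nx \<sigma> k * nx \<sigma> l)"
proof -
  have nx: "nx (x - y) k = nx x k - nx y k" "nx (x + y) k = nx x k + nx y k" for x y :: "'a rvec" and k
    by (auto simp: nx_def)
  show "bez t g r \<sigma> 0 0 = 1 - r" "bez t g r \<sigma> (Suc k) 0 = nx t k - r * nx \<sigma> k"
    "bez t g r \<sigma> 0 (Suc k) = nx t k - r * nx \<sigma> k"
    "bez t g r \<sigma> (Suc k) (Suc l) = nx t k * nx t l - nx g k * nx g l - r * (nx \<sigma> k * nx \<sigma> l)"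
    by (simp_all add: bez_def pair_coeff_def nx field_simps)
qed

lemma disp_eq_iff_bez:
  assumes sym: "transpose P = P"
  shows "disp_eq t g r \<sigma> (P :: 'n::{finite,linorder} rmat) \<longleftrightarrow>
    (\<forall>j. bez t g r \<sigma> 0 j = qn P 0 j) \<and> (\<forall>i. bez t g r \<sigma> i 0 = qn P i 0) \<and>
    (\<forall>i j. bez t g r \<sigma> (Suc i) (Suc j) = qn P (Suc i) (Suc j) - qn P i j)"
proof
  assume d: "disp_eq t g r \<sigma> P"
  have A: "bez t g r \<sigma> i 0 = qn P i 0" for i
  proof (cases i)
    case 0
    then show ?thesis using d by (simp add: bez_nth disp_eq_def)
  next
    case (Suc k)
    show ?thesis
    proof (cases "k < CARD('n)")
      case True
      then obtain i' :: 'n where "idx i' = k" using exists_idx by blast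
      then show ?thesis using d Suc by (auto simp: bez_nth disp_eq_def)
    qed (simp add: Suc bez_nth nx_ge qn_ge)
  qed
  moreover have "bez t g r \<sigma> 0 j = qn P 0 j" for j
    using A[of j] qn_sym[OF sym, of 0 j] by (cases j) (simp_all add: bez_nth)
  moreover have "bez t g r \<sigma> (Suc i) (Suc j) = qn P (Suc i) (Suc j) - qn P i j" for i j
  proof (cases "i < CARD('n) \<and> j < CARD('n)")
    case True
    then obtain i' j' :: 'n where ij: "i = idx i'" "j = idx j'" using exists_idx by metis
    have "P $ i' $ j' = qn P (Suc (idx i')) (Suc (idx j')) - t $ i' * t $ j' + g $ i' * g $ j' + r * (\<sigma> $ i' * \<sigma> $ j')"
      using d by (simp add: disp_eq_def)
    then show ?thesis by (simp add: ij bez_nth algebra_simps)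
  next
    case False
    then show ?thesis by (auto simp: bez_nth nx_ge qn_ge not_less)
  qed
  ultimately show "(\<forall>j. bez t g r \<sigma> 0 j = qn P 0 j) \<and> (\<forall>i. bez t g r \<sigma> i 0 = qn P i 0) \<and>
    (\<forall>i j. bez t g r \<sigma> (Suc i) (Suc j) = qn P (Suc i) (Suc j) - qn P i j)" by blast
next
  assume b: "(\<forall>j. bez t g r \<sigma> 0 j = qn P 0 j) \<and> (\<forall>i. bez t g r \<sigma> i 0 = qn P i 0) \<and>
    (\<forall>i j. bez t g r \<sigma> (Suc i) (Suc j) = qn P (Suc i) (Suc j) - qn P i j)"
  have "qn P 0 0 = 1 - r" using b bez_nth(1)[of t g r \<sigma>] by auto
  moreover have "qn P (Suc (idx i)) 0 = t $ i - r * \<sigma> $ i" for i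
    using b bez_nth(2)[of t g r \<sigma> "idx i"] by auto
  moreover have "P $ i $ j = qn P (Suc (idx i)) (Suc (idx j)) - t $ i * t $ j + g $ i * g $ j + r * (\<sigma> $ i * \<sigma> $ j)" for i j
  proof -
    have "bez t g r \<sigma> (Suc (idx i)) (Suc (idx j)) = qn P (Suc (idx i)) (Suc (idx j)) - qn P (idx i) (idx j)"
      using b by blast
    then show ?thesis by (simp add: bez_nth algebra_simps)
  qed
  ultimately show "disp_eq t g r \<sigma> P" by (simp add: disp_eq_def)
qed

definition bezout :: "'n::{finite,linorder} rvec \<Rightarrow> 'n rvec \<Rightarrow> real \<Rightarrow> 'n rvec \<Rightarrow> 'n rmat" where
  "bezout t g r \<sigma> = (\<chi> i j. diagsum (bez t g r \<sigma>) (idx i) (idx j))"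

lemma bez_sym: "bez t g r \<sigma> i j = bez t g r \<sigma> j i"
  by (simp add: bez_def pair_coeff_def mult.commute add.commute)

lemma bezout_sym: "transpose (bezout t g r \<sigma>) = bezout t g r \<sigma>"
  by (simp add: bezout_def transpose_def vec_eq_iff diagsum_def min.commute bez_sym)

lemma bez_gt: "CARD('n) < i \<or> CARD('n) < j \<Longrightarrow> bez t g r (\<sigma> :: 'n::{finite,linorder} rvec) i j = 0"
  unfolding bez_def
  using pair_coeff_gt[of i j "bord 1 (t - g)" "bord 1 (t + g)"] pair_coeff_gt[of i j "bord 1 \<sigma>" "bord 1 \<sigma>"]
  by auto

text \<open>Beyond position n the partial diagonal sums are complete as well, which matches the
  extension of \<open>qn\<close> by 0.\<close>

lemma diagsum_ge_zero:
  assumes supp: "\<And>i j. n < i \<or> n < j \<Longrightarrow> \<mu> i j = 0" and sym: "\<And>i j. \<mu> i j = \<mu> j i"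
    and zero: "\<And>k. k \<le> n \<Longrightarrow> (\<Sum>l\<le>n. \<mu> l (l + k)) = (0::real)" and ij: "n \<le> i \<or> n \<le> j"
  shows "diagsum \<mu> i j = 0"
proof -
  have *: "diagsum \<mu> i j = 0" if ij: "i \<le> j" "n \<le> j" for i j
  proof -
    have "diagsum \<mu> i j = (\<Sum>l\<le>i. \<mu> (i - l) (j - l))" using ij by (simp add: diagsum_def min_def)
    also have "\<dots> = (\<Sum>l\<le>i. \<mu> l (l + (j - i)))"
      by (rule sum.reindex_bij_witness[of _ "\<lambda>l. i - l" "\<lambda>l. i - l"]) (use ij in auto)
    also have "\<dots> = (\<Sum>l\<le>max i n. \<mu> l (l + (j - i)))"
      by (rule sum.mono_neutral_left) (use ij in \<open>auto intro!: supp\<close>)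
    also have "\<dots> = (\<Sum>l\<le>n. \<mu> l (l + (j - i)))"
      by (rule sum.mono_neutral_right) (auto intro!: supp)
    also have "\<dots> = 0"
    proof (cases "j - i \<le> n")
      case False
      then show ?thesis by (intro sum.neutral) (auto intro!: supp)
    qed (rule zero)
    finally show ?thesis .
  qed
  have "diagsum \<mu> i j = diagsum \<mu> j i" by (simp add: diagsum_def min.commute sym)
  then show ?thesis using *[of i j] *[of j i] ij by (cases "i \<le> j") auto
qed

text \<open>Equality of the autocorrelations says that the diagonal sums of \<open>bez\<close>
  vanish, so division by 1 - x y terminates within an n x n array.\<close>

lemma bezout_disp:
  fixes \<sigma> :: "'n::{finite,linorder} rvec"
  assumes ac: "acorr (bord 1 (t - g)) (bord 1 (t + g)) = r *\<^sub>R acorr (bord 1 \<sigma>) (bord 1 \<sigma>)"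
  shows "disp_eq t g r \<sigma> (bezout t g r \<sigma>)"
proof -
  let ?n = "CARD('n)" and ?P = "bezout t g r \<sigma>" and ?b = "bez t g r \<sigma>"
  have zero: "(\<Sum>l\<le>?n. ?b l (l + k)) = 0" if "k \<le> ?n" for k
  proof -
    have k: "idx (idx_inv k :: 'n option) = k" using that by (simp add: idx_idx_inv card_option)
    have "(\<Sum>l\<le>?n. ?b l (l + k)) = (acorr (bord 1 (t - g)) (bord 1 (t + g)) $ (idx_inv k)
        - r * acorr (bord 1 \<sigma>) (bord 1 \<sigma>) $ (idx_inv k)) / 2"
      by (simp add: acorr_nth k bez_def sum_subtractf sum_distrib_left sum_divide_distrib diff_divide_distrib)
    then show ?thesis by (simp add: ac)
  qed
  note ge = diagsum_ge_zero[of ?n ?b, OF bez_gt bez_sym zero]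
  have q: "qn ?P i j = diagsum ?b i j" for i j
    using ge[of i j] by (auto simp: qn_def bezout_def idx_idx_inv not_less)
  show ?thesis unfolding disp_eq_iff_bez[OF bezout_sym] q by (simp add: diagsum_Suc)
qed

text \<open>The first row and column are prescribed, and the recursion determines every further
  entry along its diagonal.\<close>

lemma disp_eq_unique:
  assumes "disp_eq t g r \<sigma> P" "transpose P = P"
  shows "P = bezout t g r \<sigma>"
proof -
  have b: "(\<forall>j. bez t g r \<sigma> 0 j = qn P 0 j) \<and> (\<forall>i. bez t g r \<sigma> i 0 = qn P i 0) \<and>
    (\<forall>i j. bez t g r \<sigma> (Suc i) (Suc j) = qn P (Suc i) (Suc j) - qn P i j)"
    using assms by (simp add: disp_eq_iff_bez)
  have "qn P i j = diagsum (bez t g r \<sigma>) i j" for i j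
  proof (induction i arbitrary: j)
    case (Suc i)
    show ?case
      using b Suc by (cases j) (simp_all add: diagsum_Suc)
  qed (use b in simp)
  then have "P $ i $ j = bezout t g r \<sigma> $ i $ j" for i j
    unfolding bezout_def by (metis (no_types, lifting) qn_idx vec_lambda_beta)
  then show ?thesis by (simp add: vec_eq_iff)
qed

subsection \<open>Schur polynomials and positive real pairs\<close>

lemma coeff_rev_poly: "coeff (rev_poly n p) j = (if j \<le> n then coeff p (n - j) else 0)"
proof (cases "j \<le> n")
  case True
  have "coeff (rev_poly n p) j = (\<Sum>i\<le>n. if n - i = j then coeff p i else 0)"
    by (simp add: rev_poly_def coeff_sum)
  also have "\<dots> = (\<Sum>i\<in>{n - j}. coeff p i)"
    by (rule sum.mono_neutral_cong_right) (use True in auto)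
  finally show ?thesis using True by simp
next
  case False
  have "coeff (rev_poly n p) j = (\<Sum>i\<le>n. if n - i = j then coeff p i else 0)"
    by (simp add: rev_poly_def coeff_sum)
  also have "\<dots> = 0" using False by (intro sum.neutral) auto
  finally show ?thesis using False by simp
qed

text \<open>The descending order of \<open>monic_poly\<close>, opposite to that of
  \<open>vpoly\<close>; in it the matrix \<open>Gam a\<close> becomes multiplication by z modulo
  a(z) (\<open>rpol_Gam\<close>).\<close>

definition rpol :: "'n::{finite,linorder} rvec \<Rightarrow> real poly" where
  "rpol v = (\<Sum>i\<in>UNIV. monom (v $ i) (CARD('n) - 1 - idx i))"

lemma coeff_rpol: "coeff (rpol (v :: 'n::{finite,linorder} rvec)) k = (if k < CARD('n) then nx v (CARD('n) - 1 - k) else 0)"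
proof -
  have "coeff (rpol v) k = (\<Sum>i\<in>(UNIV::'n set). if CARD('n) - 1 - idx i = k then nx v (idx i) else 0)"
    by (simp only: rpol_def coeff_sum coeff_monom nx_idx)
  also have "\<dots> = (\<Sum>i<CARD('n). if CARD('n) - 1 - i = k then nx v i else 0)"
    by (rule sum_idx)
  also have "\<dots> = (if k < CARD('n) then nx v (CARD('n) - 1 - k) else 0)"
  proof (cases "k < CARD('n)")
    case True
    have "(\<Sum>i<CARD('n). if CARD('n) - 1 - i = k then nx v i else 0) = (\<Sum>i\<in>{CARD('n) - 1 - k}. nx v i)"
      by (rule sum.mono_neutral_cong_right) (use True in auto)
    then show ?thesis using True by simp
  next
    case False
    then show ?thesis by (auto intro!: sum.neutral)
  qed
  finally show ?thesis .
qed

lemma coeff_monic_poly: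
  "coeff (monic_poly (a :: 'n::{finite,linorder} rvec)) k
    = (if k = CARD('n) then 1 else if k < CARD('n) then nx a (CARD('n) - 1 - k) else 0)"
  unfolding monic_poly_def rpol_def[symmetric] by (simp add: coeff_rpol)

lemma monic_poly_rpol: "monic_poly (a :: 'n::{finite,linorder} rvec) = monom 1 CARD('n) + rpol a"
  by (simp add: monic_poly_def rpol_def)

lemma monic_poly_rev: "monic_poly (a :: 'n::{finite,linorder} rvec) = rev_poly CARD('n) (vpoly (bord 1 a))"
proof (rule poly_eqI)
  fix k
  consider "CARD('n) < k" | "k = CARD('n)" | "k < CARD('n)" by linarith
  then show "coeff (monic_poly a) k = coeff (rev_poly CARD('n) (vpoly (bord 1 a))) k"
  proof cases
    case 3
    then have "CARD('n) - k = Suc (CARD('n) - 1 - k)" by simp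
    then show ?thesis using 3 by (simp add: coeff_monic_poly coeff_rev_poly)
  qed (simp_all add: coeff_monic_poly coeff_rev_poly)
qed

lemma degree_monic_poly [simp]: "degree (monic_poly (a :: 'n::{finite,linorder} rvec)) = CARD('n)"
  by (rule antisym[OF degree_le le_degree]) (simp_all add: coeff_monic_poly)

lemma monic_poly_nz [simp]: "monic_poly (a :: 'n::{finite,linorder} rvec) \<noteq> 0"
  using degree_monic_poly[of a] by (metis degree_0 zero_less_card_finite less_irrefl)

lemma star_poly_vpoly: "star_poly a = vpoly (bord 1 (a :: 'n::{finite,linorder} rvec))"
proof (rule poly_eqI)
  fix k show "coeff (star_poly a) k = coeff (vpoly (bord 1 a)) k"
    unfolding star_poly_def coeff_reflect_poly degree_monic_poly
    by (simp add: monic_poly_rev coeff_rev_poly coeff_vpoly_gt)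
qed

lemma cpoly_monic_poly:
  "z \<noteq> 0 \<Longrightarrow> cpoly (monic_poly (a :: 'n::{finite,linorder} rvec)) z
     = z ^ CARD('n) * cpoly (vpoly (bord 1 a)) (inverse z)"
  unfolding monic_poly_rev using degree_vpoly_less[of "bord 1 a"]
  by (intro cpoly_rev_poly) (simp_all add: card_option)

lemma Schur_iff: "a \<in> Schur \<longleftrightarrow> bord 1 (a :: 'n::{finite,linorder} rvec) \<in> stable_vecs"
proof
  assume a: "a \<in> Schur"
  have "cpoly (vpoly (bord 1 a)) x \<noteq> 0" if "cmod x \<le> 1" for x
  proof (cases "x = 0")
    case False
    then have "1 \<le> cmod (inverse x)" unfolding norm_inverse using that by (intro one_le_inverse) auto
    then have "cpoly (monic_poly a) (inverse x) \<noteq> 0" using a unfolding Schur_def by force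
    then show ?thesis using False by (simp add: cpoly_monic_poly)
  qed simp
  then show "bord 1 a \<in> stable_vecs" by (simp add: stable_vecs_iff)
next
  assume s: "bord 1 a \<in> stable_vecs"
  show "a \<in> Schur" unfolding Schur_def
  proof (clarify, rule ccontr)
    fix z assume z: "cpoly (monic_poly a) z = 0" "\<not> cmod z < 1"
    then have "z \<noteq> 0" "cmod (inverse z) \<le> 1" by (auto simp: norm_inverse inverse_le_1_iff)
    then show False using s z(1) by (auto simp: cpoly_monic_poly stable_vecs_iff)
  qed
qed

text \<open>Used in two ways: y = cnj x turns the last sum into a Hermitian form of P, and x y = 1
  removes it and leaves the spectral equation.\<close>

lemma disp_generating:
  fixes \<sigma> :: "'n::{finite,linorder} rvec"
  assumes d: "disp_eq t g r \<sigma> P" and sym: "transpose P = P"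
  shows "cpoly (vpoly (bord 1 (t - g))) x * cpoly (vpoly (bord 1 (t + g))) y
      + cpoly (vpoly (bord 1 (t + g))) x * cpoly (vpoly (bord 1 (t - g))) y
      = 2 * of_real r * (cpoly (vpoly (bord 1 \<sigma>)) x * cpoly (vpoly (bord 1 \<sigma>)) y)
        + 2 * (1 - x * y) * (\<Sum>i\<in>UNIV. \<Sum>j\<in>UNIV. of_real (P $ i $ j) * x ^ idx i * y ^ idx j)"
proof -
  let ?n = "CARD('n)"
  note b = d[unfolded disp_eq_iff_bez[OF sym]]
  have "(\<Sum>i\<le>?n. \<Sum>j\<le>?n. complex_of_real (bez t g r \<sigma> i j) * x ^ i * y ^ j)
      = (1 - x * y) * (\<Sum>i<?n. \<Sum>j<?n. of_real (qn P i j) * x ^ i * y ^ j)"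
    by (rule displacement_generating) (use b in \<open>auto simp: qn_ge\<close>)
  also have "(\<Sum>i<?n. \<Sum>j<?n. of_real (qn P i j) * x ^ i * y ^ j)
      = (\<Sum>i\<in>UNIV. \<Sum>j\<in>UNIV. of_real (P $ i $ j) * x ^ idx i * y ^ idx j)"
  proof -
    have "(\<Sum>i<?n. \<Sum>j<?n. of_real (qn P i j) * x ^ i * y ^ j)
        = (\<Sum>i\<in>(UNIV::'n set). \<Sum>j\<in>(UNIV::'n set). of_real (qn P (idx i) (idx j)) * x ^ idx i * y ^ idx j)"
      unfolding sum_idx[where 'k='n, symmetric] ..
    then show ?thesis by simp
  qed
  finally have 1: "(\<Sum>i\<le>?n. \<Sum>j\<le>?n. complex_of_real (bez t g r \<sigma> i j) * x ^ i * y ^ j)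
      = (1 - x * y) * (\<Sum>i\<in>UNIV. \<Sum>j\<in>UNIV. of_real (P $ i $ j) * x ^ idx i * y ^ idx j)" .
  have "2 * (\<Sum>i\<le>?n. \<Sum>j\<le>?n. complex_of_real (bez t g r \<sigma> i j) * x ^ i * y ^ j)
      = (\<Sum>i\<le>?n. \<Sum>j\<le>?n. of_real (pair_coeff (bord 1 (t - g)) (bord 1 (t + g)) i j) * x ^ i * y ^ j)
       - of_real r * (\<Sum>i\<le>?n. \<Sum>j\<le>?n. of_real (pair_coeff (bord 1 \<sigma>) (bord 1 \<sigma>) i j) * x ^ i * y ^ j)"
    by (simp add: bez_def sum_distrib_left sum_subtractf[symmetric] algebra_simps)
  then show ?thesis unfolding sum_pair_coeff 1 by (simp add: algebra_simps)
qed

lemma hermitian_form_nonneg: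
  fixes P :: "'n::{finite,linorder} rmat"
  assumes "psdef P"
  shows "0 \<le> Re (\<Sum>i\<in>UNIV. \<Sum>j\<in>UNIV. of_real (P $ i $ j) * x ^ idx i * cnj x ^ idx j)"
proof -
  define a where "a = (\<chi> i::'n. Re (x ^ idx i))"
  define b where "b = (\<chi> i::'n. Im (x ^ idx i))"
  have "Re (\<Sum>i\<in>(UNIV::'n set). \<Sum>j\<in>UNIV. of_real (P $ i $ j) * x ^ idx i * cnj x ^ idx j)
      = (\<Sum>i\<in>UNIV. \<Sum>j\<in>UNIV. P $ i $ j * (a $ i * a $ j + b $ i * b $ j))"
  proof -
    have "Re (of_real p * x ^ k * cnj x ^ l) = p * (Re (x ^ k) * Re (x ^ l) + Im (x ^ k) * Im (x ^ l))" for p k l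
      by (simp add: mult.assoc flip: complex_cnj_power)
    then show ?thesis by (simp only: Re_sum a_def b_def vec_lambda_beta)
  qed
  also have "\<dots> = a \<bullet> (P *v a) + b \<bullet> (P *v b)"
    by (simp add: inner_vec_def matrix_vector_mult_def sum_distrib_left sum.distrib[symmetric] algebra_simps)
  also have "\<dots> \<ge> 0" using assms by (simp add: psdef_def)
  finally show ?thesis .
qed

text \<open>For y = cnj x the generating identity reads Re (B cnj A) = r |S|^2 + (1 - |x|^2) Q,
  where Q \<ge> 0 is the form of P at the powers of x, and S has no zero in the closed disc.\<close>

lemma disp_positive:
  fixes \<sigma> :: "'n::{finite,linorder} rvec"
  assumes d: "disp_eq t g r \<sigma> P" and sym: "transpose P = P" and psd: "psdef P" and r: "0 < r"
    and s: "\<sigma> \<in> Schur" and x: "cmod x \<le> 1"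
  shows "0 < Re (cpoly (vpoly (bord 1 (t + g))) x * cnj (cpoly (vpoly (bord 1 (t - g))) x))"
proof -
  let ?A = "cpoly (vpoly (bord 1 (t - g))) x" and ?B = "cpoly (vpoly (bord 1 (t + g))) x"
  let ?S = "cpoly (vpoly (bord 1 \<sigma>)) x" and ?Q = "\<Sum>i\<in>UNIV. \<Sum>j\<in>UNIV. of_real (P $ i $ j) * x ^ idx i * cnj x ^ idx j"
  have xx: "x * cnj x = of_real ((cmod x)\<^sup>2)" by (simp add: complex_norm_square del: of_real_power)
  have "?A * cnj ?B + ?B * cnj ?A = 2 * of_real r * (?S * cnj ?S) + 2 * (1 - x * cnj x) * ?Q"
    using disp_generating[OF d sym, of x "cnj x"] by (simp add: cnj_cpoly)
  also have "\<dots> = of_real (2 * r * (cmod ?S)\<^sup>2) + of_real (2 * (1 - (cmod x)\<^sup>2)) * ?Q"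
    unfolding xx by (simp add: complex_norm_square del: of_real_power)
  finally have "Re (?A * cnj ?B + ?B * cnj ?A) = 2 * r * (cmod ?S)\<^sup>2 + 2 * (1 - (cmod x)\<^sup>2) * Re ?Q"
    by (simp only: plus_complex.sel Re_complex_of_real times_complex.sel Im_complex_of_real)
  moreover have "Re (?A * cnj ?B) = Re (?B * cnj ?A)" by simp
  ultimately have "Re (?B * cnj ?A) = r * (cmod ?S)\<^sup>2 + (1 - (cmod x)\<^sup>2) * Re ?Q"
    by (simp only: plus_complex.sel)
  moreover have "?S \<noteq> 0" using s x by (simp add: Schur_iff stable_vecs_iff)
  moreover have "0 \<le> (1 - (cmod x)\<^sup>2) * Re ?Q"
    using hermitian_form_nonneg[OF psd, of x] x by (intro mult_nonneg_nonneg) (auto simp: power_le_one)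
  ultimately show ?thesis using r by (simp add: add_pos_nonneg)
qed

lemma monic_poly_pair:
  "z \<noteq> 0 \<Longrightarrow> cpoly (monic_poly (a :: 'n::{finite,linorder} rvec)) z * cpoly (monic_poly b) (inverse z)
    = cpoly (vpoly (bord 1 a)) (inverse z) * cpoly (vpoly (bord 1 (b :: 'n::{finite,linorder} rvec))) z"
  by (simp add: cpoly_monic_poly field_simps)

text \<open>Positivity of Re (B cnj A) on the closed disc gives everything at once: neither factor
  vanishes, so both polynomials are Schur, and z \<mapsto> 1/z turns it into strict positive
  realness.\<close>

lemma disp_imp_P_sigma:
  fixes \<sigma> :: "'n::{finite,linorder} rvec"
  assumes d: "disp_eq t g r \<sigma> P" and sym: "transpose P = P" and psd: "psdef P" and r: "0 < r"
    and s: "\<sigma> \<in> Schur"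
  shows "(t - g, t + g) \<in> P_sigma \<sigma>"
proof -
  let ?A = "vpoly (bord 1 (t - g))" and ?B = "vpoly (bord 1 (t + g))"
  have pos: "0 < Re (cpoly ?B x * cnj (cpoly ?A x))" if "cmod x \<le> 1" for x
    by (rule disp_positive[OF d sym psd r s that])
  then have nz: "cpoly ?A x \<noteq> 0 \<and> cpoly ?B x \<noteq> 0" if "cmod x \<le> 1" for x
    using that by fastforce
  have Schur: "t - g \<in> Schur" "t + g \<in> Schur" using nz by (auto simp: Schur_iff stable_vecs_iff)
  have quot: "cpoly (monic_poly (t + g)) z / cpoly (monic_poly (t - g)) z = cpoly ?B (inverse z) / cpoly ?A (inverse z)"
    if "1 < cmod z" for z
  proof -
    have "z \<noteq> 0" using that by auto
    then show ?thesis by (simp add: cpoly_monic_poly)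
  qed
  have iz: "cmod (inverse z) \<le> 1" if "1 < cmod z" for z
    using that by (simp add: norm_inverse inverse_le_1_iff)
  have "(\<lambda>z. cpoly (monic_poly (t + g)) z / cpoly (monic_poly (t - g)) z) holomorphic_on {z. 1 < cmod z}"
    using Schur by (intro holomorphic_intros) (force simp: Schur_def)
  then have an: "(\<lambda>z. cpoly (monic_poly (t + g)) z / cpoly (monic_poly (t - g)) z) analytic_on {z. 1 < cmod z}"
    by (subst analytic_on_open) (auto intro!: open_Collect_less continuous_intros)
  have re: "0 < Re (cpoly (monic_poly (t + g)) z / cpoly (monic_poly (t - g)) z)" if "1 < cmod z" for z
    unfolding quot[OF that] by (subst complex_div_cnj)
      (use pos[OF iz[OF that]] nz[OF iz[OF that]] in \<open>simp add: Re_divide_of_real flip: of_real_power\<close>)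
  have id: "cpoly (monic_poly (t - g)) z * cpoly (monic_poly (t + g)) (inverse z)
       + cpoly (monic_poly (t + g)) z * cpoly (monic_poly (t - g)) (inverse z)
     = 2 * (complex_of_real (sqrt r))\<^sup>2 * cpoly (monic_poly \<sigma>) z * cpoly (monic_poly \<sigma>) (inverse z)" if "z \<noteq> 0" for z
  proof -
    note m = monic_poly_pair[OF that]
    have "(complex_of_real (sqrt r))\<^sup>2 = of_real r" using r by (simp flip: of_real_power)
    moreover have "inverse z * z = 1" using that by simp
    ultimately show ?thesis
      using disp_generating[OF d sym, of "inverse z" z] unfolding mult.assoc[of _ "cpoly (monic_poly \<sigma>) z"] m
      by simp
  qed
  have "\<exists>\<rho>>0. \<forall>z. z \<noteq> 0 \<longrightarrow> cpoly (monic_poly (t - g)) z * cpoly (monic_poly (t + g)) (inverse z)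
       + cpoly (monic_poly (t + g)) z * cpoly (monic_poly (t - g)) (inverse z)
     = 2 * (complex_of_real \<rho>)\<^sup>2 * cpoly (monic_poly \<sigma>) z * cpoly (monic_poly \<sigma>) (inverse z)"
    using r id by (intro exI[of _ "sqrt r"]) simp
  then show ?thesis using Schur an re unfolding P_sigma_def P_set_def by blast
qed

lemma P_sigma_imp_acorr:
  fixes \<sigma> :: "'n::{finite,linorder} rvec"
  assumes ab: "(a, b) \<in> P_sigma \<sigma>"
  shows "\<exists>\<rho>>0. acorr (bord 1 a) (bord 1 b) = \<rho>\<^sup>2 *\<^sub>R acorr (bord 1 \<sigma>) (bord 1 \<sigma>)"
proof -
  obtain \<rho> where \<rho>: "\<rho> > 0" and id: "\<And>z. z \<noteq> 0 \<Longrightarrow>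
     cpoly (monic_poly a) z * cpoly (monic_poly b) (inverse z)
       + cpoly (monic_poly b) z * cpoly (monic_poly a) (inverse z)
     = 2 * (complex_of_real \<rho>)\<^sup>2 * cpoly (monic_poly \<sigma>) z * cpoly (monic_poly \<sigma>) (inverse z)"
    using ab unfolding P_sigma_def by blast
  have "acorr (bord 1 a) (bord 1 b) = \<rho>\<^sup>2 *\<^sub>R acorr (bord 1 \<sigma>) (bord 1 \<sigma>)"
  proof (rule trig_eq_imp)
    fix z :: complex assume z: "cmod z = 1"
    then have z0: "z \<noteq> 0" by auto
    have m: "cpoly (monic_poly p) z * cpoly (monic_poly q) (inverse z)
        = cnj (cpoly (vpoly (bord 1 p)) z) * cpoly (vpoly (bord 1 q)) z" for p q :: "'n rvec"
      using monic_poly_pair[OF z0, of p q] inverse_on_circle[OF z] by (simp only: cnj_cpoly)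
    have "cnj (cpoly (vpoly (bord 1 a)) z) * cpoly (vpoly (bord 1 b)) z + cnj (cpoly (vpoly (bord 1 b)) z) * cpoly (vpoly (bord 1 a)) z
      = of_real (2 * \<rho>\<^sup>2) * (cnj (cpoly (vpoly (bord 1 \<sigma>)) z) * cpoly (vpoly (bord 1 \<sigma>)) z)"
      using id[OF z0] unfolding mult.assoc[of _ "cpoly (monic_poly \<sigma>) z"] m by simp
    from arg_cong[OF this, of Re]
    have "2 * Re (cpoly (vpoly (bord 1 b)) z * cnj (cpoly (vpoly (bord 1 a)) z))
        = \<rho>\<^sup>2 * (2 * Re (cpoly (vpoly (bord 1 \<sigma>)) z * cnj (cpoly (vpoly (bord 1 \<sigma>)) z)))"
      by (simp add: algebra_simps)
    then show "trig (acorr (bord 1 a) (bord 1 b)) z = trig (\<rho>\<^sup>2 *\<^sub>R acorr (bord 1 \<sigma>) (bord 1 \<sigma>)) z"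
      by (simp only: trig_acorr[OF z] trig_scaleR)
  qed
  then show ?thesis using \<rho> by blast
qed

lemma pos_trig_acorr_self:
  assumes "\<sigma> \<in> Schur"
  shows "acorr (bord 1 \<sigma>) (bord 1 \<sigma>) \<in> pos_trig"
  unfolding pos_trig_def
proof (clarsimp)
  fix z :: complex assume z: "cmod z = 1"
  have "cpoly (vpoly (bord 1 \<sigma>)) z \<noteq> 0" using assms z by (simp add: Schur_iff stable_vecs_iff)
  then have "0 < (cmod (cpoly (vpoly (bord 1 \<sigma>)) z))\<^sup>2" by simp
  then show "0 < trig (acorr (bord 1 \<sigma>) (bord 1 \<sigma>)) z"
    unfolding trig_acorr[OF z, symmetric] by (simp add: complex_mult_cnj cmod_power2)
qed

subsection \<open>Gramian structure and rank\<close>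

text \<open>A second reading of the same entries: with a = t - g the products of t and g are
  absorbed into \<open>Gam a\<close>, leaving a rank-one term in a - \<sigma>. As the weight r is
  positive, semidefiniteness and the kernel of P become accessible.\<close>

lemma disp_gramian:
  assumes d: "disp_eq t g r \<sigma> P" and sym: "transpose P = P"
  shows "P = Gam (t - g) ** P ** transpose (Gam (t - g)) + r *\<^sub>R outer (t - g - \<sigma>) (t - g - \<sigma>)"
proof -
  have q0: "qn P (Suc (idx i)) 0 = t $ i - r * \<sigma> $ i" "qn P 0 (Suc (idx i)) = t $ i - r * \<sigma> $ i" for i
    using d qn_sym[OF sym, of 0 "Suc (idx i)"] by (auto simp: disp_eq_def)
  have "P $ i $ j = (Gam (t - g) ** P ** transpose (Gam (t - g)) + r *\<^sub>R outer (t - g - \<sigma>) (t - g - \<sigma>)) $ i $ j" for i j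
  proof -
    have p: "P $ i $ j = qn P (Suc (idx i)) (Suc (idx j)) - t $ i * t $ j + g $ i * g $ j + r * (\<sigma> $ i * \<sigma> $ j)"
      and q00: "qn P 0 0 = 1 - r" using d by (auto simp: disp_eq_def)
    show ?thesis
      by (simp only: vector_add_component vector_scaleR_component vector_minus_component
          Gam_sandwich_nth q0 q00 outer_nth p) (simp add: algebra_simps)
  qed
  then show ?thesis by (simp add: vec_eq_iff)
qed

lemma rpol_add: "rpol (u + v) = rpol u + rpol v"
  by (simp add: rpol_def add_monom[symmetric] sum.distrib)

lemma rpol_scaleR: "rpol (r *\<^sub>R u) = smult r (rpol u)"
  by (intro poly_eqI) (simp add: coeff_rpol nx_def)

lemma rpol_diff: "rpol (u - v) = rpol u - rpol v"
  using rpol_add[of "u - v" v] by simp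

lemma degree_rpol_less: "degree (rpol (v :: 'n::{finite,linorder} rvec)) < CARD('n)"
proof (cases "rpol v = 0")
  case False
  then have "lead_coeff (rpol v) \<noteq> 0" by simp
  then show ?thesis unfolding coeff_rpol by (metis (full_types))
qed simp

lemma nth_rpol: "v $ i = coeff (rpol (v :: 'n::{finite,linorder} rvec)) (CARD('n) - 1 - idx i)"
  using idx_bound[of i] by (simp add: coeff_rpol)

lemma rpol_inject: "rpol u = rpol v \<longleftrightarrow> u = v"
  using nth_rpol by (metis vec_eq_iff)

lemma rpol_surj: "degree p < CARD('n) \<Longrightarrow> \<exists>v :: 'n::{finite,linorder} rvec. rpol v = p"
proof (intro exI poly_eqI)
  fix k assume p: "degree p < CARD('n)"
  define v :: "'n rvec" where "v = (\<chi> i. coeff p (CARD('n) - 1 - idx i))"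
  have "nx v j = coeff p (CARD('n) - 1 - j)" if "j < CARD('n)" for j
    using that by (simp add: nx_def v_def idx_idx_inv)
  then have "coeff (rpol v) k = coeff p k" using p by (simp add: coeff_rpol coeff_eq_0)
  then show "coeff (rpol (\<chi> i. coeff p (CARD('n) - 1 - idx i) :: 'n rvec)) k = coeff p k" by (simp add: v_def)
qed

text \<open>\<open>Gam a\<close> is a companion matrix of a(z): the shift multiplies by z, and the
  rank-one part subtracts the leading coefficient times a(z).\<close>

lemma rpol_Gam: "rpol (Gam a *v v) = monom 1 1 * rpol v mod monic_poly (a :: 'n::{finite,linorder} rvec)"
proof -
  have "monom 1 1 * rpol v = monic_poly a * [:nx v 0:] + rpol (Gam a *v v)"
  proof (rule poly_eqI)
    fix k
    have nxG: "nx (Gam a *v v) j = nx v (Suc j) - nx a j * nx v 0" for j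
    proof (cases "j < CARD('n)")
      case True
      then obtain i :: 'n where "idx i = j" using exists_idx by blast
      then show ?thesis using Gam_nth[of a v i] by auto
    qed (simp add: nx_ge)
    show "coeff (monom 1 1 * rpol v) k = coeff (monic_poly a * [:nx v 0:] + rpol (Gam a *v v)) k"
    proof (cases k)
      case 0
      then show ?thesis by (simp add: coeff_monom_mult coeff_monic_poly coeff_rpol nxG nx_ge mult.commute[of "nx v 0"])
    next
      case (Suc l)
      consider "CARD('n) < k" | "k = CARD('n)" | "k < CARD('n)" by linarith
      then show ?thesis
      proof cases
        case 3
        then have "Suc (CARD('n) - 1 - k) = CARD('n) - 1 - l" using Suc by simp
        then show ?thesis using 3 Suc by (simp add: coeff_monom_mult coeff_monic_poly coeff_rpol nxG mult.commute[of "nx v 0"])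
      qed (use Suc in \<open>simp_all add: coeff_monom_mult coeff_monic_poly coeff_rpol mult.commute[of "nx v 0"]\<close>)
    qed
  qed
  then have "monom 1 1 * rpol v mod monic_poly a = rpol (Gam a *v v) mod monic_poly a"
    by (simp only: mod_mult_self4)
  then show ?thesis using degree_rpol_less[of "Gam a *v v"] by (simp add: mod_poly_less)
qed

lemma rpol_Gam_power: "rpol (((*v) (Gam a) ^^ k) v) = monom 1 k * rpol v mod monic_poly (a :: 'n::{finite,linorder} rvec)"
proof (induction k)
  case 0
  then show ?case using degree_rpol_less[of v] by (simp add: mod_poly_less monom_0 one_pCons[symmetric])
next
  case (Suc k)
  have "rpol (((*v) (Gam a) ^^ Suc k) v) = monom 1 1 * (monom 1 k * rpol v mod monic_poly a) mod monic_poly a"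
    by (simp add: rpol_Gam Suc)
  also have "\<dots> = monom 1 1 * (monom 1 k * rpol v) mod monic_poly a" by (rule mod_mult_right_eq)
  finally show ?case by (simp add: mult.assoc[symmetric] mult_monom)
qed

lemma Gam_power_tendsto:
  fixes a :: "'n::{finite,linorder} rvec"
  assumes "a \<in> Schur"
  shows "(\<lambda>k. ((*v) (Gam a) ^^ k) v) \<longlonglongrightarrow> 0"
proof (rule vec_tendstoI)
  fix i :: 'n
  have "(\<lambda>k. coeff (monom 1 k * rpol v mod monic_poly a) (CARD('n) - 1 - idx i)) \<longlonglongrightarrow> 0"
    using assms by (intro mod_power_tendsto_0) (auto simp: Schur_def)
  then show "(\<lambda>k. ((*v) (Gam a) ^^ k) v $ i) \<longlonglongrightarrow> 0 $ i"
    by (simp add: nth_rpol[of "((*v) (Gam a) ^^ k) v" i for k] rpol_Gam_power)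
qed

lemma gramian_quad:
  assumes P: "P = A ** P ** transpose A + r *\<^sub>R outer w (w :: real^'k)"
  shows "x \<bullet> (P *v x) = (transpose A *v x) \<bullet> (P *v (transpose A *v x)) + r * (x \<bullet> w)\<^sup>2"
proof -
  have "P *v x = A *v (P *v (transpose A *v x)) + (r * (w \<bullet> x)) *\<^sub>R w"
    by (subst P) (simp only: matrix_vector_mult_add_rdistrib matrix_vector_mul_assoc matrix_mul_assoc
        outer_mult scaleR_matrix_vector_assoc[symmetric] scaleR_scaleR)
  then show ?thesis
    by (simp only: inner_add_right inner_transpose_vec inner_scaleR_right) (simp add: power2_eq_square inner_commute)
qed

lemma disp_psdef:
  assumes d: "disp_eq t g r \<sigma> P" and sym: "transpose P = P" and r: "0 \<le> r" and s: "t - g \<in> Schur"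
  shows "psdef P"
  unfolding psdef_def
proof
  show "0 \<le> x \<bullet> (P *v x)" for x
    by (rule stein_psd[OF Gam_power_tendsto[OF s]])
       (subst (2) gramian_quad[OF disp_gramian[OF d sym]], use r in \<open>simp del: transpose_matrix_vector\<close>)
qed

subsection \<open>Degrees\<close>

lemma cpoly_dvd: "p dvd q \<Longrightarrow> cpoly p z = 0 \<Longrightarrow> cpoly q z = 0"
  by (auto simp: dvd_def cpoly_mult)

lemma exists_cpoly_root:
  assumes "0 < degree p"
  shows "\<exists>z. cpoly p z = 0"
proof -
  have "degree (map_poly complex_of_real p) = degree p" by (rule degree_map_poly) simp
  then show ?thesis
    using alg_closed_imp_poly_has_root[of "map_poly complex_of_real p"] assms unfolding cpoly_def by auto
qed

lemma coprime_iff_no_common_root: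
  assumes "p \<noteq> 0"
  shows "coprime p q \<longleftrightarrow> (\<forall>z. cpoly p z = 0 \<longrightarrow> cpoly q z \<noteq> 0)"
proof
  assume c: "coprime p q"
  show "\<forall>z. cpoly p z = 0 \<longrightarrow> cpoly q z \<noteq> 0"
  proof (intro allI impI notI)
    fix z assume z: "cpoly p z = 0" "cpoly q z = 0"
    have "fst (bezout_coefficients p q) * p + snd (bezout_coefficients p q) * q = 1"
      using bezout_coefficients_fst_snd[of p q] c by simp
    from arg_cong[OF this, of "\<lambda>p. cpoly p z"] show False using z by (simp add: cpoly_add cpoly_mult)
  qed
next
  assume r: "\<forall>z. cpoly p z = 0 \<longrightarrow> cpoly q z \<noteq> 0"
  have "degree (gcd p q) = 0"
    using exists_cpoly_root[of "gcd p q"] cpoly_dvd[OF gcd_dvd1[of p q]] cpoly_dvd[OF gcd_dvd2[of p q]] r by blast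
  moreover have "gcd p q \<noteq> 0" using assms by simp
  ultimately have "is_unit (gcd p q)" using is_unit_iff_degree by blast
  then show "coprime p q" by (simp only: is_unit_gcd)
qed

lemma gcd_smult_left: "c \<noteq> 0 \<Longrightarrow> gcd (smult c p) q = gcd p (q :: real poly)"
proof (rule associated_eqI)
  assume c: "c \<noteq> 0"
  have "gcd (smult c p) q dvd p" using gcd_dvd1[of "smult c p" q] unfolding dvd_smult_iff[OF c] .
  then show "gcd (smult c p) q dvd gcd p q" by (rule gcd_greatest) (rule gcd_dvd2)
  have "gcd p q dvd smult c p" by (rule dvd_smult) (rule gcd_dvd1)
  then show "gcd p q dvd gcd (smult c p) q" by (rule gcd_greatest) (rule gcd_dvd2)
qed simp_all

lemma degree_normalize_poly: "degree (normalize p) = degree (p :: real poly)"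
proof (cases "p = 0")
  case False
  then show ?thesis
    using dvd_imp_degree_le[of p "normalize p"] dvd_imp_degree_le[of "normalize p" p] by simp
qed simp

lemma degree_div_dvd:
  assumes "g dvd p" "p \<noteq> (0 :: real poly)"
  shows "degree (p div g) = degree p - degree g"
proof -
  obtain k where k: "p = g * k" using assms(1) by (elim dvdE)
  then have "g \<noteq> 0" "k \<noteq> 0" using assms(2) by auto
  then show ?thesis by (simp add: k degree_mult_eq)
qed

lemma reflect_poly_rev: "reflect_poly p = rev_poly (degree p) p"
  by (intro poly_eqI) (simp add: coeff_reflect_poly coeff_rev_poly)

lemma cpoly_reflect_poly: "z \<noteq> 0 \<Longrightarrow> cpoly (reflect_poly p) z = z ^ degree p * cpoly p (inverse z)"
  by (simp add: reflect_poly_rev cpoly_rev_poly)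

text \<open>Reversal inverts the nonzero roots, and 0 is not a root of a reversed polynomial because
  the leading coefficient becomes the constant term.\<close>

lemma coprime_reflect_poly:
  assumes "p \<noteq> 0" "coprime p q" "q \<noteq> (0 :: real poly)"
  shows "coprime (reflect_poly p) (reflect_poly q)"
proof (subst coprime_iff_no_common_root)
  show "\<forall>z. cpoly (reflect_poly p) z = 0 \<longrightarrow> cpoly (reflect_poly q) z \<noteq> 0"
  proof (intro allI impI)
    fix z assume z: "cpoly (reflect_poly p) z = 0"
    then have z0: "z \<noteq> 0" using assms(1) by (intro notI) simp
    then have "cpoly p (inverse z) = 0" using z by (simp add: cpoly_reflect_poly)
    then show "cpoly (reflect_poly q) z \<noteq> 0"
      using z0 assms(1,2) coprime_iff_no_common_root[of p q] by (simp add: cpoly_reflect_poly)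
  qed
qed (use assms in simp)

lemma deg_f_eq:
  fixes a b :: "'n::{finite,linorder} rvec"
  shows "deg_f a b = CARD('n) - degree (gcd (monic_poly a) (monic_poly b))"
proof -
  have "gcd (smult (1/2) (monic_poly b)) (monic_poly a) = gcd (monic_poly a) (monic_poly b)"
    using gcd_smult_left[of "1/2" "monic_poly b" "monic_poly a"] by (simp add: gcd.commute[of "monic_poly b"])
  then show ?thesis
    by (simp add: deg_f_def ratfun_degree_def degree_div_dvd dvd_smult)
qed

text \<open>Reversal lowers the degree of a polynomial with root 0, so a_* or b_* alone may have
  smaller degree. After cancelling the gcd the two cofactors do not both vanish at 0, so the larger
  of the two reversed degrees is the full one.\<close>

lemma deg_phi_eq:
  fixes a b :: "'n::{finite,linorder} rvec"
  shows "deg_phi a b = CARD('n) - degree (gcd (monic_poly a) (monic_poly b))"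
proof -
  let ?q = "gcd (monic_poly a) (monic_poly b)"
  define a1 where "a1 = monic_poly a div ?q"
  define b1 where "b1 = monic_poly b div ?q"
  have a: "monic_poly a = ?q * a1" and b: "monic_poly b = ?q * b1"
    by (simp_all add: a1_def b1_def)
  have cop: "coprime a1 b1" unfolding a1_def b1_def by (intro div_gcd_coprime) simp
  have nz: "a1 \<noteq> 0" "b1 \<noteq> 0" using a b monic_poly_nz by (metis mult_zero_right)+
  have da: "degree a1 = CARD('n) - degree ?q" "degree b1 = CARD('n) - degree ?q"
    unfolding a1_def b1_def by (simp_all add: degree_div_dvd)
  have sa: "star_poly a = reflect_poly ?q * reflect_poly a1" and sb: "star_poly b = reflect_poly ?q * reflect_poly b1"
    unfolding star_poly_def reflect_poly_mult[symmetric] using a b by simp_all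
  have q0: "reflect_poly ?q \<noteq> 0" by simp
  have "gcd (smult (1/2) (star_poly b)) (star_poly a) = gcd (star_poly b) (star_poly a)"
    by (rule gcd_smult_left) simp
  also have "\<dots> = normalize (reflect_poly ?q * gcd (reflect_poly b1) (reflect_poly a1))"
    unfolding sa sb by (rule gcd_mult_left)
  also have "gcd (reflect_poly b1) (reflect_poly a1) = 1"
    using coprime_reflect_poly[OF nz(1) cop nz(2)] by (simp add: coprime_commute)
  finally have g: "gcd (smult (1/2) (star_poly b)) (star_poly a) = normalize (reflect_poly ?q)" by simp
  have "degree (smult (1/2) (star_poly b) div normalize (reflect_poly ?q)) = degree (reflect_poly b1)"
  proof (subst degree_div_dvd)
    show "normalize (reflect_poly ?q) dvd smult (1/2) (star_poly b)" by (simp add: sb dvd_smult)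
    show "smult (1/2) (star_poly b) \<noteq> 0" using nz q0 by (simp add: sb)
    show "degree (smult (1/2) (star_poly b)) - degree (normalize (reflect_poly ?q)) = degree (reflect_poly b1)"
      using nz q0 by (simp add: sb degree_mult_eq degree_normalize_poly)
  qed
  moreover have "degree (star_poly a div normalize (reflect_poly ?q)) = degree (reflect_poly a1)"
  proof (subst degree_div_dvd)
    show "normalize (reflect_poly ?q) dvd star_poly a" by (simp add: sa)
    show "star_poly a \<noteq> 0" using nz q0 by (simp add: sa)
    show "degree (star_poly a) - degree (normalize (reflect_poly ?q)) = degree (reflect_poly a1)"
      using nz q0 by (simp add: sa degree_mult_eq degree_normalize_poly)
  qed
  ultimately have "deg_phi a b = max (degree (reflect_poly b1)) (degree (reflect_poly a1))"
    by (simp add: deg_phi_def ratfun_degree_def g)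
  moreover have "coeff a1 0 \<noteq> 0 \<or> coeff b1 0 \<noteq> 0"
    using coprime_iff_no_common_root[OF nz(1), of b1] cop by (metis cpoly_at_0 of_real_0)
  ultimately show ?thesis
    using degree_reflect_poly_le[of a1] degree_reflect_poly_le[of b1] da by (auto simp: max_def)
qed

text \<open>From a b_* + b a_* = 2 r \<sigma> \<sigma>_*: the roots of a lie inside the disc and
  those of a_* and \<sigma>_* outside, so a is coprime to both and a common factor of a and b must
  divide \<sigma>, and conversely.\<close>

lemma disp_gcd:
  fixes \<sigma> :: "'n::{finite,linorder} rvec"
  assumes d: "disp_eq t g r \<sigma> P" and sym: "transpose P = P" and r: "0 < r"
    and s: "\<sigma> \<in> Schur" and a: "t - g \<in> Schur"
  shows "gcd (monic_poly (t - g)) (monic_poly (t + g)) = gcd (monic_poly (t - g)) (monic_poly \<sigma>)"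
proof -
  let ?a = "monic_poly (t - g)" and ?b = "monic_poly (t + g)" and ?s = "monic_poly \<sigma>"
  let ?A = "vpoly (bord 1 (t - g))" and ?B = "vpoly (bord 1 (t + g))" and ?S = "vpoly (bord 1 \<sigma>)"
  have id: "?a * ?B + ?b * ?A = smult (2 * r) (?s * ?S)"
  proof (rule cpoly_eq_on_circle)
    fix z :: complex assume "cmod z = 1"
    then have z: "z \<noteq> 0" "inverse z * z = 1" by (auto intro!: left_inverse)
    have 1: "cpoly ?A (inverse z) * cpoly ?B z + cpoly ?B (inverse z) * cpoly ?A z
        = 2 * of_real r * (cpoly ?S (inverse z) * cpoly ?S z)"
      using disp_generating[OF d sym, of "inverse z" z] unfolding z(2) by simp
    have "cpoly (?a * ?B + ?b * ?A) z
        = z ^ CARD('n) * (cpoly ?A (inverse z) * cpoly ?B z + cpoly ?B (inverse z) * cpoly ?A z)"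
      by (simp add: cpoly_add cpoly_mult cpoly_monic_poly[OF z(1)] algebra_simps)
    also have "\<dots> = cpoly (smult (2 * r) (?s * ?S)) z"
      unfolding 1 by (simp add: cpoly_smult cpoly_mult cpoly_monic_poly[OF z(1)])
    finally show "cpoly (?a * ?B + ?b * ?A) z = cpoly (smult (2 * r) (?s * ?S)) z" .
  qed
  have cop: "coprime ?a (vpoly (bord 1 c))" if "c \<in> Schur" for c :: "'n rvec"
    using a that unfolding coprime_iff_no_common_root[OF monic_poly_nz]
    by (auto simp: Schur_iff[of c] stable_vecs_iff) (auto simp: Schur_def less_imp_le)
  show ?thesis
  proof (rule associated_eqI)
    show "gcd ?a ?b dvd gcd ?a ?s"
    proof (rule gcd_greatest)
      have "gcd ?a ?b dvd smult (2 * r) (?s * ?S)" unfolding id[symmetric] by (intro dvd_add dvd_mult2) auto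
      then have "gcd ?a ?b dvd ?s * ?S" using r by (simp add: dvd_smult_iff)
      moreover have "coprime (gcd ?a ?b) ?S" using cop[OF s] by (meson coprime_divisors dvd_refl gcd_dvd1)
      ultimately show "gcd ?a ?b dvd ?s" by (simp add: coprime_dvd_mult_left_iff)
    qed simp
    show "gcd ?a ?s dvd gcd ?a ?b"
    proof (rule gcd_greatest)
      have "gcd ?a ?s dvd smult (2 * r) (?s * ?S) - ?a * ?B" by (intro dvd_diff dvd_smult dvd_mult2) auto
      then have "gcd ?a ?s dvd ?b * ?A" unfolding id[symmetric] by simp
      moreover have "coprime (gcd ?a ?s) ?A" using cop[OF a] by (meson coprime_divisors dvd_refl gcd_dvd1)
      ultimately show "gcd ?a ?s dvd ?b" by (simp add: coprime_dvd_mult_left_iff)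
    qed simp
  qed simp_all
qed

subsection \<open>The rank of a Gramian\<close>

definition multiples :: "real poly \<Rightarrow> 'n::{finite,linorder} rvec set" where
  "multiples q = {v. q dvd rpol v}"

lemma rpol_0 [simp]: "rpol 0 = 0"
  by (simp add: rpol_def)

lemma subspace_multiples: "subspace (multiples q)"
  unfolding multiples_def subspace_def by (auto simp: rpol_add rpol_scaleR dvd_smult)

text \<open>Multiplication by q is an isomorphism from the polynomials of degree below n - deg q
  onto the multiples of q of degree below n.\<close>

lemma dim_multiples:
  assumes q: "q \<noteq> 0" "degree q \<le> CARD('n)"
  shows "dim (multiples q :: 'n::{finite,linorder} rvec set) = CARD('n) - degree q"
proof -
  \<comment> \<open>Position i carries the power n - 1 - \<open>idx i\<close>, so these are the
    powers below n - deg q.\<close>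
  define I where "I = {i::'n. degree q \<le> idx i}"
  define D where "D = {v :: 'n rvec. \<forall>i. i \<notin> I \<longrightarrow> v $ i = 0}"
  define \<psi> where "\<psi> v = (SOME w :: 'n rvec. rpol w = rpol v * q)" for v :: "'n rvec"
  have Ddeg: "rpol v = 0 \<or> degree (rpol v) + degree q < CARD('n)" if "v \<in> D" for v
  proof (cases "rpol v = 0")
    case False
    let ?k = "degree (rpol v)"
    have k: "?k < CARD('n)" by (rule degree_rpol_less)
    then obtain i :: 'n where i: "idx i = CARD('n) - 1 - ?k" using exists_idx[where 'n='n, of "CARD('n) - 1 - ?k"] by auto
    then have "CARD('n) - 1 - idx i = ?k" using k by simp
    then have "v $ i \<noteq> 0" using False nth_rpol[of v i] by simp
    then have "i \<in> I" using that unfolding D_def by blast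
    then show ?thesis using i k by (auto simp: I_def)
  qed simp
  have D\<psi>: "rpol (\<psi> v) = rpol v * q" if "v \<in> D" for v
  proof -
    have "degree (rpol v * q) < CARD('n)" using Ddeg[OF that] degree_mult_le[of "rpol v" q] by auto
    then have "\<exists>w :: 'n rvec. rpol w = rpol v * q" by (rule rpol_surj)
    then show ?thesis unfolding \<psi>_def by (rule someI_ex)
  qed
  have sD: "subspace D" unfolding D_def subspace_def by auto
  obtain f where f: "linear f" "\<And>v. v \<in> D \<Longrightarrow> f v = \<psi> v"
  proof -
    \<comment> \<open>\<psi> is meaningful only on D; composing with this projection makes it linear
      on the whole space.\<close>
    define pr where "pr v = (\<chi> i. if i \<in> I then v $ i else 0)" for v :: "'n rvec"
    have inD: "pr v \<in> D" for v by (simp add: D_def pr_def)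
    have pr: "pr (u + v) = pr u + pr v" "pr (c *\<^sub>R u) = c *\<^sub>R pr u" for u v c
      by (simp_all add: pr_def vec_eq_iff)
    have rp: "rpol (\<psi> (pr v)) = rpol (pr v) * q" for v by (rule D\<psi>[OF inD])
    have "linear (\<lambda>v. \<psi> (pr v))"
    proof (rule linearI)
      fix u v :: "'n rvec" and c :: real
      have "rpol (\<psi> (pr (u + v))) = rpol (\<psi> (pr u) + \<psi> (pr v))"
        unfolding rpol_add rp by (simp only: pr rpol_add distrib_right)
      then show "\<psi> (pr (u + v)) = \<psi> (pr u) + \<psi> (pr v)" by (simp only: rpol_inject)
      have "rpol (\<psi> (pr (c *\<^sub>R u))) = rpol (c *\<^sub>R \<psi> (pr u))"
        unfolding rpol_scaleR rp by (simp only: pr rpol_scaleR mult_smult_left)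
      then show "\<psi> (pr (c *\<^sub>R u)) = c *\<^sub>R \<psi> (pr u)" by (simp only: rpol_inject)
    qed
    moreover have "\<psi> (pr v) = \<psi> v" if "v \<in> D" for v
    proof -
      have "pr v = v" using that by (auto simp: D_def pr_def vec_eq_iff)
      then show ?thesis by simp
    qed
    ultimately show ?thesis using that by blast
  qed
  have "f ` D = multiples q"
  proof (intro set_eqI iffI)
    fix w assume "w \<in> f ` D"
    then show "w \<in> multiples q" using f(2) D\<psi> by (auto simp: multiples_def)
  next
    fix w :: "'n rvec" assume w: "w \<in> multiples q"
    then obtain k where k: "rpol w = q * k" by (auto simp: multiples_def)
    show "w \<in> f ` D"
    proof (cases "k = 0")
      case True
      then have "w = 0" using k rpol_inject[of w 0] by (simp add: rpol_def)
      then show ?thesis using linear_0[OF f(1)] subspace_0[OF sD] by (metis imageI)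
    next
      case False
      have dk: "degree q + degree k < CARD('n)"
        using degree_rpol_less[of w] False q(1) by (simp add: k degree_mult_eq)
      then obtain v :: "'n rvec" where v: "rpol v = k" using rpol_surj[where 'n='n, of k] by auto
      have "v \<in> D" unfolding D_def
      proof (clarify)
        fix i :: 'n assume "i \<notin> I"
        then have "degree k < CARD('n) - 1 - idx i" using dk by (simp add: I_def)
        then show "v $ i = 0" using nth_rpol[of v i] v by (simp add: coeff_eq_0)
      qed
      moreover have "f v = w"
      proof -
        have "rpol (f v) = rpol w" using f(2)[OF \<open>v \<in> D\<close>] D\<psi>[OF \<open>v \<in> D\<close>] v k by (simp add: mult.commute)
        then show ?thesis by (simp only: rpol_inject)
      qed
      ultimately show ?thesis by blast
    qed
  qed
  moreover have "dim (f ` D) = dim D"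
  proof (rule dim_image_eq[OF f(1)])
    have "inj_on f D"
    proof (rule inj_onI)
      fix u v assume uv: "u \<in> D" "v \<in> D" "f u = f v"
      then have "rpol u * q = rpol v * q" using D\<psi> f(2) by metis
      then show "u = v" using q(1) by (simp add: rpol_inject)
    qed
    then show "inj_on f (span D)" using sD by (simp add: span_eq_iff[THEN iffD2])
  qed
  moreover have "dim D = card I"
    unfolding D_def using dim_substandard_cart[where 'a=real and d=I] by (simp add: dim_vec_eq)
  moreover have "card I = CARD('n) - degree q"
  proof -
    have "idx ` I = {degree q..<CARD('n)}"
      unfolding I_def using exists_idx[where 'n='n] idx_bound[where 'k='n] by force
    then have "card (idx ` I) = CARD('n) - degree q" by simp
    then show ?thesis using card_image[of idx I] inj_on_subset[OF idx_inj] by (metis subset_UNIV)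
  qed
  ultimately show ?thesis by metis
qed

text \<open>The range of a symmetric matrix is the orthogonal complement of its kernel.\<close>

lemma symmetric_range:
  fixes P :: "real^'k^'k"
  assumes sym: "transpose P = P" and W: "subspace W"
    and ker: "\<And>x. P *v x = 0 \<longleftrightarrow> (\<forall>v\<in>W. x \<bullet> v = 0)"
  shows "range ((*v) P) = W"
proof -
  have sr: "subspace (range ((*v) P))"
    by (intro linear_subspace_image matrix_vector_mul_linear subspace_UNIV)
  have "(range ((*v) P))\<^sup>\<bottom> = W\<^sup>\<bottom>"
  proof (intro set_eqI)
    fix x
    have "x \<in> (range ((*v) P))\<^sup>\<bottom> \<longleftrightarrow> (\<forall>y. x \<bullet> (P *v y) = 0)"
      by (auto simp: orthogonal_comp_def orthogonal_def inner_commute)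
    also have "\<dots> \<longleftrightarrow> (\<forall>y. (P *v x) \<bullet> y = 0)"
      using inner_transpose_vec[of P x] sym by simp
    also have "\<dots> \<longleftrightarrow> P *v x = 0" by (metis inner_eq_zero_iff inner_zero_left)
    also have "\<dots> \<longleftrightarrow> x \<in> W\<^sup>\<bottom>" unfolding ker
      by (auto simp: orthogonal_comp_def orthogonal_def inner_commute)
    finally show "x \<in> (range ((*v) P))\<^sup>\<bottom> \<longleftrightarrow> x \<in> W\<^sup>\<bottom>" .
  qed
  from arg_cong[OF this, of orthogonal_comp] show ?thesis
    by (simp only: orthogonal_comp_self[OF sr] orthogonal_comp_self[OF W])
qed

text \<open>The range of P is the reachable space of (\<open>Gam a\<close>, a - \<sigma>). Modulo
  a(z) this is the ideal generated by a - \<sigma>, that is, the multiples of gcd(a,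
  \<sigma>).\<close>

lemma rank_gramian:
  fixes a \<sigma> :: "'n::{finite,linorder} rvec"
  assumes P: "P = Gam a ** P ** transpose (Gam a) + r *\<^sub>R outer (a - \<sigma>) (a - \<sigma>)"
    and sym: "transpose P = P" and psd: "psdef P" and r: "0 < r" and a: "a \<in> Schur"
  shows "rank P = CARD('n) - degree (gcd (monic_poly a) (monic_poly \<sigma>))"
proof -
  let ?q = "gcd (monic_poly a) (monic_poly \<sigma>)" and ?A = "Gam a" and ?w = "a - \<sigma>"
  let ?W = "multiples ?q :: 'n rvec set"
  have w: "rpol ?w = monic_poly a - monic_poly \<sigma>" by (simp add: monic_poly_rpol rpol_diff)
  have ker: "P *v x = 0 \<longleftrightarrow> (\<forall>v\<in>?W. x \<bullet> v = 0)" for x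
  proof
    assume Px: "P *v x = 0"
    let ?t = "\<lambda>k. ((*v) (transpose ?A) ^^ k) x"
    have t0: "?t k \<bullet> (P *v ?t k) = 0 \<and> (k > 0 \<longrightarrow> ?t (k - 1) \<bullet> ?w = 0)" for k
    proof (induction k)
      case (Suc k)
      have e: "0 = ?t (Suc k) \<bullet> (P *v ?t (Suc k)) + r * (?t k \<bullet> ?w)\<^sup>2"
        using gramian_quad[OF P, of "?t k"] Suc by (simp del: transpose_matrix_vector)
      moreover have "0 \<le> ?t (Suc k) \<bullet> (P *v ?t (Suc k))" using psd unfolding psdef_def by blast
      moreover have "0 \<le> r * (?t k \<bullet> ?w)\<^sup>2" using r by simp
      ultimately have "?t (Suc k) \<bullet> (P *v ?t (Suc k)) = 0" "r * (?t k \<bullet> ?w)\<^sup>2 = 0" by linarith+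
      then show ?case using r by (simp del: transpose_matrix_vector funpow.simps)
    qed (simp add: Px)
    have xw: "x \<bullet> (((*v) ?A ^^ k) ?w) = 0" for k
      using t0[of "Suc k"] transpose_iter_inner[where A="?A" and k=k and x=x and y="?w"] by simp
    show "\<forall>v\<in>?W. x \<bullet> v = 0"
    proof
      fix v assume "v \<in> ?W"
      then obtain m where m: "rpol v = ?q * m" by (auto simp: multiples_def)
      define s f where "s = snd (bezout_coefficients (monic_poly a) (monic_poly \<sigma>))"
        and "f = fst (bezout_coefficients (monic_poly a) (monic_poly \<sigma>))"
      have bz: "f * monic_poly a + s * monic_poly \<sigma> = ?q"
        by (simp add: s_def f_def bezout_coefficients_fst_snd)
      \<comment> \<open>From q = f a + s \<sigma> and \<sigma> = a - (a - \<sigma>): modulo a, the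
        multiple q m is - s m (a - \<sigma>), a combination of the iterates of a - \<sigma>.\<close>
      define c where "c = - (s * m)"
      have "rpol v = monic_poly a * (f * m + s * m) + c * rpol ?w"
        unfolding m bz[symmetric] w c_def by (simp add: algebra_simps)
      then have "rpol v mod monic_poly a = c * rpol ?w mod monic_poly a" by (simp only: mod_mult_self4)
      then have "rpol v = c * rpol ?w mod monic_poly a"
        using degree_rpol_less[of v] by (simp add: mod_poly_less)
      also have "c * rpol ?w = (\<Sum>l\<le>degree c. smult (coeff c l) (monom 1 l * rpol ?w))"
      proof -
        have "c * rpol ?w = (\<Sum>l\<le>degree c. monom (coeff c l) l) * rpol ?w" by (simp only: poly_as_sum_of_monoms)
        then show ?thesis by (simp add: sum_distrib_right smult_monom flip: mult_smult_left)
      qed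
      also have "\<dots> mod monic_poly a = (\<Sum>l\<le>degree c. smult (coeff c l) (rpol (((*v) ?A ^^ l) ?w)))"
        by (simp add: mod_sum_real mod_smult_left rpol_Gam_power)
      also have "\<dots> = rpol (\<Sum>l\<le>degree c. coeff c l *\<^sub>R (((*v) ?A ^^ l) ?w))"
      proof -
        have "rpol (\<Sum>l\<in>S. h l) = (\<Sum>l\<in>S. rpol (h l))" if "finite S" for S and h :: "nat \<Rightarrow> 'n rvec"
          using that by (induction S rule: finite_induct) (auto simp: rpol_add)
        then show ?thesis by (simp add: rpol_scaleR)
      qed
      finally have "v = (\<Sum>l\<le>degree c. coeff c l *\<^sub>R (((*v) ?A ^^ l) ?w))" by (simp only: rpol_inject)
      then show "x \<bullet> v = 0" by (simp add: inner_sum_right xw)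
    qed
  next
    assume x: "\<forall>v\<in>?W. x \<bullet> v = 0"
    let ?t = "\<lambda>k. ((*v) (transpose ?A) ^^ k) x"
    have tW: "\<forall>v\<in>?W. ?t k \<bullet> v = 0" for k
    proof (induction k)
      case (Suc k)
      show ?case
      proof
        fix v assume "v \<in> ?W"
        then have "?A *v v \<in> ?W" by (auto simp: multiples_def rpol_Gam intro!: dvd_mod)
        moreover have "?t (Suc k) \<bullet> v = ?t k \<bullet> (?A *v v)" by (simp add: inner_transpose_vec del: transpose_matrix_vector)
        ultimately show "?t (Suc k) \<bullet> v = 0" using Suc by simp
      qed
    qed (use x in simp)
    have "?w \<in> ?W" by (simp add: multiples_def w)
    then have "?t k \<bullet> ?w = 0" for k using tW by blast
    then have st: "x \<bullet> (P *v x) = ?t k \<bullet> (P *v ?t k)" for k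
    proof (induction k)
      case (Suc k)
      then show ?case using gramian_quad[OF P, of "?t k"] by (simp del: transpose_matrix_vector)
    qed simp
    have "(\<lambda>k. ?t k \<bullet> (P *v ?t k)) \<longlonglongrightarrow> 0 \<bullet> (P *v 0)"
      by (intro tendsto_inner transpose_iter_tendsto Gam_power_tendsto[OF a]
          bounded_linear.tendsto[OF matrix_vector_mul_bounded_linear])
    then have "x \<bullet> (P *v x) = 0" unfolding st[symmetric] by (simp add: LIMSEQ_const_iff)
    then show "P *v x = 0" by (rule psdef_null[OF sym psd])
  qed
  have "range ((*v) P) = ?W" by (rule symmetric_range[OF sym subspace_multiples ker])
  moreover have "degree ?q \<le> CARD('n)" using dvd_imp_degree_le[of ?q "monic_poly a"] by simp
  ultimately show ?thesis by (simp add: rank_dim_range dim_multiples)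
qed

subsection \<open>Complexification of real matrices\<close>

definition cvec :: "real^'k \<Rightarrow> complex^'k" where "cvec v = (\<chi> i. of_real (v $ i))"

definition cmat :: "real^'k^'l \<Rightarrow> complex^'k^'l" where "cmat A = (\<chi> i j. of_real (A $ i $ j))"

lemma cmat_mult: "cmat (A ** B) = cmat A ** cmat B"
  by (simp add: cmat_def matrix_matrix_mult_def vec_eq_iff)

lemma cmat_cvec: "cmat A *v cvec v = cvec (A *v v)"
  by (simp add: cmat_def cvec_def matrix_vector_mult_def vec_eq_iff)

lemma cmat_add: "cmat (A + B) = cmat A + cmat B"
  by (simp add: cmat_def vec_eq_iff)

lemma cmat_mat: "cmat (mat x) = mat (of_real x)"
  by (simp add: cmat_def mat_def vec_eq_iff)

lemma cmat_transpose: "cmat (transpose A) = ctranspose (cmat A)"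
  by (simp add: cmat_def ctranspose_def transpose_def vec_eq_iff)

lemma cvec_inject: "cvec u = cvec v \<longleftrightarrow> u = v"
  by (simp add: cvec_def vec_eq_iff)

lemma cvec_nth: "cvec v $ i = of_real (v $ i)"
  by (simp add: cvec_def)

text \<open>Real vectors suffice because they contain the standard basis; identities over the
  complex numbers can thus be checked on real polynomials.\<close>

lemma cmat_eqI:
  assumes "\<And>v. A *v cvec v = B *v cvec v"
  shows "A = B"
proof -
  have "A $ i $ j = B $ i $ j" for i j
  proof -
    have "(M *v cvec (axis j 1)) $ i = M $ i $ j" for M :: "complex^'a^'b"
    proof -
      have "(M *v cvec (axis j 1)) $ i = (\<Sum>k\<in>UNIV. if k = j then M $ i $ k else 0)"
        by (simp add: matrix_vector_mult_def cvec_def axis_def if_distrib cong: if_cong)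
      then show ?thesis by simp
    qed
    then show ?thesis using assms by metis
  qed
  then show ?thesis by (simp add: vec_eq_iff)
qed

lemma ctranspose_mult: "ctranspose (A ** B) = ctranspose B ** ctranspose A"
  by (simp add: ctranspose_def matrix_matrix_mult_def vec_eq_iff mult.commute)

lemma ctranspose_ctranspose [simp]: "ctranspose (ctranspose A) = A"
  by (simp add: ctranspose_def vec_eq_iff)

text \<open>The coefficients are real, so real and imaginary part solve the equation
  separately.\<close>

lemma complex_stein_unique_0:
  fixes A :: "real^'k^'k" and Y :: "complex^'k^'k"
  assumes lim: "\<And>x. (\<lambda>k. ((*v) A ^^ k) x) \<longlonglongrightarrow> 0" and Y: "Y = cmat A ** Y ** ctranspose (cmat A)"
  shows "Y = 0"
proof -
  define R where "R = ((\<chi> i j. Re (Y $ i $ j)) :: real^'k^'k)"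
  define I where "I = ((\<chi> i j. Im (Y $ i $ j)) :: real^'k^'k)"
  have e: "Y $ i $ j = (\<Sum>k\<in>UNIV. (\<Sum>l\<in>UNIV. of_real (A $ i $ l) * Y $ l $ k) * of_real (A $ j $ k))" for i j
    by (subst Y) (simp add: matrix_matrix_mult_def ctranspose_def cmat_def)
  have "R = A ** R ** transpose A"
    unfolding vec_eq_iff
    by (intro allI, subst (1) R_def, simp, subst e) (simp add: R_def matrix_matrix_mult_def transpose_def)
  then have "R = 0" by (rule stein_unique_0[OF lim])
  moreover have "I = A ** I ** transpose A"
    unfolding vec_eq_iff
    by (intro allI, subst (1) I_def, simp, subst e) (simp add: I_def matrix_matrix_mult_def transpose_def)
  then have "I = 0" by (rule stein_unique_0[OF lim])
  ultimately have "Re (Y $ i $ j) = 0 \<and> Im (Y $ i $ j) = 0" for i j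
    unfolding R_def I_def by (simp add: vec_eq_iff)
  then show ?thesis by (simp add: vec_eq_iff complex_eq_iff)
qed

definition cform :: "complex^'k^'k \<Rightarrow> complex^'k \<Rightarrow> complex" where
  "cform A x = (\<Sum>i\<in>UNIV. \<Sum>j\<in>UNIV. cnj (x $ i) * A $ i $ j * x $ j)"

lemma cform_altdef: "cform A x = (\<Sum>i\<in>UNIV. cnj (x $ i) * (A *v x) $ i)"
  by (simp add: cform_def matrix_vector_mult_def sum_distrib_left mult.assoc)

lemma cform_congruence: "cform (V ** S ** ctranspose V) x = cform S (ctranspose V *v x)"
proof -
  have adj: "(\<Sum>i\<in>UNIV. cnj (x $ i) * (V *v y) $ i) = (\<Sum>i\<in>UNIV. cnj ((ctranspose V *v x) $ i) * y $ i)" for y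
  proof -
    have "(\<Sum>i\<in>UNIV. cnj (x $ i) * (V *v y) $ i) = (\<Sum>i\<in>UNIV. \<Sum>j\<in>UNIV. cnj (x $ i) * V $ i $ j * y $ j)"
      by (simp add: matrix_vector_mult_def sum_distrib_left mult.assoc)
    also have "\<dots> = (\<Sum>j\<in>UNIV. \<Sum>i\<in>UNIV. cnj (x $ i) * V $ i $ j * y $ j)" by (rule sum.swap)
    also have "\<dots> = (\<Sum>j\<in>UNIV. cnj ((ctranspose V *v x) $ j) * y $ j)"
      by (simp add: matrix_vector_mult_def ctranspose_def sum_distrib_right sum_distrib_left mult_ac)
    finally show ?thesis .
  qed
  show ?thesis
    unfolding cform_altdef matrix_vector_mul_assoc[symmetric] by (rule adj)
qed

lemma cform_cmat:
  fixes S :: "real^'k^'k"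
  assumes "transpose S = S"
  shows "Re (cform (cmat S) y) = (\<chi> i. Re (y $ i)) \<bullet> (S *v (\<chi> i. Re (y $ i))) + (\<chi> i. Im (y $ i)) \<bullet> (S *v (\<chi> i. Im (y $ i)))"
  by (simp add: cform_def cmat_def inner_vec_def matrix_vector_mult_def sum_distrib_left sum.distrib[symmetric] algebra_simps)

text \<open>Congruence by an invertible matrix preserves definiteness, and at a + i b the Hermitian
  form of a real symmetric S is the sum of its values at a and b.\<close>

lemma posdef_congruence:
  fixes S :: "real^'k^'k" and V :: "complex^'k^'k"
  assumes S: "transpose S = S" and V: "invertible V"
  shows "hermitian_posdef (V ** cmat S ** ctranspose V) \<longleftrightarrow> pdef S"
proof -
  let ?H = "V ** cmat S ** ctranspose V"
  obtain V' where V': "V ** V' = mat 1" "V' ** V = mat 1" using V unfolding invertible_def by blast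
  have ct1: "ctranspose (mat 1 :: complex^'k^'k) = mat 1"
    by (simp add: ctranspose_def mat_def vec_eq_iff)
  have herm: "ctranspose ?H = ?H"
    using S by (simp add: ctranspose_mult matrix_mul_assoc flip: cmat_transpose)
  have inv1: "ctranspose V *v (ctranspose V' *v y) = y" for y
    using V'(2) by (simp add: matrix_vector_mul_assoc ct1 flip: ctranspose_mult)
  have inv2: "ctranspose V' *v (ctranspose V *v y) = y" for y
    using V'(1) by (simp add: matrix_vector_mul_assoc ct1 flip: ctranspose_mult)
  have "hermitian_posdef ?H \<longleftrightarrow> (\<forall>x. x \<noteq> 0 \<longrightarrow> 0 < Re (cform (cmat S) (ctranspose V *v x)))"
    unfolding hermitian_posdef_def cform_def[symmetric] cform_congruence using herm by simp
  also have "\<dots> \<longleftrightarrow> (\<forall>y. y \<noteq> 0 \<longrightarrow> 0 < Re (cform (cmat S) y))"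
    using inv1 inv2 by (metis matrix_vector_mult_0_right)
  also have "\<dots> \<longleftrightarrow> pdef S"
  proof
    assume a: "\<forall>y. y \<noteq> 0 \<longrightarrow> 0 < Re (cform (cmat S) y)"
    show "pdef S" unfolding pdef_def
    proof (intro allI impI)
      fix x :: "real^'k" assume "x \<noteq> 0"
      then have "cvec x \<noteq> 0" by (simp add: cvec_def vec_eq_iff)
      then have "0 < Re (cform (cmat S) (cvec x))" using a by blast
      moreover have "(\<chi> i. Re (cvec x $ i)) = x" "(\<chi> i. Im (cvec x $ i)) = 0"
        by (simp_all add: cvec_def vec_eq_iff)
      ultimately show "0 < x \<bullet> (S *v x)" by (simp add: cform_cmat[OF S])
    qed
  next
    assume p: "pdef S"
    show "\<forall>y. y \<noteq> 0 \<longrightarrow> 0 < Re (cform (cmat S) y)"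
    proof (intro allI impI)
      fix y :: "complex^'k" assume y: "y \<noteq> 0"
      define a b where "a = (\<chi> i. Re (y $ i))" and "b = (\<chi> i. Im (y $ i))"
      have "a \<noteq> 0 \<or> b \<noteq> 0" using y by (auto simp: a_def b_def vec_eq_iff complex_eq_iff)
      moreover have "0 \<le> x \<bullet> (S *v x)" for x
        using p by (cases "x = 0") (auto simp: pdef_def less_imp_le)
      ultimately have "0 < a \<bullet> (S *v a) + b \<bullet> (S *v b)"
        using p unfolding pdef_def by (metis add_nonneg_pos add_pos_nonneg)
      then show "0 < Re (cform (cmat S) y)" by (simp add: cform_cmat[OF S] a_def b_def)
    qed
  qed
  finally show ?thesis .
qed

subsection \<open>Taylor coefficients of polynomials at the nodes\<close>

text \<open>The number p^(k)(x)/k!, read off algebraically after translating x to 0.\<close>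

definition tc :: "complex poly \<Rightarrow> complex \<Rightarrow> nat \<Rightarrow> complex" where
  "tc p x k = coeff (pcompose p [:x, 1:]) k"

lemma tc_mult: "tc (p * q) x k = (\<Sum>l\<le>k. tc p x l * tc q x (k - l))"
  by (simp add: tc_def pcompose_mult coeff_mult)

lemma tc_add: "tc (p + q) x k = tc p x k + tc q x k"
  by (simp add: tc_def pcompose_add)

lemma tc_diff: "tc (p - q) x k = tc p x k - tc q x k"
  by (simp add: tc_def pcompose_diff)

lemma tc_smult: "tc (smult c p) x k = c * tc p x k"
  by (simp add: tc_def pcompose_smult)

lemma tc_0 [simp]: "tc 0 x k = 0" by (simp add: tc_def)

lemma tc_1: "tc 1 x k = (if k = 0 then 1 else 0)"
  by (simp add: tc_def pcompose_1 coeff_1)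

lemma pcompose_pow: "pcompose (p ^ n) q = pcompose p q ^ n"
  by (induction n) (simp_all add: pcompose_mult pcompose_1)

text \<open>Translation by x is a ring automorphism that carries z - x to z.\<close>

lemma tc_zero_iff: "(\<forall>k<n. tc p x k = 0) \<longleftrightarrow> [:- x, 1:] ^ n dvd p"
proof -
  have mp: "pcompose (monom 1 n) [:- x, 1:] = [:- x, 1:] ^ n"
    by (simp add: monom_altdef pcompose_pow pcompose_pCons)
  have bk: "pcompose (pcompose p [:x, 1:]) [:- x, 1:] = p"
    by (simp add: pcompose_assoc[symmetric] pcompose_pCons)
  have forth: "pcompose ([:- x, 1:] ^ n) [:x, 1:] = monom 1 n"
    by (simp add: monom_altdef pcompose_pow pcompose_pCons)
  have "(\<forall>k<n. tc p x k = 0) \<longleftrightarrow> monom 1 n dvd pcompose p [:x, 1:]"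
    by (simp add: tc_def monom_1_dvd_iff')
  also have "\<dots> \<longleftrightarrow> [:- x, 1:] ^ n dvd p"
  proof
    assume "monom 1 n dvd pcompose p [:x, 1:]"
    then obtain k where "pcompose p [:x, 1:] = monom 1 n * k" by (elim dvdE)
    then have "p = [:- x, 1:] ^ n * pcompose k [:- x, 1:]"
      using bk by (simp add: pcompose_mult mp)
    then show "[:- x, 1:] ^ n dvd p" by simp
  next
    assume "[:- x, 1:] ^ n dvd p"
    then obtain k where "p = [:- x, 1:] ^ n * k" by (elim dvdE)
    then show "monom 1 n dvd pcompose p [:x, 1:]" by (simp add: pcompose_mult forth)
  qed
  finally show ?thesis .
qed

lemma tc_cnj: "tc (map_poly cnj p) (cnj x) k = cnj (tc p x k)"
proof -
  have "map_poly cnj (pcompose p q) = pcompose (map_poly cnj p) (map_poly cnj q)" for q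
  proof (induction p)
    case (pCons a p)
    have m: "map_poly cnj (u * v) = map_poly cnj u * map_poly cnj v" for u v
      by (intro poly_eqI) (simp add: coeff_map_poly coeff_mult)
    have a: "map_poly cnj (u + v) = map_poly cnj u + map_poly cnj v" for u v
      by (intro poly_eqI) (simp add: coeff_map_poly)
    show ?case using pCons by (simp add: pcompose_pCons map_poly_pCons m a)
  qed simp
  from this[of "[:x, 1:]"] show ?thesis
    by (simp add: tc_def map_poly_pCons coeff_map_poly flip: coeff_map_poly)
qed

lemma prod_power_dvd:
  fixes z :: "nat \<Rightarrow> complex"
  assumes "inj_on z {..m}" "\<And>j. j \<le> m \<Longrightarrow> [:- z j, 1:] ^ \<nu> j dvd p"
  shows "(\<Prod>j\<le>m. [:- z j, 1:] ^ \<nu> j) dvd p"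
  using assms
proof (induction m)
  case (Suc m)
  have "(\<Prod>j\<le>m. [:- z j, 1:] ^ \<nu> j) dvd p"
    using Suc.prems by (intro Suc.IH) (auto intro: inj_on_subset)
  moreover have "coprime (\<Prod>j\<le>m. [:- z j, 1:] ^ \<nu> j) ([:- z (Suc m), 1:] ^ \<nu> (Suc m))"
  proof (intro prod_coprime_left)
    fix j assume "j \<in> {..m}"
    then have ne: "z j \<noteq> z (Suc m)" using inj_onD[OF Suc.prems(1), of j "Suc m"] by auto
    have "coprime [:- z j, 1:] [:- z (Suc m), 1:]"
    proof (rule coprimeI)
      fix d assume "d dvd [:- z j, 1:]" "d dvd [:- z (Suc m), 1:]"
      then have "d dvd [:- z j, 1:] - [:- z (Suc m), 1:]" by (rule dvd_diff)
      then have "d dvd [:z (Suc m) - z j:]" by simp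
      moreover have "is_unit [:z (Suc m) - z j:]" using ne by (simp add: is_unit_const_poly_iff dvd_field_iff)
      ultimately show "is_unit d" by (rule dvd_trans)
    qed
    then show "coprime ([:- z j, 1:] ^ \<nu> j) ([:- z (Suc m), 1:] ^ \<nu> (Suc m))" by (simp add: coprime_power_left_iff coprime_power_right_iff)
  qed
  ultimately show ?case using Suc.prems(2)[of "Suc m"] by (simp add: divides_mult)
qed simp

subsection \<open>The interpolation data\<close>

locale nodes =
  fixes m :: nat and z :: "nat \<Rightarrow> complex" and \<nu> :: "nat \<Rightarrow> nat" and T :: "'n::{finite,linorder} itself"
  assumes inj_z: "inj_on z {..m}"
    and z_0: "z 0 = 0"
    and z_disc: "\<forall>j\<le>m. cmod (z j) < 1"
    and \<nu>_pos: "\<forall>j\<le>m. 1 \<le> \<nu> j"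
    and z_conj: "\<forall>j\<le>m. \<exists>j'\<le>m. z j' = cnj (z j) \<and> \<nu> j' = \<nu> j"
    and card_n: "CARD('n) = (\<Sum>j\<le>m. \<nu> j) - 1"
begin

lemma total: "offset \<nu> (Suc m) = Suc CARD('n)"
proof -
  have "\<nu> 0 \<le> (\<Sum>j\<le>m. \<nu> j)" by (rule member_le_sum) auto
  then have "1 \<le> (\<Sum>j\<le>m. \<nu> j)" using \<nu>_pos by (meson le0 order_trans)
  then show ?thesis using card_n by (simp add: offset_def lessThan_Suc_atMost)
qed

lemma offset_Suc: "offset \<nu> (Suc j) = offset \<nu> j + \<nu> j"
  by (simp add: offset_def)

lemma offset_mono: "i \<le> j \<Longrightarrow> offset \<nu> i \<le> offset \<nu> j"
  unfolding offset_def by (intro sum_mono2) auto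

definition ix :: "nat \<Rightarrow> nat \<Rightarrow> 'n option" where
  "ix j k = idx_inv (offset \<nu> j + k)"

lemma idx_ix: "j \<le> m \<Longrightarrow> k < \<nu> j \<Longrightarrow> idx (ix j k) = offset \<nu> j + k"
proof -
  assume j: "j \<le> m" "k < \<nu> j"
  have "offset \<nu> j + k < offset \<nu> (Suc j)" using j by (simp add: offset_Suc)
  also have "\<dots> \<le> offset \<nu> (Suc m)" using j by (intro offset_mono) simp
  finally show ?thesis unfolding ix_def by (intro idx_idx_inv) (simp add: total card_option)
qed

lemma block_ix: "j \<le> m \<Longrightarrow> k < \<nu> j \<Longrightarrow> block \<nu> (ix j k) = j"
  unfolding block_def
proof (rule Least_equality)
  assume j: "j \<le> m" "k < \<nu> j"
  show "idx (ix j k) < offset \<nu> (Suc j)" using j by (simp add: idx_ix offset_Suc)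
  fix i assume "idx (ix j k) < offset \<nu> (Suc i)"
  then have "offset \<nu> j < offset \<nu> (Suc i)" using j by (simp add: idx_ix)
  then show "j \<le> i" using offset_mono[of "Suc i" j] by (meson not_less not_less_eq_eq)
qed

lemma loc_ix: "j \<le> m \<Longrightarrow> k < \<nu> j \<Longrightarrow> loc \<nu> (ix j k) = k"
  by (simp add: loc_def block_ix idx_ix)

lemma block_loc:
  fixes i :: "'n option"
  shows "block \<nu> i \<le> m" "loc \<nu> i < \<nu> (block \<nu> i)" "ix (block \<nu> i) (loc \<nu> i) = i"
proof -
  let ?P = "\<lambda>j. idx i < offset \<nu> (Suc j)"
  have Pm: "?P m" using idx_bound[of i] by (simp add: total card_option)
  then have P: "?P (block \<nu> i)" unfolding block_def by (rule LeastI)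
  show b: "block \<nu> i \<le> m" unfolding block_def using Pm by (rule Least_le)
  have lo: "offset \<nu> (block \<nu> i) \<le> idx i"
  proof (cases "block \<nu> i")
    case 0
    then show ?thesis by (simp add: offset_def)
  next
    case (Suc j)
    then have "\<not> ?P j" unfolding block_def by (intro not_less_Least) simp
    then show ?thesis using Suc by simp
  qed
  show "loc \<nu> i < \<nu> (block \<nu> i)" using P lo by (simp add: loc_def offset_Suc)
  show "ix (block \<nu> i) (loc \<nu> i) = i" using lo by (simp add: ix_def loc_def)
qed

lemma sum_block:
  fixes g :: "nat \<Rightarrow> complex"
  assumes b: "b \<le> m"
  shows "(\<Sum>c\<in>(UNIV::'n option set). if block \<nu> c = b then g (loc \<nu> c) else 0) = (\<Sum>l<\<nu> b. g l)"
proof -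
  have "(\<Sum>c\<in>(UNIV::'n option set). if block \<nu> c = b then g (loc \<nu> c) else 0) = (\<Sum>c\<in>{c::'n option. block \<nu> c = b}. g (loc \<nu> c))"
    by (rule sum.mono_neutral_cong_right) auto
  also have "\<dots> = (\<Sum>l<\<nu> b. g l)"
    by (rule sum.reindex_bij_witness[of _ "ix b" "loc \<nu>"]) (use b block_loc in \<open>auto simp: block_ix loc_ix\<close>)
  finally show ?thesis .
qed

lemma block_None: "block \<nu> (None :: 'n option) = 0" "loc \<nu> (None :: 'n option) = 0"
proof -
  have "idx (None :: 'n option) < offset \<nu> (Suc 0)" using \<nu>_pos[rule_format, of 0] by (simp add: offset_def)
  then show "block \<nu> (None :: 'n option) = 0" unfolding block_def by (intro Least_eq_0)
  then show "loc \<nu> (None :: 'n option) = 0" by (simp add: loc_def)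
qed

text \<open>Hermite evaluation at all nodes with multiplicities. On such vectors
  \<open>Z_mat\<close>, \<open>W_mat\<close> and \<open>V_mat\<close> act by polynomial operations,
  as the next lemmas show.\<close>

definition tvec :: "complex poly \<Rightarrow> 'n option cvec" where
  "tvec p = (\<chi> i. tc p (z (block \<nu> i)) (loc \<nu> i))"

lemma tvec_add: "tvec (p + q) = tvec p + tvec q" by (simp add: tvec_def vec_eq_iff tc_add)
lemma tvec_diff: "tvec (p - q) = tvec p - tvec q" by (simp add: tvec_def vec_eq_iff tc_diff)
lemma tvec_0 [simp]: "tvec 0 = 0" by (simp add: tvec_def vec_eq_iff)
lemma tvec_smult: "tvec (smult c p) = c *s tvec p" by (simp add: tvec_def vec_eq_iff tc_smult)

lemma tvec_eq_iff: "tvec p = tvec q \<longleftrightarrow> (\<forall>j\<le>m. \<forall>k<\<nu> j. tc p (z j) k = tc q (z j) k)"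
proof
  assume e: "tvec p = tvec q"
  show "\<forall>j\<le>m. \<forall>k<\<nu> j. tc p (z j) k = tc q (z j) k"
  proof (intro allI impI)
    fix j k assume "j \<le> m" "k < \<nu> j"
    then show "tc p (z j) k = tc q (z j) k"
      using arg_cong[OF e, of "\<lambda>v. v $ ix j k"] by (simp add: tvec_def block_ix loc_ix)
  qed
qed (use block_loc in \<open>auto simp: tvec_def vec_eq_iff\<close>)

definition nodal :: "complex poly" where
  "nodal = (\<Prod>j\<le>m. [:- z j, 1:] ^ \<nu> j)"

lemma tvec_eq_0_iff: "tvec p = 0 \<longleftrightarrow> nodal dvd p"
proof -
  have "tvec p = 0 \<longleftrightarrow> tvec p = tvec 0" by (simp add: tvec_def vec_eq_iff)
  also have "\<dots> \<longleftrightarrow> (\<forall>j\<le>m. [:- z j, 1:] ^ \<nu> j dvd p)"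
    unfolding tvec_eq_iff tc_zero_iff[symmetric] by simp
  also have "\<dots> \<longleftrightarrow> nodal dvd p"
  proof
    assume "\<forall>j\<le>m. [:- z j, 1:] ^ \<nu> j dvd p"
    then show "nodal dvd p" unfolding nodal_def by (intro prod_power_dvd[OF inj_z]) blast
  next
    assume d: "nodal dvd p"
    show "\<forall>j\<le>m. [:- z j, 1:] ^ \<nu> j dvd p"
    proof (intro allI impI)
      fix j assume "j \<le> m"
      then have "[:- z j, 1:] ^ \<nu> j dvd nodal" unfolding nodal_def by (intro dvd_prodI) auto
      then show "[:- z j, 1:] ^ \<nu> j dvd p" using d by (rule dvd_trans)
    qed
  qed
  finally show ?thesis .
qed

text \<open>Multiplying by z = z_j + (z - z_j) adds z_j times the coefficient and the preceding
  coefficient: diagonal and subdiagonal of the block.\<close>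

lemma Z_tvec: "Z_mat z \<nu> *v tvec p = tvec ([:0, 1:] * p)"
proof -
  have "(Z_mat z \<nu> *v tvec p) $ r = tvec ([:0, 1:] * p) $ r" for r
  proof -
    let ?b = "block \<nu> r" and ?l = "loc \<nu> r"
    have b: "?b \<le> m" "?l < \<nu> ?b" using block_loc[of r] by auto
    have rc: "r = c \<longleftrightarrow> block \<nu> c = ?b \<and> loc \<nu> c = ?l" for c
      using block_loc(3)[of r] block_loc(3)[of c] by metis
    have "(Z_mat z \<nu> *v tvec p) $ r = (\<Sum>c\<in>(UNIV::'n option set). if block \<nu> c = ?b
        then (if loc \<nu> c = ?l then z ?b else if ?l = Suc (loc \<nu> c) then 1 else 0) * tc p (z ?b) (loc \<nu> c) else 0)"
      unfolding Z_mat_def matrix_vector_mult_def tvec_def vec_lambda_beta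
      by (intro sum.cong refl) (auto simp: rc)
    also have "\<dots> = (\<Sum>k<\<nu> ?b. (if k = ?l then z ?b else if ?l = Suc k then 1 else 0) * tc p (z ?b) k)"
      by (rule sum_block[OF b(1)])
    also have "\<dots> = tc ([:0, 1:] * p) (z ?b) ?l"
    proof (cases ?l)
      case 0
      have "(\<Sum>k<\<nu> ?b. (if k = ?l then z ?b else if ?l = Suc k then 1 else 0) * tc p (z ?b) k) = (\<Sum>k\<in>{0}. z ?b * tc p (z ?b) k)"
        by (rule sum.mono_neutral_cong_right) (use b 0 in auto)
      then show ?thesis by (simp add: tc_def pcompose_mult pcompose_pCons 0)
    next
      case (Suc l)
      have "(\<Sum>k<\<nu> ?b. (if k = ?l then z ?b else if ?l = Suc k then 1 else 0) * tc p (z ?b) k)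
          = (\<Sum>k\<in>{l, Suc l}. (if k = Suc l then z ?b else 1) * tc p (z ?b) k)"
        by (rule sum.mono_neutral_cong_right) (use b Suc in auto)
      then show ?thesis by (simp add: tc_def pcompose_mult pcompose_pCons Suc)
    qed
    finally show ?thesis by (simp add: tvec_def)
  qed
  then show ?thesis by (simp add: vec_eq_iff)
qed

lemma e_tvec: "e_vec \<nu> = tvec 1"
  by (simp add: e_vec_def tvec_def tc_1 vec_eq_iff)

text \<open>Column k is the evaluation of z^k, so \<open>V_mat\<close> is a confluent Vandermonde
  matrix.\<close>

lemma V_tvec: "V_mat z \<nu> *v a = tvec (vpoly a)"
proof -
  have pow: "((\<lambda>x. Z_mat z \<nu> *v x) ^^ k) (e_vec \<nu>) = tvec (monom 1 k)" for k
    by (induction k) (simp_all add: e_tvec Z_tvec monom_Suc monom_0 flip: one_pCons)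
  have sum: "tvec (\<Sum>i\<in>A. f i) = (\<Sum>i\<in>A. tvec (f i))" if "finite A" for A and f :: "'n option \<Rightarrow> complex poly"
    using that by (induction A rule: finite_induct) (auto simp: tvec_add)
  have "vpoly a = (\<Sum>i\<in>UNIV. smult (a $ i) (monom 1 (idx i)))"
    by (simp add: vpoly_def smult_monom)
  then have "tvec (vpoly a) = (\<Sum>i\<in>UNIV. a $ i *s tvec (monom 1 (idx i)))"
    by (simp add: sum tvec_smult)
  moreover have "V_mat z \<nu> $ r $ c = tvec (monom 1 (idx c)) $ r" for r c
    by (simp only: V_mat_def vec_lambda_beta pow)
  ultimately show ?thesis
    by (simp add: matrix_vector_mult_def vec_eq_iff mult.commute)
qed

lemma datum_eq: "full_data w = tvec c \<Longrightarrow> j \<le> m \<Longrightarrow> k < \<nu> j \<Longrightarrow> datum \<nu> (w :: 'n cvec) j k = tc c (z j) k"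
  unfolding datum_def ix_def[symmetric] by (simp add: tvec_def block_ix loc_ix)

text \<open>A lower triangular Toeplitz block is the Cauchy product of Taylor coefficients.\<close>

lemma W_tvec:
  assumes w: "full_data w = tvec c"
  shows "W_mat \<nu> w *v tvec p = tvec (c * p)"
proof -
  have "(W_mat \<nu> w *v tvec p) $ r = tvec (c * p) $ r" for r
  proof -
    let ?b = "block \<nu> r" and ?l = "loc \<nu> r"
    have b: "?b \<le> m" "?l < \<nu> ?b" using block_loc[of r] by auto
    have "(W_mat \<nu> w *v tvec p) $ r = (\<Sum>c'\<in>(UNIV::'n option set). if block \<nu> c' = ?b
        then (if loc \<nu> c' \<le> ?l then datum \<nu> w ?b (?l - loc \<nu> c') else 0) * tc p (z ?b) (loc \<nu> c') else 0)"
      unfolding W_mat_def matrix_vector_mult_def tvec_def vec_lambda_beta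
      by (intro sum.cong refl) auto
    also have "\<dots> = (\<Sum>k<\<nu> ?b. (if k \<le> ?l then datum \<nu> w ?b (?l - k) else 0) * tc p (z ?b) k)"
      by (rule sum_block[OF b(1)])
    also have "\<dots> = (\<Sum>k\<le>?l. tc p (z ?b) k * tc c (z ?b) (?l - k))"
      by (rule sum.mono_neutral_cong_right) (use b in \<open>auto simp: datum_eq[OF w] mult.commute\<close>)
    also have "\<dots> = tc (p * c) (z ?b) ?l" by (simp add: tc_mult)
    finally show ?thesis by (simp add: tvec_def mult.commute)
  qed
  then show ?thesis by (simp add: vec_eq_iff)
qed

lemma tvec_None: "tvec p $ None = coeff p 0"
  by (simp add: tvec_def block_None z_0 tc_def)

text \<open>Conjugation permutes the nodes and preserves multiplicities, so it only reorders the
  factors.\<close>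

lemma nodal_cnj: "map_poly cnj nodal = nodal"
proof -
  have hom: "map_poly cnj (p * q) = map_poly cnj p * map_poly cnj q" for p q
    by (intro poly_eqI) (simp add: coeff_map_poly coeff_mult)
  have hpow: "map_poly cnj (p ^ k) = map_poly cnj p ^ k" for p k
    by (induction k) (simp_all add: hom)
  have hprod: "map_poly cnj (\<Prod>j\<in>A. f j) = (\<Prod>j\<in>A. map_poly cnj (f j))" if "finite A" for A and f :: "nat \<Rightarrow> complex poly"
    using that by (induction A rule: finite_induct) (simp_all add: hom)
  obtain \<pi> where \<pi>: "\<And>j. j \<le> m \<Longrightarrow> \<pi> j \<le> m \<and> z (\<pi> j) = cnj (z j) \<and> \<nu> (\<pi> j) = \<nu> j"
    using z_conj by metis
  have inv: "\<pi> (\<pi> j) = j" if "j \<le> m" for j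
  proof (rule inj_onD[OF inj_z])
    show "z (\<pi> (\<pi> j)) = z j" using \<pi>[OF that] \<pi>[of "\<pi> j"] by simp
  qed (use \<pi>[OF that] \<pi>[of "\<pi> j"] that in auto)
  have "map_poly cnj nodal = (\<Prod>j\<le>m. [:- cnj (z j), 1:] ^ \<nu> j)"
    by (simp add: nodal_def hprod hpow map_poly_pCons)
  also have "\<dots> = (\<Prod>j\<le>m. [:- z j, 1:] ^ \<nu> j)"
    by (rule prod.reindex_bij_witness[of _ \<pi> \<pi>]) (use \<pi> inv in auto)
  finally show ?thesis by (simp add: nodal_def)
qed

definition N :: "real poly" where "N = map_poly Re nodal"

lemma map_N: "map_poly complex_of_real N = nodal"
proof (rule poly_eqI)
  fix k
  have "coeff nodal k = cnj (coeff nodal k)"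
    by (subst (1) nodal_cnj[symmetric]) (simp add: coeff_map_poly)
  then have "Im (coeff nodal k) = 0" by (metis Im_complex_of_real Reals_cnj_iff complex_is_Real_iff)
  then show "coeff (map_poly complex_of_real N) k = coeff nodal k"
    by (simp add: N_def coeff_map_poly complex_eq_iff)
qed

sublocale stable_modulus N T
proof
  have "degree nodal = (\<Sum>j\<le>m. degree ([:- z j, 1:] ^ \<nu> j))"
    unfolding nodal_def by (intro degree_prod_eq_sum_degree) auto
  also have "\<dots> = (\<Sum>j\<le>m. \<nu> j)" by (simp add: degree_linear_power)
  also have "\<dots> = Suc CARD('n)" using total by (simp add: offset_def lessThan_Suc_atMost)
  finally show "degree N = Suc CARD('n)"
    using degree_map_poly[of complex_of_real N] by (simp add: map_N)
  show "cmod x < 1" if "cpoly N x = 0" for x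
  proof -
    have "poly nodal x = 0" using that by (simp add: cpoly_def map_N)
    then obtain j where "j \<le> m" "x = z j" by (auto simp: nodal_def poly_prod)
    then show ?thesis using z_disc by blast
  qed
  have "0 < \<nu> 0" using \<nu>_pos[rule_format, of 0] by simp
  then have "poly nodal 0 = 0" using z_0 by (auto simp: nodal_def poly_prod intro!: bexI[of _ 0])
  then show "coeff N 0 = 0" by (simp add: N_def coeff_map_poly poly_0_coeff_0)
qed

end

lemma cayley_eq_iff: "a + (1/2) *\<^sub>R x = b - (1/2) *\<^sub>R y' \<longleftrightarrow> 2 *\<^sub>R (b - a) = y' + x" for a b x y' :: "'k::finite rvec"
proof -
  have *: "2 *\<^sub>R (b - a) - (y' + x) = - 2 *\<^sub>R ((a + (1/2) *\<^sub>R x) - (b - (1/2) *\<^sub>R y'))"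
    by (simp add: algebra_simps)
  have "2 *\<^sub>R (b - a) = y' + x \<longleftrightarrow> 2 *\<^sub>R (b - a) - (y' + x) = 0" by (rule eq_iff_diff_eq_0)
  also have "\<dots> \<longleftrightarrow> (a + (1/2) *\<^sub>R x) - (b - (1/2) *\<^sub>R y') = 0" unfolding * by (simp only: scaleR_eq_0_iff) simp
  finally show ?thesis unfolding eq_iff_diff_eq_0[symmetric] by blast
qed

lemma map_of_real_mult: "map_poly complex_of_real (p * q) = map_poly complex_of_real p * map_poly complex_of_real q"
  by (intro poly_eqI) (simp add: coeff_map_poly coeff_mult)

lemma map_of_real_diff: "map_poly complex_of_real (p - q) = map_poly complex_of_real p - map_poly complex_of_real q"
  by (intro poly_eqI) (simp add: coeff_map_poly)

lemma map_of_real_smult: "map_poly complex_of_real (smult r p) = smult (of_real r) (map_poly complex_of_real p)"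
  by (intro poly_eqI) (simp add: coeff_map_poly)

lemma map_of_real_cnj: "map_poly cnj (map_poly complex_of_real p) = map_poly complex_of_real p"
  by (intro poly_eqI) (simp add: coeff_map_poly)

lemma vpoly_cvec: "vpoly (cvec v) = map_poly complex_of_real (vpoly v)"
proof (rule poly_eqI)
  fix k show "coeff (vpoly (cvec v)) k = coeff (map_poly complex_of_real (vpoly v)) k"
    by (simp add: vpoly_def coeff_sum coeff_map_poly cvec_nth if_distrib cong: if_cong)
qed

lemma full_data_bord: "full_data w = bord (1/2) w"
  by (simp add: full_data_def bord_def)

lemma bord_Some_eta: "(\<chi> i. u $ Some i) = v \<Longrightarrow> u = bord (u $ None) v"
  by (rule bord_eqI) auto

lemma matrix_inv_both:
  fixes A :: "'a::field^'k^'k"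
  assumes "invertible A"
  shows "A ** matrix_inv A = mat 1" "matrix_inv A ** A = mat 1"
proof -
  obtain B where "A ** B = mat 1 \<and> B ** A = mat 1" using assms unfolding invertible_def by blast
  then have "A ** matrix_inv A = mat 1 \<and> matrix_inv A ** A = mat 1" unfolding matrix_inv_def by (rule someI)
  then show "A ** matrix_inv A = mat 1" "matrix_inv A ** A = mat 1" by auto
qed

lemma matrix_inv_eqI:
  fixes A :: "'a::field^'k^'k"
  assumes "A ** B = mat 1" "B ** A = mat 1"
  shows "matrix_inv A = B"
proof -
  have "invertible A" unfolding invertible_def using assms by blast
  then have "A ** matrix_inv A = mat 1" by (rule matrix_inv_both)
  then have "B ** A ** matrix_inv A = B" by (simp only: matrix_mul_assoc[symmetric] matrix_mul_rid)
  then show ?thesis by (simp add: assms(2))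
qed

lemma invertible_ctranspose:
  assumes "V' ** V = mat 1"
  shows "ctranspose V ** ctranspose V' = mat 1"
proof -
  have "ctranspose V ** ctranspose V' = ctranspose (V' ** V)" by (simp add: ctranspose_mult)
  then show ?thesis by (simp add: assms) (simp add: ctranspose_def mat_def vec_eq_iff)
qed

section \<open>Passage to real coordinates through the matrix V\<close>

context nodes
begin

abbreviation Vm :: "'n option cmat" where "Vm \<equiv> V_mat z \<nu>"

definition rt :: "real poly \<Rightarrow> 'n option cvec" where
  "rt p = tvec (map_poly complex_of_real p)"

lemma V_cvec: "Vm *v cvec v = rt (vpoly v)"
  by (simp add: V_tvec vpoly_cvec rt_def)

lemma rt_mod: "rt (p mod N) = rt p"
proof -
  have "p - p mod N = N * (p div N)" by (simp add: minus_mod_eq_mult_div)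
  then have "map_poly complex_of_real p - map_poly complex_of_real (p mod N)
      = nodal * map_poly complex_of_real (p div N)"
    by (simp add: map_N[symmetric] map_of_real_mult flip: map_of_real_diff)
  then have "tvec (map_poly complex_of_real p - map_poly complex_of_real (p mod N)) = 0"
    by (simp add: tvec_eq_0_iff)
  then show ?thesis by (simp add: rt_def tvec_diff)
qed

lemma degree_nodal: "degree nodal = Suc CARD('n)"
  using deg_N degree_map_poly[of complex_of_real N] by (simp add: map_N)

lemma V_kernel: "Vm *v a = 0 \<Longrightarrow> a = 0"
proof -
  assume "Vm *v a = 0"
  then have "nodal dvd vpoly a" by (simp add: V_tvec tvec_eq_0_iff)
  moreover have "degree (vpoly a) < degree nodal"
    using degree_vpoly_less[of a] by (simp add: degree_nodal card_option)
  ultimately have "vpoly a = 0" using dvd_imp_degree_le[of nodal "vpoly a"] by force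
  then show ?thesis by simp
qed

lemma invertible_V: "invertible Vm"
  unfolding invertible_det_nz det_eq_0_iff_kernel using V_kernel by blast

definition Vi :: "'n option cmat" where "Vi = matrix_inv Vm"

lemma V_Vi: "Vm ** Vi = mat 1" "Vi ** Vm = mat 1"
  using matrix_inv_both[OF invertible_V] by (simp_all add: Vi_def)

lemma V_Vi_vec: "Vm *v (Vi *v x) = x" "Vi *v (Vm *v x) = x"
  by (simp_all add: matrix_vector_mul_assoc V_Vi)

lemma V_inject: "Vm *v a = Vm *v b \<longleftrightarrow> a = b"
  using V_Vi_vec(2) by metis

text \<open>Both sides multiply a polynomial by z and evaluate it; \<open>rt\<close> does not see
  reduction modulo \<open>N\<close>.\<close>

lemma Z_V: "Z_mat z \<nu> ** Vm = Vm ** cmat Cm"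
proof (rule cmat_eqI)
  fix v :: "real^'n option"
  have "Vm *v (cmat Cm *v cvec v) = rt ([:0, 1:] * vpoly v mod N)"
    by (simp add: cmat_cvec V_cvec Cm_def Mc_works vpoly_mm vpoly_X1 del: mult_pCons_left)
  also have "\<dots> = Z_mat z \<nu> *v (Vm *v cvec v)"
    unfolding rt_mod V_cvec by (simp add: rt_def Z_tvec map_of_real_mult map_poly_pCons del: mult_pCons_left)
  finally show "(Z_mat z \<nu> ** Vm) *v cvec v = (Vm ** cmat Cm) *v cvec v"
    by (simp add: matrix_vector_mul_assoc)
qed

lemma W_V:
  assumes w: "full_data w = Vm *v cvec c"
  shows "W_mat \<nu> w ** Vm = Vm ** cmat (Mc c)"
proof (rule cmat_eqI)
  fix v :: "real^'n option"
  have "Vm *v (cmat (Mc c) *v cvec v) = rt (vpoly c * vpoly v mod N)"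
    by (simp add: cmat_cvec V_cvec Mc_works vpoly_mm)
  also have "\<dots> = W_mat \<nu> w *v (Vm *v cvec v)"
    unfolding rt_mod V_cvec using w by (simp add: rt_def W_tvec[of w] map_of_real_mult V_cvec)
  finally show "(W_mat \<nu> w ** Vm) *v cvec v = (Vm ** cmat (Mc c)) *v cvec v"
    by (simp add: matrix_vector_mul_assoc)
qed

lemma e_V: "e_vec \<nu> = Vm *v cvec e0"
proof -
  have "map_poly complex_of_real 1 = 1" by (intro poly_eqI) (simp add: coeff_map_poly coeff_1)
  then show ?thesis by (simp add: V_cvec vpoly_e0 rt_def e_tvec)
qed

lemma outer_e: "outer (e_vec \<nu>) (e_vec \<nu>) = Vm ** cmat (outer e0 e0) ** ctranspose Vm"
proof -
  have cnj: "cnj ((e_vec \<nu> :: 'n option cvec) $ i) = e_vec \<nu> $ i" for i by (simp add: e_vec_def)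
  have r: "(Vm ** cmat (outer e0 e0) ** ctranspose Vm) $ i $ j = (Vm *v cvec e0) $ i * cnj ((Vm *v cvec e0) $ j)" for i j
    by (simp add: matrix_matrix_mult_def matrix_vector_mult_def ctranspose_def cmat_def cvec_def outer_def
        sum_distrib_left sum_distrib_right mult_ac)
  show ?thesis unfolding vec_eq_iff r e_V[symmetric] cnj by (simp add: outer_def)
qed

text \<open>The real Stein equation is transported by V. For the uniqueness behind
  \<open>THE\<close>, conjugating the difference of two solutions back by V leaves a complex
  solution of the homogeneous equation for the stable real matrix \<open>Cm\<close>.\<close>

lemma E_mat_eq: "E_mat z \<nu> = Vm ** cmat Eh ** ctranspose Vm"
  unfolding E_mat_def
proof (rule the_equality)
  let ?E = "Vm ** cmat Eh ** ctranspose Vm" and ?Z = "Z_mat z \<nu> :: 'n option cmat"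
  have "?Z ** ?E ** ctranspose ?Z = (?Z ** Vm) ** cmat Eh ** ctranspose (?Z ** Vm)"
    by (simp add: ctranspose_mult matrix_mul_assoc)
  also have "\<dots> = Vm ** cmat (Cm ** Eh ** transpose Cm) ** ctranspose Vm"
    unfolding Z_V by (simp add: ctranspose_mult matrix_mul_assoc cmat_mult cmat_transpose)
  finally have "?Z ** ?E ** ctranspose ?Z + outer (e_vec \<nu>) (e_vec \<nu>)
      = Vm ** cmat (Cm ** Eh ** transpose Cm + outer e0 e0) ** ctranspose Vm"
    by (simp add: outer_e cmat_add matrix_add_ldistrib matrix_add_rdistrib)
  then show e: "?E = ?Z ** ?E ** ctranspose ?Z + outer (e_vec \<nu>) (e_vec \<nu>)" using Eh by simp
  fix X assume X: "X = ?Z ** X ** ctranspose ?Z + outer (e_vec \<nu>) (e_vec \<nu>)"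
  define D where "D = X - ?E"
  have D: "D = ?Z ** D ** ctranspose ?Z"
  proof -
    have "D = (?Z ** X ** ctranspose ?Z + outer (e_vec \<nu>) (e_vec \<nu>)) - (?Z ** ?E ** ctranspose ?Z + outer (e_vec \<nu>) (e_vec \<nu>))"
      unfolding D_def by (rule arg_cong2[of X _ ?E _ "(-)", OF X e])
    also have "\<dots> = ?Z ** X ** ctranspose ?Z - ?Z ** ?E ** ctranspose ?Z" by simp
    also have "\<dots> = ?Z ** D ** ctranspose ?Z"
      using matrix_add_ldistrib[of ?Z D ?E] matrix_add_rdistrib[of "?Z ** D" "?Z ** ?E" "ctranspose ?Z"]
      by (simp add: D_def)
    finally show ?thesis .
  qed
  have ViZ: "Vi ** ?Z = cmat Cm ** Vi"
  proof -
    have "Vi ** ?Z = Vi ** (?Z ** Vm) ** Vi" by (simp add: matrix_mul_assoc[symmetric] V_Vi)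
    also have "\<dots> = cmat Cm ** Vi" unfolding Z_V by (simp add: matrix_mul_assoc V_Vi)
    finally show ?thesis .
  qed
  define Y where "Y = Vi ** D ** ctranspose Vi"
  have "Y = (Vi ** ?Z) ** D ** ctranspose (Vi ** ?Z)"
    unfolding Y_def by (subst D) (simp add: ctranspose_mult matrix_mul_assoc)
  also have "\<dots> = cmat Cm ** Y ** ctranspose (cmat Cm)"
    unfolding ViZ Y_def by (simp add: ctranspose_mult matrix_mul_assoc)
  finally have "Y = 0" by (rule complex_stein_unique_0[OF Cm_power_tendsto])
  moreover have "D = Vm ** Y ** ctranspose Vm"
  proof -
    have "Vm ** Y ** ctranspose Vm = (Vm ** Vi) ** D ** (ctranspose Vi ** ctranspose Vm)"
      unfolding Y_def by (simp only: matrix_mul_assoc)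
    then show ?thesis using invertible_ctranspose[OF V_Vi(1)] by (simp add: V_Vi)
  qed
  ultimately show "X = ?E" by (simp add: D_def)
qed

lemma pick_mat_eq:
  assumes w: "full_data w = Vm *v cvec c"
  shows "pick_mat z \<nu> w = Vm ** cmat (Pick c) ** ctranspose Vm"
proof -
  have 1: "W_mat \<nu> w ** E_mat z \<nu> = Vm ** cmat (Mc c ** Eh) ** ctranspose Vm"
  proof -
    have "W_mat \<nu> w ** E_mat z \<nu> = (W_mat \<nu> w ** Vm) ** cmat Eh ** ctranspose Vm"
      unfolding E_mat_eq by (simp only: matrix_mul_assoc)
    then show ?thesis unfolding W_V[OF w] by (simp only: matrix_mul_assoc cmat_mult)
  qed
  have 2: "E_mat z \<nu> ** ctranspose (W_mat \<nu> w) = Vm ** cmat (Eh ** transpose (Mc c)) ** ctranspose Vm"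
  proof -
    have "E_mat z \<nu> ** ctranspose (W_mat \<nu> w) = Vm ** cmat Eh ** ctranspose (W_mat \<nu> w ** Vm)"
      unfolding E_mat_eq by (simp only: matrix_mul_assoc ctranspose_mult)
    then show ?thesis unfolding W_V[OF w] by (simp only: matrix_mul_assoc ctranspose_mult cmat_mult cmat_transpose)
  qed
  show ?thesis unfolding pick_mat_def 1 2 Pick_def
    by (simp add: cmat_add matrix_add_ldistrib matrix_add_rdistrib)
qed

text \<open>The Cayley transform of multiplication by c. It equals V^-1 D V (\<open>VDV_eq\<close>),
  which is therefore real, so that \<open>Re\<close> in \<open>u_vec\<close> and
  \<open>U_mat\<close> discards nothing.\<close>

definition Kc :: "real^'n option \<Rightarrow> real^'n option^'n option" where
  "Kc c = matrix_inv (Mc c + mat (1/2)) ** (Mc c - mat (1/2))"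

lemma Kc: "det (Mc c + mat (1/2)) \<noteq> 0 \<Longrightarrow> (Mc c + mat (1/2)) ** Kc c = Mc c - mat (1/2)"
  unfolding Kc_def using matrix_inv_both(1)[of "Mc c + mat (1/2)"]
  by (simp add: invertible_det_nz matrix_mul_assoc)

lemma VDV_eq:
  assumes w: "full_data w = Vm *v cvec c" and d: "det (Mc c + mat (1/2)) \<noteq> 0"
  shows "VDV_mat z \<nu> w = cmat (Kc c)"
proof -
  let ?W = "W_mat \<nu> w" and ?K = "Kc c"
  have com: "mat r ** A = A ** mat r" for r and A :: "'n option cmat"
    by (simp add: matrix_matrix_mult_def mat_def vec_eq_iff if_distrib[of "\<lambda>x. x * _"] if_distrib[of "\<lambda>x. _ * x"] mult.commute cong: if_cong)
  have p: "(?W + mat (1/2)) ** Vm = Vm ** cmat (Mc c + mat (1/2))"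
    by (simp add: matrix_add_ldistrib matrix_add_rdistrib W_V[OF w] cmat_add cmat_mat com)
  have mm: "(?W - mat (1/2)) ** Vm = Vm ** cmat (Mc c - mat (1/2))"
  proof -
    have "(?W - mat (1/2)) ** Vm + mat (1/2) ** Vm = Vm ** cmat (Mc c - mat (1/2)) + Vm ** cmat (mat (1/2))"
      unfolding matrix_add_rdistrib[symmetric] matrix_add_ldistrib[symmetric] cmat_add[symmetric]
      by (simp add: W_V[OF w])
    then show ?thesis by (simp add: cmat_mat com)
  qed
  let ?M = "Mc c + mat (1/2)"
  have Mi: "matrix_inv ?M ** ?M = mat 1" "?M ** matrix_inv ?M = mat 1"
    using matrix_inv_both[of ?M] d by (simp_all add: invertible_det_nz)
  define Q where "Q = Vm ** cmat (matrix_inv ?M) ** Vi"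
  have pe: "?W + mat (1/2) = Vm ** cmat ?M ** Vi"
  proof -
    have "?W + mat (1/2) = ((?W + mat (1/2)) ** Vm) ** Vi" by (simp add: matrix_mul_assoc[symmetric] V_Vi)
    then show ?thesis by (simp add: p)
  qed
  have Q1: "Q ** (?W + mat (1/2)) = mat 1"
  proof -
    have "Q ** (?W + mat (1/2)) = Vm ** cmat (matrix_inv ?M) ** (Vi ** Vm) ** cmat ?M ** Vi"
      unfolding Q_def pe by (simp only: matrix_mul_assoc)
    also have "\<dots> = Vm ** cmat (matrix_inv ?M ** ?M) ** Vi"
      by (simp only: V_Vi matrix_mul_rid cmat_mult matrix_mul_assoc)
    finally show ?thesis by (simp add: Mi cmat_mat V_Vi)
  qed
  then have Q2: "(?W + mat (1/2)) ** Q = mat 1" using matrix_left_right_inverse by blast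
  have inv: "matrix_inv (?W + mat (1/2)) = Q" by (rule matrix_inv_eqI[OF Q2 Q1])
  have "VDV_mat z \<nu> w = Vi ** (Q ** (?W - mat (1/2))) ** Vm"
    by (simp add: VDV_mat_def D_mat_def inv Vi_def)
  also have "\<dots> = (Vi ** Vm) ** cmat (matrix_inv ?M) ** (Vi ** Vm) ** cmat (Mc c - mat (1/2))"
  proof -
    have "Vi ** (Q ** (?W - mat (1/2))) ** Vm = Vi ** Q ** ((?W - mat (1/2)) ** Vm)" by (simp only: matrix_mul_assoc)
    then show ?thesis unfolding mm Q_def by (simp only: matrix_mul_assoc)
  qed
  also have "\<dots> = cmat (Kc c)" by (simp add: V_Vi Kc_def cmat_mult)
  finally show ?thesis .
qed

text \<open>The real coordinates c of a data vector; the omitted coordinate is 1/2. Taking real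
  parts makes the map affine on all of \<open>complex^'n\<close>, so functions of
  \<open>dcoord w\<close> extend smoothly off the data space, as \<open>smooth_on\<close>
  requires.\<close>

definition dcoord :: "'n cvec \<Rightarrow> 'n rvec" where
  "dcoord w = (\<chi> i. Re ((Vi *v full_data w) $ Some i))"

definition Lmap :: "'n rvec \<Rightarrow> 'n cvec" where
  "Lmap c = (\<chi> i. (Vm *v cvec (bord (1/2) c)) $ Some i)"

lemma V_None: "(Vm *v a) $ None = a $ None"
  using coeff_vpoly_idx[of a None] by (simp add: V_tvec tvec_None)

lemma full_data_Lmap: "full_data (Lmap c) = Vm *v cvec (bord (1/2) c)"
proof -
  let ?x = "Vm *v cvec (bord (1/2) c)"
  have n: "?x $ None = 1/2" by (simp add: V_None cvec_nth)
  have "?x = bord (?x $ None) (Lmap c)" by (rule bord_Some_eta) (simp add: Lmap_def)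
  then show ?thesis unfolding full_data_bord n by (rule sym)
qed

lemma conj_index:
  assumes "j \<le> m" "j' \<le> m" "z j' = cnj (z j)"
  shows "\<nu> j' = \<nu> j"
proof -
  obtain j'' where "j'' \<le> m" "z j'' = cnj (z j)" "\<nu> j'' = \<nu> j" using z_conj assms(1) by blast
  then show ?thesis using inj_onD[OF inj_z, of j'' j'] assms by auto
qed

lemma Lmap_data: "Lmap c \<in> data_space m z \<nu>"
  unfolding data_space_def
proof (clarify)
  fix j j' k assume j: "j \<le> m" "j' \<le> m" "z j' = cnj (z j)" "k < \<nu> j"
  have k': "k < \<nu> j'" using conj_index[OF j(1,2,3)] j(4) by simp
  let ?p = "map_poly complex_of_real (vpoly (bord (1/2) c))"
  have fd: "full_data (Lmap c) = tvec ?p" by (simp add: full_data_Lmap V_cvec rt_def)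
  show "datum \<nu> (Lmap c) j' k = cnj (datum \<nu> (Lmap c) j k)"
    using tc_cnj[of ?p "z j" k]
    by (simp add: datum_eq[OF fd j(1,4)] datum_eq[OF fd j(2) k'] j(3) map_of_real_cnj)
qed

text \<open>Conjugating the coefficients of the interpolating polynomial of degree at most n gives
  an interpolant of the conjugated data at the conjugated nodes. For symmetric data these are the
  original data, and invertibility of V forces the coefficients to be real.\<close>

lemma data_space_iff: "w \<in> data_space m z \<nu> \<longleftrightarrow> (\<forall>i. Im ((Vi *v full_data w) $ i) = 0)"
  and data_space_coord: "w \<in> data_space m z \<nu> \<Longrightarrow> full_data w = Vm *v cvec (bord (1/2) (dcoord w))"
proof -
  let ?a = "Vi *v full_data w"
  have Va: "Vm *v ?a = full_data w" by (rule V_Vi_vec)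
  have a0: "?a $ None = 1/2" using V_None[of ?a] Va by (simp add: full_data_bord)
  have coord: "?a = cvec (bord (1/2) (dcoord w))" if "\<forall>i. Im (?a $ i) = 0"
  proof -
    have "?a $ i = cvec (bord (1/2) (dcoord w)) $ i" for i
      using that a0 by (cases i) (auto simp: cvec_nth dcoord_def complex_eq_iff)
    then show ?thesis by (simp add: vec_eq_iff)
  qed
  have real: "\<forall>i. Im (?a $ i) = 0" if w: "w \<in> data_space m z \<nu>"
  proof -
    define b where "b = (\<chi> i. cnj (?a $ i))"
    have vb: "vpoly b = map_poly cnj (vpoly ?a)"
    proof (rule poly_eqI)
      fix k show "coeff (vpoly b) k = coeff (map_poly cnj (vpoly ?a)) k"
        by (simp add: vpoly_def coeff_sum coeff_map_poly b_def if_distrib cong: if_cong)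
    qed
    have fd: "full_data w = tvec (vpoly ?a)" using Va by (simp add: V_tvec)
    have "tvec (vpoly b) = tvec (vpoly ?a)" unfolding tvec_eq_iff
    proof (intro allI impI)
      fix j k assume j: "j \<le> m" "k < \<nu> j"
      obtain j' where j': "j' \<le> m" "z j' = cnj (z j)" "\<nu> j' = \<nu> j" using z_conj j(1) by blast
      have "tc (vpoly b) (z j) k = cnj (tc (vpoly ?a) (z j') k)"
        using tc_cnj[of "vpoly ?a" "z j'" k] by (simp add: vb j'(2))
      also have "\<dots> = cnj (datum \<nu> w j' k)" using datum_eq[OF fd j'(1), of k] j(2) j'(3) by simp
      also have "datum \<nu> w j' k = cnj (datum \<nu> w j k)" using w j j' unfolding data_space_def by blast
      also have "datum \<nu> w j k = tc (vpoly ?a) (z j) k" by (rule datum_eq[OF fd j])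
      finally show "tc (vpoly b) (z j) k = tc (vpoly ?a) (z j) k" by simp
    qed
    then have "b = ?a" using V_inject by (simp add: V_tvec)
    then have "cnj (?a $ i) = ?a $ i" for i by (metis b_def vec_lambda_beta)
    then show ?thesis by (metis Reals_cnj_iff complex_is_Real_iff)
  qed
  show "w \<in> data_space m z \<nu> \<Longrightarrow> full_data w = Vm *v cvec (bord (1/2) (dcoord w))"
    using coord[OF real] Va by simp
  show "w \<in> data_space m z \<nu> \<longleftrightarrow> (\<forall>i. Im (?a $ i) = 0)"
  proof
    assume im: "\<forall>i. Im (?a $ i) = 0"
    have "full_data w = full_data (Lmap (dcoord w))" using coord[OF im] Va full_data_Lmap by simp
    then have "w = Lmap (dcoord w)" by (simp add: full_data_bord)
    then show "w \<in> data_space m z \<nu>" using Lmap_data by metis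
  qed (rule real)
qed

lemma Lmap_dcoord: "w \<in> data_space m z \<nu> \<Longrightarrow> Lmap (dcoord w) = w"
proof -
  assume w: "w \<in> data_space m z \<nu>"
  have "full_data (Lmap (dcoord w)) = full_data w"
    unfolding full_data_Lmap data_space_coord[OF w, symmetric] ..
  then show ?thesis by (simp add: full_data_bord)
qed

lemma dcoord_Lmap: "dcoord (Lmap c) = c"
  by (simp add: dcoord_def full_data_Lmap V_Vi_vec cvec_nth vec_eq_iff)

lemma W_plus_iff: "w \<in> W_plus m z \<nu> \<longleftrightarrow> w \<in> data_space m z \<nu> \<and> dcoord w \<in> Wset"
proof (cases "w \<in> data_space m z \<nu>")
  case True
  then show ?thesis
    by (simp add: W_plus_def Wset_def pick_mat_eq[OF data_space_coord[OF True]]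
        posdef_congruence[OF Pick_sym invertible_V])
qed (simp add: W_plus_def)

lemma Wset_det: "c \<in> Wset \<Longrightarrow> det (Mc (bord (1/2) c) + mat (1/2)) \<noteq> 0"
  unfolding Wset_def by (simp add: det_half_nz)

lemma uU_nth:
  assumes "w \<in> W_plus m z \<nu>"
  shows "u_vec z \<nu> w $ i = Kc (bord (1/2) (dcoord w)) $ Some i $ None"
    "U_mat z \<nu> w $ i $ j = Kc (bord (1/2) (dcoord w)) $ Some i $ Some j"
proof -
  have "VDV_mat z \<nu> w = cmat (Kc (bord (1/2) (dcoord w)))"
    using assms by (intro VDV_eq data_space_coord Wset_det) (simp_all add: W_plus_iff)
  then show "u_vec z \<nu> w $ i = Kc (bord (1/2) (dcoord w)) $ Some i $ None"
    "U_mat z \<nu> w $ i $ j = Kc (bord (1/2) (dcoord w)) $ Some i $ Some j"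
    by (simp_all add: u_vec_def U_mat_def cmat_def)
qed

text \<open>Multiplying by the invertible M + 1/2 undoes the Cayley transform: (M + 1/2) g = (M -
  1/2) t, with t and g standing for [1; t] and [0; g], is the relation 2 M (t - g) = t + g.\<close>

lemma uU_iff:
  assumes w: "w \<in> W_plus m z \<nu>"
  shows "g = u_vec z \<nu> w + U_mat z \<nu> w *v t \<longleftrightarrow> beta (dcoord w) (bord 1 (t - g)) = bord 1 (t + g)"
proof -
  let ?c = "bord (1/2) (dcoord w)" and ?ut = "u_vec z \<nu> w + U_mat z \<nu> w *v t"
  let ?M = "Mc ?c" and ?y = "Kc ?c *v bord 1 t"
  have d: "det (?M + mat (1/2)) \<noteq> 0" using w by (simp add: W_plus_iff Wset_det)
  have My: "?M *v ?y + (1/2) *\<^sub>R ?y = ?M *v bord 1 t - (1/2) *\<^sub>R bord 1 t"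
  proof -
    have "(?M + mat (1/2)) *v ?y = (?M - mat (1/2)) *v bord 1 t"
      by (simp add: matrix_vector_mul_assoc Kc[OF d])
    moreover have "(?M - mat (1/2)) *v bord 1 t = ?M *v bord 1 t - (1/2) *\<^sub>R bord 1 t"
    proof -
      have "(mat (- (1/2)) :: real^'n option^'n option) = - mat (1/2)" by (simp add: mat_def vec_eq_iff)
      then show ?thesis using matrix_add_mat_mult[of "?M" "-(1/2)" "bord 1 t"] by simp
    qed
    ultimately show ?thesis by (simp add: matrix_add_mat_mult)
  qed
  \<comment> \<open>At the node 0 the matrix M multiplies by w_00 = 1/2, so the equation
    \<open>My\<close> reads y_0/2 + y_0/2 = 1/2 - 1/2. This is why the first row can be
    deleted.\<close>
  have "?y $ None = 0"
    using arg_cong[OF My, of "\<lambda>v. v $ None"] by (simp add: Mc_works mm_None)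
  moreover have "?y $ Some i = ?ut $ i" for i
    by (simp add: matrix_vector_mult_def sum_UNIV_option uU_nth[OF w])
  ultimately have y: "?y = bord 0 ?ut" by (intro bord_eqI) auto
  have "g = ?ut \<longleftrightarrow> bord 0 g = ?y" unfolding y by simp
  also have "\<dots> \<longleftrightarrow> (?M + mat (1/2)) *v bord 0 g = (?M + mat (1/2)) *v ?y"
  proof
    assume "(?M + mat (1/2)) *v bord 0 g = (?M + mat (1/2)) *v ?y"
    then have "(?M + mat (1/2)) *v (bord 0 g - ?y) = 0" by (simp add: matrix_vector_mult_diff_distrib)
    then show "bord 0 g = ?y" using d det_eq_0_iff_kernel[of "?M + mat (1/2)"] by (metis eq_iff_diff_eq_0)
  qed simp
  also have "\<dots> \<longleftrightarrow> ?M *v bord 0 g + (1/2) *\<^sub>R bord 0 g = ?M *v bord 1 t - (1/2) *\<^sub>R bord 1 t"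
    unfolding matrix_add_mat_mult My ..
  also have "\<dots> \<longleftrightarrow> 2 *\<^sub>R (?M *v (bord 1 t - bord 0 g)) = bord 1 t + bord 0 g"
  proof -
    note cayley_eq_iff[of "?M *v bord 0 g" "bord 0 g" "?M *v bord 1 t" "bord 1 t"]
    then show ?thesis by (simp add: matrix_vector_mult_diff_distrib)
  qed
  also have "bord 1 t - bord 0 g = bord 1 (t - g)" by (simp add: bord_diff)
  also have "bord 1 t + bord 0 g = bord 1 (t + g)" by (simp add: bord_add)
  finally show ?thesis by (simp add: beta_def Mc_works)
qed

section \<open>The interpolation conditions as identities of power series\<close>

lemma has_fps_expansion_poly:
  fixes p :: "complex poly"
  shows "poly p has_fps_expansion fps_of_poly p"
proof (induction p)
  case 0
  then show ?case by simp
next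
  case (pCons a p)
  have "(\<lambda>u. a + u * poly p u) has_fps_expansion (fps_const a + fps_X * fps_of_poly p)"
    by (intro has_fps_expansion_add has_fps_expansion_const has_fps_expansion_mult has_fps_expansion_fps_X pCons.IH)
  then show ?case by (simp add: fps_of_poly_pCons mult.commute add.commute)
qed

lemma fps_poly_shift:
  fixes p :: "complex poly"
  shows
  "(\<lambda>u. poly p (x + u)) has_fps_expansion fps_of_poly (pcompose p [:x, 1:])"
proof -
  have "(\<lambda>u. poly (pcompose p [:x, 1:]) u) has_fps_expansion fps_of_poly (pcompose p [:x, 1:])"
    by (rule has_fps_expansion_poly)
  then show ?thesis by (simp add: poly_pcompose)
qed

lemma fps_mult_low_zero:
  fixes G H :: "'a::comm_ring_1 fps"
  assumes "\<And>k. k < n \<Longrightarrow> fps_nth G k = 0" "k < n"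
  shows "fps_nth (G * H) k = 0"
  unfolding fps_mult_nth using assms by (intro sum.neutral) auto

text \<open>At each node the series F of \<phi> satisfies F A = B/2, where A is a unit because a_*
  has no zero in the disc. Multiplication by a unit preserves agreement up to a given order, so F
  can be compared with the data after clearing the denominator.\<close>

lemma interpolates_iff:
  assumes w: "full_data w = Vm *v cvec (bord (1/2) c)" and a: "bord 1 a \<in> stable_vecs"
  shows "interpolates m z \<nu> w (phi a b) \<longleftrightarrow> beta c (bord 1 a) = bord 1 b"
proof -
  have poly_analytic: "poly p analytic_on {x}" for p :: "complex poly" and x
    by (rule analytic_on_subset[OF _ subset_UNIV]) (intro analytic_on_holomorphic[THEN iffD2] exI[of _ UNIV] conjI holomorphic_intros; simp)
  let ?a = "map_poly complex_of_real (vpoly (bord 1 a))" and ?b = "map_poly complex_of_real (vpoly (bord 1 b))"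
  let ?c = "map_poly complex_of_real (vpoly (bord (1/2) c))"
  have fd: "full_data w = tvec ?c" using w by (simp add: V_cvec rt_def)
  have phi: "phi a b x = 1/2 * (poly ?b x / poly ?a x)" for x
    by (simp add: phi_def star_poly_vpoly cpoly_def)
  have loc: "(\<forall>k<\<nu> j. (deriv ^^ k) (phi a b) (z j) / fact k = datum \<nu> w j k)
      \<longleftrightarrow> (\<forall>k<\<nu> j. tc (smult 2 (?c * ?a)) (z j) k = tc ?b (z j) k)" if j: "j \<le> m" for j
  proof -
    have nz: "poly ?a (z j) \<noteq> 0"
      using a z_disc j unfolding stable_vecs_iff cpoly_def by (simp add: less_imp_le)
    define F where "F = fps_expansion (phi a b) (z j)"
    have "phi a b analytic_on {z j}"
      unfolding phi using nz poly_analytic by (intro analytic_intros) auto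
    then have F: "(\<lambda>u. phi a b (z j + u)) has_fps_expansion F"
      unfolding F_def by (rule analytic_at_imp_has_fps_expansion)
    define A B C where "A = fps_of_poly (pcompose ?a [:z j, 1:])" and "B = fps_of_poly (pcompose ?b [:z j, 1:])"
      and "C = fps_of_poly (pcompose ?c [:z j, 1:])"
    have A0: "fps_nth A 0 \<noteq> 0" using nz by (simp add: A_def poly_0_coeff_0[symmetric] poly_pcompose)
    have "\<forall>\<^sub>F u in nhds 0. poly ?a (z j + u) \<noteq> 0"
    proof -
      have "isCont (\<lambda>u. poly ?a (z j + u)) 0" by (intro continuous_intros)
      then have "((\<lambda>u. poly ?a (z j + u)) \<longlongrightarrow> poly ?a (z j + 0)) (nhds 0)"
        using tendsto_at_iff_tendsto_nhds[of "\<lambda>u. poly ?a (z j + u)" 0] by (simp only: isCont_def)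
      from tendsto_imp_eventually_ne[OF this, of 0] show ?thesis using nz by simp
    qed
    then have "\<forall>\<^sub>F u in nhds 0. phi a b (z j + u) * poly ?a (z j + u) = 1/2 * poly ?b (z j + u)"
      by eventually_elim (simp add: phi)
    from has_fps_expansion_cong[OF this refl]
    have "(\<lambda>u. 1/2 * poly ?b (z j + u)) has_fps_expansion (F * A)"
      using has_fps_expansion_mult[OF F fps_poly_shift[of ?a "z j"]]
      unfolding A_def by (rule iffD1)
    moreover have "(\<lambda>u. 1/2 * poly ?b (z j + u)) has_fps_expansion (fps_const (1/2) * B)"
      unfolding B_def by (rule has_fps_expansion_cmult_left[OF fps_poly_shift])
    ultimately have FA: "F * A = fps_const (1/2) * B" by (rule fps_expansion_unique_complex)
    have tcC: "datum \<nu> w j k = fps_nth C k" if "k < \<nu> j" for k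
      using datum_eq[OF fd j that] by (simp add: C_def tc_def)
    have Fk: "(deriv ^^ k) (phi a b) (z j) / fact k = fps_nth F k" for k
      by (simp add: F_def fps_expansion_def)
    have CA: "tc (smult 2 (?c * ?a)) (z j) k = 2 * fps_nth (C * A) k" for k
      by (simp add: tc_def pcompose_smult pcompose_mult C_def A_def flip: fps_of_poly_mult)
    have Bk: "tc ?b (z j) k = 2 * fps_nth (F * A) k" for k
      by (simp add: FA B_def tc_def)
    have "(\<forall>k<\<nu> j. fps_nth F k = fps_nth C k) \<longleftrightarrow> (\<forall>k<\<nu> j. fps_nth (C * A) k = fps_nth (F * A) k)"
    proof
      assume h: "\<forall>k<\<nu> j. fps_nth F k = fps_nth C k"
      have "fps_nth ((F - C) * A) k = 0" if "k < \<nu> j" for k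
        by (rule fps_mult_low_zero[OF _ that]) (simp add: h)
      then show "\<forall>k<\<nu> j. fps_nth (C * A) k = fps_nth (F * A) k" by (simp add: left_diff_distrib)
    next
      assume h: "\<forall>k<\<nu> j. fps_nth (C * A) k = fps_nth (F * A) k"
      have "fps_nth (((F - C) * A) * inverse A) k = 0" if "k < \<nu> j" for k
        by (rule fps_mult_low_zero[OF _ that]) (simp add: left_diff_distrib h)
      moreover have "((F - C) * A) * inverse A = F - C"
        using A0 by (simp add: mult.assoc inverse_mult_eq_1')
      ultimately show "\<forall>k<\<nu> j. fps_nth F k = fps_nth C k" by simp
    qed
    then show ?thesis unfolding Fk CA Bk by (simp add: tcC)
  qed
  have "interpolates m z \<nu> w (phi a b) \<longleftrightarrow> tvec (smult 2 (?c * ?a)) = tvec ?b"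
    unfolding interpolates_def tvec_eq_iff using loc by blast
  also have "tvec (smult 2 (?c * ?a)) = Vm *v cvec (beta c (bord 1 a))"
  proof -
    have "Vm *v cvec (beta c (bord 1 a)) = rt (smult 2 (vpoly (bord (1/2) c) * vpoly (bord 1 a)) mod N)"
      by (simp add: V_cvec beta_def vpoly_scaleR vpoly_mm mod_smult_left)
    then show ?thesis unfolding rt_mod by (simp add: rt_def map_of_real_smult map_of_real_mult)
  qed
  also have "tvec ?b = Vm *v cvec (bord 1 b)" by (simp add: V_cvec rt_def)
  finally show ?thesis unfolding V_inject cvec_inject .
qed

subsection \<open>Solving the covariance extension equation\<close>

lemma disp_acorr:
  fixes \<sigma> :: "'k::{finite,linorder} rvec"
  assumes d: "disp_eq t g r \<sigma> P" and sym: "transpose P = P"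
  shows "acorr (bord 1 (t - g)) (bord 1 (t + g)) = r *\<^sub>R acorr (bord 1 \<sigma>) (bord 1 \<sigma>)"
proof (rule trig_eq_imp)
  fix x :: complex assume x: "cmod x = 1"
  have xx: "x * cnj x = 1" using x by (simp add: complex_norm_square[symmetric])
  have "cpoly (vpoly (bord 1 (t - g))) x * cnj (cpoly (vpoly (bord 1 (t + g))) x)
      + cpoly (vpoly (bord 1 (t + g))) x * cnj (cpoly (vpoly (bord 1 (t - g))) x)
      = 2 * of_real r * (cpoly (vpoly (bord 1 \<sigma>)) x * cnj (cpoly (vpoly (bord 1 \<sigma>)) x))"
    using disp_generating[OF d sym, of x "cnj x"] unfolding xx by (simp add: cnj_cpoly)
  from arg_cong[OF this, of Re]
  have "2 * Re (cpoly (vpoly (bord 1 (t + g))) x * cnj (cpoly (vpoly (bord 1 (t - g))) x))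
      = r * (2 * Re (cpoly (vpoly (bord 1 \<sigma>)) x * cnj (cpoly (vpoly (bord 1 \<sigma>)) x)))"
    by (simp add: algebra_simps)
  then show "trig (acorr (bord 1 (t - g)) (bord 1 (t + g))) x = trig (r *\<^sub>R acorr (bord 1 \<sigma>) (bord 1 \<sigma>)) x"
    by (simp only: trig_acorr[OF x] trig_scaleR)
qed

definition dvec :: "'n rvec \<Rightarrow> real^'n option" where
  "dvec \<sigma> = acorr (bord 1 \<sigma>) (bord 1 \<sigma>)"

text \<open>Dividing a_* by \<rho> divides the autocorrelation by \<rho>^2 and lands in the fibre of
  \<open>Om\<close> over \<open>dvec \<sigma>\<close>, which has a single point for each c. Hence
  any admissible pair is determined, including \<rho>.\<close>

lemma sol_scale:
  assumes s: "\<sigma> \<in> Schur" and c: "c \<in> Wset" and a: "bord 1 a \<in> stable_vecs"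
    and b: "beta c (bord 1 a) = bord 1 b" and ac: "acorr (bord 1 a) (bord 1 b) = \<rho>\<^sup>2 *\<^sub>R dvec \<sigma>" and \<rho>: "0 < \<rho>"
  shows "sol (dvec \<sigma>) c $ None = 1 / \<rho>" "bord 1 a = \<rho> *\<^sub>R sol (dvec \<sigma>) c"
proof -
  let ?v = "(1 / \<rho>) *\<^sub>R bord 1 a"
  have dp: "dvec \<sigma> \<in> pos_trig" unfolding dvec_def by (rule pos_trig_acorr_self[OF s])
  have av: "acorr ?v (beta c ?v) = dvec \<sigma>"
    unfolding acorr_beta_scale b ac using \<rho> by (simp add: power2_eq_square)
  have "?v \<in> stable_vecs"
    using a \<rho> unfolding stable_vecs_iff by (simp add: vpoly_scaleR cpoly_smult)
  then have "(?v, c) \<in> Om" using \<rho> c dp by (simp add: Om_def av)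
  then have v: "?v = sol (dvec \<sigma>) c" using av by (rule sol_unique)
  show "sol (dvec \<sigma>) c $ None = 1 / \<rho>" by (simp add: v[symmetric])
  show "bord 1 a = \<rho> *\<^sub>R sol (dvec \<sigma>) c" using \<rho> by (simp add: v[symmetric])
qed

text \<open>\<open>sol\<close> is a_*/\<rho> with constant coefficient 1/\<rho>; dividing by that
  coefficient makes a monic. The same divisor serves for b by \<open>beta_None\<close>, and \<rho>^2
  is its inverse square.\<close>

definition a_sol :: "'n rvec \<Rightarrow> 'n rvec \<Rightarrow> 'n rvec" where
  "a_sol \<sigma> c = (\<chi> i. sol (dvec \<sigma>) c $ Some i / sol (dvec \<sigma>) c $ None)"

definition b_sol :: "'n rvec \<Rightarrow> 'n rvec \<Rightarrow> 'n rvec" where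
  "b_sol \<sigma> c = (\<chi> i. beta c (sol (dvec \<sigma>) c) $ Some i / sol (dvec \<sigma>) c $ None)"

definition r_sol :: "'n rvec \<Rightarrow> 'n rvec \<Rightarrow> real" where
  "r_sol \<sigma> c = 1 / (sol (dvec \<sigma>) c $ None)\<^sup>2"

definition P_sol :: "'n rvec \<Rightarrow> 'n rvec \<Rightarrow> 'n rmat" where
  "P_sol \<sigma> c = bezout ((1/2) *\<^sub>R (a_sol \<sigma> c + b_sol \<sigma> c)) ((1/2) *\<^sub>R (b_sol \<sigma> c - a_sol \<sigma> c)) (r_sol \<sigma> c) \<sigma>"

lemma half_sum_diff: "(1/2) *\<^sub>R (a + b) - (1/2) *\<^sub>R (b - a) = (a :: 'k::finite rvec)"
  "(1/2) *\<^sub>R (a + b) + (1/2) *\<^sub>R (b - a) = (b :: 'k::finite rvec)"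
  by (simp_all add: vec_eq_iff field_simps)

lemma sol_facts:
  assumes s: "\<sigma> \<in> Schur" and c: "c \<in> Wset"
  shows "bord 1 (a_sol \<sigma> c) \<in> stable_vecs" "beta c (bord 1 (a_sol \<sigma> c)) = bord 1 (b_sol \<sigma> c)"
    "acorr (bord 1 (a_sol \<sigma> c)) (bord 1 (b_sol \<sigma> c)) = r_sol \<sigma> c *\<^sub>R dvec \<sigma>" "0 < r_sol \<sigma> c"
    "0 < sol (dvec \<sigma>) c $ None"
proof -
  let ?v = "sol (dvec \<sigma>) c"
  have dp: "dvec \<sigma> \<in> pos_trig" unfolding dvec_def by (rule pos_trig_acorr_self[OF s])
  have Om: "(?v, c) \<in> Om" "acorr ?v (beta c ?v) = dvec \<sigma>" using sol[OF dp c] by auto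
  then show v0: "0 < ?v $ None" by (simp add: Om_def)
  have av: "bord 1 (a_sol \<sigma> c) = (1 / ?v $ None) *\<^sub>R ?v"
    by (rule bord_eqI[symmetric]) (use v0 in \<open>simp_all add: a_sol_def\<close>)
  have bv: "bord 1 (b_sol \<sigma> c) = (1 / ?v $ None) *\<^sub>R beta c ?v"
    by (rule bord_eqI[symmetric]) (use v0 in \<open>simp_all add: b_sol_def beta_None\<close>)
  show "bord 1 (a_sol \<sigma> c) \<in> stable_vecs"
    using Om(1) v0 unfolding av Om_def stable_vecs_iff by (simp add: vpoly_scaleR cpoly_smult)
  show "beta c (bord 1 (a_sol \<sigma> c)) = bord 1 (b_sol \<sigma> c)" unfolding av bv beta_scaleR ..
  show "acorr (bord 1 (a_sol \<sigma> c)) (bord 1 (b_sol \<sigma> c)) = r_sol \<sigma> c *\<^sub>R dvec \<sigma>"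
    unfolding av bv acorr_scaleR_left acorr_scaleR_right Om(2) by (simp add: r_sol_def power2_eq_square)
  show "0 < r_sol \<sigma> c" using v0 by (simp add: r_sol_def)
qed

lemma CEE_iff:
  fixes \<sigma> :: "'n rvec"
  shows "CEE z \<nu> \<sigma> w P \<longleftrightarrow> cee_eq \<sigma> (u_vec z \<nu> w + U_mat z \<nu> w *v (Gam \<sigma> *v (P *v h_vec) + \<sigma>)) P"
  by (simp add: CEE_def cee_eq_def Let_def matrix_vector_right_distrib add.commute add.left_commute)

text \<open>The two conditions of \<open>Pi_set\<close> enter here: h'Ph < 1 gives r > 0, and with P
  \<ge> 0 this makes the pair stable and positive real. Then \<open>sol_scale\<close> identifies a,
  b and r, and these determine P.\<close>

lemma CEE_imp:
  assumes s: "\<sigma> \<in> Schur" and w: "w \<in> W_plus m z \<nu>" and P: "P \<in> Pi_set" and cee: "CEE z \<nu> \<sigma> w P"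
    and t: "t = Gam \<sigma> *v (P *v h_vec) + \<sigma>" and g: "g = u_vec z \<nu> w + U_mat z \<nu> w *v t"
  shows "transpose P = P" "psdef P" "t - g = a_sol \<sigma> (dcoord w)" "t + g = b_sol \<sigma> (dcoord w)"
    "disp_eq t g (r_sol \<sigma> (dcoord w)) \<sigma> P" "P = P_sol \<sigma> (dcoord w)"
proof -
  let ?c = "dcoord w"
  show sym: "transpose P = P" and psd: "psdef P" using P by (simp_all add: Pi_set_def sym_psd_def psdef_def)
  define r where "r = 1 - h_vec \<bullet> (P *v h_vec)"
  have r: "0 < r" using P by (simp add: r_def Pi_set_def)
  have "cee_eq \<sigma> g P" using cee unfolding CEE_iff g t .
  then have d: "disp_eq t g r \<sigma> P" using cee_iff_disp[OF sym, of \<sigma> g t r] t r_def by simp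
  have c: "?c \<in> Wset" using w by (simp add: W_plus_iff)
  have b: "beta ?c (bord 1 (t - g)) = bord 1 (t + g)" using uU_iff[OF w] g by blast
  have "(t - g, t + g) \<in> P_sigma \<sigma>" by (rule disp_imp_P_sigma[OF d sym psd r s])
  then have a: "bord 1 (t - g) \<in> stable_vecs" by (simp add: P_sigma_def P_set_def Schur_iff)
  have ac: "acorr (bord 1 (t - g)) (bord 1 (t + g)) = (sqrt r)\<^sup>2 *\<^sub>R dvec \<sigma>"
    using disp_acorr[OF d sym] r by (simp add: dvec_def)
  have sq: "0 < sqrt r" using r by simp
  note sc = sol_scale[OF s c a b ac sq]
  have rs: "r_sol \<sigma> ?c = r" using r unfolding r_sol_def sc(1) by (simp add: power_divide)
  have at: "t - g = a_sol \<sigma> ?c"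
  proof -
    have "(t - g) $ i = a_sol \<sigma> ?c $ i" for i
      using arg_cong[OF sc(2), of "\<lambda>x. x $ Some i"] by (simp add: a_sol_def sc(1))
    then show ?thesis by (simp add: vec_eq_iff)
  qed
  then show "t - g = a_sol \<sigma> ?c" .
  show bt: "t + g = b_sol \<sigma> ?c"
    using b sol_facts(2)[OF s c] unfolding at by simp
  show dd: "disp_eq t g (r_sol \<sigma> ?c) \<sigma> P" using d by (simp add: rs)
  have "t = (1/2) *\<^sub>R (a_sol \<sigma> ?c + b_sol \<sigma> ?c)" "g = (1/2) *\<^sub>R (b_sol \<sigma> ?c - a_sol \<sigma> ?c)"
    unfolding at[symmetric] bt[symmetric] by (simp_all add: vec_eq_iff)
  then show "P = P_sol \<sigma> ?c" using disp_eq_unique[OF dd sym] unfolding P_sol_def by simp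
qed

text \<open>P \<ge> 0 follows from the Gramian equation for the stable a, and h'Ph < 1 from 1 - h'Ph
  = r > 0.\<close>

lemma P_sol_works:
  assumes s: "\<sigma> \<in> Schur" and w: "w \<in> W_plus m z \<nu>"
  shows "P_sol \<sigma> (dcoord w) \<in> Pi_set" "CEE z \<nu> \<sigma> w (P_sol \<sigma> (dcoord w))"
proof -
  let ?c = "dcoord w"
  define t where "t = (1/2) *\<^sub>R (a_sol \<sigma> ?c + b_sol \<sigma> ?c)"
  define g where "g = (1/2) *\<^sub>R (b_sol \<sigma> ?c - a_sol \<sigma> ?c)"
  define r where "r = r_sol \<sigma> ?c"
  define P where "P = P_sol \<sigma> ?c"
  have c: "?c \<in> Wset" using w by (simp add: W_plus_iff)
  note f = sol_facts[OF s c]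
  have tg: "t - g = a_sol \<sigma> ?c" "t + g = b_sol \<sigma> ?c" unfolding t_def g_def by (rule half_sum_diff)+
  have Pb: "P = bezout t g r \<sigma>" by (simp add: P_def P_sol_def t_def g_def r_def)
  have d: "disp_eq t g r \<sigma> P"
    unfolding Pb using f(3) by (intro bezout_disp) (simp add: tg r_def dvec_def)
  have sym: "transpose P = P" unfolding Pb by (rule bezout_sym)
  have psd: "psdef P"
    using f(1,4) by (intro disp_psdef[OF d sym]) (simp_all add: r_def tg Schur_iff)
  have e: "cee_eq \<sigma> g P" "t = Gam \<sigma> *v (P *v h_vec) + \<sigma>" "r = 1 - h_vec \<bullet> (P *v h_vec)"
    using cee_iff_disp[OF sym, of \<sigma> g t r] d by auto
  have "P \<in> Pi_set" using sym psd e(3) f(4) by (simp add: Pi_set_def sym_psd_def psdef_def r_def)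
  then show "P_sol \<sigma> ?c \<in> Pi_set" by (simp add: P_def)
  have "g = u_vec z \<nu> w + U_mat z \<nu> w *v t" using uU_iff[OF w, of g t] f(2) tg by simp
  then have "CEE z \<nu> \<sigma> w P" unfolding CEE_iff e(2)[symmetric] using e(1) by simp
  then show "CEE z \<nu> \<sigma> w (P_sol \<sigma> ?c)" by (simp add: P_def)
qed

text \<open>The locus is a graph over the data; its smoothness and dimension are reduced to the
  smoothness of \<open>P_sol\<close>.\<close>

lemma CEE_locus_eq:
  fixes \<sigma> :: "'n rvec"
  assumes s: "\<sigma> \<in> Schur"
  shows "CEE_locus m z \<nu> \<sigma> = (\<lambda>w. (w, P_sol \<sigma> (dcoord w))) ` W_plus m z \<nu>"
proof (intro set_eqI iffI)
  fix x assume "x \<in> CEE_locus m z \<nu> \<sigma>"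
  then obtain w P where x: "x = (w, P)" "w \<in> W_plus m z \<nu>" "P \<in> Pi_set" "CEE z \<nu> \<sigma> w P"
    by (auto simp: CEE_locus_def)
  then show "x \<in> (\<lambda>w. (w, P_sol \<sigma> (dcoord w))) ` W_plus m z \<nu>"
    using CEE_imp(6)[OF s x(2-4) refl refl] by auto
next
  fix x assume "x \<in> (\<lambda>w. (w, P_sol \<sigma> (dcoord w))) ` W_plus m z \<nu>"
  then show "x \<in> CEE_locus m z \<nu> \<sigma>" using P_sol_works[OF s] by (auto simp: CEE_locus_def)
qed

text \<open>The rank comes out as n - deg gcd(a, \<sigma>) and both degrees as n - deg gcd(a, b);
  \<open>disp_gcd\<close> equates the two gcds.\<close>

lemma CEE_solution_pair:
  fixes \<sigma> :: "'n rvec"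
  assumes s: "\<sigma> \<in> Schur" and w: "w \<in> W_plus m z \<nu>" and P: "P \<in> Pi_set" and cee: "CEE z \<nu> \<sigma> w P"
    and t: "t = Gam \<sigma> *v (P *v h_vec) + \<sigma>"
    and a: "a = (mat 1 - U_mat z \<nu> w) *v t - u_vec z \<nu> w" and b: "b = (mat 1 + U_mat z \<nu> w) *v t + u_vec z \<nu> w"
  shows "(a, b) \<in> P_sigma \<sigma> \<and> interpolates m z \<nu> w (phi a b) \<and>
           (\<forall>a' b'. (a', b') \<in> P_sigma \<sigma> \<and> interpolates m z \<nu> w (phi a' b') \<longrightarrow> (a', b') = (a, b)) \<and>
           rank P = deg_phi a b \<and> deg_phi a b = deg_f a b"
proof -
  let ?c = "dcoord w"
  define g where "g = u_vec z \<nu> w + U_mat z \<nu> w *v t"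
  have ab: "a = t - g" "b = t + g"
    by (simp_all add: a b g_def matrix_vector_mult_add_rdistrib matrix_vector_mult_diff_rdistrib)
  note I = CEE_imp[OF s w P cee t g_def]
  have c: "?c \<in> Wset" using w by (simp add: W_plus_iff)
  have fd: "full_data w = Vm *v cvec (bord (1/2) ?c)" using w by (simp add: W_plus_iff data_space_coord)
  note f = sol_facts[OF s c]
  have ps: "(a, b) \<in> P_sigma \<sigma>" unfolding ab by (rule disp_imp_P_sigma[OF I(5,1,2) f(4) s])
  have abs: "a = a_sol \<sigma> ?c" "b = b_sol \<sigma> ?c" using I(3,4) ab by auto
  have int: "interpolates m z \<nu> w (phi a b)"
    using f(1,2) by (simp add: abs interpolates_iff[OF fd])
  have uniq: "(a', b') = (a, b)" if ps': "(a', b') \<in> P_sigma \<sigma>" and int': "interpolates m z \<nu> w (phi a' b')" for a' b'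
  proof -
    have st: "bord 1 a' \<in> stable_vecs" using ps' by (simp add: P_sigma_def P_set_def Schur_iff)
    have be: "beta ?c (bord 1 a') = bord 1 b'" using int' by (simp add: interpolates_iff[OF fd st])
    obtain \<rho> where \<rho>: "\<rho> > 0" "acorr (bord 1 a') (bord 1 b') = \<rho>\<^sup>2 *\<^sub>R dvec \<sigma>"
      using P_sigma_imp_acorr[OF ps'] unfolding dvec_def by blast
    note sc = sol_scale[OF s c st be \<rho>(2,1)]
    have "a' $ i = a $ i" for i
      using arg_cong[OF sc(2), of "\<lambda>x. x $ Some i"] by (simp add: abs a_sol_def sc(1))
    then have a': "a' = a" by (simp add: vec_eq_iff)
    then show ?thesis using be f(2) by (simp add: abs)
  qed
  have Sch: "t - g \<in> Schur" using f(1) I(3) by (simp add: Schur_iff)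
  have "rank P = CARD('n) - degree (gcd (monic_poly a) (monic_poly \<sigma>))"
    unfolding ab by (rule rank_gramian[OF disp_gramian[OF I(5,1)] I(1,2) f(4) Sch])
  then have "rank P = deg_phi a b"
    unfolding deg_phi_eq ab disp_gcd[OF I(5,1) f(4) s Sch] .
  moreover have "deg_phi a b = deg_f a b" unfolding deg_phi_eq deg_f_eq ..
  ultimately show ?thesis using ps int uniq by blast
qed

end

subsection \<open>Smoothness and semialgebraicity of the solution set\<close>

lemma diffeomorphismI:
  assumes "\<And>x. x \<in> X \<Longrightarrow> f x \<in> Y \<and> g (f x) = x" and "\<And>y. y \<in> Y \<Longrightarrow> g y \<in> X \<and> f (g y) = y"
    and "smooth_on X f" "smooth_on Y g"
  shows "diffeomorphism X Y f"
proof -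
  have bij: "bij_betw f X Y" by (rule bij_betw_byWitness[of X g f Y]) (use assms(1,2) in auto)
  have "inv_into X f y = g y" if "y \<in> Y" for y
    using assms(2)[OF that] bij by (metis bij_betw_imp_inj_on inv_into_f_f)
  then have "smooth_on Y (inv_into X f)" using assms(4) unfolding smooth_on_def by fastforce
  then show ?thesis using bij assms(3) by (simp add: diffeomorphism_def)
qed

lemma rat_on_coeff_vpoly:
  assumes "\<And>i. rat_on S (\<lambda>x. u x $ i)"
  shows "rat_on S (\<lambda>x. coeff (vpoly (u x)) k)"
proof -
  have "rat_on S (\<lambda>x. if idx i = k then u x $ i else 0)" for i
    by (cases "idx i = k") (use assms in \<open>simp_all add: rat_on_const\<close>)
  then show ?thesis unfolding vpoly_def coeff_sum coeff_monom by (intro rat_on_sum)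
qed

lemma rat_on_bezout:
  fixes t g :: "'a::real_normed_vector \<Rightarrow> 'k::{finite,linorder} rvec"
  assumes "\<And>i. rat_on S (\<lambda>x. t x $ i)" "\<And>i. rat_on S (\<lambda>x. g x $ i)" "rat_on S r"
  shows "rat_on S (\<lambda>x. bezout (t x) (g x) (r x) \<sigma> $ i $ j)"
proof -
  have b: "rat_on S (\<lambda>x. bord 1 (f x) $ k)" if "\<And>i. rat_on S (\<lambda>x. f x $ i)"
    for f :: "'a \<Rightarrow> 'k rvec" and k
    by (cases k) (simp_all add: rat_on_const that)
  have "rat_on S (\<lambda>x. bez (t x) (g x) (r x) \<sigma> k l)" for k l
    unfolding bez_def pair_coeff_def
    by (intro rat_on_diff rat_on_add rat_on_mult rat_on_divide rat_on_const rat_on_coeff_vpoly b assms)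
      (simp_all add: rat_on_add rat_on_diff assms)
  then show ?thesis by (simp add: bezout_def diagsum_def rat_on_sum)
qed

lemma rat_on_matrix_mult:
  assumes "\<And>i j. rat_on S (\<lambda>x. A x $ i $ j)" "\<And>i j. rat_on S (\<lambda>x. B x $ i $ j)"
  shows "rat_on S (\<lambda>x. (A x ** B x) $ i $ j)"
  using assms by (simp add: matrix_matrix_mult_def rat_on_sum rat_on_mult)

lemma rat_on_matrix_vector_mult:
  assumes "\<And>i j. rat_on S (\<lambda>x. A x $ i $ j)" "\<And>i. rat_on S (\<lambda>x. v x $ i)"
  shows "rat_on S (\<lambda>x. (A x *v v x) $ i)"
  using assms by (simp add: matrix_vector_mult_def rat_on_sum rat_on_mult)

lemma rpf_linear_compose:
  fixes L :: "real^'k \<Rightarrow> real"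
  assumes "linear L" "vec_rpf f"
  shows "real_polynomial_function (\<lambda>x. L (f x))"
proof -
  have "L y = (\<Sum>j\<in>UNIV. y $ j * L (axis j 1))" for y
  proof -
    have "y = (\<Sum>j\<in>UNIV. y $ j *\<^sub>R axis j 1)"
      using basis_expansion[of y] by (simp add: scalar_mult_eq_scaleR)
    from arg_cong[OF this, of L] show ?thesis by (simp add: linear_sum[OF assms(1)] linear_cmul[OF assms(1)])
  qed
  then have "(\<lambda>x. L (f x)) = (\<lambda>x. \<Sum>j\<in>UNIV. f x $ j * L (axis j 1))" by (intro ext)
  then show ?thesis using assms(2) unfolding vec_rpf_def
    by (simp only:) (intro rpf_intros; simp)
qed

context nodes
begin

text \<open>Each entry of P is a rational function of the point
  (\<open>sol (dvec \<sigma>) c\<close>, c), with powers of the positive constant coefficient of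
  \<open>sol\<close> as denominators, so \<open>Ck_on_sol\<close> applies.\<close>

lemma Ck_on_P_sol:
  assumes s: "\<sigma> \<in> Schur"
  shows "Ck_on k Wset (P_sol \<sigma>)"
proof (rule Ck_on_componentwise[OF open_Wset])
  fix b :: "'n rmat" assume "b \<in> Basis"
  then obtain i j where b: "b = axis i (axis j 1)" by (auto simp: Basis_vec_def)
  let ?d = "dvec \<sigma>"
  have dp: "?d \<in> pos_trig" unfolding dvec_def by (rule pos_trig_acorr_self[OF s])
  define S where "S = (\<lambda>c. (sol ?d c, c)) ` Wset"
  have nz: "fst x $ None \<noteq> 0" if "x \<in> S" for x using that less_imp_neq[OF sol_facts(5)[OF s]] by (force simp: S_def)
  define A where "A = (\<lambda>x :: (real^'n option) \<times> 'n rvec. (\<chi> i. fst x $ Some i / fst x $ None) :: 'n rvec)"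
  define B where "B = (\<lambda>x :: (real^'n option) \<times> 'n rvec. (\<chi> i. beta (snd x) (fst x) $ Some i / fst x $ None) :: 'n rvec)"
  have l: "linear (fst :: (real^'n option) \<times> 'n rvec \<Rightarrow> _)" "linear (snd :: (real^'n option) \<times> 'n rvec \<Rightarrow> _)"
    by (auto intro!: bounded_linear.linear bounded_linear_fst bounded_linear_snd)
  have f: "rat_on S (\<lambda>x. fst x $ i)" for i
    using vec_rpf_linear[OF l(1)] unfolding vec_rpf_def by (intro rat_on_rpf) simp
  have be: "rat_on S (\<lambda>x. beta (snd x) (fst x) $ i)" for i
    using vec_rpf_beta[OF l(2) vec_rpf_linear[OF l(1)]] unfolding vec_rpf_def by (intro rat_on_rpf) simp
  have A: "rat_on S (\<lambda>x. A x $ i)" and B: "rat_on S (\<lambda>x. B x $ i)" for i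
    using f be nz by (simp_all add: A_def B_def rat_on_divide)
  let ?p = "\<lambda>x. bezout ((1/2) *\<^sub>R (A x + B x)) ((1/2) *\<^sub>R (B x - A x)) (1 / (fst x $ None)\<^sup>2) \<sigma> $ i $ j"
  have "rat_on S ?p"
  proof (rule rat_on_bezout)
    show "rat_on S (\<lambda>x. ((1/2) *\<^sub>R (A x + B x)) $ i)" "rat_on S (\<lambda>x. ((1/2) *\<^sub>R (B x - A x)) $ i)" for i
      unfolding vector_scaleR_component vector_add_component vector_minus_component real_scaleR_def
      by (intro rat_on_mult rat_on_add rat_on_diff rat_on_const A B)+
    show "rat_on S (\<lambda>x. 1 / (fst x $ None)\<^sup>2)"
      unfolding power2_eq_square using nz by (intro rat_on_divide rat_on_mult rat_on_const f) auto
  qed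
  from Ck_on_sol[OF dp this[unfolded S_def]] show "Ck_on k Wset (\<lambda>c. P_sol \<sigma> c \<bullet> b)"
    by (simp add: b inner_axis P_sol_def A_def B_def a_sol_def[abs_def] b_sol_def[abs_def] r_sol_def)
qed

definition dlin :: "'n cvec \<Rightarrow> 'n rvec" where
  "dlin w = (\<chi> i. Re (\<Sum>j\<in>UNIV. Vi $ Some i $ Some j * w $ j))"

definition llin :: "'n rvec \<Rightarrow> 'n cvec" where
  "llin c = (\<chi> i. \<Sum>j\<in>UNIV. Vm $ Some i $ Some j * complex_of_real (c $ j))"

lemma linear_dlin: "linear dlin"
  by (intro linearI) (simp_all add: dlin_def vec_eq_iff algebra_simps sum.distrib sum_subtractf sum_distrib_left)

lemma linear_llin: "linear llin"
  by (intro linearI) (simp_all add: llin_def vec_eq_iff distrib_left sum.distrib sum_distrib_left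
      scaleR_conv_of_real[where 'a = complex] mult.left_commute)

lemma Vi_full_data: "(Vi *v full_data w) $ i = Vi $ i $ None / 2 + (\<Sum>j\<in>UNIV. Vi $ i $ Some j * w $ j)"
  by (simp add: full_data_bord matrix_vector_mult_def sum_UNIV_option)

lemma dcoord_affine: "dcoord w = dlin w + dcoord 0"
  by (simp add: dcoord_def Vi_full_data dlin_def vec_eq_iff)

lemma Lmap_affine: "Lmap c = llin c + Lmap 0"
  by (simp add: Lmap_def llin_def vec_eq_iff matrix_vector_mult_def sum_UNIV_option cvec_nth)

lemma open_dcoord: "open {w. dcoord w \<in> Wset}"
proof -
  have "continuous_on UNIV (\<lambda>w. dlin w + dcoord 0)"
    using linear_dlin by (intro continuous_intros linear_continuous_on) (simp add: linear_conv_bounded_linear)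
  then have "continuous_on UNIV dcoord" by (rule continuous_on_eq) (simp add: dcoord_affine[symmetric])
  from open_vimage[OF open_Wset this] show ?thesis by (simp add: vimage_def)
qed

lemma CEE_locus_diffeomorphism:
  fixes \<sigma> :: "'n rvec"
  assumes s: "\<sigma> \<in> Schur"
  shows "diffeomorphism (CEE_locus m z \<nu> \<sigma>) (W_plus m z \<nu>) fst"
proof (rule diffeomorphismI[where g = "\<lambda>w. (w, P_sol \<sigma> (dcoord w))"])
  show "smooth_on (CEE_locus m z \<nu> \<sigma>) fst"
    by (rule Ck_on_smooth_onI[OF open_UNIV subset_UNIV Ck_on_affine[OF _ open_UNIV, where c = 0]])
      (simp_all add: bounded_linear.linear bounded_linear_fst)
  have P: "Ck_on k {w. dcoord w \<in> Wset} (\<lambda>w. P_sol \<sigma> (dcoord w))" for k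
    by (subst dcoord_affine, rule Ck_on_affine_compose[OF Ck_on_P_sol[OF s] linear_dlin _ open_dcoord])
      (simp add: dcoord_affine[symmetric])
  have I: "Ck_on k {w. dcoord w \<in> Wset} (\<lambda>w. w)" for k
    using Ck_on_affine[OF linear_id open_dcoord, of k 0] by simp
  show "smooth_on (W_plus m z \<nu>) (\<lambda>w. (w, P_sol \<sigma> (dcoord w)))"
    by (rule Ck_on_smooth_onI[OF open_dcoord _ Ck_on_Pair[OF open_dcoord I P]]) (auto simp: W_plus_iff)
qed (auto simp: CEE_locus_eq[OF s])

text \<open>A single global chart suffices: the coordinates of w map the locus onto the open set
  \<open>Wset\<close>.\<close>

lemma CEE_locus_manifold:
  fixes \<sigma> :: "'n rvec"
  assumes s: "\<sigma> \<in> Schur"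
  shows "smooth_manifold TYPE('n rvec) (CEE_locus m z \<nu> \<sigma>)"
  unfolding smooth_manifold_def
proof
  fix x
  have "diffeomorphism (CEE_locus m z \<nu> \<sigma>) Wset (\<lambda>x. dcoord (fst x))"
  proof (rule diffeomorphismI[where g = "\<lambda>c. (Lmap c, P_sol \<sigma> c)"])
    have l: "linear (\<lambda>x :: 'n cvec \<times> 'n rmat. dlin (fst x))"
      using linear_compose[OF bounded_linear.linear[OF bounded_linear_fst] linear_dlin] by (simp add: o_def)
    show "smooth_on (CEE_locus m z \<nu> \<sigma>) (\<lambda>x. dcoord (fst x))"
      by (rule Ck_on_smooth_onI[OF open_UNIV subset_UNIV Ck_on_affine[OF l open_UNIV, where c = "dcoord 0"]])
        (simp add: dcoord_affine[symmetric])
    show "smooth_on Wset (\<lambda>c. (Lmap c, P_sol \<sigma> c))"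
      by (rule Ck_on_smooth_onI[OF open_Wset subset_refl
            Ck_on_Pair[OF open_Wset Ck_on_affine[OF linear_llin open_Wset, where c = "Lmap 0"] Ck_on_P_sol[OF s]]])
        (simp add: Lmap_affine[symmetric])
    fix c assume "c \<in> Wset"
    then have "Lmap c \<in> W_plus m z \<nu>" by (simp add: W_plus_iff Lmap_data dcoord_Lmap)
    then show "(Lmap c, P_sol \<sigma> c) \<in> CEE_locus m z \<nu> \<sigma> \<and> dcoord (fst (Lmap c, P_sol \<sigma> c)) = c"
      by (auto simp: CEE_locus_eq[OF s] dcoord_Lmap)
  qed (auto simp: CEE_locus_eq[OF s] W_plus_iff Lmap_dcoord)
  then show "\<exists>N (T :: 'n rvec set) \<phi>. open N \<and> x \<in> N \<and> open T \<and> diffeomorphism (CEE_locus m z \<nu> \<sigma> \<inter> N) T \<phi>"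
    using open_Wset by (intro exI[of _ UNIV] exI[of _ Wset] exI[of _ "\<lambda>x. dcoord (fst x)"]) simp
qed

lemma Mc_entry_rpf:
  assumes "vec_rpf f"
  shows "real_polynomial_function (\<lambda>x. Mc (bord (1/2) (f x)) $ i $ j)"
    "real_polynomial_function (\<lambda>x. Pick (bord (1/2) (f x)) $ i $ j)"
proof -
  have b: "bord 0 (x + y) = bord 0 x + bord 0 y" "bord 0 (r *\<^sub>R x) = r *\<^sub>R bord 0 x" for x y :: "'n rvec" and r
    by (rule linear_add[OF linear_bord_0] linear_cmul[OF linear_bord_0])+
  have "linear (\<lambda>y. Mc (bord 0 y) $ i $ j)" "linear (\<lambda>y. Pick (bord 0 y) $ i $ j)"
    by (intro linearI; simp add: b Mc_add Mc_scaleR Pick_add Pick_scaleR)+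
  note l = this[THEN rpf_linear_compose, OF assms]
  show "real_polynomial_function (\<lambda>x. Mc (bord (1/2) (f x)) $ i $ j)"
    by (subst bord_split) (simp add: Mc_add rpf_intros l)
  show "real_polynomial_function (\<lambda>x. Pick (bord (1/2) (f x)) $ i $ j)"
    by (subst bord_split) (simp add: Pick_add rpf_intros l)
qed

text \<open>Each column of \<open>Kc\<close> solves a linear system with matrix M + 1/2, whose
  determinant has no zero on \<open>Wset\<close>.\<close>

lemma Kc_rat_on:
  assumes f: "vec_rpf f" and S: "\<And>x. x \<in> S \<Longrightarrow> f x \<in> Wset"
  shows "rat_on S (\<lambda>x. Kc (bord (1/2) (f x)) $ k $ l)"
proof -
  let ?M = "\<lambda>x. Mc (bord (1/2) (f x))"
  have col: "(A *v axis l 1) $ i = A $ i $ l" for A :: "real^'n option^'n option" and i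
    by (simp add: matrix_vector_mult_basis column_def)
  have M: "rat_on S (\<lambda>x. ?M x $ i $ j)" for i j by (rule rat_on_rpf[OF Mc_entry_rpf(1)[OF f]])
  have "rat_on S (\<lambda>x. (Kc (bord (1/2) (f x)) *v axis l 1) $ k)"
  proof (rule rat_on_solve[where A = "\<lambda>x. ?M x + mat (1/2)" and b = "\<lambda>x. (?M x - mat (1/2)) *v axis l 1"])
    fix x assume "x \<in> S"
    then show d: "det (?M x + mat (1/2)) \<noteq> 0" by (intro Wset_det S)
    show "(?M x + mat (1/2)) *v (Kc (bord (1/2) (f x)) *v axis l 1) = (?M x - mat (1/2)) *v axis l 1"
      unfolding matrix_vector_mul_assoc Kc[OF d] ..
  qed (use M in \<open>simp_all add: col rat_on_add rat_on_diff rat_on_const\<close>)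
  then show ?thesis by (simp add: col)
qed

text \<open>The sets \<open>S1\<close> to \<open>S5\<close> impose, in turn, symmetry of the data,
  definiteness of the Pick matrix, symmetry and semidefiniteness of P, and h'Ph < 1. The equation
  itself comes last, since its coefficients are rational functions only there.\<close>

lemma CEE_locus_semialgebraic:
  fixes \<sigma> :: "'n rvec"
  shows "semialgebraic (CEE_locus m z \<nu> \<sigma>)"
proof -
  have fl: "linear (fst :: 'n cvec \<times> 'n rmat \<Rightarrow> _)" "linear (snd :: 'n cvec \<times> 'n rmat \<Rightarrow> _)"
    by (auto intro!: bounded_linear.linear bounded_linear_fst bounded_linear_snd)
  have Pl: "real_polynomial_function (\<lambda>x :: 'n cvec \<times> 'n rmat. snd x $ i $ j)" for i j
    by (rule rpf_linear) (intro linearI; simp)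
  have dc: "vec_rpf (\<lambda>x :: 'n cvec \<times> 'n rmat. dcoord (fst x))"
    by (subst dcoord_affine) (intro vec_rpf_add vec_rpf_const vec_rpf_linear linear_compose[OF fl(1) linear_dlin, unfolded o_def])
  define S1 :: "('n cvec \<times> 'n rmat) set" where "S1 = {x. \<forall>i\<in>UNIV. x \<in> {x. Im ((Vi *v full_data (fst x)) $ i) = 0}}"
  have S1: "semialgebraic S1" unfolding S1_def
  proof (rule semialgebraic_INT[OF finite], rule semialgebraic_zero)
    fix i
    have "linear (\<lambda>x :: 'n cvec \<times> 'n rmat. Im (\<Sum>j\<in>UNIV. Vi $ i $ Some j * fst x $ j))"
      by (intro linearI) (simp_all add: algebra_simps sum.distrib sum_distrib_left)
    then show "real_polynomial_function (\<lambda>x :: 'n cvec \<times> 'n rmat. Im ((Vi *v full_data (fst x)) $ i))"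
      unfolding Vi_full_data plus_complex.sel by (intro rpf_intros rpf_linear)
  qed
  define S2 where "S2 = {x \<in> S1. pdef (Pick (bord (1/2) (dcoord (fst x))))}"
  have S2: "semialgebraic S2" unfolding S2_def
    by (rule semialgebraic_pdef[OF Mc_entry_rpf(2)[OF dc] Pick_sym S1])
  define S3 where "S3 = S2 \<inter> {x. \<forall>p\<in>UNIV. x \<in> {x. snd x $ fst p $ snd p - snd x $ snd p $ fst p = 0}}"
  have S3: "semialgebraic S3" unfolding S3_def
    by (intro semialgebraic_Int S2 semialgebraic_INT[OF finite] semialgebraic_zero rpf_intros Pl)
  have sym: "transpose (snd x) = snd x" if "x \<in> S3" for x
    using that by (auto simp: S3_def transpose_def vec_eq_iff)
  define S4 where "S4 = {x \<in> S3. psdef (snd x)}"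
  have S4: "semialgebraic S4" unfolding S4_def by (rule semialgebraic_psdef[OF Pl sym S3])
  define S5 where "S5 = S4 \<inter> {x. 0 < 1 - h_vec \<bullet> (snd x *v h_vec)}"
  have "real_polynomial_function (\<lambda>x :: 'n cvec \<times> 'n rmat. 1 - h_vec \<bullet> (snd x *v h_vec))"
    unfolding inner_vec_def matrix_vector_mult_def vec_lambda_beta inner_real_def
    by (intro rpf_intros Pl finite)
  then have S5: "semialgebraic S5" unfolding S5_def by (intro semialgebraic_Int S4 semialgebraic_pos)
  have memb: "x \<in> S5 \<longleftrightarrow> fst x \<in> W_plus m z \<nu> \<and> snd x \<in> Pi_set" for x
    by (auto simp: S5_def S4_def S3_def S2_def S1_def W_plus_iff data_space_iff Wset_def Pi_set_def sym_psd_def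
        psdef_def transpose_def vec_eq_iff)
  let ?K = "\<lambda>x :: 'n cvec \<times> 'n rmat. Kc (bord (1/2) (dcoord (fst x)))"
  \<comment> \<open>On \<open>S5\<close> the coordinates lie in \<open>Wset\<close>, so the
    denominator det (M + 1/2) has no zero there and can be cleared from the equation.\<close>
  have K: "rat_on S5 (\<lambda>x. ?K x $ k $ l)" for k l
    by (rule Kc_rat_on[OF dc]) (simp add: memb W_plus_iff)
  have u: "rat_on S5 (\<lambda>x. u_vec z \<nu> (fst x) $ i)" for i
    using K[of "Some i" None] by (subst rat_on_cong[where g = "\<lambda>x. ?K x $ Some i $ None"]) (simp_all add: memb uU_nth)
  have U: "rat_on S5 (\<lambda>x. U_mat z \<nu> (fst x) $ i $ j)" for i j
    using K[of "Some i" "Some j"]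
    by (subst rat_on_cong[where g = "\<lambda>x. ?K x $ Some i $ Some j"]) (simp_all add: memb uU_nth)
  have P: "rat_on S5 (\<lambda>x. snd x $ i $ j)" for i j by (rule rat_on_rpf[OF Pl])
  let ?g = "\<lambda>x. u_vec z \<nu> (fst x) + U_mat z \<nu> (fst x) *v (Gam \<sigma> *v (snd x *v h_vec) + \<sigma>)"
  have g: "rat_on S5 (\<lambda>x. ?g x $ i)" for i
    unfolding vector_add_component
    by (intro rat_on_add u rat_on_matrix_vector_mult U)
      (simp add: rat_on_add rat_on_matrix_vector_mult rat_on_const P)
  let ?R = "\<lambda>x. snd x - (Gam \<sigma> ** (snd x - snd x ** outer h_vec h_vec ** snd x) ** transpose (Gam \<sigma>) + outer (?g x) (?g x))"
  have "rat_on S5 (\<lambda>x. snd x $ k $ l - (snd x ** outer h_vec h_vec ** snd x) $ k $ l)" for k l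
    by (intro rat_on_diff P rat_on_matrix_mult rat_on_const)
  moreover have "rat_on S5 (\<lambda>x. outer (?g x) (?g x) $ k $ l)" for k l
    unfolding outer_nth by (intro rat_on_mult g)
  ultimately have R: "rat_on S5 (\<lambda>x. ?R x $ i $ j)" for i j
    unfolding vector_minus_component vector_add_component
    by (intro rat_on_diff rat_on_add P rat_on_matrix_mult rat_on_const) simp_all
  have "CEE_locus m z \<nu> \<sigma> = {x. \<forall>p\<in>UNIV. x \<in> {x \<in> S5. ?R x $ fst p $ snd p = 0}}" (is "_ = ?X")
  proof (intro set_eqI)
    fix x
    have "x \<in> CEE_locus m z \<nu> \<sigma> \<longleftrightarrow> x \<in> S5 \<and> CEE z \<nu> \<sigma> (fst x) (snd x)"
      unfolding memb CEE_locus_def by (cases x) auto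
    also have "CEE z \<nu> \<sigma> (fst x) (snd x) \<longleftrightarrow> ?R x = 0" unfolding CEE_iff cee_eq_def by (rule eq_iff_diff_eq_0)
    also have "?R x = 0 \<longleftrightarrow> (\<forall>p. ?R x $ fst p $ snd p = 0)"
      unfolding vec_eq_iff[of "?R x"] vec_eq_iff[of "?R x $ _"] by (simp only: split_paired_All fst_conv snd_conv zero_index)
    finally show "x \<in> CEE_locus m z \<nu> \<sigma> \<longleftrightarrow> x \<in> ?X" by blast
  qed
  also have "semialgebraic ?X"
    by (rule semialgebraic_INT[OF finite], rule semialgebraic_rat_zero[OF S5 R])
  finally show ?thesis .
qed

end

theorem theorem2:
  fixes m :: nat and z :: "nat \<Rightarrow> complex" and \<nu> :: "nat \<Rightarrow> nat"
    and \<sigma> :: "'n::{finite,linorder} rvec"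
  assumes "inj_on z {..m}"
    and "z 0 = 0"
    and "\<forall>j\<le>m. cmod (z j) < 1"
    and "\<forall>j\<le>m. 1 \<le> \<nu> j"
    and "\<forall>j\<le>m. \<exists>j'\<le>m. z j' = cnj (z j) \<and> \<nu> j' = \<nu> j"
    and "CARD('n) = (\<Sum>j\<le>m. \<nu> j) - 1"
    and "\<sigma> \<in> Schur"
  shows
    \<comment> \<open>(1)\<close>
    "smooth_manifold TYPE('n rvec) (CEE_locus m z \<nu> \<sigma>) \<and>
     semialgebraic (CEE_locus m z \<nu> \<sigma>) \<and>
     \<comment> \<open>(2)\<close>
     diffeomorphism (CEE_locus m z \<nu> \<sigma>) (W_plus m z \<nu>) fst \<and>
     (\<forall>w \<in> W_plus m z \<nu>. \<exists>!P. P \<in> Pi_set \<and> CEE z \<nu> \<sigma> w P) \<and>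
     \<comment> \<open>(3)\<close>
     (\<forall>w \<in> W_plus m z \<nu>. \<forall>P \<in> Pi_set. CEE z \<nu> \<sigma> w P \<longrightarrow>
       (let u = u_vec z \<nu> w; U = U_mat z \<nu> w; t = Gam \<sigma> *v (P *v h_vec) + \<sigma>;
            a = (mat 1 - U) *v t - u;
            b = (mat 1 + U) *v t + u
        in (a, b) \<in> P_sigma \<sigma> \<and> interpolates m z \<nu> w (phi a b) \<and>
           (\<forall>a' b'. (a', b') \<in> P_sigma \<sigma> \<and> interpolates m z \<nu> w (phi a' b') \<longrightarrow>
              (a', b') = (a, b)) \<and>
           rank P = deg_phi a b \<and> deg_phi a b = deg_f a b))"
proof -
  interpret nodes m z \<nu> "TYPE('n)" by standard (use assms in auto)
  note s = assms(7)
  have uniq: "\<exists>!P. P \<in> Pi_set \<and> CEE z \<nu> \<sigma> w P" if "w \<in> W_plus m z \<nu>" for w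
    using P_sol_works[OF s that] CEE_imp(6)[OF s that _ _ refl refl] by blast
  show ?thesis
    unfolding Let_def
    by (intro conjI ballI impI CEE_locus_manifold CEE_locus_semialgebraic CEE_locus_diffeomorphism s uniq)
      (use CEE_solution_pair[OF s _ _ _ refl refl refl] in blast)+
qed

end
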